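(* Let $\Phi$ be a complete unimodular simplicial fan. Then for every $\gamma\in K(\Phi)$ $$\chi(\gamma)=\int_\Phi\operatorname{ch}(\gamma)\cdot\operatorname{Td}(\Phi).$$
   Context: Fans. Let $\Lambda$ be a free abelian group of rank $n$, $V=\Lambda\otimes_{\mathbb Z}\mathbb R$. A volume form $\Omega_V$ on $V$ is fixed. A cone in $V$ is a closed convex polyhedral cone with vertex at the origin (so $\underline o=\{0\}$ is a face); $\tau\leqslant\sigma$ means $\tau$ is a face of $\sigma$. A fan $\Phi$ in $V$ is a finite set of cones closed under faces such that any two intersect along a common face; it is complete if its cones cover $V$. $\Phi(i)$ is the set of $i$-dimensional cones; elements of $\Phi(1)$ are rays; $[\sigma](1)$ is the set of rays of $\sigma$. $\Phi$ is simplicial if each $k$-dimensional cone has exactly $k$ rays. It is unimodular if it is simplicial, each ray $\rho$ contains a nonzero lattice vector, and for each $\sigma\in\Phi$ the primitive vectors $v_\rho$ (generators of $\rho\cap\Lambda$), $\rho\in[\sigma](1)$, form part of a $\mathbb Z$-basis of $\Lambda$. Sheaves and $K(\Phi)$. $\Phi$ is a topological space whose open sets are the subfans. A sheaf $F$ of real vector spaces on $\Phi$ is the same as a system of stalks $F_\sigma$ ($\sigma\in\Phi$) with compatible restriction maps $F_\sigma\to F_\tau$ for $\tau\leqslant\sigma$. $K(\Phi)$ is the Grothendieck group of the abelian category of sheaves of finite-dimensional real vector spaces on $\Phi$. $\chi\colon K(\Phi)\to\mathbb Z$ is the homomorphism $\chi([F])=\sum_i(-1)^i\sum_{\sigma\in\Phi(n-i)}\dim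 F_\sigma$ (which for complete $\Phi$ equals $\sum_i(-1)^i\dim H^i(\Phi;F)$). For a ray $\rho$, $\mathcal O(\rho)$ is the kernel of the surjection from the constant sheaf with fiber $\operatorname{Span}(\rho)^\vee$ to the constant sheaf with the same fiber on the closed set $\operatorname{Star}(\rho)=\{\sigma\mid\sigma\geqslant\rho\}$ extended by zero. For $\sigma\in\Phi$, $\mathcal O(\sigma)=\bigotimes_{\rho\in[\sigma](1)}\mathcal O(\rho)$, and $\mathcal O=\mathcal O(\underline o)=\mathbb R_\Phi$. The classes $[\mathcal O(\sigma)]$, $\sigma\in\Phi$, form a $\mathbb Z$-basis of $K(\Phi)$. Cohomology. $A=\operatorname{S}(V^\vee)$ is graded with linear functions in degree $2$; $A^+$ is the ideal of positive degree elements. $\mathcal A_\Phi(\Phi)$ is the graded ring of continuous cone-wise polynomial functions on $\Phi$ (cone-wise linear functions have degree $2$), $H(\Phi)=\mathcal A_\Phi(\Phi)/A^+\mathcal A_\Phi(\Phi)$. $H^0(\Phi;\widehat{\mathcal A}_\Phi)=\prod_{i\ge0}\mathcal A_\Phi^{2i}(\Phi)$ is the completed ring and $\widehat A=\prod_i A^{2i}$, with $\widehat A^+$ the elements without degree $0$ term; the natural map $H(\Phi)\to H^0(\Phi;\widehat{\mathcal A}_\Phi)/\widehat A^+H^0(\Phi;\widehat{\mathcal A}_\Phi)$ is an isomorphism. For $\rho\in\Phi(1)$, $\phi_\rho$ (the Courant function of $\rho$) is the cone-wise linear function with $\phi_\rho(v_\rho)=1$ and vanishing on all other rays. Chern character and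 Todd class. $\widetilde{\operatorname{ch}}\colon K(\Phi)\to H^0(\Phi;\widehat{\mathcal A}_\Phi)$ is the homomorphism of abelian groups with $\widetilde{\operatorname{ch}}([\mathcal O(\sigma)])=\prod_{\rho\in[\sigma](1)}\exp(-\phi_\rho)$ for all $\sigma\in\Phi$ (so $[\mathcal O]\mapsto1$); $\operatorname{ch}\colon K(\Phi)\to H(\Phi)$ is its composition with the projection to $H(\Phi)$. $\operatorname{Td}(\Phi)\in H(\Phi)$ is the image of $\prod_{\rho\in\Phi(1)}\frac{\phi_\rho}{1-\exp(-\phi_\rho)}$. Integral. For $f\in\mathcal A_\Phi(\Phi)$ and $\sigma\in\Phi(n)$ let $f_\sigma\in A$ be the polynomial agreeing with $f$ on $\sigma$. For $\sigma\in\Phi(n)$ with rays $\rho_1,\dots,\rho_n$ let $F_\sigma\in A$ be the polynomial agreeing with $|\Omega_V(v_{\rho_1},\dots,v_{\rho_n})|^{-1}\,\phi_{\rho_1}\cdots\phi_{\rho_n}$ on $\sigma$. Then $\zeta_\Phi(f)=\sum_{\sigma\in\Phi(n)}f_\sigma/F_\sigma$ lies in $A$ (Brion), $\zeta_\Phi$ is $A$-linear and lowers degree by $2n$, and it induces $\int_\Phi\colon H(\Phi)\to\mathbb R$, vanishing outside degree $2n$.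
   Formalization: The volume form Ω_V is required to take the values ±1 on ℤ-bases of Λ; for an arbitrary Ω_V the formula fails, since the integral scales with |Ω_V| while χ does not (e.g. the fan of P¹ with γ=[O]). *)

theory Defs
  imports
    "HOL-Algebra.QuotRing"
    "HOL-Algebra.Free_Abelian_Groups"
    "HOL-Library.Function_Algebras"
    "HOL-Computational_Algebra.Formal_Power_Series"
    "HOL-Analysis.Analysis"
begin

text \<open>Real-valued functions form a real vector space under the pointwise operations; vector
  spaces of functions serve as stalks of sheaves below.\<close>

instantiation "fun" :: (type, real_vector) real_vector
begin

definition scaleR_fun :: "real \<Rightarrow> ('a \<Rightarrow> 'b) \<Rightarrow> 'a \<Rightarrow> 'b"
  where "scaleR_fun r f = (\<lambda>x. r *\<^sub>R f x)"

instance
  by standard (auto simp: scaleR_fun_def fun_eq_iff scaleR_add_right scaleR_add_left)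

end


section \<open>Lattices, cones and fans\<close>

definition int_span :: "'a::real_vector set \<Rightarrow> 'a set"
  where "int_span B = {(\<Sum>b\<in>B. of_int (c b) *\<^sub>R b) | c :: 'a \<Rightarrow> int. True}"

text \<open>A free abelian group \<open>\<Lambda>\<close> of finite rank together with \<open>V = \<Lambda> \<otimes> \<real>\<close> is given as a subgroup of a
  Euclidean space having a \<open>\<int>\<close>-basis that is linearly independent over \<open>\<real>\<close>. Then \<open>V\<close> is
  \<open>span \<Lambda>\<close>, and the rank is \<open>dim \<Lambda>\<close>. The ambient space may be larger than \<open>V\<close> (so rank 0 is
  included); its inner product plays no role.\<close>

definition lattice_basis :: "'a::euclidean_space set \<Rightarrow> 'a set \<Rightarrow> bool"
  where "lattice_basis \<Lambda> B \<longleftrightarrow> independent B \<and> \<Lambda> = int_span B"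

definition is_lattice :: "'a::euclidean_space set \<Rightarrow> bool"
  where "is_lattice \<Lambda> \<longleftrightarrow> (\<exists>B. lattice_basis \<Lambda> B)"

text \<open>A nonzero alternating multilinear form of top degree on \<open>V\<close>, applied to lists of
  \<open>dim V\<close> vectors of \<open>V\<close>.\<close>

definition volume_form :: "'a::euclidean_space set \<Rightarrow> ('a list \<Rightarrow> real) \<Rightarrow> bool"
  where "volume_form V \<Omega> \<longleftrightarrow>
    (\<forall>xs\<in>lists V. length xs = dim V \<longrightarrow>
      (\<forall>i<dim V. \<forall>x\<in>V. \<forall>y\<in>V. \<forall>a b.
        \<Omega> (xs[i := a *\<^sub>R x + b *\<^sub>R y]) = a * \<Omega> (xs[i := x]) + b * \<Omega> (xs[i := y])) \<and>
      (\<forall>i j. i < j \<and> j < dim V \<and> xs ! i = xs ! j \<longrightarrow> \<Omega> xs = 0)) \<and>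
    (\<exists>xs\<in>lists V. length xs = dim V \<and> \<Omega> xs \<noteq> 0)"

text \<open>\<open>\<Lambda>\<close> has covolume 1.\<close>

definition lattice_normalized :: "'a::euclidean_space set \<Rightarrow> ('a list \<Rightarrow> real) \<Rightarrow> bool"
  where "lattice_normalized \<Lambda> \<Omega> \<longleftrightarrow>
    (\<forall>bs. distinct bs \<and> lattice_basis \<Lambda> (set bs) \<longrightarrow> \<bar>\<Omega> bs\<bar> = 1)"

definition polyhedral_cone :: "'a::euclidean_space set \<Rightarrow> bool"
  where "polyhedral_cone \<sigma> \<longleftrightarrow> polyhedron \<sigma> \<and> cone \<sigma> \<and> {0} face_of \<sigma>"

text \<open>The empty set is a \<^const>\<open>face_of\<close> every convex set, but not a face of a cone.\<close>

definition cone_face :: "'a::euclidean_space set \<Rightarrow> 'a set \<Rightarrow> bool"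
  where "cone_face \<tau> \<sigma> \<longleftrightarrow> \<tau> face_of \<sigma> \<and> \<tau> \<noteq> {}"

definition is_fan :: "'a::euclidean_space set \<Rightarrow> 'a set set \<Rightarrow> bool"
  where "is_fan V \<Phi> \<longleftrightarrow> finite \<Phi> \<and>
    (\<forall>\<sigma>\<in>\<Phi>. polyhedral_cone \<sigma> \<and> \<sigma> \<subseteq> V) \<and>
    (\<forall>\<sigma>\<in>\<Phi>. \<forall>\<tau>. cone_face \<tau> \<sigma> \<longrightarrow> \<tau> \<in> \<Phi>) \<and>
    (\<forall>\<sigma>\<in>\<Phi>. \<forall>\<tau>\<in>\<Phi>. cone_face (\<sigma> \<inter> \<tau>) \<sigma> \<and> cone_face (\<sigma> \<inter> \<tau>) \<tau>)"

definition complete_fan :: "'a::euclidean_space set \<Rightarrow> 'a set set \<Rightarrow> bool"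
  where "complete_fan V \<Phi> \<longleftrightarrow> \<Union>\<Phi> = V"

definition cones_of_dim :: "'a::euclidean_space set set \<Rightarrow> nat \<Rightarrow> 'a set set"
  where "cones_of_dim \<Phi> i = {\<sigma>\<in>\<Phi>. dim \<sigma> = i}"

definition cone_rays :: "'a::euclidean_space set \<Rightarrow> 'a set set"
  where "cone_rays \<sigma> = {\<rho>. cone_face \<rho> \<sigma> \<and> dim \<rho> = 1}"

definition simplicial_fan :: "'a::euclidean_space set set \<Rightarrow> bool"
  where "simplicial_fan \<Phi> \<longleftrightarrow> (\<forall>\<sigma>\<in>\<Phi>. card (cone_rays \<sigma>) = dim \<sigma>)"

definition primitive_vector :: "'a::euclidean_space set \<Rightarrow> 'a set \<Rightarrow> 'a"
  where "primitive_vector \<Lambda> \<rho> =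
    (THE v. v \<in> \<rho> \<inter> \<Lambda> \<and> \<rho> \<inter> \<Lambda> = {of_nat k *\<^sub>R v | k :: nat. True})"

definition unimodular_fan :: "'a::euclidean_space set \<Rightarrow> 'a set set \<Rightarrow> bool"
  where "unimodular_fan \<Lambda> \<Phi> \<longleftrightarrow> simplicial_fan \<Phi> \<and>
    (\<forall>\<rho>\<in>cones_of_dim \<Phi> 1. \<exists>v\<in>\<rho> \<inter> \<Lambda>. v \<noteq> 0) \<and>
    (\<forall>\<sigma>\<in>\<Phi>. \<exists>B. lattice_basis \<Lambda> B \<and> primitive_vector \<Lambda> ` cone_rays \<sigma> \<subseteq> B)"


section \<open>Sheaves on a fan\<close>

definition linear_between ::
    "'u::real_vector set \<Rightarrow> 'w::real_vector set \<Rightarrow> ('u \<Rightarrow> 'w) \<Rightarrow> bool"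
  where "linear_between S T f \<longleftrightarrow> f ` S \<subseteq> T \<and>
    (\<forall>x\<in>S. \<forall>y\<in>S. f (x + y) = f x + f y) \<and> (\<forall>c. \<forall>x\<in>S. f (c *\<^sub>R x) = c *\<^sub>R f x)"

text \<open>A sheaf is given by its stalks \<open>F\<^sub>\<sigma>\<close>, which are subspaces of a type \<open>'u\<close>, and restriction maps
  \<open>restr F \<sigma> \<tau>\<close> from \<open>F\<^sub>\<sigma>\<close> to \<open>F\<^sub>\<tau>\<close> for \<open>\<tau> \<le> \<sigma>\<close>.\<close>

record ('a, 'u) fan_sheaf =
  stalk :: "'a set \<Rightarrow> 'u set"
  restr :: "'a set \<Rightarrow> 'a set \<Rightarrow> 'u \<Rightarrow> 'u"

definition is_sheaf ::
    "'a::euclidean_space set set \<Rightarrow> ('a, 'u::real_vector) fan_sheaf \<Rightarrow> bool"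
  where "is_sheaf \<Phi> F \<longleftrightarrow>
    (\<forall>\<sigma>\<in>\<Phi>. subspace (stalk F \<sigma>) \<and> (\<exists>B. finite B \<and> stalk F \<sigma> = span B)) \<and>
    (\<forall>\<sigma>\<in>\<Phi>. \<forall>\<tau>\<in>\<Phi>. cone_face \<tau> \<sigma> \<longrightarrow>
      linear_between (stalk F \<sigma>) (stalk F \<tau>) (restr F \<sigma> \<tau>)) \<and>
    (\<forall>\<sigma>\<in>\<Phi>. \<forall>x\<in>stalk F \<sigma>. restr F \<sigma> \<sigma> x = x) \<and>
    (\<forall>\<sigma>\<in>\<Phi>. \<forall>\<tau>\<in>\<Phi>. \<forall>\<upsilon>\<in>\<Phi>. cone_face \<tau> \<sigma> \<and> cone_face \<upsilon> \<tau> \<longrightarrow>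
      (\<forall>x\<in>stalk F \<sigma>. restr F \<tau> \<upsilon> (restr F \<sigma> \<tau> x) = restr F \<sigma> \<upsilon> x))"

definition sheaf_morphism ::
    "'a::euclidean_space set set \<Rightarrow> ('a, 'u::real_vector) fan_sheaf \<Rightarrow>
     ('a, 'w::real_vector) fan_sheaf \<Rightarrow> ('a set \<Rightarrow> 'u \<Rightarrow> 'w) \<Rightarrow> bool"
  where "sheaf_morphism \<Phi> F G m \<longleftrightarrow>
    (\<forall>\<sigma>\<in>\<Phi>. linear_between (stalk F \<sigma>) (stalk G \<sigma>) (m \<sigma>)) \<and>
    (\<forall>\<sigma>\<in>\<Phi>. \<forall>\<tau>\<in>\<Phi>. cone_face \<tau> \<sigma> \<longrightarrow>
      (\<forall>x\<in>stalk F \<sigma>. m \<tau> (restr F \<sigma> \<tau> x) = restr G \<sigma> \<tau> (m \<sigma> x)))"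

definition sheaf_isomorphic ::
    "'a::euclidean_space set set \<Rightarrow> ('a, 'u::real_vector) fan_sheaf \<Rightarrow>
     ('a, 'w::real_vector) fan_sheaf \<Rightarrow> bool"
  where "sheaf_isomorphic \<Phi> F G \<longleftrightarrow> (\<exists>m. sheaf_morphism \<Phi> F G m \<and>
    (\<forall>\<sigma>\<in>\<Phi>. bij_betw (m \<sigma>) (stalk F \<sigma>) (stalk G \<sigma>)))"

definition short_exact ::
    "'a::euclidean_space set set \<Rightarrow> ('a, 'u::real_vector) fan_sheaf \<Rightarrow>
     ('a, 'u) fan_sheaf \<Rightarrow> ('a, 'u) fan_sheaf \<Rightarrow> bool"
  where "short_exact \<Phi> F' F F'' \<longleftrightarrow> (\<exists>i p. sheaf_morphism \<Phi> F' F i \<and> sheaf_morphism \<Phi> F F'' p \<and>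
    (\<forall>\<sigma>\<in>\<Phi>. inj_on (i \<sigma>) (stalk F' \<sigma>) \<and>
      i \<sigma> ` stalk F' \<sigma> = {x\<in>stalk F \<sigma>. p \<sigma> x = 0} \<and>
      p \<sigma> ` stalk F \<sigma> = stalk F'' \<sigma>))"

text \<open>The Grothendieck group. Generators are the sheaves whose stalks are finite-dimensional
  subspaces of \<open>\<real>\<^sup>\<nat>\<close>; up to isomorphism these are all sheaves of finite-dimensional vector
  spaces.\<close>

type_synonym 'a ksheaf = "('a, nat \<Rightarrow> real) fan_sheaf"

definition K_free :: "'a::euclidean_space set set \<Rightarrow> ('a ksheaf \<Rightarrow>\<^sub>0 int) monoid"
  where "K_free \<Phi> = free_Abelian_group {F. is_sheaf \<Phi> F}"

definition K_relations :: "'a::euclidean_space set set \<Rightarrow> ('a ksheaf \<Rightarrow>\<^sub>0 int) set"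
  where "K_relations \<Phi> = generate (K_free \<Phi>)
    {frag_of F - frag_of F' - frag_of F'' | F' F F''.
      is_sheaf \<Phi> F' \<and> is_sheaf \<Phi> F \<and> is_sheaf \<Phi> F'' \<and> short_exact \<Phi> F' F F''}"

definition K_group :: "'a::euclidean_space set set \<Rightarrow> ('a ksheaf \<Rightarrow>\<^sub>0 int) set monoid"
  where "K_group \<Phi> = K_free \<Phi> Mod K_relations \<Phi>"

text \<open>The class of a sheaf with stalks in an arbitrary type is the class of an isomorphic sheaf
  with stalks in \<open>\<real>\<^sup>\<nat>\<close>.\<close>

definition K_class ::
    "'a::euclidean_space set set \<Rightarrow> ('a, 'u::real_vector) fan_sheaf \<Rightarrow> ('a ksheaf \<Rightarrow>\<^sub>0 int) set"
  where "K_class \<Phi> F = K_relations \<Phi> #>\<^bsub>K_free \<Phi>\<^esub>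
    frag_of (SOME G :: 'a ksheaf. is_sheaf \<Phi> G \<and> sheaf_isomorphic \<Phi> F G)"

definition sheaf_euler ::
    "nat \<Rightarrow> 'a::euclidean_space set set \<Rightarrow> ('a, 'u::real_vector) fan_sheaf \<Rightarrow> int"
  where "sheaf_euler n \<Phi> F =
    (\<Sum>i\<le>n. (-1) ^ i * (\<Sum>\<sigma>\<in>cones_of_dim \<Phi> (n - i). int (dim (stalk F \<sigma>))))"

text \<open>Here and for \<open>ch_tilde\<close> below, the homomorphism is determined on the carrier of
  \<open>K_group \<Phi>\<close>, which is generated by the classes at which it is prescribed.\<close>

definition K_euler ::
    "'a::euclidean_space set \<Rightarrow> 'a set set \<Rightarrow> ('a ksheaf \<Rightarrow>\<^sub>0 int) set \<Rightarrow> int"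
  where "K_euler \<Lambda> \<Phi> = (SOME h. h \<in> hom (K_group \<Phi>) integer_group \<and>
    (\<forall>F :: 'a ksheaf. is_sheaf \<Phi> F \<longrightarrow> h (K_class \<Phi> F) = sheaf_euler (dim \<Lambda>) \<Phi> F))"

subsection \<open>The sheaves \<open>\<O>(\<sigma>)\<close>\<close>

definition const_sheaf :: "'u set \<Rightarrow> ('a, 'u) fan_sheaf"
  where "const_sheaf E = \<lparr>stalk = (\<lambda>_. E), restr = (\<lambda>_ _ x. x)\<rparr>"

text \<open>The constant sheaf on a closed (upward closed) subset \<open>Z\<close>, extended by zero.\<close>

definition const_sheaf_on :: "'a set set \<Rightarrow> 'u::zero set \<Rightarrow> ('a, 'u) fan_sheaf"
  where "const_sheaf_on Z E =
    \<lparr>stalk = (\<lambda>\<sigma>. if \<sigma> \<in> Z then E else {0}),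
     restr = (\<lambda>\<sigma> \<tau> x. if \<tau> \<in> Z then x else 0)\<rparr>"

definition const_sheaf_proj :: "'a set set \<Rightarrow> 'a set \<Rightarrow> 'u::zero \<Rightarrow> 'u"
  where "const_sheaf_proj Z \<sigma> x = (if \<sigma> \<in> Z then x else 0)"

definition kernel_sheaf ::
    "('a, 'u) fan_sheaf \<Rightarrow> ('a, 'w::zero) fan_sheaf \<Rightarrow> ('a set \<Rightarrow> 'u \<Rightarrow> 'w) \<Rightarrow> ('a, 'u) fan_sheaf"
  where "kernel_sheaf F G m = \<lparr>stalk = (\<lambda>\<sigma>. {x\<in>stalk F \<sigma>. m \<sigma> x = 0}), restr = restr F\<rparr>"

definition dual_space :: "'a::real_vector set \<Rightarrow> ('a \<Rightarrow> real) set"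
  where "dual_space W = {f. linear_between W UNIV f \<and> (\<forall>x. x \<notin> W \<longrightarrow> f x = 0)}"

definition star :: "'a::euclidean_space set set \<Rightarrow> 'a set \<Rightarrow> 'a set set"
  where "star \<Phi> \<rho> = {\<sigma>\<in>\<Phi>. cone_face \<rho> \<sigma>}"

definition ray_sheaf :: "'a::euclidean_space set set \<Rightarrow> 'a set \<Rightarrow> ('a, 'a \<Rightarrow> real) fan_sheaf"
  where "ray_sheaf \<Phi> \<rho> =
    kernel_sheaf (const_sheaf (dual_space (span \<rho>)))
      (const_sheaf_on (star \<Phi> \<rho>) (dual_space (span \<rho>)))
      (const_sheaf_proj (star \<Phi> \<rho>))"

text \<open>The tensor product of a finite family of spaces of functions \<open>E\<^sub>i\<close> on \<open>X\<close> is realised as a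
  space of functions on \<open>X\<^sup>I\<close>, the pure tensor of \<open>e\<^sub>i \<in> E\<^sub>i\<close> being \<open>x \<mapsto> \<Prod>\<^sub>i e\<^sub>i (x\<^sub>i)\<close>. For
  \<open>I = {}\<close> this is the line of constant functions.\<close>

definition pure_tensor :: "'i set \<Rightarrow> ('i \<Rightarrow> 'x \<Rightarrow> real) \<Rightarrow> ('i \<Rightarrow> 'x) \<Rightarrow> real"
  where "pure_tensor I e = (\<lambda>x. \<Prod>i\<in>I. e i (x i))"

definition tensor_sheaf ::
    "'i set \<Rightarrow> ('i \<Rightarrow> ('a, 'x \<Rightarrow> real) fan_sheaf) \<Rightarrow> ('a, ('i \<Rightarrow> 'x) \<Rightarrow> real) fan_sheaf"
  where "tensor_sheaf I F =
    \<lparr>stalk = (\<lambda>\<sigma>. span {pure_tensor I e | e. \<forall>i\<in>I. e i \<in> stalk (F i) \<sigma>}),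
     restr = (\<lambda>\<sigma> \<tau>. SOME h. linear h \<and>
       (\<forall>e. (\<forall>i\<in>I. e i \<in> stalk (F i) \<sigma>) \<longrightarrow>
         h (pure_tensor I e) = pure_tensor I (\<lambda>i. restr (F i) \<sigma> \<tau> (e i))))\<rparr>"

definition cone_sheaf ::
    "'a::euclidean_space set set \<Rightarrow> 'a set \<Rightarrow> ('a, ('a set \<Rightarrow> 'a) \<Rightarrow> real) fan_sheaf"
  where "cone_sheaf \<Phi> \<sigma> = tensor_sheaf (cone_rays \<sigma>) (ray_sheaf \<Phi>)"


section \<open>Cone-wise polynomial functions and cohomology\<close>

text \<open>The graded ring \<open>A = S(V\<^sup>\<or>)\<close> is identified with the ring of polynomial functions, the piece of
  degree \<open>2i\<close> being the homogeneous polynomial functions of polynomial degree \<open>i\<close>. Every polynomial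
  function on \<open>V\<close> is the restriction of one on the ambient space. Cone-wise polynomial functions
  are functions on the support \<open>\<Union>\<Phi>\<close>, extended by zero outside.\<close>

definition homogeneous_poly :: "nat \<Rightarrow> ('a::euclidean_space \<Rightarrow> real) \<Rightarrow> bool"
  where "homogeneous_poly i p \<longleftrightarrow>
    real_polynomial_function p \<and> (\<forall>c x. p (c *\<^sub>R x) = c ^ i * p x)"

definition conewise ::
    "(('a::euclidean_space \<Rightarrow> real) \<Rightarrow> bool) \<Rightarrow> 'a set set \<Rightarrow> ('a \<Rightarrow> real) set"
  where "conewise P \<Phi> = {f. continuous_on (\<Union>\<Phi>) f \<and> (\<forall>x. x \<notin> \<Union>\<Phi> \<longrightarrow> f x = 0) \<and>
    (\<forall>\<sigma>\<in>\<Phi>. \<exists>p. P p \<and> (\<forall>x\<in>\<sigma>. f x = p x))}"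

definition cpoly_ring :: "'a::euclidean_space set set \<Rightarrow> ('a \<Rightarrow> real) ring"
  where "cpoly_ring \<Phi> =
    \<lparr>carrier = conewise real_polynomial_function \<Phi>,
     monoid.mult = (\<lambda>f g x. f x * g x),
     monoid.one = indicat_real (\<Union>\<Phi>),
     ring.zero = (\<lambda>x. 0),
     ring.add = (\<lambda>f g x. f x + g x)\<rparr>"

definition restrict_fan :: "'a::euclidean_space set set \<Rightarrow> ('a \<Rightarrow> real) \<Rightarrow> 'a \<Rightarrow> real"
  where "restrict_fan \<Phi> p = (\<lambda>x. if x \<in> \<Union>\<Phi> then p x else 0)"

text \<open>The ideal generated by \<open>A\<^sup>+\<close>, the polynomials without constant term.\<close>

definition cpoly_ideal :: "'a::euclidean_space set set \<Rightarrow> ('a \<Rightarrow> real) set"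
  where "cpoly_ideal \<Phi> = Idl\<^bsub>cpoly_ring \<Phi>\<^esub>
    {restrict_fan \<Phi> p | p. real_polynomial_function p \<and> p 0 = 0}"

definition H_ring :: "'a::euclidean_space set set \<Rightarrow> ('a \<Rightarrow> real) set ring"
  where "H_ring \<Phi> = cpoly_ring \<Phi> Quot cpoly_ideal \<Phi>"

text \<open>An element of the completed ring is the sequence of its homogeneous components.\<close>

definition hat_ring :: "'a::euclidean_space set set \<Rightarrow> (nat \<Rightarrow> 'a \<Rightarrow> real) ring"
  where "hat_ring \<Phi> =
    \<lparr>carrier = {s. \<forall>i. s i \<in> conewise (homogeneous_poly i) \<Phi>},
     monoid.mult = (\<lambda>s t i x. \<Sum>j\<le>i. s j x * t (i - j) x),
     monoid.one = (\<lambda>i. if i = 0 then indicat_real (\<Union>\<Phi>) else (\<lambda>x. 0)),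
     ring.zero = (\<lambda>i x. 0),
     ring.add = (\<lambda>s t i x. s i x + t i x)\<rparr>"

definition hat_ideal :: "'a::euclidean_space set set \<Rightarrow> (nat \<Rightarrow> 'a \<Rightarrow> real) set"
  where "hat_ideal \<Phi> = Idl\<^bsub>hat_ring \<Phi>\<^esub>
    {(\<lambda>i. restrict_fan \<Phi> (p i)) | p. (\<forall>i. homogeneous_poly i (p i)) \<and> p 0 = (\<lambda>x. 0)}"

text \<open>The inclusion of the ring of cone-wise polynomial functions into its completion.\<close>

definition hat_incl :: "'a::euclidean_space set set \<Rightarrow> ('a \<Rightarrow> real) \<Rightarrow> nat \<Rightarrow> 'a \<Rightarrow> real"
  where "hat_incl \<Phi> f = (THE s. s \<in> carrier (hat_ring \<Phi>) \<and> finite {i. s i \<noteq> (\<lambda>x. 0)} \<and>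
    (\<forall>x. f x = (\<Sum>i | s i \<noteq> (\<lambda>x. 0). s i x)))"

definition H_to_hat ::
    "'a::euclidean_space set set \<Rightarrow> ('a \<Rightarrow> real) set \<Rightarrow> (nat \<Rightarrow> 'a \<Rightarrow> real) set"
  where "H_to_hat \<Phi> h = the_elem ((\<lambda>f. hat_ideal \<Phi> +>\<^bsub>hat_ring \<Phi>\<^esub> hat_incl \<Phi> f) ` h)"

definition H_proj ::
    "'a::euclidean_space set set \<Rightarrow> (nat \<Rightarrow> 'a \<Rightarrow> real) \<Rightarrow> ('a \<Rightarrow> real) set"
  where "H_proj \<Phi> s = inv_into (carrier (H_ring \<Phi>)) (H_to_hat \<Phi>) (hat_ideal \<Phi> +>\<^bsub>hat_ring \<Phi>\<^esub> s)"

definition courant ::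
    "'a::euclidean_space set \<Rightarrow> 'a set set \<Rightarrow> 'a set \<Rightarrow> 'a \<Rightarrow> real"
  where "courant \<Lambda> \<Phi> \<rho> = (THE f. f \<in> conewise linear \<Phi> \<and> f (primitive_vector \<Lambda> \<rho>) = 1 \<and>
    (\<forall>\<rho>'\<in>cones_of_dim \<Phi> 1. \<rho>' \<noteq> \<rho> \<longrightarrow> (\<forall>x\<in>\<rho>'. f x = 0)))"


section \<open>Chern character and Todd class\<close>

text \<open>The value \<open>G(\<phi>)\<close> of a formal power series \<open>G\<close> at a cone-wise linear function \<open>\<phi>\<close>.\<close>

definition fps_at ::
    "'a::euclidean_space set set \<Rightarrow> real fps \<Rightarrow> ('a \<Rightarrow> real) \<Rightarrow> nat \<Rightarrow> 'a \<Rightarrow> real"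
  where "fps_at \<Phi> G \<phi> = (\<lambda>i. restrict_fan \<Phi> (\<lambda>x. fps_nth G i * \<phi> x ^ i))"

definition ch_tilde ::
    "'a::euclidean_space set \<Rightarrow> 'a set set \<Rightarrow> ('a ksheaf \<Rightarrow>\<^sub>0 int) set \<Rightarrow> nat \<Rightarrow> 'a \<Rightarrow> real"
  where "ch_tilde \<Lambda> \<Phi> = (SOME h. h \<in> hom (K_group \<Phi>) (add_monoid (hat_ring \<Phi>)) \<and>
    (\<forall>\<sigma>\<in>\<Phi>. h (K_class \<Phi> (cone_sheaf \<Phi> \<sigma>)) =
      finprod (hat_ring \<Phi>) (\<lambda>\<rho>. fps_at \<Phi> (fps_exp (-1)) (courant \<Lambda> \<Phi> \<rho>)) (cone_rays \<sigma>)))"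

definition ch ::
    "'a::euclidean_space set \<Rightarrow> 'a set set \<Rightarrow> ('a ksheaf \<Rightarrow>\<^sub>0 int) set \<Rightarrow> ('a \<Rightarrow> real) set"
  where "ch \<Lambda> \<Phi> \<gamma> = H_proj \<Phi> (ch_tilde \<Lambda> \<Phi> \<gamma>)"

definition Td :: "'a::euclidean_space set \<Rightarrow> 'a set set \<Rightarrow> ('a \<Rightarrow> real) set"
  where "Td \<Lambda> \<Phi> = H_proj \<Phi> (finprod (hat_ring \<Phi>)
    (\<lambda>\<rho>. fps_at \<Phi> (fps_X / (1 - fps_exp (-1))) (courant \<Lambda> \<Phi> \<rho>)) (cones_of_dim \<Phi> 1))"


section \<open>The integral\<close>

text \<open>Polynomial functions on the subspace \<open>V\<close>, extended by zero outside.\<close>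

definition polys_on :: "'a::euclidean_space set \<Rightarrow> ('a \<Rightarrow> real) set"
  where "polys_on V = {f. (\<exists>p. real_polynomial_function p \<and> (\<forall>x\<in>V. f x = p x)) \<and>
    (\<forall>x. x \<notin> V \<longrightarrow> f x = 0)}"

definition local_poly ::
    "'a::euclidean_space set \<Rightarrow> ('a \<Rightarrow> real) \<Rightarrow> 'a set \<Rightarrow> 'a \<Rightarrow> real"
  where "local_poly V f \<sigma> = (THE p. p \<in> polys_on V \<and> (\<forall>x\<in>\<sigma>. p x = f x))"

text \<open>The absolute value makes the choice of the ordering of the rays immaterial.\<close>

definition cone_volume ::
    "'a::euclidean_space set \<Rightarrow> ('a list \<Rightarrow> real) \<Rightarrow> 'a set \<Rightarrow> real"
  where "cone_volume \<Lambda> \<Omega> \<sigma> =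
    \<bar>\<Omega> (map (primitive_vector \<Lambda>) (SOME \<rho>s. distinct \<rho>s \<and> set \<rho>s = cone_rays \<sigma>))\<bar>"

definition brion_denom ::
    "'a::euclidean_space set \<Rightarrow> ('a list \<Rightarrow> real) \<Rightarrow> 'a set set \<Rightarrow> 'a set \<Rightarrow> 'a \<Rightarrow> real"
  where "brion_denom \<Lambda> \<Omega> \<Phi> \<sigma> = local_poly (span \<Lambda>)
    (\<lambda>x. inverse (cone_volume \<Lambda> \<Omega> \<sigma>) * (\<Prod>\<rho>\<in>cone_rays \<sigma>. courant \<Lambda> \<Phi> \<rho> x)) \<sigma>"

text \<open>The equation \<open>\<zeta> f = (\<Sum>\<sigma>. f\<^sub>\<sigma> / F\<^sub>\<sigma>)\<close> in the field of fractions of \<open>A\<close> is read as an equation of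
  functions on the dense open subset of \<open>V\<close> where no denominator vanishes.\<close>

definition brion_zeta ::
    "'a::euclidean_space set \<Rightarrow> ('a list \<Rightarrow> real) \<Rightarrow> 'a set set \<Rightarrow> ('a \<Rightarrow> real) \<Rightarrow> 'a \<Rightarrow> real"
  where "brion_zeta \<Lambda> \<Omega> \<Phi> f = (THE p. p \<in> polys_on (span \<Lambda>) \<and>
    (\<forall>x\<in>span \<Lambda>. (\<forall>\<sigma>\<in>cones_of_dim \<Phi> (dim \<Lambda>). brion_denom \<Lambda> \<Omega> \<Phi> \<sigma> x \<noteq> 0) \<longrightarrow>
      p x = (\<Sum>\<sigma>\<in>cones_of_dim \<Phi> (dim \<Lambda>).
        local_poly (span \<Lambda>) f \<sigma> x / brion_denom \<Lambda> \<Omega> \<Phi> \<sigma> x)))"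

text \<open>By \<open>A\<close>-linearity \<open>\<zeta>\<close> induces a map from \<open>H(\<Phi>)\<close> to \<open>A / A\<^sup>+ = \<real>\<close>, where the class of a
  polynomial in \<open>A / A\<^sup>+\<close> is its value at 0.\<close>

definition fan_integral ::
    "'a::euclidean_space set \<Rightarrow> ('a list \<Rightarrow> real) \<Rightarrow> 'a set set \<Rightarrow> ('a \<Rightarrow> real) set \<Rightarrow> real"
  where "fan_integral \<Lambda> \<Omega> \<Phi> h = the_elem ((\<lambda>f. brion_zeta \<Lambda> \<Omega> \<Phi> f 0) ` h)"

end

theory Submission
  imports Defs
begin

text \<open>Every sheaf is filtered by sheaves supported at single cones, so an additive function \<open>h\<close> on \<open>K(\<Phi>)\<close>
  is \<open>h \<gamma> = \<Sum>\<^sub>\<tau> d\<^sub>\<tau>(\<gamma>) h(\<delta>\<^sub>\<tau>)\<close>, where \<open>\<delta>\<^sub>\<tau>\<close> is the class of a one-dimensional sheaf supported at \<open>\<tau>\<close>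
  and \<open>d\<^sub>\<tau>\<close> is the dimension of the stalk at \<open>\<tau>\<close>. Since \<open>[\<O>(\<sigma>)]\<close> is the sum of the \<open>\<delta>\<^sub>\<tau>\<close> over the \<open>\<tau>\<close>
  without common ray with \<open>\<sigma>\<close>, the Chern character of \<open>\<delta>\<^sub>\<tau>\<close> is the product of the factors
  \<open>1 - exp(-\<phi>\<^sub>\<rho>)\<close> over \<open>\<rho> \<in> [\<tau>](1)\<close> and \<open>exp(-\<phi>\<^sub>\<rho>)\<close> over the other rays. Localizing the integral at the
  maximal cones, its product with the Todd class becomes the sum over \<open>\<kappa> \<ge> \<tau>\<close> of the products of
  the Bernoulli series \<open>t / (exp(a t) - 1)\<close>, where \<open>a\<close> runs over the coordinates on \<open>\<kappa>\<close> belonging to the rays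
  outside \<open>\<tau>\<close>, evaluated at a generic point \<open>x\<close>. This sum is \<open>(-t)^(n - dim \<tau>)\<close>: expand each factor in a
  geometric series, so that all the sums run over the lattice of integral functionals \<open>m\<close> vanishing on
  \<open>\<tau>\<close>. The coefficient of \<open>exp(-m)\<close> does not depend on \<open>x\<close>; for \<open>m \<noteq> 0\<close> it is seen to vanish by moving \<open>x\<close> to
  the side where \<open>m\<close> is negative, and for \<open>m = 0\<close> exactly one cone \<open>\<kappa>\<close> contributes.\<close>

section \<open>Polyhedral cones\<close>

text \<open>The Bernoulli identity on a star is used twice. Its coefficient of degree
  \<open>n - dim \<tau>\<close> is the Euler characteristic of \<open>\<delta>\<^sub>\<tau>\<close>.
  Its constant coefficient is Brion's sum for the squarefree monomial of \<tau>, which is 1 or 0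
  according as \<tau> is maximal or not; since these monomials generate the cone-wise polynomials
  over the polynomials, this gives both the polynomiality of \<open>brion_zeta\<close> and a formula
  for the integral. The obstacle in the lattice sum is that the convergent expansion of
  \<open>1 / (exp a - 1)\<close> depends on the sign of \<open>a\<close>. The weights
  \<open>wt\<close> split into a part free of that sign and a part free of the lattice point, which
  makes coefficients at different points \<open>x\<close> comparable. A second difficulty is that
  \<open>K_euler\<close>, \<open>ch_tilde\<close> and \<open>H_proj\<close> are chosen objects: each
  needs a witness, and then enough uniqueness to compute it. For \<open>ch_tilde\<close> this is the
  nonsingularity of the matrix expressing the classes of \<O>(\<sigma>) through the
  \<open>\<delta>\<^sub>\<tau>\<close>; for \<open>H_proj\<close> one works modulo
  \<open>hat_ideal\<close>, on which the component of degree \<open>n\<close> has integral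
  0.\<close>

lemma polyhedral_coneD:
  assumes "polyhedral_cone \<sigma>"
  shows "closed \<sigma>" "convex \<sigma>" "cone \<sigma>" "0 \<in> \<sigma>" "{0} face_of \<sigma>"
proof -
  have *: "polyhedron \<sigma>" "cone \<sigma>" "{0} face_of \<sigma>" using assms by (simp_all add: polyhedral_cone_def)
  show "closed \<sigma>" "convex \<sigma>" "cone \<sigma>" "{0} face_of \<sigma>"
    using * polyhedron_imp_closed polyhedron_imp_convex by simp_all
  show "0 \<in> \<sigma>" using face_of_imp_subset[OF *(3)] by simp
qed

lemma convex_cone_add:
  assumes "convex \<sigma>" "cone \<sigma>" "x \<in> \<sigma>" "y \<in> \<sigma>"
  shows "x + y \<in> \<sigma>"
  using assms convex_cone[of \<sigma>] by simp

lemma sum_mem_cone: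
  assumes "polyhedral_cone \<sigma>" "\<And>i. i \<in> I \<Longrightarrow> f i \<in> \<sigma>"
  shows "sum f I \<in> \<sigma>"
  using assms(2)
proof (induction I rule: infinite_finite_induct)
  case (insert i I)
  then show ?case
    by (simp add: convex_cone_add[OF polyhedral_coneD(2,3)[OF assms(1)]])
qed (simp_all add: polyhedral_coneD(4)[OF assms(1)])

text \<open>The origin is the midpoint of \<open>x\<close> and \<open>- x\<close>; as
  \<open>{0}\<close> is a face, both end points lie in it.\<close>

lemma pointed_cone_uminus:
  assumes "polyhedral_cone \<sigma>" "x \<in> \<sigma>" "- x \<in> \<sigma>"
  shows "x = 0"
proof (rule ccontr)
  assume "x \<noteq> 0"
  have "0 \<in> open_segment x (- x)"
  proof -
    have "x \<noteq> - x" using \<open>x \<noteq> 0\<close> by (metis add.right_inverse scaleR_2 scaleR_eq_0_iff zero_neq_numeral)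
    moreover have "0 = (1 - 1/2) *\<^sub>R x + (1/2) *\<^sub>R (- x)" by simp
    ultimately show ?thesis unfolding in_segment by (intro conjI exI[of _ "1/2"]) simp_all
  qed
  then show False
    using polyhedral_coneD(5)[OF assms(1)] assms(2,3) \<open>x \<noteq> 0\<close> unfolding face_of_def by blast
qed

text \<open>Faces of a polyhedron are exposed. A hyperplane exposing \<open>{0}\<close> passes
  through the origin, and its inward normal is the functional.\<close>

lemma pointed_cone_positive_functional:
  assumes "polyhedral_cone \<sigma>"
  obtains a where "\<And>x. x \<in> \<sigma> \<Longrightarrow> x \<noteq> 0 \<Longrightarrow> a \<bullet> x > 0"
proof -
  have "{0} exposed_face_of \<sigma>"
    using assms exposed_face_of_polyhedron polyhedral_coneD unfolding polyhedral_cone_def by blast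
  then obtain a b where ab: "\<sigma> \<subseteq> {x. a \<bullet> x \<le> b}" "{0} = \<sigma> \<inter> {x. a \<bullet> x = b}"
    unfolding exposed_face_of_def by blast
  then have "0 \<in> \<sigma> \<inter> {x. a \<bullet> x = b}" by blast
  then have b: "b = 0" by simp
  have "(- a) \<bullet> x > 0" if "x \<in> \<sigma>" "x \<noteq> 0" for x
  proof -
    have "a \<bullet> x \<le> 0" using ab(1) b that by blast
    moreover have "a \<bullet> x \<noteq> 0"
    proof
      assume "a \<bullet> x = 0"
      then have "x \<in> \<sigma> \<inter> {x. a \<bullet> x = b}" using b that by simp
      then have "x \<in> {0}" using ab(2) by simp
      then show False using that by simp
    qed
    ultimately show ?thesis by simp
  qed
  then show ?thesis using that by blast
qed

text \<open>The span is a line, and a negative multiple of \<open>u\<close> in the cone would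
  rescale to \<open>- u\<close>, against pointedness.\<close>

lemma one_dim_cone_eq:
  assumes "polyhedral_cone \<rho>" "dim \<rho> = 1" "u \<in> \<rho>" "u \<noteq> 0"
  shows "\<rho> = {c *\<^sub>R u | c. c \<ge> 0}"
proof
  have "span {u} = span \<rho>"
    by (rule dim_eq_span) (use assms in auto)
  then have sub: "\<rho> \<subseteq> span {u}" using span_superset by blast
  show "\<rho> \<subseteq> {c *\<^sub>R u | c. c \<ge> 0}"
  proof
    fix x assume x: "x \<in> \<rho>"
    then obtain c where c: "x = c *\<^sub>R u" using sub unfolding span_singleton by blast
    have "c \<ge> 0"
    proof (rule ccontr)
      assume "\<not> c \<ge> 0"
      then have "- 1 / c \<ge> 0" by (simp add: divide_nonpos_neg)
      then have "(- 1 / c) *\<^sub>R x \<in> \<rho>"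
        using polyhedral_coneD(3)[OF assms(1)] x unfolding cone_def by blast
      then have "- u \<in> \<rho>" using c \<open>\<not> c \<ge> 0\<close> by simp
      then show False using pointed_cone_uminus assms by blast
    qed
    then show "x \<in> {c *\<^sub>R u | c. c \<ge> 0}" using c by blast
  qed
  show "{c *\<^sub>R u | c. c \<ge> 0} \<subseteq> \<rho>"
    using polyhedral_coneD(3)[OF assms(1)] assms(3) unfolding cone_def by blast
qed

lemma ne_empty_mem: "x \<in> A \<Longrightarrow> A \<noteq> {}" by blast

text \<open>If a point of the half-line lies inside a segment of the cone, rescale both end points
  to the slice \<open>a \<bullet> x = 1\<close>: then \<open>e\<close> is a convex combination of
  the rescaled points, and by extremality both are equal to \<open>e\<close>. End points at the
  origin cannot be rescaled and are treated apart.\<close>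

lemma extreme_point_slice_ray:
  assumes \<sigma>: "polyhedral_cone \<sigma>" and a: "\<And>x. x \<in> \<sigma> \<Longrightarrow> x \<noteq> 0 \<Longrightarrow> a \<bullet> x > 0"
    and e: "e extreme_point_of {x \<in> \<sigma>. a \<bullet> x = 1}"
  shows "{c *\<^sub>R e | c. c \<ge> 0} \<in> cone_rays \<sigma>"
proof -
  let ?r = "{c *\<^sub>R e | c. c \<ge> 0}"
  have e1: "e \<in> \<sigma>" "a \<bullet> e = 1" using e by (auto simp: extreme_point_of_def)
  then have e0: "e \<noteq> 0" by auto
  have \<sigma>cone: "\<And>c x. c \<ge> 0 \<Longrightarrow> x \<in> \<sigma> \<Longrightarrow> c *\<^sub>R x \<in> \<sigma>"
    using polyhedral_coneD(3)[OF \<sigma>] unfolding cone_def by blast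
  have face: "x \<in> ?r \<and> y \<in> ?r" if xy: "x \<in> \<sigma>" "y \<in> \<sigma>" and z: "z \<in> ?r" "z \<in> open_segment x y" for x y z
  proof -
    obtain t where t: "0 < t" "t < 1" "z = (1 - t) *\<^sub>R x + t *\<^sub>R y" and "x \<noteq> y"
      using z by (auto simp: in_segment)
    obtain c where c: "c \<ge> 0" "z = c *\<^sub>R e" using z by auto
    have "0 = 0 *\<^sub>R e \<and> (0::real) \<ge> 0" by simp
    then have 0: "0 \<in> ?r" by blast
    have az: "a \<bullet> z = (1 - t) * (a \<bullet> x) + t * (a \<bullet> y)" by (simp add: t inner_right_distrib)
    have azc: "a \<bullet> z = c" by (simp add: c e1)
    have pos: "u \<in> \<sigma> \<Longrightarrow> a \<bullet> u \<ge> 0" for u using a[of u] by (cases "u = 0") (auto simp: less_imp_le)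
    show ?thesis
    proof (cases "x = 0")
      case True
      then have "c *\<^sub>R e = t *\<^sub>R y" using t c by simp
      then have "y = (1 / t) *\<^sub>R (c *\<^sub>R e)" using t by simp
      then have "y = (c / t) *\<^sub>R e" by simp
      moreover have "c / t \<ge> 0" using c t by simp
      ultimately have "y \<in> ?r" by blast
      then show ?thesis using True 0 by simp
    next
      case x0: False
      show ?thesis
      proof (cases "y = 0")
        case True
        then have "c *\<^sub>R e = (1 - t) *\<^sub>R x" using t c by simp
        then have "x = (1 / (1 - t)) *\<^sub>R (c *\<^sub>R e)" using t by simp
        then have "x = (c / (1 - t)) *\<^sub>R e" by simp
        moreover have "c / (1 - t) \<ge> 0" using c t by simp
        ultimately have "x \<in> ?r" by blast
        then show ?thesis using True 0 by simp
      next
        case y0: False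
        define p q where "p = a \<bullet> x" and "q = a \<bullet> y"
        have pq: "p > 0" "q > 0" using a xy x0 y0 by (auto simp: p_def q_def)
        have cpos: "c = (1 - t) * p + t * q" using az azc by (simp add: p_def q_def)
        then have c0: "c > 0" using pq t by (simp add: add_pos_pos)
        \<comment> \<open>Dividing \<open>z = c *\<^sub>R e\<close> by \<open>c\<close> gives the
          rescaled end points the weights \<open>(1 - t) * p / c\<close> and
          \<open>t * q / c\<close>, which add up to 1.\<close>
        define s where "s = t * q / c"
        have s: "0 < s" "1 - s = (1 - t) * p / c" using pq t c0 cpos by (auto simp: s_def field_simps)
        have "(1 - t) * p / c > 0" using pq t c0 by simp
        then have s1: "s < 1" using s(2) by simp
        define x' y' where "x' = (1 / p) *\<^sub>R x" and "y' = (1 / q) *\<^sub>R y"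
        have x'y': "x' \<in> {x \<in> \<sigma>. a \<bullet> x = 1}" "y' \<in> {x \<in> \<sigma>. a \<bullet> x = 1}"
          using pq xy \<sigma>cone by (auto simp: x'_def y'_def p_def q_def)
        have "e = (1 / c) *\<^sub>R z" using c c0 by simp
        also have "\<dots> = (1 - s) *\<^sub>R x' + s *\<^sub>R y'"
        proof -
          have "((1 - t) * p / c) *\<^sub>R x' = ((1 - t) / c) *\<^sub>R x" "(t * q / c) *\<^sub>R y' = (t / c) *\<^sub>R y"
            using pq by (simp_all add: x'_def y'_def)
          then show ?thesis unfolding s(2) unfolding t s_def by (simp add: scaleR_right_distrib)
        qed
        finally have e': "e = (1 - s) *\<^sub>R x' + s *\<^sub>R y'" .
        have "x' = y'"
        proof (rule ccontr)
          assume "x' \<noteq> y'"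
          then have "e \<in> open_segment x' y'" unfolding in_segment using e' s(1) s1 by blast
          then show False using e x'y' unfolding extreme_point_of_def by blast
        qed
        moreover have "(1 - s) *\<^sub>R y' + s *\<^sub>R y' = y'" by (simp flip: scaleR_left_distrib)
        ultimately have ee: "e = x'" "e = y'" using e' by simp_all
        have "x = p *\<^sub>R e" unfolding ee(1) x'_def using pq by simp
        moreover have "y = q *\<^sub>R e" unfolding ee(2) y'_def using pq by simp
        ultimately show ?thesis using pq by (intro conjI CollectI) (rule exI[of _ p], simp, rule exI[of _ q], simp)
      qed
    qed
  qed
  have conv: "convex ?r"
  proof (rule convexI)
    fix x y :: 'a and u w :: real assume *: "x \<in> ?r" "y \<in> ?r" "0 \<le> u" "0 \<le> w" "u + w = 1"
    from *(1) obtain b where b: "x = b *\<^sub>R e" "b \<ge> 0" by blast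
    from *(2) obtain c where c: "y = c *\<^sub>R e" "c \<ge> 0" by blast
    have "u *\<^sub>R x + w *\<^sub>R y = (u * b + w * c) *\<^sub>R e \<and> u * b + w * c \<ge> 0"
      using * b c by (simp add: scaleR_left_distrib)
    then show "u *\<^sub>R x + w *\<^sub>R y \<in> ?r" by (intro CollectI exI)
  qed
  have "?r face_of \<sigma>"
    unfolding face_of_def
  proof (intro conjI ballI impI)
    show "?r \<subseteq> \<sigma>" using \<sigma>cone[OF _ e1(1)] by (intro subsetI, elim CollectE exE conjE) simp
    show "convex ?r" by (rule conv)
    fix x y z assume "x \<in> \<sigma>" "y \<in> \<sigma>" "z \<in> ?r" "z \<in> open_segment x y"
    from face[OF this] show "x \<in> ?r" "y \<in> ?r" by (rule conjunct1, rule conjunct2)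
  qed
  moreover have er: "e \<in> ?r"
    by (rule CollectI, rule exI[of _ 1]) simp
  moreover have "dim ?r = 1"
  proof -
    have "span ?r = span {e}"
    proof
      have "?r \<subseteq> span {e}" unfolding span_singleton by (intro subsetI, elim CollectE exE conjE, hypsubst) (rule rangeI)
      then show "span ?r \<subseteq> span {e}" by (rule span_minimal[OF _ subspace_span])
      show "span {e} \<subseteq> span ?r" using er by (intro span_mono) simp
    qed
    then have "dim (span ?r) = dim (span {e})" by (rule arg_cong)
    then show ?thesis using e0 by (simp only: dim_span dim_singleton if_False)
  qed
  ultimately have "?r face_of \<sigma>" "dim ?r = 1" by simp_all
  moreover have "?r \<noteq> {}" using er by (rule ne_empty_mem)
  ultimately show ?thesis unfolding cone_rays_def cone_face_def by simp
qed

section \<open>Cones spanned by finitely many vectors\<close>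

definition conic :: "'i set \<Rightarrow> ('i \<Rightarrow> 'a::real_vector) \<Rightarrow> 'a set"
  where "conic I w = {\<Sum>i\<in>I. c i *\<^sub>R w i | c. \<forall>i\<in>I. c i \<ge> 0}"

lemma conicI: "x = (\<Sum>i\<in>I. c i *\<^sub>R w i) \<Longrightarrow> (\<And>i. i \<in> I \<Longrightarrow> c i \<ge> 0) \<Longrightarrow> x \<in> conic I w"
  unfolding conic_def by (rule CollectI, rule exI[of _ c]) simp

lemma conicE:
  assumes "x \<in> conic I w"
  obtains c where "x = (\<Sum>i\<in>I. c i *\<^sub>R w i)" "\<forall>i\<in>I. c i \<ge> 0"
  using assms unfolding conic_def by (elim CollectE exE conjE) (rule that)

lemma conic_scaleR: "b \<ge> 0 \<Longrightarrow> x \<in> conic I w \<Longrightarrow> b *\<^sub>R x \<in> conic I w"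
  by (erule conicE, rule_tac c = "\<lambda>i. b * c i" in conicI) (simp_all add: scaleR_sum_right)

lemma conic_add:
  assumes "x \<in> conic I w" "y \<in> conic I w"
  shows "x + y \<in> conic I w"
proof -
  from assms obtain c d where "x = (\<Sum>i\<in>I. c i *\<^sub>R w i)" "\<forall>i\<in>I. c i \<ge> 0"
     "y = (\<Sum>i\<in>I. d i *\<^sub>R w i)" "\<forall>i\<in>I. d i \<ge> 0" by (elim conicE) blast
  then show ?thesis
    by (intro conicI[where c = "\<lambda>i. c i + d i"]) (simp_all add: scaleR_left_distrib sum.distrib)
qed

lemma conic_scaled_generator:
  assumes "finite I" "i \<in> I" "c \<ge> 0"
  shows "c *\<^sub>R w i \<in> conic I w"
proof (rule conicI)
  show "c *\<^sub>R w i = (\<Sum>j\<in>I. (if j = i then c else 0) *\<^sub>R w j)"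
    using assms by (subst sum.remove[OF assms(1,2)]) (simp add: sum.neutral)
qed (use assms in auto)

lemma conic_zero: "0 \<in> conic I w"
  by (rule conicI[of _ "\<lambda>_. 0"]) simp_all

text \<open>The slice of \<sigma> at height 1 of a positive functional is compact and convex, hence
  the hull of its extreme points, and these lie on rays.\<close>

lemma polyhedral_cone_eq_rays:
  assumes \<sigma>: "polyhedral_cone \<sigma>" and fin: "finite (cone_rays \<sigma>)"
    and w: "\<And>\<rho>. \<rho> \<in> cone_rays \<sigma> \<Longrightarrow> \<rho> = {c *\<^sub>R w \<rho> | c. c \<ge> 0}"
  shows "\<sigma> = conic (cone_rays \<sigma>) w" (is "_ = ?Q")
proof
  obtain a where a: "\<And>x. x \<in> \<sigma> \<Longrightarrow> x \<noteq> 0 \<Longrightarrow> a \<bullet> x > 0"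
    using pointed_cone_positive_functional[OF \<sigma>] by blast
  let ?P = "{x \<in> \<sigma>. a \<bullet> x = 1}"
  have \<sigma>cone: "\<And>c x. c \<ge> 0 \<Longrightarrow> x \<in> \<sigma> \<Longrightarrow> c *\<^sub>R x \<in> \<sigma>"
    using polyhedral_coneD(3)[OF \<sigma>] unfolding cone_def by blast
  have cl: "closed ?P"
  proof -
    have "?P = \<sigma> \<inter> {x. a \<bullet> x = 1}" by auto
    then show ?thesis using polyhedral_coneD(1)[OF \<sigma>] closed_hyperplane by (metis closed_Int)
  qed
  have "bounded ?P"
  proof (cases "\<sigma> \<inter> sphere 0 1 = {}")
    case True
    have "?P = {}"
    proof (rule ccontr)
      assume "?P \<noteq> {}"
      then obtain x where x: "x \<in> \<sigma>" "a \<bullet> x = 1" by auto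
      then have "x \<noteq> 0" by auto
      then have "(1 / norm x) *\<^sub>R x \<in> \<sigma> \<inter> sphere 0 1" using x \<sigma>cone by auto
      then show False using True by auto
    qed
    then show ?thesis by (metis bounded_empty)
  next
    case False
    \<comment> \<open>The functional has a positive minimum on the unit vectors of \<sigma>, and its
      reciprocal bounds the norms on the slice.\<close>
    have "compact (\<sigma> \<inter> sphere 0 1)"
      using polyhedral_coneD(1)[OF \<sigma>] by (simp add: closed_Int_compact)
    moreover have "continuous_on (\<sigma> \<inter> sphere 0 1) (\<lambda>x. a \<bullet> x)"
      by (intro continuous_intros)
    ultimately obtain m where m: "m \<in> \<sigma> \<inter> sphere 0 1" "\<And>x. x \<in> \<sigma> \<inter> sphere 0 1 \<Longrightarrow> a \<bullet> m \<le> a \<bullet> x"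
      using continuous_attains_inf[of "\<sigma> \<inter> sphere 0 1" "\<lambda>x. a \<bullet> x"] False by blast
    then have am: "a \<bullet> m > 0" using a[of m] by fastforce
    have "norm x \<le> 1 / (a \<bullet> m)" if "x \<in> ?P" for x
    proof -
      have x0: "x \<noteq> 0" using that by auto
      then have "(1 / norm x) *\<^sub>R x \<in> \<sigma> \<inter> sphere 0 1" using that \<sigma>cone by auto
      then have "a \<bullet> m \<le> a \<bullet> ((1 / norm x) *\<^sub>R x)" using m by blast
      also have "\<dots> = 1 / norm x" using that by auto
      finally show ?thesis using am x0 by (simp add: field_simps)
    qed
    then show ?thesis by (auto simp: bounded_iff)
  qed
  then have comp: "compact ?P" using cl by (simp add: compact_eq_bounded_closed)
  have convP: "convex ?P"
  proof -
    have "?P = \<sigma> \<inter> {x. a \<bullet> x = 1}" by auto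
    then show ?thesis using polyhedral_coneD(2)[OF \<sigma>] convex_hyperplane by (metis convex_Int)
  qed
  have Qconv: "convex ?Q"
    by (rule convexI) (intro conic_add conic_scaleR)
  have "e \<in> ?Q" if e: "e extreme_point_of ?P" for e
  proof -
    have r: "{c *\<^sub>R e | c. c \<ge> 0} \<in> cone_rays \<sigma>" (is "?r \<in> _")
      using extreme_point_slice_ray[OF \<sigma> _ e] a by blast
    have "e \<in> ?r" by (rule CollectI, rule exI[of _ 1]) simp
    then have "e \<in> {c *\<^sub>R w ?r | c. c \<ge> 0}" by (rule subsetD[OF equalityD1[OF w[OF r]]])
    then obtain c where c: "e = c *\<^sub>R w ?r" "c \<ge> 0" by (elim CollectE exE conjE)
    show ?thesis by (subst c(1)) (rule conic_scaled_generator[OF fin r c(2)])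
  qed
  then have "{x. x extreme_point_of ?P} \<subseteq> ?Q" by blast
  then have "convex hull {x. x extreme_point_of ?P} \<subseteq> ?Q"
    using Qconv by (intro hull_minimal)
  then have PQ: "?P \<subseteq> ?Q" using Krein_Milman_Minkowski[OF comp convP] by simp
  show "\<sigma> \<subseteq> ?Q"
  proof
    fix x assume x: "x \<in> \<sigma>"
    show "x \<in> ?Q"
    proof (cases "x = 0")
      case True then show ?thesis by (simp add: conic_zero)
    next
      case False
      then have ax: "a \<bullet> x > 0" using a x by auto
      then have "(1 / (a \<bullet> x)) *\<^sub>R x \<in> ?P" using \<sigma>cone x by auto
      then have "(1 / (a \<bullet> x)) *\<^sub>R x \<in> ?Q" using PQ by (rule subsetD[rotated])
      then have "(a \<bullet> x) *\<^sub>R (1 / (a \<bullet> x)) *\<^sub>R x \<in> ?Q" by (rule conic_scaleR[OF less_imp_le[OF ax]])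
      then show ?thesis using ax by simp
    qed
  qed
  show "?Q \<subseteq> \<sigma>"
  proof
    fix x assume "x \<in> ?Q"
    then obtain c where c: "x = (\<Sum>\<rho>\<in>cone_rays \<sigma>. c \<rho> *\<^sub>R w \<rho>)" "\<forall>\<rho>\<in>cone_rays \<sigma>. c \<rho> \<ge> 0" by (rule conicE)
    have "c \<rho> *\<^sub>R w \<rho> \<in> \<sigma>" if "\<rho> \<in> cone_rays \<sigma>" for \<rho>
    proof -
      have "c \<rho> *\<^sub>R w \<rho> \<in> {d *\<^sub>R w \<rho> | d. d \<ge> 0}"
        by (rule CollectI, rule exI[of _ "c \<rho>"]) (use c(2) that in simp)
      then have "c \<rho> *\<^sub>R w \<rho> \<in> \<rho>" by (rule subsetD[OF equalityD2[OF w[OF that]]])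
      moreover have "\<rho> \<subseteq> \<sigma>" using that face_of_imp_subset by (auto simp: cone_rays_def cone_face_def)
      ultimately show ?thesis by blast
    qed
    then show "x \<in> \<sigma>" unfolding c(1)
      by (intro sum_mem_cone[OF \<sigma>])
  qed
qed

section \<open>Coordinates on unimodular cones\<close>

lemma int_spanE:
  assumes "x \<in> int_span B"
  obtains c :: "_ \<Rightarrow> int" where "x = (\<Sum>b\<in>B. of_int (c b) *\<^sub>R b)"
  using assms unfolding int_span_def by blast

lemma int_spanI: "x = (\<Sum>b\<in>B. of_int (c b) *\<^sub>R b) \<Longrightarrow> x \<in> int_span B"
  unfolding int_span_def by blast

lemma int_span_base:
  assumes "finite B" "b \<in> B" shows "b \<in> int_span B"
proof (rule int_spanI)
  show "b = (\<Sum>x\<in>B. of_int (if x = b then 1 else 0) *\<^sub>R x)"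
    using assms by (subst sum.remove[OF assms]) (simp add: sum.neutral)
qed

lemma int_span_diff_scale:
  assumes "x \<in> int_span B" "y \<in> int_span B"
  shows "x - of_int k *\<^sub>R y \<in> int_span B"
proof -
  from assms obtain c d where "x = (\<Sum>b\<in>B. of_int (c b) *\<^sub>R b)" "y = (\<Sum>b\<in>B. of_int (d b) *\<^sub>R b)"
    by (elim int_spanE)
  then show ?thesis
    by (intro int_spanI[where c = "\<lambda>b. c b - k * d b"])
       (simp add: scaleR_sum_right sum_subtractf scaleR_left_diff_distrib)
qed

lemma span_sum_scale: "(\<And>i. i \<in> I \<Longrightarrow> w i \<in> S) \<Longrightarrow> (\<Sum>i\<in>I. c i *\<^sub>R w i) \<in> span S"
  by (intro span_sum span_scale span_base) simp

lemma int_span_subset_span: "int_span B \<subseteq> span B"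
  by (rule subsetI, erule int_spanE) (simp add: span_sum_scale)

lemma lattice_basis_facts:
  assumes "lattice_basis \<Lambda> B"
  shows "finite B" "span \<Lambda> = span B" "dim \<Lambda> = card B" "B \<subseteq> \<Lambda>"
proof -
  have ind: "independent B" and \<Lambda>: "\<Lambda> = int_span B" using assms by (auto simp: lattice_basis_def)
  show fin: "finite B" using ind independent_imp_finite by blast
  show sub: "B \<subseteq> \<Lambda>" using int_span_base fin \<Lambda> by blast
  show sp: "span \<Lambda> = span B"
  proof
    show "span \<Lambda> \<subseteq> span B" using int_span_subset_span \<Lambda> by (metis span_minimal subspace_span)
    show "span B \<subseteq> span \<Lambda>" using sub by (rule span_mono)
  qed
  show "dim \<Lambda> = card B" by (rule dim_eq_card[OF sp[symmetric] ind])
qed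

text \<open>Division with remainder on the half-line: a functional that is integral on the lattice
  and positive at \<open>u\<close> is smallest at some nonzero lattice point \<open>w\<close>; the
  remainder of any other lattice point modulo \<open>w\<close> has a smaller value and is therefore
  0.\<close>

lemma primitive_vector_exists:
  assumes B: "lattice_basis \<Lambda> B" and u: "u \<in> \<Lambda>" "u \<noteq> 0" and \<rho>: "\<rho> = {c *\<^sub>R u | c. c \<ge> 0}"
  shows "primitive_vector \<Lambda> \<rho> \<in> \<rho> \<inter> \<Lambda>" "primitive_vector \<Lambda> \<rho> \<noteq> 0"
proof -
  have ind: "independent B" and \<Lambda>: "\<Lambda> = int_span B" using B by (auto simp: lattice_basis_def)
  obtain c where c: "u = (\<Sum>b\<in>B. of_int (c b) *\<^sub>R b)" using u(1) unfolding \<Lambda> by (rule int_spanE)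
  obtain b0 where b0: "b0 \<in> B" "c b0 \<noteq> 0"
  proof -
    have "\<exists>b\<in>B. c b \<noteq> 0"
    proof (rule ccontr)
      assume "\<not> ?thesis"
      then have "u = 0" unfolding c by (intro sum.neutral) auto
      then show False using u by simp
    qed
    then show ?thesis using that by blast
  qed
  obtain f :: "'a \<Rightarrow> real" where f: "linear f" "\<And>b. b \<in> B \<Longrightarrow> f b = (if b = b0 then 1 else 0)"
    using linear_independent_extend[OF ind, of "\<lambda>b. if b = b0 then 1 else 0"] by auto
  have fsum: "f (\<Sum>b\<in>B. of_int (d b) *\<^sub>R b) = of_int (d b0)" for d :: "'a \<Rightarrow> int"
  proof -
    have "f (\<Sum>b\<in>B. of_int (d b) *\<^sub>R b) = (\<Sum>b\<in>B. of_int (d b) * f b)"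
      by (simp add: linear_sum[OF f(1)] linear_scale[OF f(1)])
    also have "\<dots> = (\<Sum>b\<in>B. if b = b0 then of_int (d b) else 0)"
      by (rule sum.cong) (auto simp: f(2))
    finally show ?thesis using b0 lattice_basis_facts(1)[OF B] by simp
  qed
  \<comment> \<open>The coordinate of \<open>u\<close> at \<open>b0\<close> may be negative; the
    sign makes the functional positive at \<open>u\<close>.\<close>
  define g where "g x = sgn (f u) * f x" for x
  have glin: "linear g" unfolding g_def
    using f(1) by (auto simp: linear_iff algebra_simps)
  have fu: "f u = of_int (c b0)" using c fsum by simp
  have gu: "g u > 0" using fu b0 by (auto simp: g_def sgn_if)
  have gint: "g x \<in> \<int>" if "x \<in> \<Lambda>" for x
  proof -
    from that \<Lambda> have "x \<in> int_span B" by simp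
    then obtain d where "x = (\<Sum>b\<in>B. of_int (d b) *\<^sub>R b)" by (rule int_spanE)
    then have "f x = of_int (d b0)" using fsum by simp
    then show ?thesis by (auto simp: g_def sgn_if)
  qed
  have gpos: "g x \<ge> 0" "g x = 0 \<Longrightarrow> x = 0" if "x \<in> \<rho>" for x
    using that gu unfolding \<rho> by (auto simp: linear_scale[OF glin])
  define S where "S = {w \<in> \<rho> \<inter> \<Lambda>. w \<noteq> 0}"
  have "u \<in> S" using u unfolding S_def \<rho> by (auto intro: exI[of _ 1])
  \<comment> \<open>On \<open>S\<close> the values of \<open>g\<close> are nonnegative integers;
    \<open>nat \<lfloor>g y\<rfloor>\<close> only makes them natural numbers.\<close>
  then obtain w where w: "w \<in> S" "\<And>y. y \<in> S \<Longrightarrow> nat \<lfloor>g w\<rfloor> \<le> nat \<lfloor>g y\<rfloor>"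
    using ex_has_least_nat[of "\<lambda>x. x \<in> S" u "\<lambda>x. nat \<lfloor>g x\<rfloor>"] by blast
  have w': "w \<in> \<rho>" "w \<in> \<Lambda>" "w \<noteq> 0" using w by (auto simp: S_def)
  have gw: "g w > 0" using gpos[OF w'(1)] w'(3) by fastforce
  have wmin: "g w \<le> g y" if "y \<in> S" for y
  proof -
    have "g y \<ge> 0" using gpos(1) that by (simp add: S_def)
    then have "0 \<le> \<lfloor>g y\<rfloor>" by simp
    then have "\<lfloor>g w\<rfloor> \<le> \<lfloor>g y\<rfloor>" using w(2)[OF that] by linarith
    moreover have "of_int \<lfloor>g w\<rfloor> = g w" "of_int \<lfloor>g y\<rfloor> = g y"
      using gint that w' by (auto simp: S_def)
    ultimately show ?thesis by linarith
  qed
  have mult: "\<rho> \<inter> \<Lambda> = {of_nat k *\<^sub>R w | k :: nat. True}"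
  proof (intro equalityI subsetI)
    fix y assume y: "y \<in> \<rho> \<inter> \<Lambda>"
    define k where "k = \<lfloor>g y / g w\<rfloor>"
    have k0: "k \<ge> 0" using gpos(1)[of y] y gw by (simp add: k_def)
    define z where "z = y - of_int k *\<^sub>R w"
    have z\<Lambda>: "z \<in> \<Lambda>" using y w' \<Lambda> int_span_diff_scale by (auto simp: z_def)
    have gz: "g z = g y - of_int k * g w"
      by (simp add: z_def linear_diff[OF glin] linear_scale[OF glin])
    have "of_int k \<le> g y / g w" "g y / g w < of_int k + 1" unfolding k_def by linarith+
    then have gz': "0 \<le> g z" "g z < g w" using gw gz by (auto simp: field_simps)
    have "z \<in> \<rho>"
    proof -
      obtain s t where st: "y = s *\<^sub>R u" "w = t *\<^sub>R u" using y w' unfolding \<rho> by auto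
      then have z: "z = (s - of_int k * t) *\<^sub>R u" by (simp add: z_def algebra_simps)
      then have "(s - of_int k * t) * g u \<ge> 0" using gz' by (simp add: linear_scale[OF glin])
      then have "s - of_int k * t \<ge> 0" using gu by (simp add: zero_le_mult_iff)
      then show ?thesis using z \<rho> by blast
    qed
    then have "z = 0" using wmin[of z] gz' z\<Lambda> by (fastforce simp: S_def)
    then have "y = of_nat (nat k) *\<^sub>R w" using k0 by (simp add: z_def)
    then show "y \<in> {of_nat k *\<^sub>R w | k :: nat. True}" by blast
  next
    fix y assume "y \<in> {of_nat k *\<^sub>R w | k :: nat. True}"
    then obtain k :: nat where k: "y = of_nat k *\<^sub>R w" by blast
    obtain t where t: "w = t *\<^sub>R u" "t \<ge> 0" using w' \<rho> by auto
    have "y = (of_nat k * t) *\<^sub>R u" by (simp add: k t)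
    then have "y \<in> \<rho>" unfolding \<rho> using t by auto
    moreover have "y \<in> \<Lambda>"
    proof -
      have "0 \<in> int_span B" by (rule int_spanI[of _ "\<lambda>_. 0"]) simp
      then have "0 - of_int (- int k) *\<^sub>R w \<in> \<Lambda>" using int_span_diff_scale w' unfolding \<Lambda> by blast
      then show ?thesis by (simp add: k)
    qed
    ultimately show "y \<in> \<rho> \<inter> \<Lambda>" by simp
  qed
  have "primitive_vector \<Lambda> \<rho> = w" unfolding primitive_vector_def
  proof (rule the_equality)
    show "w \<in> \<rho> \<inter> \<Lambda> \<and> \<rho> \<inter> \<Lambda> = {of_nat k *\<^sub>R w | k :: nat. True}" using w' mult by blast
  next
    \<comment> \<open>Two generators are natural multiples of each other, by factors whose product
      is 1.\<close>
    fix y assume y: "y \<in> \<rho> \<inter> \<Lambda> \<and> \<rho> \<inter> \<Lambda> = {of_nat k *\<^sub>R y | k :: nat. True}"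
    then have "y \<in> {of_nat k *\<^sub>R w | k :: nat. True}" using mult by blast
    then obtain k :: nat where k: "y = of_nat k *\<^sub>R w" by blast
    have "w \<in> {of_nat k *\<^sub>R y | k :: nat. True}" using y w' by blast
    then obtain l :: nat where "w = of_nat l *\<^sub>R y" by blast
    then have "w = (of_nat l * of_nat k) *\<^sub>R w" by (simp add: k)
    then have "(1 - of_nat l * of_nat k) *\<^sub>R w = 0" by (simp add: algebra_simps)
    then have "of_nat (l * k) = (1::real)" using w' by simp
    then have "l * k = 1" by (metis of_nat_eq_1_iff)
    then show "y = w" using k by simp
  qed
  then show "primitive_vector \<Lambda> \<rho> \<in> \<rho> \<inter> \<Lambda>" "primitive_vector \<Lambda> \<rho> \<noteq> 0" using w' by auto
qed

lemma span_image_sum: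
  assumes "finite I" "inj_on w I" "x \<in> span (w ` I)"
  obtains c where "x = (\<Sum>i\<in>I. c i *\<^sub>R w i)"
proof -
  obtain u where "x = (\<Sum>a\<in>w ` I. u a *\<^sub>R a)"
    using assms span_finite[of "w ` I"] by auto
  then have "x = (\<Sum>i\<in>I. u (w i) *\<^sub>R w i)" using assms by (simp add: sum.reindex)
  then show ?thesis by (rule that)
qed

lemma linear_extend_indexed:
  fixes w :: "'i \<Rightarrow> 'a::real_vector"
  assumes "inj_on w I" "independent (w ` I)"
  obtains f :: "'a \<Rightarrow> real" where "linear f" "\<And>i. i \<in> I \<Longrightarrow> f (w i) = c i"
proof -
  obtain f where "linear f" "\<And>b. b \<in> w ` I \<Longrightarrow> f b = c (the_inv_into I w b)"
    using linear_independent_extend[OF assms(2), of "\<lambda>b. c (the_inv_into I w b)"] by auto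
  then show ?thesis using that assms(1) by (simp add: the_inv_into_f_f)
qed

section \<open>Coordinates and faces in a unimodular fan\<close>

locale unimodular_complete_fan =
  fixes \<Lambda> :: "'a::euclidean_space set" and \<Phi> :: "'a set set"
  assumes lattice: "is_lattice \<Lambda>"
    and fan: "is_fan (span \<Lambda>) \<Phi>"
    and complete: "complete_fan (span \<Lambda>) \<Phi>"
    and unimodular: "unimodular_fan \<Lambda> \<Phi>"
begin

abbreviation "V \<equiv> span \<Lambda>"
abbreviation "n \<equiv> dim \<Lambda>"
abbreviation "R \<equiv> cones_of_dim \<Phi> 1"
abbreviation "v \<equiv> primitive_vector \<Lambda>"
abbreviation "Max_cones \<equiv> cones_of_dim \<Phi> n"

lemma finite_fan: "finite \<Phi>"
  and fan_cone: "\<sigma> \<in> \<Phi> \<Longrightarrow> polyhedral_cone \<sigma>"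
  and fan_subset: "\<sigma> \<in> \<Phi> \<Longrightarrow> \<sigma> \<subseteq> V"
  and fan_face: "\<sigma> \<in> \<Phi> \<Longrightarrow> cone_face \<tau> \<sigma> \<Longrightarrow> \<tau> \<in> \<Phi>"
  and fan_Int: "\<sigma> \<in> \<Phi> \<Longrightarrow> \<tau> \<in> \<Phi> \<Longrightarrow> cone_face (\<sigma> \<inter> \<tau>) \<sigma>"
     "\<sigma> \<in> \<Phi> \<Longrightarrow> \<tau> \<in> \<Phi> \<Longrightarrow> cone_face (\<sigma> \<inter> \<tau>) \<tau>"
  using fan unfolding is_fan_def by blast+

lemma Union_fan: "\<Union>\<Phi> = V"
  using complete by (simp add: complete_fan_def)

lemma finite_R: "finite R" and finite_Max: "finite Max_cones"
  using finite_fan by (auto simp: cones_of_dim_def)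

lemma cone_rays_subset: "\<sigma> \<in> \<Phi> \<Longrightarrow> cone_rays \<sigma> \<subseteq> R"
  using fan_face by (auto simp: cone_rays_def cones_of_dim_def)

lemma finite_rays [simp]: "\<sigma> \<in> \<Phi> \<Longrightarrow> finite (cone_rays \<sigma>)"
  using cone_rays_subset finite_R finite_subset by blast

lemma dim_eq_card_rays: "\<sigma> \<in> \<Phi> \<Longrightarrow> dim \<sigma> = card (cone_rays \<sigma>)"
  using unimodular by (simp add: unimodular_fan_def simplicial_fan_def)

lemma primitive_vector_ray:
  assumes "\<rho> \<in> R"
  shows "v \<rho> \<in> \<rho>" "v \<rho> \<in> \<Lambda>" "v \<rho> \<noteq> 0" "\<rho> = {c *\<^sub>R v \<rho> | c. c \<ge> 0}"
proof -
  have \<rho>: "\<rho> \<in> \<Phi>" "dim \<rho> = 1" using assms by (auto simp: cones_of_dim_def)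
  obtain u where u: "u \<in> \<rho>" "u \<in> \<Lambda>" "u \<noteq> 0"
    using unimodular assms by (auto simp: unimodular_fan_def)
  obtain B where "lattice_basis \<Lambda> B" using lattice by (auto simp: is_lattice_def)
  from primitive_vector_exists[OF this u(2,3) one_dim_cone_eq[OF fan_cone[OF \<rho>(1)] \<rho>(2) u(1,3)]]
  show *: "v \<rho> \<in> \<rho>" "v \<rho> \<in> \<Lambda>" "v \<rho> \<noteq> 0" by auto
  show "\<rho> = {c *\<^sub>R v \<rho> | c. c \<ge> 0}"
    using one_dim_cone_eq[OF fan_cone[OF \<rho>(1)] \<rho>(2) *(1,3)] .
qed

lemma inj_v: "inj_on v R"
proof (rule inj_onI)
  fix \<rho> \<rho>' assume *: "\<rho> \<in> R" "\<rho>' \<in> R" "v \<rho> = v \<rho>'"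
  have "\<rho> = {c *\<^sub>R v \<rho> | c. c \<ge> 0}" by (rule primitive_vector_ray(4)[OF *(1)])
  also have "\<dots> = {c *\<^sub>R v \<rho>' | c. c \<ge> 0}" by (simp add: *(3))
  also have "\<dots> = \<rho>'" by (rule primitive_vector_ray(4)[OF *(2), symmetric])
  finally show "\<rho> = \<rho>'" .
qed

lemma inj_v_rays: "\<sigma> \<in> \<Phi> \<Longrightarrow> inj_on v (cone_rays \<sigma>)"
  using inj_v cone_rays_subset inj_on_subset by blast

lemma cone_eq_conic: "\<sigma> \<in> \<Phi> \<Longrightarrow> \<sigma> = conic (cone_rays \<sigma>) v"
  using cone_rays_subset primitive_vector_ray(4)
  by (intro polyhedral_cone_eq_rays fan_cone finite_rays) blast+

lemma mem_coneD: "\<sigma> \<in> \<Phi> \<Longrightarrow> x \<in> \<sigma> \<Longrightarrow> x \<in> conic (cone_rays \<sigma>) v"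
  by (drule cone_eq_conic) (erule subsetD[OF equalityD1])

lemma mem_coneI: "\<sigma> \<in> \<Phi> \<Longrightarrow> x \<in> conic (cone_rays \<sigma>) v \<Longrightarrow> x \<in> \<sigma>"
  by (drule cone_eq_conic) (erule subsetD[OF equalityD2])

lemma conic_subset_span: "conic I w \<subseteq> span (w ` I)"
  by (rule subsetI, erule conicE) (simp add: span_sum_scale)

lemma lattice_basis_rays:
  assumes "\<sigma> \<in> \<Phi>" obtains B where "lattice_basis \<Lambda> B" "v ` cone_rays \<sigma> \<subseteq> B"
  using unimodular assms by (auto simp: unimodular_fan_def)

lemma independent_v: "\<sigma> \<in> \<Phi> \<Longrightarrow> independent (v ` cone_rays \<sigma>)"
  by (meson lattice_basis_def lattice_basis_rays independent_mono)

text \<open>The primitive vectors are part of a lattice basis, and their number is already the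
  rank.\<close>

lemma lattice_basis_max:
  assumes "\<kappa> \<in> Max_cones" shows "lattice_basis \<Lambda> (v ` cone_rays \<kappa>)"
proof -
  have \<kappa>: "\<kappa> \<in> \<Phi>" "dim \<kappa> = n" using assms by (auto simp: cones_of_dim_def)
  obtain B where B: "lattice_basis \<Lambda> B" "v ` cone_rays \<kappa> \<subseteq> B" using lattice_basis_rays[OF \<kappa>(1)] .
  have "card (v ` cone_rays \<kappa>) = card B"
    using dim_eq_card_rays \<kappa> inj_v_rays card_image lattice_basis_facts(3)[OF B(1)] by metis
  then have "v ` cone_rays \<kappa> = B" using B card_subset_eq lattice_basis_facts(1) by metis
  then show ?thesis using B by simp
qed

lemma card_rays_le: "\<sigma> \<in> \<Phi> \<Longrightarrow> card (cone_rays \<sigma>) \<le> n"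
  using lattice_basis_rays lattice_basis_facts inj_v_rays card_image card_mono by metis

lemma Max_cones_iff: "\<kappa> \<in> Max_cones \<longleftrightarrow> \<kappa> \<in> \<Phi> \<and> card (cone_rays \<kappa>) = n"
  using dim_eq_card_rays by (auto simp: cones_of_dim_def)

text \<open>A linear extension to the ambient space of a coordinate of \<sigma>; only its values on
  \<open>span \<sigma>\<close> are determined. For \<rho> outside \<open>cone_rays \<sigma>\<close>
  it vanishes on that span, so that formulas may let \<rho> run over all rays.\<close>

definition coord :: "'a set \<Rightarrow> 'a set \<Rightarrow> 'a \<Rightarrow> real"
  where "coord \<sigma> \<rho> = (SOME f. linear f \<and> (\<forall>\<rho>'\<in>cone_rays \<sigma>. f (v \<rho>') = (if \<rho>' = \<rho> then 1 else 0)))"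

lemma coord:
  assumes "\<sigma> \<in> \<Phi>"
  shows linear_coord: "linear (coord \<sigma> \<rho>)"
    and coord_v: "\<rho>' \<in> cone_rays \<sigma> \<Longrightarrow> coord \<sigma> \<rho> (v \<rho>') = (if \<rho>' = \<rho> then 1 else 0)"
proof -
  obtain f :: "'a \<Rightarrow> real" where "linear f" "\<And>\<rho>'. \<rho>' \<in> cone_rays \<sigma> \<Longrightarrow> f (v \<rho>') = (if \<rho>' = \<rho> then 1 else 0)"
    by (rule linear_extend_indexed[OF inj_v_rays[OF assms] independent_v[OF assms], where c = "\<lambda>\<rho>'. if \<rho>' = \<rho> then 1 else 0"]) blast
  then have "\<exists>f :: 'a \<Rightarrow> real. linear f \<and> (\<forall>\<rho>'\<in>cone_rays \<sigma>. f (v \<rho>') = (if \<rho>' = \<rho> then 1 else 0))"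
    by (intro exI[of _ f]) simp
  from someI_ex[OF this]
  have *: "linear (coord \<sigma> \<rho>) \<and> (\<forall>\<rho>'\<in>cone_rays \<sigma>. coord \<sigma> \<rho> (v \<rho>') = (if \<rho>' = \<rho> then 1 else 0))"
    unfolding coord_def .
  show "linear (coord \<sigma> \<rho>)" by (rule conjunct1[OF *])
  show "\<rho>' \<in> cone_rays \<sigma> \<Longrightarrow> coord \<sigma> \<rho> (v \<rho>') = (if \<rho>' = \<rho> then 1 else 0)"
    by (rule bspec[OF conjunct2[OF *]])
qed

lemma coord_sum:
  assumes "\<sigma> \<in> \<Phi>" "I \<subseteq> cone_rays \<sigma>"
  shows "coord \<sigma> \<rho> (\<Sum>\<rho>'\<in>I. c \<rho>' *\<^sub>R v \<rho>') = (if \<rho> \<in> I then c \<rho> else 0)"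
proof -
  have fin: "finite I" using assms finite_subset finite_rays by blast
  have "coord \<sigma> \<rho> (\<Sum>\<rho>'\<in>I. c \<rho>' *\<^sub>R v \<rho>') = (\<Sum>\<rho>'\<in>I. c \<rho>' * coord \<sigma> \<rho> (v \<rho>'))"
    by (simp add: linear_sum[OF linear_coord[OF assms(1)]] linear_scale[OF linear_coord[OF assms(1)]])
  also have "\<dots> = (\<Sum>\<rho>'\<in>I. if \<rho>' = \<rho> then c \<rho>' else 0)"
    by (rule sum.cong[OF refl]) (use assms(2) in \<open>simp add: coord_v[OF assms(1)] subset_iff\<close>)
  finally show ?thesis using fin by simp
qed

lemma span_cone: "\<sigma> \<in> \<Phi> \<Longrightarrow> span \<sigma> = span (v ` cone_rays \<sigma>)"
proof
  assume \<sigma>: "\<sigma> \<in> \<Phi>"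
  have "\<sigma> \<subseteq> span (v ` cone_rays \<sigma>)"
    using mem_coneD[OF \<sigma>] conic_subset_span by blast
  then show "span \<sigma> \<subseteq> span (v ` cone_rays \<sigma>)" by (rule span_minimal[OF _ subspace_span])
  have "v ` cone_rays \<sigma> \<subseteq> \<sigma>"
  proof
    fix x assume "x \<in> v ` cone_rays \<sigma>"
    then obtain \<rho> where \<rho>: "\<rho> \<in> cone_rays \<sigma>" "x = v \<rho>" by blast
    have "\<rho> \<subseteq> \<sigma>" using \<rho> by (auto simp: cone_rays_def cone_face_def face_of_imp_subset)
    then show "x \<in> \<sigma>" using \<rho> primitive_vector_ray(1) cone_rays_subset[OF \<sigma>] by blast
  qed
  then show "span (v ` cone_rays \<sigma>) \<subseteq> span \<sigma>" by (rule span_mono)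
qed

lemma span_coord:
  assumes \<sigma>: "\<sigma> \<in> \<Phi>" and "x \<in> span \<sigma>"
  shows "x = (\<Sum>\<rho>\<in>cone_rays \<sigma>. coord \<sigma> \<rho> x *\<^sub>R v \<rho>)"
proof -
  obtain c where c: "x = (\<Sum>\<rho>\<in>cone_rays \<sigma>. c \<rho> *\<^sub>R v \<rho>)"
    using assms(2) span_image_sum[OF finite_rays[OF \<sigma>] inj_v_rays[OF \<sigma>]] span_cone[OF \<sigma>] by metis
  then have "coord \<sigma> \<rho> x = c \<rho>" if "\<rho> \<in> cone_rays \<sigma>" for \<rho>
    using coord_sum[OF \<sigma> subset_refl] that by simp
  then show ?thesis using c by simp
qed

lemma coord_outside:
  assumes \<sigma>: "\<sigma> \<in> \<Phi>" and "x \<in> span \<sigma>" "\<rho> \<notin> cone_rays \<sigma>"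
  shows "coord \<sigma> \<rho> x = 0"
  by (subst span_coord[OF assms(1,2)]) (simp add: coord_sum[OF \<sigma> subset_refl] assms(3))

lemma mem_cone_iff:
  assumes \<sigma>: "\<sigma> \<in> \<Phi>"
  shows "x \<in> \<sigma> \<longleftrightarrow> x \<in> span \<sigma> \<and> (\<forall>\<rho>\<in>cone_rays \<sigma>. coord \<sigma> \<rho> x \<ge> 0)"
proof
  assume x: "x \<in> \<sigma>"
  from mem_coneD[OF \<sigma> this] obtain c where c: "x = (\<Sum>\<rho>\<in>cone_rays \<sigma>. c \<rho> *\<^sub>R v \<rho>)" "\<forall>\<rho>\<in>cone_rays \<sigma>. c \<rho> \<ge> 0"
    by (rule conicE)
  have "\<forall>\<rho>\<in>cone_rays \<sigma>. coord \<sigma> \<rho> x \<ge> 0"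
    using c(2) by (simp add: c(1) coord_sum[OF \<sigma> subset_refl])
  then show "x \<in> span \<sigma> \<and> (\<forall>\<rho>\<in>cone_rays \<sigma>. coord \<sigma> \<rho> x \<ge> 0)" using x by (auto intro: span_base)
next
  assume x: "x \<in> span \<sigma> \<and> (\<forall>\<rho>\<in>cone_rays \<sigma>. coord \<sigma> \<rho> x \<ge> 0)"
  have "x \<in> conic (cone_rays \<sigma>) v"
    by (rule conicI[where c = "\<lambda>\<rho>. coord \<sigma> \<rho> x"]) (use x span_coord[OF \<sigma>] in auto)
  then show "x \<in> \<sigma>" by (rule mem_coneI[OF \<sigma>])
qed

lemma ray_in_cone: "\<sigma> \<in> \<Phi> \<Longrightarrow> \<rho> \<in> cone_rays \<sigma> \<Longrightarrow> v \<rho> \<in> \<sigma>"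
  using span_base[of "v \<rho>" "v ` cone_rays \<sigma>"] span_cone by (auto simp: mem_cone_iff coord_v)

lemma face_rays_subset: "\<sigma> \<in> \<Phi> \<Longrightarrow> cone_face \<tau> \<sigma> \<Longrightarrow> cone_rays \<tau> \<subseteq> cone_rays \<sigma>"
  by (auto simp: cone_rays_def cone_face_def intro: face_of_trans)

text \<open>Inclusion of the rays gives \<open>\<tau> \<subseteq> \<sigma>\<close>, so \<tau> is its
  own intersection with \<sigma>, a face by the fan axiom. From here on incidence of cones is
  incidence of sets of rays.\<close>

lemma cone_face_iff_rays:
  assumes "\<sigma> \<in> \<Phi>" "\<tau> \<in> \<Phi>"
  shows "cone_face \<tau> \<sigma> \<longleftrightarrow> cone_rays \<tau> \<subseteq> cone_rays \<sigma>"
proof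
  assume sub: "cone_rays \<tau> \<subseteq> cone_rays \<sigma>"
  have "\<tau> \<subseteq> \<sigma>"
  proof
    fix x assume "x \<in> \<tau>"
    from mem_coneD[OF assms(2) this] obtain c where c: "x = (\<Sum>\<rho>\<in>cone_rays \<tau>. c \<rho> *\<^sub>R v \<rho>)" "\<forall>\<rho>\<in>cone_rays \<tau>. c \<rho> \<ge> 0"
      by (rule conicE)
    have "x = (\<Sum>\<rho>\<in>cone_rays \<sigma>. (if \<rho> \<in> cone_rays \<tau> then c \<rho> else 0) *\<^sub>R v \<rho>)"
      unfolding c(1) using sub assms by (intro sum.mono_neutral_cong_left) auto
    then have "x \<in> conic (cone_rays \<sigma>) v" by (rule conicI) (use c in auto)
    then show "x \<in> \<sigma>" by (rule mem_coneI[OF assms(1)])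
  qed
  then show "cone_face \<tau> \<sigma>" using fan_Int[OF assms] by (simp add: Int_absorb1)
qed (use assms face_rays_subset in blast)

lemma rays_inj:
  assumes "\<sigma> \<in> \<Phi>" "\<tau> \<in> \<Phi>" "cone_rays \<sigma> = cone_rays \<tau>" shows "\<sigma> = \<tau>"
  using cone_eq_conic[OF assms(1)] cone_eq_conic[OF assms(2)] assms(3) by (rule_tac trans) (assumption, simp)

lemma rays_Int:
  assumes "\<sigma> \<in> \<Phi>" "\<tau> \<in> \<Phi>"
  shows "\<sigma> \<inter> \<tau> \<in> \<Phi>" "cone_rays (\<sigma> \<inter> \<tau>) = cone_rays \<sigma> \<inter> cone_rays \<tau>"
proof -
  show I: "\<sigma> \<inter> \<tau> \<in> \<Phi>" using fan_Int fan_face assms by blast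
  have "cone_rays \<sigma> \<inter> cone_rays \<tau> \<subseteq> cone_rays (\<sigma> \<inter> \<tau>)"
  proof
    fix \<rho> assume \<rho>: "\<rho> \<in> cone_rays \<sigma> \<inter> cone_rays \<tau>"
    have "\<rho> face_of \<sigma>" "\<rho> face_of \<tau>" using \<rho> by (auto simp: cone_rays_def cone_face_def)
    then have "\<rho> face_of \<sigma> \<inter> \<tau>" by (metis face_of_subset face_of_imp_subset Int_lower1 le_inf_iff)
    then show "\<rho> \<in> cone_rays (\<sigma> \<inter> \<tau>)" using \<rho> by (auto simp: cone_rays_def cone_face_def)
  qed
  then show "cone_rays (\<sigma> \<inter> \<tau>) = cone_rays \<sigma> \<inter> cone_rays \<tau>"
    using face_rays_subset fan_Int assms by blast
qed

text \<open>The cone over \<open>S\<close> is cut out of \<sigma> by the vanishing of coordinates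
  that are nonnegative on \<sigma>, hence is a face. It has no rays besides \<open>S\<close> because
  its dimension is \<open>card S\<close> and the fan is simplicial.\<close>

lemma subset_rays_face:
  assumes \<sigma>: "\<sigma> \<in> \<Phi>" and S: "S \<subseteq> cone_rays \<sigma>"
  obtains \<tau> where "\<tau> \<in> \<Phi>" "cone_rays \<tau> = S"
proof -
  let ?c = "conic S v"
  have finS: "finite S" using S \<sigma> finite_subset finite_rays by blast
  have mem: "x \<in> ?c \<longleftrightarrow> x \<in> \<sigma> \<and> (\<forall>\<rho>\<in>cone_rays \<sigma> - S. coord \<sigma> \<rho> x = 0)" for x
  proof
    assume "x \<in> ?c"
    then obtain c where c: "x = (\<Sum>\<rho>\<in>S. c \<rho> *\<^sub>R v \<rho>)" "\<forall>\<rho>\<in>S. c \<rho> \<ge> 0" by (rule conicE)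
    have "x \<in> span (v ` cone_rays \<sigma>)" unfolding c(1) using S by (intro span_sum_scale) blast
    then show "x \<in> \<sigma> \<and> (\<forall>\<rho>\<in>cone_rays \<sigma> - S. coord \<sigma> \<rho> x = 0)"
      unfolding mem_cone_iff[OF \<sigma>] span_cone[OF \<sigma>] using c(2) by (simp add: c(1) coord_sum[OF \<sigma> S])
  next
    assume x: "x \<in> \<sigma> \<and> (\<forall>\<rho>\<in>cone_rays \<sigma> - S. coord \<sigma> \<rho> x = 0)"
    then have "x = (\<Sum>\<rho>\<in>cone_rays \<sigma>. coord \<sigma> \<rho> x *\<^sub>R v \<rho>)"
      using span_coord[OF \<sigma>] mem_cone_iff[OF \<sigma>] by blast
    also have "\<dots> = (\<Sum>\<rho>\<in>S. coord \<sigma> \<rho> x *\<^sub>R v \<rho>)"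
      using x S \<sigma> by (intro sum.mono_neutral_right) auto
    finally show "x \<in> ?c" by (rule conicI) (use x mem_cone_iff[OF \<sigma>] S in auto)
  qed
  have face: "?c face_of \<sigma>"
    unfolding face_of_def
  proof (intro conjI ballI impI)
    show "?c \<subseteq> \<sigma>" using mem by blast
    show "convex ?c" by (rule convexI) (intro conic_add conic_scaleR)
  next
    fix x y z assume xyz: "x \<in> \<sigma>" "y \<in> \<sigma>" "z \<in> ?c" "z \<in> open_segment x y"
    obtain t where t: "0 < t" "t < 1" "z = (1 - t) *\<^sub>R x + t *\<^sub>R y"
      using xyz(4) by (auto simp: in_segment)
    have "coord \<sigma> \<rho> x = 0 \<and> coord \<sigma> \<rho> y = 0" if \<rho>: "\<rho> \<in> cone_rays \<sigma> - S" for \<rho>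
    proof -
      have "0 = coord \<sigma> \<rho> z" using mem xyz \<rho> by simp
      also have "\<dots> = (1 - t) * coord \<sigma> \<rho> x + t * coord \<sigma> \<rho> y"
        using linear_coord[OF \<sigma>, of \<rho>] by (simp add: t linear_add linear_scale)
      finally have 0: "(1 - t) * coord \<sigma> \<rho> x + t * coord \<sigma> \<rho> y = 0" by simp
      have "coord \<sigma> \<rho> x \<ge> 0" "coord \<sigma> \<rho> y \<ge> 0" using xyz \<rho> mem_cone_iff[OF \<sigma>] by auto
      then have "(1 - t) * coord \<sigma> \<rho> x \<ge> 0" "t * coord \<sigma> \<rho> y \<ge> 0" using t by auto
      then have "(1 - t) * coord \<sigma> \<rho> x = 0" "t * coord \<sigma> \<rho> y = 0" using 0 by linarith+
      then show ?thesis using t by simp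
    qed
    then show "x \<in> ?c" "y \<in> ?c" using mem xyz by auto
  qed
  moreover have "?c \<noteq> {}" using conic_zero by blast
  ultimately have cf: "cone_face ?c \<sigma>" by (simp add: cone_face_def)
  then have \<Phi>: "?c \<in> \<Phi>" using fan_face \<sigma> by blast
  have sub: "S \<subseteq> cone_rays ?c"
  proof
    fix \<rho> assume \<rho>: "\<rho> \<in> S"
    then have \<rho>': "\<rho> \<in> R" using S cone_rays_subset[OF \<sigma>] by blast
    have "\<rho> \<subseteq> ?c"
    proof
      fix x assume "x \<in> \<rho>"
      then have "x \<in> {c *\<^sub>R v \<rho> | c. c \<ge> 0}" by (rule subsetD[OF equalityD1[OF primitive_vector_ray(4)[OF \<rho>']]])
      then show "x \<in> ?c" using conic_scaled_generator[OF finS \<rho>] by (elim CollectE exE conjE) simp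
    qed
    moreover have "\<rho> \<in> \<Phi>" "dim \<rho> = 1" using \<rho>' by (auto simp: cones_of_dim_def)
    moreover have "cone_face (\<rho> \<inter> ?c) ?c" using fan_Int \<Phi> \<open>\<rho> \<in> \<Phi>\<close> by blast
    ultimately show "\<rho> \<in> cone_rays ?c" by (simp add: cone_rays_def Int_absorb2)
  qed
  have "dim ?c = card S"
  proof -
    have "span ?c = span (v ` S)"
    proof
      show "span ?c \<subseteq> span (v ` S)" by (rule span_minimal[OF conic_subset_span subspace_span])
      have "v ` S \<subseteq> ?c" using conic_scaled_generator[OF finS, of _ 1 v] by auto
      then show "span (v ` S) \<subseteq> span ?c" by (rule span_mono)
    qed
    moreover have "independent (v ` S)"
      using independent_v[OF \<sigma>] S by (meson image_mono independent_mono)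
    ultimately have "dim ?c = card (v ` S)" by (intro dim_eq_card) simp_all
    then show ?thesis using inj_v_rays[OF \<sigma>] S by (metis card_image inj_on_subset)
  qed
  then have "cone_rays ?c = S"
    using sub dim_eq_card_rays[OF \<Phi>] card_subset_eq[OF finite_rays[OF \<Phi>] sub] by simp
  then show ?thesis using that \<Phi> by blast
qed

text \<open>Both sides are read off from the expansion of \<open>x\<close> in the common
  face.\<close>

lemma coord_agree:
  assumes "\<sigma> \<in> \<Phi>" "\<tau> \<in> \<Phi>" "x \<in> \<sigma>" "x \<in> \<tau>"
  shows "coord \<sigma> \<rho> x = coord \<tau> \<rho> x"
proof -
  have I: "\<sigma> \<inter> \<tau> \<in> \<Phi>" "cone_rays (\<sigma> \<inter> \<tau>) = cone_rays \<sigma> \<inter> cone_rays \<tau>" using rays_Int assms by auto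
  have x: "x = (\<Sum>\<rho>\<in>cone_rays (\<sigma> \<inter> \<tau>). coord (\<sigma> \<inter> \<tau>) \<rho> x *\<^sub>R v \<rho>)" (is "_ = ?s")
    using span_coord[OF I(1)] assms by (simp add: span_base)
  have "coord \<sigma> \<rho> ?s = coord \<tau> \<rho> ?s"
    using I(2) assms by (simp add: coord_sum)
  then show ?thesis using x by simp
qed

section \<open>Courant functions\<close>

text \<open>The Courant function, glued from the coordinates of the cones; by
  \<open>coord_agree\<close> the chosen cone is immaterial.\<close>

definition phi :: "'a set \<Rightarrow> 'a \<Rightarrow> real"
  where "phi \<rho> x = (if x \<in> V then coord (SOME \<sigma>. \<sigma> \<in> \<Phi> \<and> x \<in> \<sigma>) \<rho> x else 0)"

lemma phi_eq_coord: "\<sigma> \<in> \<Phi> \<Longrightarrow> x \<in> \<sigma> \<Longrightarrow> phi \<rho> x = coord \<sigma> \<rho> x"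
proof -
  assume \<sigma>: "\<sigma> \<in> \<Phi>" "x \<in> \<sigma>"
  then have "\<exists>\<sigma>. \<sigma> \<in> \<Phi> \<and> x \<in> \<sigma>" by blast
  from someI_ex[OF this] have "coord (SOME \<sigma>. \<sigma> \<in> \<Phi> \<and> x \<in> \<sigma>) \<rho> x = coord \<sigma> \<rho> x"
    using coord_agree[OF _ \<sigma>(1) _ \<sigma>(2)] by blast
  moreover have "x \<in> V" using fan_subset \<sigma> by blast
  ultimately show ?thesis by (simp add: phi_def)
qed

lemma phi_outside: "x \<notin> V \<Longrightarrow> phi \<rho> x = 0"
  by (simp add: phi_def)

lemma V_cases: assumes "x \<in> V" obtains \<sigma> where "\<sigma> \<in> \<Phi>" "x \<in> \<sigma>"
  using assms Union_fan by blast

lemma phi_zero: "\<sigma> \<in> \<Phi> \<Longrightarrow> x \<in> \<sigma> \<Longrightarrow> \<rho> \<notin> cone_rays \<sigma> \<Longrightarrow> phi \<rho> x = 0"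
  by (simp add: phi_eq_coord coord_outside span_base)

lemma phi_nonneg: "\<rho> \<in> R \<Longrightarrow> phi \<rho> x \<ge> 0"
proof (cases "x \<in> V")
  case True
  then obtain \<sigma> where "\<sigma> \<in> \<Phi>" "x \<in> \<sigma>" by (rule V_cases)
  then show ?thesis using phi_zero[of \<sigma> x \<rho>] phi_eq_coord[of \<sigma> x \<rho>] mem_cone_iff[of \<sigma> x]
    by (cases "\<rho> \<in> cone_rays \<sigma>") auto
qed (simp add: phi_outside)

lemma cone_sum_phi: "\<sigma> \<in> \<Phi> \<Longrightarrow> x \<in> \<sigma> \<Longrightarrow> x = (\<Sum>\<rho>\<in>cone_rays \<sigma>. phi \<rho> x *\<^sub>R v \<rho>)"
  using span_coord[of \<sigma> x] by (simp add: phi_eq_coord span_base)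

lemma continuous_on_conewise:
  assumes "\<And>\<sigma>. \<sigma> \<in> \<Phi> \<Longrightarrow> continuous_on \<sigma> f"
  shows "continuous_on V (f :: 'a \<Rightarrow> real)"
proof -
  have "continuous_on (\<Union>\<sigma>\<in>\<Phi>. \<sigma>) f"
    using finite_fan fan_cone polyhedral_coneD(1) assms by (intro continuous_on_closed_Union) auto
  then show ?thesis using Union_fan by simp
qed

lemma phi_conewise: "phi \<rho> \<in> conewise linear \<Phi>"
proof -
  have "continuous_on V (phi \<rho>)"
  proof (rule continuous_on_conewise)
    fix \<sigma> assume \<sigma>: "\<sigma> \<in> \<Phi>"
    have "continuous_on \<sigma> (coord \<sigma> \<rho>)"
      by (rule linear_continuous_on[OF linear_linear[THEN iffD2, OF linear_coord[OF \<sigma>]]])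
    then show "continuous_on \<sigma> (phi \<rho>)"
      by (rule continuous_on_eq) (simp add: phi_eq_coord[OF \<sigma>])
  qed
  then show ?thesis unfolding conewise_def Union_fan
    by (intro CollectI conjI ballI allI impI exI) (auto simp: phi_outside phi_eq_coord linear_coord)
qed

lemma phi_v:
  assumes "\<rho>' \<in> R" shows "phi \<rho> (v \<rho>') = (if \<rho>' = \<rho> then 1 else 0)"
proof -
  have \<rho>': "\<rho>' \<in> \<Phi>" "dim \<rho>' = 1" "v \<rho>' \<in> \<rho>'"
    using assms primitive_vector_ray(1) by (auto simp: cones_of_dim_def)
  have "\<rho>' \<in> cone_rays \<rho>'"
    using \<rho>' polyhedral_coneD[OF fan_cone[OF \<rho>'(1)]]
    by (auto simp: cone_rays_def cone_face_def face_of_refl)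
  then show ?thesis using \<rho>' by (simp add: phi_eq_coord coord_v)
qed

text \<open>On each cone a cone-wise linear function is determined by its values at the primitive
  vectors of the rays.\<close>

lemma courant_eq_phi:
  assumes \<rho>: "\<rho> \<in> R" shows "courant \<Lambda> \<Phi> \<rho> = phi \<rho>"
  unfolding courant_def
proof (rule the_equality)
  have "phi \<rho> x = 0" if "\<rho>' \<in> R" "\<rho>' \<noteq> \<rho>" "x \<in> \<rho>'" for \<rho>' x
  proof -
    have "\<rho>' \<in> \<Phi>" using that by (simp add: cones_of_dim_def)
    moreover have "\<rho> \<notin> cone_rays \<rho>'"
    proof
      assume "\<rho> \<in> cone_rays \<rho>'"
      then have "v \<rho> \<in> \<rho>'" using ray_in_cone \<open>\<rho>' \<in> \<Phi>\<close> by blast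
      then show False using one_dim_cone_eq[of \<rho>' "v \<rho>"] fan_cone primitive_vector_ray[OF \<rho>] that
        by (simp add: cones_of_dim_def)
    qed
    ultimately show ?thesis using that phi_zero by blast
  qed
  then show "phi \<rho> \<in> conewise linear \<Phi> \<and> phi \<rho> (v \<rho>) = 1 \<and>
    (\<forall>\<rho>'\<in>R. \<rho>' \<noteq> \<rho> \<longrightarrow> (\<forall>x\<in>\<rho>'. phi \<rho> x = 0))"
    using phi_conewise phi_v \<rho> by auto
next
  fix f assume f: "f \<in> conewise linear \<Phi> \<and> f (v \<rho>) = 1 \<and> (\<forall>\<rho>'\<in>R. \<rho>' \<noteq> \<rho> \<longrightarrow> (\<forall>x\<in>\<rho>'. f x = 0))"
  show "f = phi \<rho>"
  proof
    fix x
    show "f x = phi \<rho> x"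
    proof (cases "x \<in> V")
      case True
      then obtain \<sigma> where \<sigma>: "\<sigma> \<in> \<Phi>" "x \<in> \<sigma>" by (rule V_cases)
      obtain p where p: "linear p" "\<forall>x\<in>\<sigma>. f x = p x" using f \<sigma> by (auto simp: conewise_def)
      have pv: "p (v \<rho>') = (if \<rho>' = \<rho> then 1 else 0)" if "\<rho>' \<in> cone_rays \<sigma>" for \<rho>'
        using p f ray_in_cone[OF \<sigma>(1) that] cone_rays_subset[OF \<sigma>(1)] that primitive_vector_ray(1)
        by (metis subsetD)
      have "f x = p (\<Sum>\<rho>'\<in>cone_rays \<sigma>. phi \<rho>' x *\<^sub>R v \<rho>')"
        using p \<sigma> cone_sum_phi by simp
      also have "\<dots> = (\<Sum>\<rho>'\<in>cone_rays \<sigma>. phi \<rho>' x * p (v \<rho>'))"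
        using p by (simp add: linear_sum linear_scale)
      also have "\<dots> = (\<Sum>\<rho>'\<in>cone_rays \<sigma>. if \<rho>' = \<rho> then phi \<rho>' x else 0)"
        using pv by (intro sum.cong) auto
      also have "\<dots> = phi \<rho> x" using \<sigma> phi_zero[OF \<sigma>] by simp
      finally show ?thesis .
    next
      case False
      then show ?thesis using f by (auto simp: conewise_def phi_outside Union_fan)
    qed
  qed
qed

end

section \<open>Stars and generic points\<close>

text \<open>Induction on the set: on the line through a point good for \<open>F\<close> in a
  direction where \<open>f\<close> is nonzero, each functional vanishes at most once.\<close>

lemma exists_avoiding_functionals:
  fixes F :: "('a::real_vector \<Rightarrow> real) set"
  assumes "finite F" "subspace S" "\<And>f. f \<in> F \<Longrightarrow> linear f" "\<And>f. f \<in> F \<Longrightarrow> \<exists>y\<in>S. f y \<noteq> 0"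
  shows "\<exists>x\<in>S. \<forall>f\<in>F. f x \<noteq> 0"
  using assms(1,3,4)
proof (induction F)
  case empty
  then show ?case using subspace_0[OF assms(2)] by auto
next
  case (insert f F)
  obtain x where x: "x \<in> S" "\<forall>g\<in>F. g x \<noteq> 0" using insert by auto
  obtain y where y: "y \<in> S" "f y \<noteq> 0" using insert.prems by auto
  have "finite {t. g (x + t *\<^sub>R y) = 0}" if "g \<in> insert f F" for g
  proof -
    have lin: "linear g" using insert.prems that by blast
    have "g x \<noteq> 0 \<or> g y \<noteq> 0" using that x y by auto
    then have "{t. g (x + t *\<^sub>R y) = 0} \<subseteq> {- g x / g y}"
      by (auto simp: linear_add[OF lin] linear_scale[OF lin] add_eq_0_iff2 eq_divide_eq)
    then show ?thesis using finite_subset by blast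
  qed
  then have "finite (\<Union>g\<in>insert f F. {t. g (x + t *\<^sub>R y) = 0})" using insert.hyps by blast
  then obtain t :: real where "t \<notin> (\<Union>g\<in>insert f F. {t. g (x + t *\<^sub>R y) = 0})"
    using ex_new_if_finite[OF infinite_UNIV_char_0] by blast
  moreover have "x + t *\<^sub>R y \<in> S" using x y assms(2) by (simp add: subspace_add subspace_scale)
  ultimately show ?case by blast
qed

text \<open>The coefficient of \<open>exp (- (k * a))\<close> in the convergent expansion of
  \<open>1 / (exp a - 1)\<close>, where \<open>b\<close> stands for \<open>k > 0\<close>: the sum
  over \<open>k > 0\<close> if \<open>a\<close> is positive, minus the sum over
  \<open>k \<le> 0\<close> if \<open>a\<close> is negative.\<close>

definition wt :: "bool \<Rightarrow> real \<Rightarrow> real"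
  where "wt b a = (if b then (if a > 0 then 1 else 0) else (if a < 0 then - 1 else 0))"

text \<open>The two expansions differ by the same amount at every exponent, so the dependence on
  \<open>b\<close> and the dependence on the sign of \<open>a\<close> separate.\<close>

lemma wt_eq: "a \<noteq> 0 \<Longrightarrow> wt b a = of_bool b + wt False a"
  by (auto simp: wt_def)

lemma prod_wt_False: "finite A \<Longrightarrow> (\<Prod>i\<in>A. wt False (a i)) = (if \<forall>i\<in>A. a i < 0 then (-1) ^ card A else 0)"
  by (induction A rule: finite_induct) (auto simp: wt_def)

context unimodular_complete_fan
begin

lemma span_max: "\<kappa> \<in> Max_cones \<Longrightarrow> span \<kappa> = V"
  using lattice_basis_facts(2)[OF lattice_basis_max] span_cone by (simp add: Max_cones_iff)

lemma max_fan: "\<kappa> \<in> Max_cones \<Longrightarrow> \<kappa> \<in> \<Phi>"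
  by (simp add: Max_cones_iff)

lemma v_in_V: "\<rho> \<in> R \<Longrightarrow> v \<rho> \<in> V"
  by (intro span_base primitive_vector_ray)

lemma sum_v_in_V: "I \<subseteq> R \<Longrightarrow> (\<Sum>\<rho>\<in>I. c \<rho> *\<^sub>R v \<rho>) \<in> V"
  by (intro span_sum span_scale v_in_V) blast

lemma coord_restricted_span:
  assumes "\<kappa> \<in> \<Phi>" "\<sigma> \<in> \<Phi>" "cone_rays \<sigma> \<subseteq> cone_rays \<kappa>" "x \<in> span \<sigma>" "\<rho> \<notin> cone_rays \<sigma>"
  shows "coord \<kappa> \<rho> x = 0"
  by (subst span_coord[OF assms(2,4)]) (simp add: coord_sum[OF assms(1,3)] assms(5))

text \<open>The points of \<open>V\<close> at which no denominator of the localization formula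
  vanishes.\<close>

definition generic :: "'a \<Rightarrow> bool"
  where "generic x \<longleftrightarrow> x \<in> V \<and> (\<forall>\<kappa>\<in>Max_cones. \<forall>\<rho>\<in>cone_rays \<kappa>. coord \<kappa> \<rho> x \<noteq> 0)"

definition star_max :: "'a set \<Rightarrow> 'a set set"
  where "star_max \<tau> = {\<kappa> \<in> Max_cones. cone_rays \<tau> \<subseteq> cone_rays \<kappa>}"

lemma finite_star_max: "finite (star_max \<tau>)"
  using finite_Max by (simp add: star_max_def)

text \<open>Complete the primitive vectors of \<sigma> to a lattice basis and take the coordinate of
  an added basis vector.\<close>

lemma lower_dim_functional:
  assumes "\<sigma> \<in> \<Phi>" "\<sigma> \<notin> Max_cones"
  shows "\<exists>f :: 'a \<Rightarrow> real. linear f \<and> (\<forall>x\<in>span \<sigma>. f x = 0) \<and> (\<exists>y\<in>V. f y \<noteq> 0)"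
proof -
  obtain B where B: "lattice_basis \<Lambda> B" "v ` cone_rays \<sigma> \<subseteq> B" using lattice_basis_rays[OF assms(1)] .
  have "card (v ` cone_rays \<sigma>) = card (cone_rays \<sigma>)" using inj_v_rays[OF assms(1)] by (rule card_image)
  then have "card (v ` cone_rays \<sigma>) \<noteq> card B"
  proof -
    have "card (cone_rays \<sigma>) \<noteq> n" using assms Max_cones_iff by blast
    then show ?thesis using lattice_basis_facts(3)[OF B(1)] \<open>card (v ` cone_rays \<sigma>) = _\<close> by simp
  qed
  then have "v ` cone_rays \<sigma> \<noteq> B" by metis
  then obtain b where b: "b \<in> B" "b \<notin> v ` cone_rays \<sigma>" using B(2) by (metis subset_antisym subsetI)
  have "independent B" using B(1) by (simp add: lattice_basis_def)
  then obtain f :: "'a \<Rightarrow> real" where f: "linear f" "\<forall>x\<in>B. f x = (if x = b then 1 else 0)"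
    using linear_independent_extend[of B "\<lambda>x. if x = b then 1 else 0"] by blast
  have "f x = 0" if "x \<in> span \<sigma>" for x
  proof (rule linear_eq_0_on_span[OF f(1), of "v ` cone_rays \<sigma>"])
    show "f y = 0" if "y \<in> v ` cone_rays \<sigma>" for y
    proof -
      have "y \<in> B" "y \<noteq> b" using b B(2) that by (blast, metis)
      then show ?thesis using f(2) by simp
    qed
    show "x \<in> span (v ` cone_rays \<sigma>)" using that span_cone[OF assms(1)] by simp
  qed
  moreover have "b \<in> V" using lattice_basis_facts(4)[OF B(1)] b by (blast intro: span_base)
  moreover have "f b \<noteq> 0" using f(2) b by simp
  ultimately show ?thesis using f(1) by blast
qed

text \<open>That every cone is a face of a maximal one is not yet known, so avoiding the spans of
  the smaller cones is demanded separately; \<open>generic_not_in_lower_span\<close> later derives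
  it from genericity.\<close>

lemma exists_strictly_generic:
  fixes F :: "('a \<Rightarrow> real) set"
  assumes "finite F" "\<And>f. f \<in> F \<Longrightarrow> linear f" "\<And>f. f \<in> F \<Longrightarrow> \<exists>y\<in>V. f y \<noteq> 0"
  shows "\<exists>x. generic x \<and> (\<forall>\<sigma>\<in>\<Phi>. \<sigma> \<notin> Max_cones \<longrightarrow> x \<notin> span \<sigma>) \<and> (\<forall>f\<in>F. f x \<noteq> 0)"
proof -
  obtain g :: "'a set \<Rightarrow> 'a \<Rightarrow> real" where g:
    "\<And>\<sigma>. \<sigma> \<in> \<Phi> - Max_cones \<Longrightarrow> linear (g \<sigma>) \<and> (\<forall>x\<in>span \<sigma>. g \<sigma> x = 0) \<and> (\<exists>y\<in>V. g \<sigma> y \<noteq> 0)"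
    using lower_dim_functional by (metis DiffD1 DiffD2)
  let ?C = "(\<lambda>(\<kappa>, \<rho>). coord \<kappa> \<rho>) ` (SIGMA \<kappa>:Max_cones. cone_rays \<kappa>)"
  let ?F = "F \<union> g ` (\<Phi> - Max_cones) \<union> ?C"
  have "finite ?F" using assms(1) finite_fan finite_Max max_fan by (auto intro!: finite_SigmaI)
  moreover have "linear f \<and> (\<exists>y\<in>V. f y \<noteq> 0)" if ff: "f \<in> ?F" for f
  proof -
    consider "f \<in> F" | \<sigma> where "\<sigma> \<in> \<Phi> - Max_cones" "f = g \<sigma>"
      | \<kappa> \<rho> where "\<kappa> \<in> Max_cones" "\<rho> \<in> cone_rays \<kappa>" "f = coord \<kappa> \<rho>" using ff by auto
    then show ?thesis
    proof cases
      case 3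
      then have "f (v \<rho>) = 1" "v \<rho> \<in> V" using max_fan cone_rays_subset v_in_V by (auto simp: coord_v)
      then show ?thesis using 3 linear_coord max_fan by (metis zero_neq_one)
    qed (use assms g in auto)
  qed
  ultimately obtain x where x: "x \<in> V" "\<forall>f\<in>?F. f x \<noteq> 0"
    using exists_avoiding_functionals[of ?F V] subspace_span by blast
  have "generic x" using x by (auto simp: generic_def)
  moreover have "x \<notin> span \<sigma>" if "\<sigma> \<in> \<Phi>" "\<sigma> \<notin> Max_cones" for \<sigma>
    using g[of \<sigma>] that x by auto
  ultimately show ?thesis using x(2) by blast
qed

text \<open>Completeness of the fan modulo \<open>span \<tau>\<close>, seen without a quotient: with
  \<open>z\<close> the sum of the primitive vectors of \<tau>, all points
  \<open>y + real k *\<^sub>R z\<close> lie in \<open>V\<close>, and by the pigeonhole principle one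
  cone contains infinitely many of them.\<close>

lemma star_max_exists:
  assumes \<tau>: "\<tau> \<in> \<Phi>" and gen: "generic y" and sg: "\<forall>\<sigma>\<in>\<Phi>. \<sigma> \<notin> Max_cones \<longrightarrow> y \<notin> span \<sigma>"
  shows "\<exists>\<kappa>\<in>star_max \<tau>. \<forall>\<rho>\<in>cone_rays \<kappa> - cone_rays \<tau>. coord \<kappa> \<rho> y > 0"
proof -
  define z where "z = (\<Sum>\<rho>\<in>cone_rays \<tau>. 1 *\<^sub>R v \<rho>)"
  define f where "f k = y + real k *\<^sub>R z" for k
  have zV: "z \<in> V" unfolding z_def by (rule sum_v_in_V[OF cone_rays_subset[OF \<tau>]])
  have "f k \<in> V" for k using gen zV by (simp add: f_def generic_def span_add span_scale)
  then have "\<exists>\<sigma>. \<sigma> \<in> \<Phi> \<and> f k \<in> \<sigma>" for k using Union_fan by blast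
  then obtain s where s: "\<And>k. s k \<in> \<Phi> \<and> f k \<in> s k" by metis
  have "finite (range s)" using s finite_fan by (meson finite_subset image_subsetI)
  then obtain k0 where k0: "infinite {k \<in> UNIV. s k = s k0}"
    using pigeonhole_infinite[OF infinite_UNIV_nat] by blast
  define \<kappa> where "\<kappa> = s k0"
  have \<kappa>: "\<kappa> \<in> \<Phi>" using s by (simp add: \<kappa>_def)
  have inf: "\<exists>k>m. f k \<in> \<kappa>" for m :: nat
  proof -
    obtain k where "k > m" "s k = s k0" using k0 unfolding infinite_nat_iff_unbounded by auto
    then show ?thesis using s[of k] by (auto simp: \<kappa>_def)
  qed
  \<comment> \<open>Two of the points in \<kappa> put the direction \<open>z\<close>, and then
    \<open>y\<close>, into \<open>span \<kappa>\<close>; \<open>sg\<close> excludes this for smaller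
    cones.\<close>
  have max: "\<kappa> \<in> Max_cones"
  proof (rule ccontr)
    assume *: "\<kappa> \<notin> Max_cones"
    obtain k where k: "f k \<in> \<kappa>" using inf by blast
    obtain l where l: "l > k" "f l \<in> \<kappa>" using inf by blast
    have "f l - f k \<in> span \<kappa>" using k l by (intro span_diff span_base)
    moreover have "f l - f k = (real l - real k) *\<^sub>R z" by (simp add: f_def algebra_simps)
    ultimately have "(real l - real k) *\<^sub>R z \<in> span \<kappa>" by simp
    from span_scale[OF this, of "1 / (real l - real k)"] have "z \<in> span \<kappa>" using l by simp
    then have "f k - real k *\<^sub>R z \<in> span \<kappa>" by (rule span_diff[OF span_base[OF k] span_scale])
    then have "y \<in> span \<kappa>" by (simp add: f_def)
    then show False using sg \<kappa> * by blast
  qed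
  have fc: "coord \<kappa> \<rho> (f k) = coord \<kappa> \<rho> y + real k * coord \<kappa> \<rho> z" for \<rho> k
    using linear_coord[OF \<kappa>, of \<rho>] by (simp add: f_def linear_add linear_scale)
  \<comment> \<open>A negative coordinate of \<open>z\<close> would move all sufficiently far points
    out of \<kappa>.\<close>
  have zpos: "coord \<kappa> \<rho> z \<ge> 0" if \<rho>: "\<rho> \<in> cone_rays \<kappa>" for \<rho>
  proof (rule ccontr)
    assume neg: "\<not> coord \<kappa> \<rho> z \<ge> 0"
    obtain m :: nat where m: "coord \<kappa> \<rho> y / (- coord \<kappa> \<rho> z) < real m" using reals_Archimedean2 by blast
    obtain k where k: "k > m" "f k \<in> \<kappa>" using inf by blast
    have "coord \<kappa> \<rho> y + real k * coord \<kappa> \<rho> z \<ge> 0" using mem_cone_iff[OF \<kappa>] k \<rho> fc by metis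
    moreover have "coord \<kappa> \<rho> y / (- coord \<kappa> \<rho> z) < real k" using m k by linarith
    ultimately show False using neg by (simp add: field_simps)
  qed
  have z\<kappa>: "z \<in> \<kappa>" using mem_cone_iff[OF \<kappa>] span_max[OF max] zV zpos by simp
  have z\<tau>: "z \<in> \<tau>" by (rule mem_coneI[OF \<tau>], rule conicI[of _ "\<lambda>_. 1"]) (simp_all add: z_def)
  \<comment> \<open>Since \<open>z\<close> lies in both cones, its coordinates in \<kappa> can be
    computed in \<tau>. They detect the rays of \<tau> and do not affect the coordinates of
    \<open>y\<close> at the other rays.\<close>
  have cz: "coord \<kappa> \<rho> z = (if \<rho> \<in> cone_rays \<tau> then 1 else 0)" for \<rho>
  proof -
    have "coord \<kappa> \<rho> z = coord \<tau> \<rho> z" by (rule coord_agree[OF \<kappa> \<tau> z\<kappa> z\<tau>])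
    also have "\<dots> = (if \<rho> \<in> cone_rays \<tau> then 1 else 0)" unfolding z_def by (rule coord_sum[OF \<tau> subset_refl])
    finally show ?thesis .
  qed
  have sub: "cone_rays \<tau> \<subseteq> cone_rays \<kappa>"
  proof
    fix \<rho> assume "\<rho> \<in> cone_rays \<tau>"
    then have "coord \<kappa> \<rho> z \<noteq> 0" using cz by simp
    then show "\<rho> \<in> cone_rays \<kappa>" using coord_outside[OF \<kappa> span_base[OF z\<kappa>]] by blast
  qed
  have "coord \<kappa> \<rho> y > 0" if \<rho>: "\<rho> \<in> cone_rays \<kappa> - cone_rays \<tau>" for \<rho>
  proof -
    obtain k where k: "f k \<in> \<kappa>" using inf by blast
    then have "coord \<kappa> \<rho> (f k) \<ge> 0" using mem_cone_iff[OF \<kappa>] \<rho> by blast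
    then have "coord \<kappa> \<rho> y \<ge> 0" using fc cz \<rho> by simp
    moreover have "coord \<kappa> \<rho> y \<noteq> 0" using gen max \<rho> by (auto simp: generic_def)
    ultimately show ?thesis by simp
  qed
  then show ?thesis using max sub by (auto simp: star_max_def)
qed

text \<open>Far out in the direction of \<tau>, the point \<open>y + real k *\<^sub>R z\<close> has
  positive coordinates at all rays of both cones; coordinates agree on common points, so the two
  cones have the same rays.\<close>

lemma star_max_unique:
  assumes \<tau>: "\<tau> \<in> \<Phi>" and \<kappa>: "\<kappa> \<in> star_max \<tau>" and \<kappa>': "\<kappa>' \<in> star_max \<tau>" and y: "y \<in> V"
    and pos: "\<forall>\<rho>\<in>cone_rays \<kappa> - cone_rays \<tau>. coord \<kappa> \<rho> y > 0"
    and pos': "\<forall>\<rho>\<in>cone_rays \<kappa>' - cone_rays \<tau>. coord \<kappa>' \<rho> y > 0"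
  shows "\<kappa> = \<kappa>'"
proof -
  define z where "z = (\<Sum>\<rho>\<in>cone_rays \<tau>. 1 *\<^sub>R v \<rho>)"
  define f where "f k = y + real k *\<^sub>R z" for k
  have zV: "z \<in> V" unfolding z_def by (rule sum_v_in_V[OF cone_rays_subset[OF \<tau>]])
  have fV: "f k \<in> V" for k using y zV by (simp add: f_def span_add span_scale)
  have ev: "\<forall>\<^sub>F k in sequentially. \<forall>\<rho>\<in>cone_rays \<mu>. coord \<mu> \<rho> (f k) > 0"
    if \<mu>: "\<mu> \<in> star_max \<tau>" and p: "\<forall>\<rho>\<in>cone_rays \<mu> - cone_rays \<tau>. coord \<mu> \<rho> y > 0" for \<mu>
  proof (rule eventually_ball_finite)
    have \<mu>\<Phi>: "\<mu> \<in> \<Phi>" and sub: "cone_rays \<tau> \<subseteq> cone_rays \<mu>" using \<mu> by (auto simp: star_max_def max_fan)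
    show "finite (cone_rays \<mu>)" using \<mu>\<Phi> by simp
    have fc: "coord \<mu> \<rho> (f k) = coord \<mu> \<rho> y + real k * (if \<rho> \<in> cone_rays \<tau> then 1 else 0)" for \<rho> k
      using linear_coord[OF \<mu>\<Phi>, of \<rho>] coord_sum[OF \<mu>\<Phi> sub, of \<rho> "\<lambda>_. 1"]
      unfolding f_def z_def by (simp add: linear_add linear_scale)
    show "\<forall>\<rho>\<in>cone_rays \<mu>. \<forall>\<^sub>F k in sequentially. coord \<mu> \<rho> (f k) > 0"
    proof
      fix \<rho> assume \<rho>: "\<rho> \<in> cone_rays \<mu>"
      show "\<forall>\<^sub>F k in sequentially. coord \<mu> \<rho> (f k) > 0"
      proof (cases "\<rho> \<in> cone_rays \<tau>")
        case True
        obtain m :: nat where m: "- coord \<mu> \<rho> y < real m" using reals_Archimedean2 by blast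
        have "coord \<mu> \<rho> (f k) > 0" if "k \<ge> m" for k
        proof -
          have "real m \<le> real k" using that by simp
          then show ?thesis using m True fc by simp
        qed
        then show ?thesis by (auto simp: eventually_sequentially)
      next
        case False
        then show ?thesis using p \<rho> fc by simp
      qed
    qed
  qed
  obtain k where k: "\<forall>\<rho>\<in>cone_rays \<kappa>. coord \<kappa> \<rho> (f k) > 0" "\<forall>\<rho>\<in>cone_rays \<kappa>'. coord \<kappa>' \<rho> (f k) > 0"
    using eventually_happens'[OF sequentially_bot eventually_conj[OF ev[OF \<kappa> pos] ev[OF \<kappa>' pos']]] by blast
  have max: "\<kappa> \<in> Max_cones" "\<kappa>' \<in> Max_cones" using \<kappa> \<kappa>' by (auto simp: star_max_def)
  note \<Phi> = max[THEN max_fan]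
  have mem: "f k \<in> \<kappa>" "f k \<in> \<kappa>'"
    unfolding mem_cone_iff[OF \<Phi>(1)] mem_cone_iff[OF \<Phi>(2)] span_max[OF max(1)] span_max[OF max(2)]
    using k fV less_imp_le by blast+
  have "cone_rays \<kappa> \<subseteq> cone_rays \<kappa>'"
  proof
    fix \<rho> assume "\<rho> \<in> cone_rays \<kappa>"
    then have "coord \<kappa>' \<rho> (f k) > 0" using k coord_agree[OF \<Phi> mem] by simp
    then show "\<rho> \<in> cone_rays \<kappa>'" using coord_outside[OF \<Phi>(2) span_base[OF mem(2)]] by (metis less_irrefl)
  qed
  moreover have "cone_rays \<kappa>' \<subseteq> cone_rays \<kappa>"
  proof
    fix \<rho> assume "\<rho> \<in> cone_rays \<kappa>'"
    then have "coord \<kappa> \<rho> (f k) > 0" using k coord_agree[OF \<Phi> mem] by simp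
    then show "\<rho> \<in> cone_rays \<kappa>" using coord_outside[OF \<Phi>(1) span_base[OF mem(1)]] by (metis less_irrefl)
  qed
  ultimately show ?thesis using rays_inj[OF \<Phi>] by blast
qed

lemma star_max_nonempty: "\<tau> \<in> \<Phi> \<Longrightarrow> star_max \<tau> \<noteq> {}"
proof -
  assume \<tau>: "\<tau> \<in> \<Phi>"
  obtain x where "generic x" "\<forall>\<sigma>\<in>\<Phi>. \<sigma> \<notin> Max_cones \<longrightarrow> x \<notin> span \<sigma>"
    using exists_strictly_generic[of "{}"] by auto
  from star_max_exists[OF \<tau> this] show ?thesis by blast
qed

text \<open>Such a cone is a proper face of a maximal one, and the coordinate of a missing ray
  vanishes on its span.\<close>

lemma generic_not_in_lower_span:
  assumes "generic y" "\<sigma> \<in> \<Phi>" "\<sigma> \<notin> Max_cones" shows "y \<notin> span \<sigma>"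
proof
  assume y: "y \<in> span \<sigma>"
  obtain \<kappa> where \<kappa>: "\<kappa> \<in> Max_cones" "cone_rays \<sigma> \<subseteq> cone_rays \<kappa>"
    using star_max_nonempty[OF assms(2)] by (auto simp: star_max_def)
  have "cone_rays \<sigma> \<noteq> cone_rays \<kappa>" using \<kappa> assms by (auto simp: Max_cones_iff)
  then obtain \<rho> where \<rho>: "\<rho> \<in> cone_rays \<kappa>" "\<rho> \<notin> cone_rays \<sigma>" using \<kappa> by blast
  have "coord \<kappa> \<rho> y = 0" using coord_restricted_span[OF max_fan[OF \<kappa>(1)] assms(2) \<kappa>(2) y \<rho>(2)] .
  then show False using assms(1) \<kappa> \<rho> by (auto simp: generic_def)
qed

lemma generic_scale: "generic x \<Longrightarrow> t \<noteq> 0 \<Longrightarrow> generic (t *\<^sub>R x)"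
  using linear_scale[OF linear_coord[OF max_fan]] by (auto simp: generic_def span_scale)

lemma generic_exists: "\<exists>x. generic x"
  using exists_strictly_generic[of "{}"] by auto

section \<open>Signed counts of maximal cones\<close>

text \<open>The coefficient of \<open>exp (- m x)\<close> in the expanded Bernoulli sum over the
  star of \<tau>, with \<open>P \<rho>\<close> standing for \<open>m (v \<rho>) > 0\<close>.\<close>

definition star_count :: "'a set \<Rightarrow> ('a set \<Rightarrow> bool) \<Rightarrow> 'a \<Rightarrow> real"
  where "star_count \<tau> P x =
    (\<Sum>\<kappa>\<in>star_max \<tau>. \<Prod>\<rho>\<in>cone_rays \<kappa> - cone_rays \<tau>. wt (P \<rho>) (coord \<kappa> \<rho> x))"

text \<open>A product survives only where all coordinates of \<open>x\<close> outside \<tau> are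
  negative; applied to \<open>- x\<close>, existence and uniqueness of such a cone leave exactly one
  summand.\<close>

lemma star_count_False:
  assumes "\<tau> \<in> \<Phi>" "generic x"
  shows "star_count \<tau> (\<lambda>_. False) x = (-1) ^ (n - card (cone_rays \<tau>))"
proof -
  have gen: "generic (- x)" using generic_scale[OF assms(2), of "-1"] by simp
  have neg: "coord \<kappa> \<rho> (- x) = - coord \<kappa> \<rho> x" if "\<kappa> \<in> star_max \<tau>" for \<kappa> \<rho>
    using that by (intro linear_neg linear_coord max_fan) (simp add: star_max_def)
  from star_max_exists[OF assms(1) gen] generic_not_in_lower_span[OF gen]
  obtain \<kappa>0 where \<kappa>0: "\<kappa>0 \<in> star_max \<tau>" "\<forall>\<rho>\<in>cone_rays \<kappa>0 - cone_rays \<tau>. coord \<kappa>0 \<rho> (- x) > 0" by blast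
  have xV: "- x \<in> V" using gen by (simp add: generic_def)
  have uniq: "\<kappa> = \<kappa>0" if "\<kappa> \<in> star_max \<tau>" "\<forall>\<rho>\<in>cone_rays \<kappa> - cone_rays \<tau>. coord \<kappa> \<rho> (- x) > 0" for \<kappa>
    by (rule star_max_unique[OF assms(1) that(1) \<kappa>0(1) xV that(2) \<kappa>0(2)])
  have summand: "(\<Prod>\<rho>\<in>cone_rays \<kappa> - cone_rays \<tau>. wt False (coord \<kappa> \<rho> x)) =
      (if \<kappa> = \<kappa>0 then (-1) ^ (n - card (cone_rays \<tau>)) else 0)" if \<kappa>: "\<kappa> \<in> star_max \<tau>" for \<kappa>
  proof -
    have \<kappa>\<Phi>: "\<kappa> \<in> \<Phi>" "card (cone_rays \<kappa>) = n" "cone_rays \<tau> \<subseteq> cone_rays \<kappa>"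
      using \<kappa> by (auto simp: star_max_def Max_cones_iff)
    have c: "card (cone_rays \<kappa> - cone_rays \<tau>) = n - card (cone_rays \<tau>)"
      using \<kappa>\<Phi> assms(1) by (simp add: card_Diff_subset)
    have iff: "(\<forall>\<rho>\<in>cone_rays \<kappa> - cone_rays \<tau>. coord \<kappa> \<rho> x < 0) \<longleftrightarrow> \<kappa> = \<kappa>0"
      using uniq[OF \<kappa>] \<kappa>0(2) neg[OF \<kappa>] neg[OF \<kappa>0(1)] by auto
    show ?thesis using prod_wt_False[of "cone_rays \<kappa> - cone_rays \<tau>" "\<lambda>\<rho>. coord \<kappa> \<rho> x"] \<kappa>\<Phi>(1)
      unfolding iff c by simp
  qed
  have "star_count \<tau> (\<lambda>_. False) x = (\<Sum>\<kappa>\<in>star_max \<tau>. if \<kappa> = \<kappa>0 then (-1) ^ (n - card (cone_rays \<tau>)) else 0)"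
    unfolding star_count_def by (rule sum.cong[OF refl summand])
  then show ?thesis using \<kappa>0(1) finite_star_max by simp
qed

text \<open>The point of the formula is that \<open>x\<close> is absent from its right side. By
  \<open>wt_eq\<close> each product expands over subsets of the rays satisfying \<open>P\<close>;
  such a subset together with \<tau> spans a face \<open>\<tau>'\<close> of \<kappa>, and for fixed
  \<open>\<tau>'\<close> the sum over \<kappa> is the count of
  \<open>star_count_False\<close>.\<close>

lemma star_count_formula:
  assumes \<tau>: "\<tau> \<in> \<Phi>" and gen: "generic x"
  shows "star_count \<tau> P x =
    (\<Sum>\<tau>'\<in>{\<tau>'\<in>\<Phi>. cone_rays \<tau> \<subseteq> cone_rays \<tau>' \<and> (\<forall>\<rho>\<in>cone_rays \<tau>' - cone_rays \<tau>. P \<rho>)}.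
      (-1) ^ (n - card (cone_rays \<tau>')))" (is "_ = sum _ ?T")
proof -
  let ?w = "\<lambda>\<kappa> \<rho>. wt False (coord \<kappa> \<rho> x)"
  have expand: "(\<Prod>\<rho>\<in>cone_rays \<kappa> - cone_rays \<tau>. wt (P \<rho>) (coord \<kappa> \<rho> x)) =
      (\<Sum>\<tau>'\<in>{\<tau>'\<in>?T. cone_rays \<tau>' \<subseteq> cone_rays \<kappa>}. \<Prod>\<rho>\<in>cone_rays \<kappa> - cone_rays \<tau>'. ?w \<kappa> \<rho>)"
    if \<kappa>: "\<kappa> \<in> star_max \<tau>" for \<kappa>
  proof -
    let ?A = "cone_rays \<kappa> - cone_rays \<tau>"
    have \<kappa>\<Phi>: "\<kappa> \<in> Max_cones" "\<kappa> \<in> \<Phi>" "cone_rays \<tau> \<subseteq> cone_rays \<kappa>"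
      using \<kappa> by (auto simp: star_max_def Max_cones_iff)
    have fin: "finite ?A" using \<kappa>\<Phi> by simp
    have "(\<Prod>\<rho>\<in>?A. wt (P \<rho>) (coord \<kappa> \<rho> x)) = (\<Prod>\<rho>\<in>?A. of_bool (P \<rho>) + ?w \<kappa> \<rho>)"
      using gen \<kappa>\<Phi>(1) by (intro prod.cong[OF refl] wt_eq) (auto simp: generic_def)
    also have "\<dots> = (\<Sum>S\<in>Pow ?A. (\<Prod>\<rho>\<in>S. of_bool (P \<rho>)) * (\<Prod>\<rho>\<in>?A - S. ?w \<kappa> \<rho>))"
      by (rule prod_add[OF fin])
    also have "\<dots> = (\<Sum>S\<in>{S \<in> Pow ?A. \<forall>\<rho>\<in>S. P \<rho>}. \<Prod>\<rho>\<in>?A - S. ?w \<kappa> \<rho>)"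
    proof (rule sum.mono_neutral_cong_right)
      show "\<forall>S\<in>Pow ?A - {S \<in> Pow ?A. \<forall>\<rho>\<in>S. P \<rho>}. (\<Prod>\<rho>\<in>S. of_bool (P \<rho>)) * (\<Prod>\<rho>\<in>?A - S. ?w \<kappa> \<rho>) = 0"
        using fin by (auto simp: finite_subset)
    qed (use fin in auto)
    \<comment> \<open>Every set of rays of \<kappa> is the set of rays of a face, so subsets of
      \<open>?A\<close> correspond to the faces of \<kappa> containing \<tau>.\<close>
    also have "\<dots> = (\<Sum>\<tau>'\<in>{\<tau>'\<in>?T. cone_rays \<tau>' \<subseteq> cone_rays \<kappa>}. \<Prod>\<rho>\<in>?A - (cone_rays \<tau>' - cone_rays \<tau>). ?w \<kappa> \<rho>)"
    proof (rule sum.reindex_bij_betw[symmetric])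
      show "bij_betw (\<lambda>\<tau>'. cone_rays \<tau>' - cone_rays \<tau>) {\<tau>'\<in>?T. cone_rays \<tau>' \<subseteq> cone_rays \<kappa>}
        {S \<in> Pow ?A. \<forall>\<rho>\<in>S. P \<rho>}"
        unfolding bij_betw_def
      proof
        show "inj_on (\<lambda>\<tau>'. cone_rays \<tau>' - cone_rays \<tau>) {\<tau>'\<in>?T. cone_rays \<tau>' \<subseteq> cone_rays \<kappa>}"
        proof (rule inj_onI)
          fix a b assume *: "a \<in> {\<tau>'\<in>?T. cone_rays \<tau>' \<subseteq> cone_rays \<kappa>}" "b \<in> {\<tau>'\<in>?T. cone_rays \<tau>' \<subseteq> cone_rays \<kappa>}"
            "cone_rays a - cone_rays \<tau> = cone_rays b - cone_rays \<tau>"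
          then have "cone_rays a = cone_rays b" by blast
          then show "a = b" using * rays_inj by blast
        qed
        show "(\<lambda>\<tau>'. cone_rays \<tau>' - cone_rays \<tau>) ` {\<tau>'\<in>?T. cone_rays \<tau>' \<subseteq> cone_rays \<kappa>} = {S \<in> Pow ?A. \<forall>\<rho>\<in>S. P \<rho>}"
        proof (intro equalityI subsetI)
          fix S assume S: "S \<in> {S \<in> Pow ?A. \<forall>\<rho>\<in>S. P \<rho>}"
          then have "cone_rays \<tau> \<union> S \<subseteq> cone_rays \<kappa>" using \<kappa>\<Phi> by blast
          then obtain \<tau>' where \<tau>': "\<tau>' \<in> \<Phi>" "cone_rays \<tau>' = cone_rays \<tau> \<union> S"
            using subset_rays_face[OF \<kappa>\<Phi>(2)] by blast
          moreover have "S = cone_rays \<tau>' - cone_rays \<tau>" using \<tau>' S by blast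
          ultimately show "S \<in> (\<lambda>\<tau>'. cone_rays \<tau>' - cone_rays \<tau>) ` {\<tau>'\<in>?T. cone_rays \<tau>' \<subseteq> cone_rays \<kappa>}"
            using S \<kappa>\<Phi>(3) by (intro image_eqI[of _ _ \<tau>']) auto
        qed auto
      qed
    qed
    also have "\<dots> = (\<Sum>\<tau>'\<in>{\<tau>'\<in>?T. cone_rays \<tau>' \<subseteq> cone_rays \<kappa>}. \<Prod>\<rho>\<in>cone_rays \<kappa> - cone_rays \<tau>'. ?w \<kappa> \<rho>)"
    proof (rule sum.cong[OF refl])
      fix \<tau>' assume "\<tau>' \<in> {\<tau>'\<in>?T. cone_rays \<tau>' \<subseteq> cone_rays \<kappa>}"
      then have "?A - (cone_rays \<tau>' - cone_rays \<tau>) = cone_rays \<kappa> - cone_rays \<tau>'" by blast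
      then show "(\<Prod>\<rho>\<in>?A - (cone_rays \<tau>' - cone_rays \<tau>). ?w \<kappa> \<rho>) = (\<Prod>\<rho>\<in>cone_rays \<kappa> - cone_rays \<tau>'. ?w \<kappa> \<rho>)" by simp
    qed
    finally show ?thesis .
  qed
  have "star_count \<tau> P x = (\<Sum>\<kappa>\<in>star_max \<tau>. \<Sum>\<tau>'\<in>{\<tau>'\<in>?T. cone_rays \<tau>' \<subseteq> cone_rays \<kappa>}. \<Prod>\<rho>\<in>cone_rays \<kappa> - cone_rays \<tau>'. ?w \<kappa> \<rho>)"
    unfolding star_count_def by (rule sum.cong[OF refl expand])
  also have "\<dots> = (\<Sum>\<tau>'\<in>?T. \<Sum>\<kappa>\<in>{\<kappa>\<in>star_max \<tau>. cone_rays \<tau>' \<subseteq> cone_rays \<kappa>}. \<Prod>\<rho>\<in>cone_rays \<kappa> - cone_rays \<tau>'. ?w \<kappa> \<rho>)"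
    using finite_star_max finite_fan by (intro sum.swap_restrict) auto
  also have "\<dots> = (\<Sum>\<tau>'\<in>?T. (-1) ^ (n - card (cone_rays \<tau>')))"
  proof (rule sum.cong[OF refl])
    fix \<tau>' assume \<tau>': "\<tau>' \<in> ?T"
    then have "{\<kappa>\<in>star_max \<tau>. cone_rays \<tau>' \<subseteq> cone_rays \<kappa>} = star_max \<tau>'" by (auto simp: star_max_def)
    then show "(\<Sum>\<kappa>\<in>{\<kappa>\<in>star_max \<tau>. cone_rays \<tau>' \<subseteq> cone_rays \<kappa>}. \<Prod>\<rho>\<in>cone_rays \<kappa> - cone_rays \<tau>'. ?w \<kappa> \<rho>)
       = (-1) ^ (n - card (cone_rays \<tau>'))"
      using star_count_False[of \<tau>' x] \<tau>' gen by (simp add: star_count_def)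
  qed
  finally show ?thesis .
qed

lemma star_count_functional:
  assumes \<tau>: "\<tau> \<in> \<Phi>" and gen: "generic x" and m: "linear m" "\<And>\<rho>. \<rho> \<in> cone_rays \<tau> \<Longrightarrow> m (v \<rho>) = 0"
    and nz: "\<exists>y\<in>V. m y \<noteq> (0::real)"
  shows "star_count \<tau> (\<lambda>\<rho>. m (v \<rho>) > 0) x = 0"
proof -
  obtain y where y: "generic y" "m y \<noteq> 0"
    using exists_strictly_generic[of "{m}"] m(1) nz by auto
  define x' where "x' = (if m y < 0 then y else - y)"
  have x': "generic x'" "m x' < 0"
    using y generic_scale[OF y(1), of "-1"] linear_neg[OF m(1)] by (auto simp: x'_def)
  have "star_count \<tau> (\<lambda>\<rho>. m (v \<rho>) > 0) x = star_count \<tau> (\<lambda>\<rho>. m (v \<rho>) > 0) x'"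
    using star_count_formula[OF \<tau>] gen x'(1) by simp
  also have "\<dots> = 0"
    unfolding star_count_def
  proof (intro sum.neutral ballI)
    fix \<kappa> assume \<kappa>: "\<kappa> \<in> star_max \<tau>"
    have \<kappa>\<Phi>: "\<kappa> \<in> Max_cones" "\<kappa> \<in> \<Phi>" "cone_rays \<tau> \<subseteq> cone_rays \<kappa>"
      using \<kappa> by (auto simp: star_max_def Max_cones_iff)
    show "(\<Prod>\<rho>\<in>cone_rays \<kappa> - cone_rays \<tau>. wt (m (v \<rho>) > 0) (coord \<kappa> \<rho> x')) = 0"
    proof (rule ccontr)
      assume nonzero: "\<not> ?thesis"
      have nz: "wt (m (v \<rho>) > 0) (coord \<kappa> \<rho> x') \<noteq> 0" if "\<rho> \<in> cone_rays \<kappa> - cone_rays \<tau>" for \<rho>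
      proof
        assume "wt (m (v \<rho>) > 0) (coord \<kappa> \<rho> x') = 0"
        then have "\<exists>\<rho>\<in>cone_rays \<kappa> - cone_rays \<tau>. wt (m (v \<rho>) > 0) (coord \<kappa> \<rho> x') = 0"
          using that by (rule_tac bexI)
        then have "(\<Prod>\<rho>\<in>cone_rays \<kappa> - cone_rays \<tau>. wt (m (v \<rho>) > 0) (coord \<kappa> \<rho> x')) = 0"
          using \<kappa>\<Phi>(2) by (intro prod_zero) simp_all
        then show False using nonzero by contradiction
      qed
      have "x' = (\<Sum>\<rho>\<in>cone_rays \<kappa>. coord \<kappa> \<rho> x' *\<^sub>R v \<rho>)"
        using span_coord[OF \<kappa>\<Phi>(2)] x' span_max[OF \<kappa>\<Phi>(1)] by (simp add: generic_def)
      then have "m x' = m (\<Sum>\<rho>\<in>cone_rays \<kappa>. coord \<kappa> \<rho> x' *\<^sub>R v \<rho>)" by (rule arg_cong)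
      also have "\<dots> = (\<Sum>\<rho>\<in>cone_rays \<kappa>. coord \<kappa> \<rho> x' * m (v \<rho>))"
        by (simp add: linear_sum[OF m(1)] linear_scale[OF m(1)])
      \<comment> \<open>A nonzero weight means that \<open>m (v \<rho>)\<close> is positive and the
        coordinate positive, or \<open>m (v \<rho>)\<close> is at most 0 and the coordinate
        negative; on the rays of \<tau> the functional vanishes.\<close>
      also have "\<dots> \<ge> 0"
      proof (rule sum_nonneg)
        fix \<rho> assume \<rho>: "\<rho> \<in> cone_rays \<kappa>"
        show "coord \<kappa> \<rho> x' * m (v \<rho>) \<ge> 0"
        proof (cases "\<rho> \<in> cone_rays \<tau>")
          case False
          then show ?thesis using nz[of \<rho>] \<rho>
            by (auto simp: wt_def split: if_splits intro: mult_nonneg_nonneg mult_nonpos_nonpos)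
        qed (simp add: m(2))
      qed
      finally show False using x' by simp
    qed
  qed
  finally show ?thesis .
qed

end

section \<open>The Bernoulli sum over a star\<close>

text \<open>For \<open>a > 0\<close> this is the geometric series of \<open>exp (- a)\<close>
  without its zeroth term, for \<open>a < 0\<close> minus the geometric series of
  \<open>exp a\<close> including its zeroth term.\<close>

lemma has_sum_wt_exp:
  assumes "a \<noteq> 0"
  shows "((\<lambda>k::int. wt (k > 0) a * exp (- (of_int k * a))) has_sum 1 / (exp a - 1)) UNIV"
proof (cases "a > 0")
  case True
  let ?q = "exp (- a)"
  have q: "norm ?q < 1" using True by simp
  have "(\<lambda>k. ?q * ?q ^ k) sums (?q * (1 / (1 - ?q)))"
    by (intro sums_mult geometric_sums q)
  moreover have "?q * (1 / (1 - ?q)) = 1 / (exp a - 1)"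
    using True by (simp add: exp_minus field_simps)
  ultimately have "(\<lambda>k. ?q * ?q ^ k) sums (1 / (exp a - 1))" by simp
  moreover have "summable (\<lambda>k. norm (?q * ?q ^ k))"
    using q by (simp add: norm_mult norm_power summable_mult summable_geometric)
  ultimately have "((\<lambda>k. ?q * ?q ^ k) has_sum 1 / (exp a - 1)) UNIV"
    by (intro norm_summable_imp_has_sum)
  also have "(\<lambda>k. ?q * ?q ^ k) = (\<lambda>j::int. wt (j > 0) a * exp (- (of_int j * a))) \<circ> (\<lambda>k. int k + 1)"
    using True by (auto simp: fun_eq_iff wt_def exp_of_nat_mult[symmetric] algebra_simps simp flip: exp_add)
  finally have "((\<lambda>j::int. wt (j > 0) a * exp (- (of_int j * a))) has_sum 1 / (exp a - 1)) (range (\<lambda>k. int k + 1))"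
    by (rule has_sum_reindex[THEN iffD2, rotated]) (simp add: inj_on_def)
  then show ?thesis
  proof (rule has_sum_cong_neutral[THEN iffD1, rotated -1])
    fix j :: int assume "j \<in> UNIV - range (\<lambda>k. int k + 1)"
    moreover have "j \<in> range (\<lambda>k. int k + 1)" if "j > 0"
      by (rule image_eqI[of _ _ "nat (j - 1)"]) (use that in simp_all)
    ultimately have "\<not> j > 0" by blast
    then show "wt (j > 0) a * exp (- (of_int j * a)) = 0" using True by (simp add: wt_def)
  qed auto
next
  case False
  then have a: "a < 0" using assms by simp
  let ?q = "exp a"
  have q: "norm ?q < 1" using a by simp
  have "(\<lambda>k. - (?q ^ k)) sums (- (1 / (1 - ?q)))"
    by (intro sums_minus geometric_sums q)
  moreover have "- (1 / (1 - ?q)) = 1 / (exp a - 1)"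
    using a by (simp add: field_simps)
  ultimately have "(\<lambda>k. - (?q ^ k)) sums (1 / (exp a - 1))" by simp
  moreover have "summable (\<lambda>k. norm (- (?q ^ k)))"
    using q by (simp add: norm_power summable_geometric)
  ultimately have "((\<lambda>k. - (?q ^ k)) has_sum 1 / (exp a - 1)) UNIV"
    by (intro norm_summable_imp_has_sum)
  also have "(\<lambda>k. - (?q ^ k)) = (\<lambda>j::int. wt (j > 0) a * exp (- (of_int j * a))) \<circ> (\<lambda>k. - int k)"
    using a by (auto simp: fun_eq_iff wt_def exp_of_nat_mult[symmetric])
  finally have "((\<lambda>j::int. wt (j > 0) a * exp (- (of_int j * a))) has_sum 1 / (exp a - 1)) (range (\<lambda>k. - int k))"
    by (rule has_sum_reindex[THEN iffD2, rotated]) (simp add: inj_on_def)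
  then show ?thesis
  proof (rule has_sum_cong_neutral[THEN iffD1, rotated -1])
    fix j :: int assume "j \<in> UNIV - range (\<lambda>k. - int k)"
    moreover have "j \<in> range (\<lambda>k. - int k)" if "\<not> j > 0"
      by (rule image_eqI[of _ _ "nat (- j)"]) (use that in simp_all)
    ultimately have "j > 0" by blast
    then show "wt (j > 0) a * exp (- (of_int j * a)) = 0" using a by (simp add: wt_def)
  qed auto
qed

text \<open>A convergent unconditional sum of reals converges absolutely. The product is absolutely
  summable because a finite set of tuples lies in a finite box, over which the sum factorizes and is
  bounded by the product of the full sums.\<close>

lemma has_sum_prod_PiE:
  fixes f :: "'i \<Rightarrow> 'j \<Rightarrow> real"
  assumes "finite A" "\<And>i. i \<in> A \<Longrightarrow> (f i has_sum s i) (B i)"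
  shows "((\<lambda>g. \<Prod>i\<in>A. f i (g i)) has_sum (\<Prod>i\<in>A. s i)) (PiE A B)"
proof -
  have abs: "(\<lambda>y. norm (f i y)) summable_on B i" if "i \<in> A" for i
  proof -
    have "f i summable_on B i" using assms(2)[OF that] by (rule has_sum_imp_summable)
    then show ?thesis by (rule summable_on_iff_abs_summable_on_real[THEN iffD1])
  qed
  define S where "S i = infsum (\<lambda>y. \<bar>f i y\<bar>) (B i)" for i
  have "(\<lambda>g. \<bar>\<Prod>i\<in>A. f i (g i)\<bar>) summable_on PiE A B"
  proof (rule nonneg_bdd_above_summable_on)
    show "bdd_above (sum (\<lambda>g. \<bar>\<Prod>i\<in>A. f i (g i)\<bar>) ` {F. F \<subseteq> PiE A B \<and> finite F})"
    proof (rule bdd_aboveI2)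
      fix F assume "F \<in> {F. F \<subseteq> PiE A B \<and> finite F}"
      then have F: "F \<subseteq> PiE A B" "finite F" by auto
      \<comment> \<open>The coordinate projections of \<open>F\<close> are the sides of the
        box.\<close>
      define C where "C i = (\<lambda>g. g i) ` F" for i
      have C: "finite (C i)" for i using F by (simp add: C_def)
      have CB: "C i \<subseteq> B i" if "i \<in> A" for i using F that by (auto simp: C_def)
      have FC: "F \<subseteq> PiE A C" using F by (auto simp: C_def PiE_iff)
      have "(\<Sum>g\<in>F. \<bar>\<Prod>i\<in>A. f i (g i)\<bar>) \<le> (\<Sum>g\<in>PiE A C. \<bar>\<Prod>i\<in>A. f i (g i)\<bar>)"
        using FC C assms(1) by (intro sum_mono2 finite_PiE) auto
      also have "\<dots> = (\<Sum>g\<in>PiE A C. \<Prod>i\<in>A. \<bar>f i (g i)\<bar>)" by (simp add: abs_prod)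
      also have "\<dots> = (\<Prod>i\<in>A. \<Sum>y\<in>C i. \<bar>f i y\<bar>)" by (rule prod_sum_PiE[OF assms(1) C, symmetric])
      also have "\<dots> \<le> (\<Prod>i\<in>A. S i)"
      proof (rule prod_mono)
        fix i assume i: "i \<in> A"
        have "(\<Sum>y\<in>C i. \<bar>f i y\<bar>) \<le> S i" unfolding S_def
          using abs[OF i] C CB[OF i] by (intro finite_sum_le_infsum) auto
        then show "0 \<le> (\<Sum>y\<in>C i. \<bar>f i y\<bar>) \<and> (\<Sum>y\<in>C i. \<bar>f i y\<bar>) \<le> S i" by (simp add: sum_nonneg)
      qed
      finally show "(\<Sum>g\<in>F. \<bar>\<Prod>i\<in>A. f i (g i)\<bar>) \<le> (\<Prod>i\<in>A. S i)" .
    qed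
  qed simp
  then have "(\<lambda>g. \<Prod>i\<in>A. f i (g i)) summable_on PiE A B"
    using summable_on_iff_abs_summable_on_real[of "\<lambda>g. \<Prod>i\<in>A. f i (g i)"] by simp
  moreover have "infsum (\<lambda>g. \<Prod>i\<in>A. f i (g i)) (PiE A B) = (\<Prod>i\<in>A. infsum (f i) (B i))"
    by (rule infsum_prod_PiE_abs[OF assms(1) abs])
  moreover have "(\<Prod>i\<in>A. infsum (f i) (B i)) = (\<Prod>i\<in>A. s i)"
    using assms(2) by (intro prod.cong[OF refl] infsumI)
  ultimately show ?thesis by (simp add: has_sum_iff)
qed

lemma has_sum_sum_fin:
  fixes f :: "'i \<Rightarrow> 'b \<Rightarrow> real"
  assumes "finite I" "\<And>i. i \<in> I \<Longrightarrow> (f i has_sum s i) A"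
  shows "((\<lambda>x. \<Sum>i\<in>I. f i x) has_sum (\<Sum>i\<in>I. s i)) A"
  using assms by (induction I rule: finite_induct) (auto intro: has_sum_add)

text \<open>The leading coefficient of a nonzero series is the limit at 0 of the function divided by
  the leading power, and that quotient vanishes near 0 off the point itself.\<close>

lemma has_fps_expansion_eq_0:
  fixes F :: "real fps"
  assumes "f has_fps_expansion F" "\<forall>\<^sub>F t in at 0. f t = 0"
  shows "F = 0"
proof (rule ccontr)
  assume F: "F \<noteq> 0"
  define d where "d = subdegree F"
  define c where "c = fps_nth F d"
  have c: "c \<noteq> 0" using F by (simp add: c_def d_def)
  let ?g = "\<lambda>x. if x = 0 then c else f x / x ^ d"
  have "?g has_fps_expansion fps_shift d F"
    by (rule has_fps_expansion_shift[OF assms(1)]) (simp_all add: d_def c_def)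
  then have "isCont ?g 0" by (rule has_fps_expansion_imp_continuous)
  then have "(?g \<longlongrightarrow> c) (at 0)" by (simp add: isCont_def)
  moreover have "\<forall>\<^sub>F t in at 0. ?g t = 0"
    using assms(2) eventually_neq_at_within[of 0 0 UNIV] by eventually_elim simp
  then have "(?g \<longlongrightarrow> 0) (at 0)" by (rule tendsto_eventually)
  ultimately have "c = 0" using LIM_unique by blast
  then show False using c by simp
qed

section \<open>The Bernoulli series and the sum over the dual lattice\<close>

text \<open>For \<open>a \<noteq> 0\<close> the expansion of \<open>t / (exp (a * t) - 1)\<close> at
  \<open>t = 0\<close>; for \<open>a = 1\<close> the exponential generating function of the
  Bernoulli numbers.\<close>

definition bern :: "real \<Rightarrow> real fps"
  where "bern a = fps_X / (fps_exp a - 1)"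

lemma subdegree_exp_minus_1: "a \<noteq> 0 \<Longrightarrow> subdegree (fps_exp a - 1 :: real fps) = 1"
  by (rule subdegreeI) auto

lemma exp_minus_1_nonzero: "a \<noteq> 0 \<Longrightarrow> fps_exp a - 1 \<noteq> (0 :: real fps)"
  using subdegree_exp_minus_1[of a] by (metis subdegree_0 zero_neq_one)

lemma bern_mult: "a \<noteq> 0 \<Longrightarrow> bern a * (fps_exp a - 1) = fps_X"
proof -
  assume a: "a \<noteq> 0"
  have "fps_exp a - 1 dvd (fps_X :: real fps)"
    using fps_dvd_iff[OF exp_minus_1_nonzero[OF a], of fps_X] subdegree_exp_minus_1[OF a]
    by (simp only: subdegree_fps_X fps_X_neq_zero not_False_eq_True simp_thms order_refl)
  then show ?thesis unfolding bern_def by (rule dvd_div_mult_self)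
qed

lemma bern_nth_0: "a \<noteq> 0 \<Longrightarrow> fps_nth (bern a) 0 = 1 / a"
proof -
  assume a: "a \<noteq> 0"
  have "fps_nth (bern a * (fps_exp a - 1)) 1 = 1" using bern_mult[OF a] by simp
  then have "fps_nth (bern a) 0 * a = 1" by (simp add: fps_mult_nth)
  then show ?thesis using a by (simp add: field_simps)
qed

lemma bern_expansion:
  assumes "a \<noteq> 0"
  shows "(\<lambda>t. if t = 0 then 1 / a else t / (exp (a * t) - 1)) has_fps_expansion bern a"
  unfolding bern_def
proof (rule has_fps_expansion_divide)
  show "(\<lambda>t. exp (a * t) - 1) has_fps_expansion fps_exp a - 1"
    by (intro fps_expansion_intros)
  show "fps_exp a - 1 \<noteq> 0" by (rule exp_minus_1_nonzero[OF assms])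
  show "subdegree (fps_exp a - 1) \<le> subdegree (fps_X :: real fps)"
    by (simp only: subdegree_exp_minus_1[OF assms] subdegree_fps_X order_refl)
  show "1 / a = fps_nth fps_X (subdegree (fps_exp a - 1)) / fps_nth (fps_exp a - 1) (subdegree (fps_exp a - 1))"
    unfolding subdegree_exp_minus_1[OF assms] by simp
qed (intro fps_expansion_intros)

context unimodular_complete_fan
begin

text \<open>Functionals are cut off to 0 outside \<open>V\<close>, so that those agreeing on
  \<open>V\<close> are equal and the lattice can serve as an index set.\<close>

definition dual_lattice :: "'a set \<Rightarrow> ('a \<Rightarrow> real) set"
  where "dual_lattice \<tau> = {m. \<exists>m'. linear m' \<and> (\<forall>u\<in>\<Lambda>. m' u \<in> \<int>) \<and> (\<forall>\<rho>\<in>cone_rays \<tau>. m' (v \<rho>) = 0) \<and>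
    m = (\<lambda>x. if x \<in> V then m' x else 0)}"

lemma coord_lattice:
  assumes \<kappa>: "\<kappa> \<in> Max_cones" and u: "u \<in> \<Lambda>"
  shows "coord \<kappa> \<rho> u \<in> \<int>"
proof -
  have \<kappa>\<Phi>: "\<kappa> \<in> \<Phi>" using \<kappa> by (rule max_fan)
  have "u \<in> int_span (v ` cone_rays \<kappa>)" using lattice_basis_max[OF \<kappa>] u by (simp add: lattice_basis_def)
  then obtain c where "u = (\<Sum>b\<in>v ` cone_rays \<kappa>. of_int (c b) *\<^sub>R b)" by (rule int_spanE)
  then have "u = (\<Sum>\<rho>\<in>cone_rays \<kappa>. of_int (c (v \<rho>)) *\<^sub>R v \<rho>)"
    by (simp add: sum.reindex[OF inj_v_rays[OF \<kappa>\<Phi>]])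
  then show ?thesis by (simp add: coord_sum[OF \<kappa>\<Phi> subset_refl])
qed

lemma linear_coord_expand:
  assumes \<kappa>: "\<kappa> \<in> Max_cones" and m: "linear m" and x: "x \<in> V"
  shows "m x = (\<Sum>\<rho>\<in>cone_rays \<kappa>. coord \<kappa> \<rho> x * (m (v \<rho>) :: real))"
proof -
  have "x = (\<Sum>\<rho>\<in>cone_rays \<kappa>. coord \<kappa> \<rho> x *\<^sub>R v \<rho>)"
    by (rule span_coord[OF max_fan[OF \<kappa>]]) (simp add: span_max[OF \<kappa>] x)
  then have "m x = m (\<Sum>\<rho>\<in>cone_rays \<kappa>. coord \<kappa> \<rho> x *\<^sub>R v \<rho>)" by (rule arg_cong)
  then show ?thesis by (simp add: linear_sum[OF m] linear_scale[OF m])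
qed

definition dual_of :: "'a set \<Rightarrow> 'a set \<Rightarrow> ('a set \<Rightarrow> int) \<Rightarrow> 'a \<Rightarrow> real"
  where "dual_of \<tau> \<kappa> g = (\<lambda>x. if x \<in> V then \<Sum>\<rho>\<in>cone_rays \<kappa> - cone_rays \<tau>. of_int (g \<rho>) * coord \<kappa> \<rho> x else 0)"

lemma dual_of_v:
  assumes \<kappa>: "\<kappa> \<in> star_max \<tau>" and \<rho>: "\<rho> \<in> cone_rays \<kappa> - cone_rays \<tau>"
  shows "dual_of \<tau> \<kappa> g (v \<rho>) = of_int (g \<rho>)"
proof -
  have \<kappa>\<Phi>: "\<kappa> \<in> \<Phi>" using \<kappa> by (simp add: star_max_def max_fan)
  have "(\<Sum>\<rho>'\<in>cone_rays \<kappa> - cone_rays \<tau>. of_int (g \<rho>') * coord \<kappa> \<rho>' (v \<rho>)) =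
    (\<Sum>\<rho>'\<in>cone_rays \<kappa> - cone_rays \<tau>. if \<rho>' = \<rho> then of_int (g \<rho>) else (0::real))"
    using \<rho> by (intro sum.cong[OF refl]) (simp add: coord_v[OF \<kappa>\<Phi>])
  also have "\<dots> = of_int (g \<rho>)" using \<rho> \<kappa>\<Phi> by simp
  finally show ?thesis
    using v_in_V cone_rays_subset[OF \<kappa>\<Phi>] \<rho> by (simp add: dual_of_def subset_iff)
qed

text \<open>The primitive vectors of \<kappa> form a lattice basis, so the coordinates are the dual
  basis, and those at the rays outside \<tau> are a basis of the functionals vanishing on
  \<tau>.\<close>

lemma bij_dual_of:
  assumes \<kappa>: "\<kappa> \<in> star_max \<tau>"
  shows "bij_betw (dual_of \<tau> \<kappa>) (PiE (cone_rays \<kappa> - cone_rays \<tau>) (\<lambda>_. UNIV)) (dual_lattice \<tau>)"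
proof -
  let ?A = "cone_rays \<kappa> - cone_rays \<tau>"
  have \<kappa>max: "\<kappa> \<in> Max_cones" and \<kappa>\<Phi>: "\<kappa> \<in> \<Phi>" and sub: "cone_rays \<tau> \<subseteq> cone_rays \<kappa>"
    using \<kappa> by (simp_all add: star_max_def max_fan)
  have inj: "inj_on (dual_of \<tau> \<kappa>) (PiE ?A (\<lambda>_. UNIV))"
  proof (rule inj_onI)
    fix g h assume *: "g \<in> PiE ?A (\<lambda>_. UNIV)" "h \<in> PiE ?A (\<lambda>_. UNIV)" "dual_of \<tau> \<kappa> g = dual_of \<tau> \<kappa> h"
    show "g = h"
    proof (rule PiE_ext[OF *(1,2)])
      fix \<rho> assume \<rho>: "\<rho> \<in> ?A"
      have "real_of_int (g \<rho>) = real_of_int (h \<rho>)"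
        using dual_of_v[OF \<kappa> \<rho>, of g] dual_of_v[OF \<kappa> \<rho>, of h] *(3) by simp
      then show "g \<rho> = h \<rho>" by simp
    qed
  qed
  have "dual_of \<tau> \<kappa> g \<in> dual_lattice \<tau>" for g
  proof -
    let ?m = "\<lambda>x. \<Sum>\<rho>\<in>?A. of_int (g \<rho>) * coord \<kappa> \<rho> x"
    have "linear ?m"
      by (rule linearI) (simp_all add: linear_add[OF linear_coord[OF \<kappa>\<Phi>]] linear_scale[OF linear_coord[OF \<kappa>\<Phi>]]
        sum.distrib sum_distrib_left algebra_simps)
    moreover have "\<forall>u\<in>\<Lambda>. ?m u \<in> \<int>" using coord_lattice[OF \<kappa>max] by (intro ballI Ints_sum Ints_mult) simp_all
    moreover have "?m (v \<rho>) = 0" if "\<rho> \<in> cone_rays \<tau>" for \<rho>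
    proof (rule sum.neutral, rule ballI)
      fix \<rho>' assume "\<rho>' \<in> ?A"
      then have "\<rho> \<noteq> \<rho>'" "\<rho> \<in> cone_rays \<kappa>" using that sub by (metis DiffD2, blast)
      then show "of_int (g \<rho>') * coord \<kappa> \<rho>' (v \<rho>) = 0" by (simp add: coord_v[OF \<kappa>\<Phi>])
    qed
    ultimately show ?thesis unfolding dual_lattice_def dual_of_def
      by (intro CollectI exI[of _ ?m]) simp
  qed
  moreover have "m \<in> dual_of \<tau> \<kappa> ` PiE ?A (\<lambda>_. UNIV)" if "m \<in> dual_lattice \<tau>" for m
  proof -
    from that obtain m' where m': "linear m'" "\<forall>u\<in>\<Lambda>. m' u \<in> \<int>" "\<forall>\<rho>\<in>cone_rays \<tau>. m' (v \<rho>) = 0"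
      and m: "m = (\<lambda>x. if x \<in> V then m' x else 0)" unfolding dual_lattice_def by (elim CollectE exE conjE)
    define g where "g = (\<lambda>\<rho>\<in>?A. \<lfloor>m' (v \<rho>)\<rfloor>)"
    have g: "of_int (g \<rho>) = m' (v \<rho>)" if "\<rho> \<in> ?A" for \<rho>
    proof -
      have "v \<rho> \<in> \<Lambda>" using that cone_rays_subset[OF \<kappa>\<Phi>] primitive_vector_ray(2) by (simp add: subset_iff)
      then have "m' (v \<rho>) \<in> \<int>" using m'(2) by simp
      then show ?thesis using that by (simp add: g_def)
    qed
    have "m x = dual_of \<tau> \<kappa> g x" for x
    proof (cases "x \<in> V")
      case True
      have "m' x = (\<Sum>\<rho>\<in>cone_rays \<kappa>. coord \<kappa> \<rho> x * m' (v \<rho>))"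
        by (rule linear_coord_expand[OF \<kappa>max m'(1) True])
      also have "\<dots> = (\<Sum>\<rho>\<in>?A. coord \<kappa> \<rho> x * m' (v \<rho>))"
        using m'(3) \<kappa>\<Phi> by (intro sum.mono_neutral_right) auto
      also have "\<dots> = (\<Sum>\<rho>\<in>?A. of_int (g \<rho>) * coord \<kappa> \<rho> x)"
        by (intro sum.cong[OF refl]) (simp add: g)
      finally show ?thesis using True by (simp add: m dual_of_def)
    qed (simp add: m dual_of_def)
    moreover have "g \<in> PiE ?A (\<lambda>_. UNIV)" by (simp add: g_def)
    ultimately show ?thesis by (intro image_eqI[of _ _ g]) auto
  qed
  ultimately show ?thesis unfolding bij_betw_def using inj by blast
qed

lemma star_sum_exp:
  assumes \<tau>: "\<tau> \<in> \<Phi>" and x: "generic x"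
  shows "(\<Sum>\<kappa>\<in>star_max \<tau>. \<Prod>\<rho>\<in>cone_rays \<kappa> - cone_rays \<tau>. 1 / (exp (coord \<kappa> \<rho> x) - 1)) =
    (-1) ^ (n - card (cone_rays \<tau>))"
proof -
  have xV: "x \<in> V" using x by (simp add: generic_def)
  have "((\<lambda>m. (\<Prod>\<rho>\<in>cone_rays \<kappa> - cone_rays \<tau>. wt (m (v \<rho>) > 0) (coord \<kappa> \<rho> x)) * exp (- m x))
      has_sum (\<Prod>\<rho>\<in>cone_rays \<kappa> - cone_rays \<tau>. 1 / (exp (coord \<kappa> \<rho> x) - 1))) (dual_lattice \<tau>)"
    if \<kappa>: "\<kappa> \<in> star_max \<tau>" for \<kappa>
  proof -
    let ?A = "cone_rays \<kappa> - cone_rays \<tau>"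
    have \<kappa>max: "\<kappa> \<in> Max_cones" and \<kappa>\<Phi>: "\<kappa> \<in> \<Phi>" using \<kappa> by (simp_all add: star_max_def max_fan)
    have nz: "coord \<kappa> \<rho> x \<noteq> 0" if "\<rho> \<in> ?A" for \<rho> using x \<kappa>max that by (simp add: generic_def)
    have "((\<lambda>g. \<Prod>\<rho>\<in>?A. wt (g \<rho> > 0) (coord \<kappa> \<rho> x) * exp (- (of_int (g \<rho>) * coord \<kappa> \<rho> x)))
        has_sum (\<Prod>\<rho>\<in>?A. 1 / (exp (coord \<kappa> \<rho> x) - 1))) (PiE ?A (\<lambda>_. UNIV))"
      using \<kappa>\<Phi> nz by (intro has_sum_prod_PiE[where B = "\<lambda>_. UNIV"] has_sum_wt_exp) simp_all
    also have "(\<lambda>g. \<Prod>\<rho>\<in>?A. wt (g \<rho> > 0) (coord \<kappa> \<rho> x) * exp (- (of_int (g \<rho>) * coord \<kappa> \<rho> x))) =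
      (\<lambda>g. (\<Prod>\<rho>\<in>?A. wt (dual_of \<tau> \<kappa> g (v \<rho>) > 0) (coord \<kappa> \<rho> x)) * exp (- dual_of \<tau> \<kappa> g x))"
    proof
      fix g :: "'a set \<Rightarrow> int"
      have "(\<Prod>\<rho>\<in>?A. wt (g \<rho> > 0) (coord \<kappa> \<rho> x) * exp (- (of_int (g \<rho>) * coord \<kappa> \<rho> x))) =
        (\<Prod>\<rho>\<in>?A. wt (dual_of \<tau> \<kappa> g (v \<rho>) > 0) (coord \<kappa> \<rho> x) * exp (- (of_int (g \<rho>) * coord \<kappa> \<rho> x)))"
        by (intro prod.cong[OF refl]) (simp add: dual_of_v[OF \<kappa>])
      also have "\<dots> = (\<Prod>\<rho>\<in>?A. wt (dual_of \<tau> \<kappa> g (v \<rho>) > 0) (coord \<kappa> \<rho> x)) * exp (\<Sum>\<rho>\<in>?A. - (of_int (g \<rho>) * coord \<kappa> \<rho> x))"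
        using \<kappa>\<Phi> by (simp add: prod.distrib exp_sum)
      also have "(\<Sum>\<rho>\<in>?A. - (of_int (g \<rho>) * coord \<kappa> \<rho> x)) = - dual_of \<tau> \<kappa> g x"
        using xV by (simp add: dual_of_def sum_negf)
      finally show "(\<Prod>\<rho>\<in>?A. wt (g \<rho> > 0) (coord \<kappa> \<rho> x) * exp (- (of_int (g \<rho>) * coord \<kappa> \<rho> x))) =
        (\<Prod>\<rho>\<in>?A. wt (dual_of \<tau> \<kappa> g (v \<rho>) > 0) (coord \<kappa> \<rho> x)) * exp (- dual_of \<tau> \<kappa> g x)" .
    qed
    \<comment> \<open>The bijection replaces an index set depending on \<kappa> by one depending
      only on \<tau>; the sum over \<kappa> can then be taken term by term.\<close>
    finally show ?thesis
      by (rule has_sum_reindex_bij_betw[OF bij_dual_of[OF \<kappa>], THEN iffD1])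
  qed
  then have "((\<lambda>m. \<Sum>\<kappa>\<in>star_max \<tau>. (\<Prod>\<rho>\<in>cone_rays \<kappa> - cone_rays \<tau>. wt (m (v \<rho>) > 0) (coord \<kappa> \<rho> x)) * exp (- m x))
      has_sum (\<Sum>\<kappa>\<in>star_max \<tau>. \<Prod>\<rho>\<in>cone_rays \<kappa> - cone_rays \<tau>. 1 / (exp (coord \<kappa> \<rho> x) - 1))) (dual_lattice \<tau>)"
    by (rule has_sum_sum_fin[OF finite_star_max])
  then have sum1: "((\<lambda>m. star_count \<tau> (\<lambda>\<rho>. m (v \<rho>) > 0) x * exp (- m x))
      has_sum (\<Sum>\<kappa>\<in>star_max \<tau>. \<Prod>\<rho>\<in>cone_rays \<kappa> - cone_rays \<tau>. 1 / (exp (coord \<kappa> \<rho> x) - 1))) (dual_lattice \<tau>)"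
    by (simp add: star_count_def sum_distrib_right)
  have zero: "(\<lambda>_. 0) \<in> dual_lattice \<tau>"
    unfolding dual_lattice_def by (intro CollectI exI[of _ "\<lambda>_. 0"]) (simp add: linear_zero)
  \<comment> \<open>At \<open>m = 0\<close> no value \<open>m (v \<rho>)\<close> is positive, so the
    coefficient is the count for the constantly false predicate.\<close>
  have "((\<lambda>m. star_count \<tau> (\<lambda>\<rho>. m (v \<rho>) > 0) x * exp (- m x)) has_sum (-1) ^ (n - card (cone_rays \<tau>))) {\<lambda>_. 0}"
    by (rule has_sum_finiteI) (simp_all add: star_count_False[OF \<tau> x])
  then have sum2: "((\<lambda>m. star_count \<tau> (\<lambda>\<rho>. m (v \<rho>) > 0) x * exp (- m x)) has_sum (-1) ^ (n - card (cone_rays \<tau>))) (dual_lattice \<tau>)"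
  proof (rule has_sum_cong_neutral[THEN iffD1, rotated -1])
    fix m assume m: "m \<in> dual_lattice \<tau> - {\<lambda>_. 0}"
    then have "m \<in> dual_lattice \<tau>" by simp
    then obtain m' where m': "linear m'" "\<forall>\<rho>\<in>cone_rays \<tau>. m' (v \<rho>) = 0"
      and mm: "m = (\<lambda>x. if x \<in> V then m' x else 0)" unfolding dual_lattice_def by (elim CollectE exE conjE)
    have "\<exists>y\<in>V. m' y \<noteq> 0"
    proof (rule ccontr)
      assume "\<not> ?thesis"
      then have "m = (\<lambda>_. 0)" unfolding mm by auto
      then show False using m by simp
    qed
    then have "star_count \<tau> (\<lambda>\<rho>. m' (v \<rho>) > 0) x = 0"
      using star_count_functional[OF \<tau> x m'(1)] m'(2) by simp
    moreover have "star_count \<tau> (\<lambda>\<rho>. m (v \<rho>) > 0) x = star_count \<tau> (\<lambda>\<rho>. m' (v \<rho>) > 0) x"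
      unfolding star_count_def
    proof (intro sum.cong[OF refl] prod.cong[OF refl])
      fix \<kappa> \<rho> assume "\<kappa> \<in> star_max \<tau>" "\<rho> \<in> cone_rays \<kappa> - cone_rays \<tau>"
      then have "\<kappa> \<in> \<Phi>" "\<rho> \<in> cone_rays \<kappa>" by (simp_all add: star_max_def max_fan)
      then have "v \<rho> \<in> V" by (intro v_in_V) (rule subsetD[OF cone_rays_subset])
      then show "wt (m (v \<rho>) > 0) (coord \<kappa> \<rho> x) = wt (m' (v \<rho>) > 0) (coord \<kappa> \<rho> x)" by (simp add: mm)
    qed
    ultimately show "star_count \<tau> (\<lambda>\<rho>. m (v \<rho>) > 0) x * exp (- m x) = 0" by simp
  qed (use zero in auto)
  show ?thesis by (rule has_sum_unique[OF sum1 sum2])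
qed

lemma card_rays_diff:
  assumes "\<tau> \<in> \<Phi>" "\<kappa> \<in> star_max \<tau>"
  shows "card (cone_rays \<kappa> - cone_rays \<tau>) = n - card (cone_rays \<tau>)"
  using assms by (simp add: star_max_def Max_cones_iff card_Diff_subset)

text \<open>Replacing \<open>x\<close> by \<open>t *\<^sub>R x\<close> turns the numerical identity
  into one between functions of \<open>t \<noteq> 0\<close>, each factor contributing one power of
  \<open>t\<close>; functions agreeing off 0 have the same expansion.\<close>

lemma star_sum_bern:
  assumes \<tau>: "\<tau> \<in> \<Phi>" and x: "generic x"
  shows "(\<Sum>\<kappa>\<in>star_max \<tau>. \<Prod>\<rho>\<in>cone_rays \<kappa> - cone_rays \<tau>. bern (coord \<kappa> \<rho> x)) =
    fps_const ((-1) ^ (n - card (cone_rays \<tau>))) * fps_X ^ (n - card (cone_rays \<tau>))" (is "?L = ?Rr")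
proof -
  let ?b = "\<lambda>\<kappa> \<rho> t. if t = 0 then 1 / coord \<kappa> \<rho> x else t / (exp (coord \<kappa> \<rho> x * t) - 1)"
  let ?f = "\<lambda>t. \<Sum>\<kappa>\<in>star_max \<tau>. \<Prod>\<rho>\<in>cone_rays \<kappa> - cone_rays \<tau>. ?b \<kappa> \<rho> t"
  have nz: "coord \<kappa> \<rho> x \<noteq> 0" if "\<kappa> \<in> star_max \<tau>" "\<rho> \<in> cone_rays \<kappa> - cone_rays \<tau>" for \<kappa> \<rho>
    using x that by (simp add: generic_def star_max_def)
  have "?f has_fps_expansion ?L"
    by (intro has_fps_expansion_sum has_fps_expansion_prod bern_expansion nz)
  moreover have "(\<lambda>t::real. (-1) ^ (n - card (cone_rays \<tau>)) * t ^ (n - card (cone_rays \<tau>))) has_fps_expansion ?Rr"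
    by (intro fps_expansion_intros)
  ultimately have "(\<lambda>t. ?f t - (-1) ^ (n - card (cone_rays \<tau>)) * t ^ (n - card (cone_rays \<tau>))) has_fps_expansion (?L - ?Rr)"
    by (rule has_fps_expansion_diff)
  moreover have "\<forall>\<^sub>F t in at 0. ?f t - (-1) ^ (n - card (cone_rays \<tau>)) * t ^ (n - card (cone_rays \<tau>)) = 0"
  proof -
    have "?f t = (-1) ^ (n - card (cone_rays \<tau>)) * t ^ (n - card (cone_rays \<tau>))" if t: "t \<noteq> 0" for t
    proof -
      have "?f t = (\<Sum>\<kappa>\<in>star_max \<tau>. t ^ (n - card (cone_rays \<tau>)) * (\<Prod>\<rho>\<in>cone_rays \<kappa> - cone_rays \<tau>. 1 / (exp (coord \<kappa> \<rho> (t *\<^sub>R x)) - 1)))"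
      proof (rule sum.cong[OF refl])
        fix \<kappa> assume \<kappa>: "\<kappa> \<in> star_max \<tau>"
        then have \<kappa>\<Phi>: "\<kappa> \<in> \<Phi>" by (simp add: star_max_def max_fan)
        have "(\<Prod>\<rho>\<in>cone_rays \<kappa> - cone_rays \<tau>. ?b \<kappa> \<rho> t) =
          (\<Prod>\<rho>\<in>cone_rays \<kappa> - cone_rays \<tau>. t * (1 / (exp (coord \<kappa> \<rho> (t *\<^sub>R x)) - 1)))"
          using t by (intro prod.cong[OF refl]) (simp add: linear_scale[OF linear_coord[OF \<kappa>\<Phi>]] mult.commute)
        also have "\<dots> = t ^ (n - card (cone_rays \<tau>)) * (\<Prod>\<rho>\<in>cone_rays \<kappa> - cone_rays \<tau>. 1 / (exp (coord \<kappa> \<rho> (t *\<^sub>R x)) - 1))"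
          by (simp only: prod.distrib prod_constant card_rays_diff[OF \<tau> \<kappa>])
        finally show "(\<Prod>\<rho>\<in>cone_rays \<kappa> - cone_rays \<tau>. ?b \<kappa> \<rho> t) =
           t ^ (n - card (cone_rays \<tau>)) * (\<Prod>\<rho>\<in>cone_rays \<kappa> - cone_rays \<tau>. 1 / (exp (coord \<kappa> \<rho> (t *\<^sub>R x)) - 1))" .
      qed
      also have "\<dots> = t ^ (n - card (cone_rays \<tau>)) * (-1) ^ (n - card (cone_rays \<tau>))"
        by (simp only: star_sum_exp[OF \<tau> generic_scale[OF x t]] flip: sum_distrib_left)
      finally show ?thesis by (simp only: mult.commute)
    qed
    then show ?thesis by (intro eventually_mono[OF eventually_neq_at_within[of 0 0 UNIV]]) simp
  qed
  ultimately have "?L - ?Rr = 0" by (rule has_fps_expansion_eq_0)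
  then show ?thesis by simp
qed

text \<open>The constant coefficient of the Bernoulli identity. The left side is the localization
  sum of the squarefree monomial of \<tau>: in a maximal cone containing \<tau>, its factors cancel
  against the denominator.\<close>

lemma star_sum_inverse:
  assumes \<tau>: "\<tau> \<in> \<Phi>" and x: "generic x"
  shows "(\<Sum>\<kappa>\<in>star_max \<tau>. \<Prod>\<rho>\<in>cone_rays \<kappa> - cone_rays \<tau>. 1 / coord \<kappa> \<rho> x) = of_bool (\<tau> \<in> Max_cones)"
proof -
  have nz: "coord \<kappa> \<rho> x \<noteq> 0" if "\<kappa> \<in> star_max \<tau>" "\<rho> \<in> cone_rays \<kappa> - cone_rays \<tau>" for \<kappa> \<rho>
    using x that by (simp add: generic_def star_max_def)
  have prod0: "fps_nth (\<Prod>i\<in>A. F i) 0 = (\<Prod>i\<in>A. fps_nth (F i) 0)" for A :: "'a set set" and F :: "'a set \<Rightarrow> real fps"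
    by (induction A rule: infinite_finite_induct) simp_all
  have "fps_nth (\<Sum>\<kappa>\<in>star_max \<tau>. \<Prod>\<rho>\<in>cone_rays \<kappa> - cone_rays \<tau>. bern (coord \<kappa> \<rho> x)) 0 =
    (\<Sum>\<kappa>\<in>star_max \<tau>. \<Prod>\<rho>\<in>cone_rays \<kappa> - cone_rays \<tau>. 1 / coord \<kappa> \<rho> x)"
    unfolding fps_sum_nth prod0 by (intro sum.cong[OF refl] prod.cong[OF refl] bern_nth_0 nz)
  moreover have "fps_nth (fps_const ((-1) ^ (n - card (cone_rays \<tau>))) * fps_X ^ (n - card (cone_rays \<tau>)) :: real fps) 0
     = of_bool (\<tau> \<in> Max_cones)"
    using card_rays_le[OF \<tau>] \<tau> by (auto simp: Max_cones_iff)
  ultimately show ?thesis using star_sum_bern[OF assms] by simp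
qed

end

section \<open>Grading of the cone-wise polynomials\<close>

lemma real_polynomial_function_linear: "linear (f :: 'a::euclidean_space \<Rightarrow> real) \<Longrightarrow> real_polynomial_function f"
  by (rule real_polynomial_function.intros(1)) (simp add: linear_conv_bounded_linear)

lemma real_polynomial_function_continuous_on:
  "real_polynomial_function (p :: 'a::euclidean_space \<Rightarrow> real) \<Longrightarrow> continuous_on S p"
  by (simp add: continuous_on_polymonial_function real_polynomial_function_eq)

text \<open>On the line the polynomial is one in \<open>t\<close> with infinitely many roots; its
  constant coefficient is \<open>p x\<close>.\<close>

lemma polynomial_function_line_zero:
  fixes p :: "'a::euclidean_space \<Rightarrow> real"
  assumes "real_polynomial_function p" "infinite {t. p (x + t *\<^sub>R y) = 0}"
  shows "p x = 0"
proof -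
  have "polynomial_function (\<lambda>t. x + t *\<^sub>R y)"
    by (intro polynomial_function_add polynomial_function_const polynomial_function_bounded_linear bounded_linear_scaleR_left)
  then have "real_polynomial_function (p \<circ> (\<lambda>t. x + t *\<^sub>R y))"
    by (rule real_polynomial_function_compose[OF _ assms(1)])
  then obtain a N where "p \<circ> (\<lambda>t. x + t *\<^sub>R y) = (\<lambda>t. \<Sum>i\<le>N. a i * t ^ i)"
    using real_polynomial_function_iff_sum by blast
  then have a: "p (x + t *\<^sub>R y) = (\<Sum>i\<le>N. a i * t ^ i)" for t by (metis comp_apply)
  have "infinite {t. (\<Sum>i\<le>N. a i * t ^ i) = 0}" using assms(2) a by simp
  then have "a 0 = 0" using polyfun_finite_roots[of a N] by auto
  moreover have "p x = (\<Sum>i\<le>N. a i * 0 ^ i)" using a[of 0] by simp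
  ultimately show ?thesis by (simp add: sum.atMost_shift)
qed

lemma homogeneous_poly_mult:
  "homogeneous_poly i p \<Longrightarrow> homogeneous_poly j q \<Longrightarrow> homogeneous_poly (i + j) (\<lambda>x. p x * q x)"
  by (auto simp: homogeneous_poly_def power_add intro: real_polynomial_function.intros)

lemma homogeneous_poly_add:
  "homogeneous_poly i p \<Longrightarrow> homogeneous_poly i q \<Longrightarrow> homogeneous_poly i (\<lambda>x. p x + q x)"
  by (auto simp: homogeneous_poly_def distrib_left intro: real_polynomial_function.intros)

lemma homogeneous_poly_cmult: "homogeneous_poly i p \<Longrightarrow> homogeneous_poly i (\<lambda>x. c * p x)"
  by (auto simp: homogeneous_poly_def intro: real_polynomial_function.intros)

lemma homogeneous_poly_zero: "homogeneous_poly i (\<lambda>x. 0)"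
  by (auto simp: homogeneous_poly_def intro: real_polynomial_function.intros)

lemma homogeneous_poly_const: "homogeneous_poly 0 (\<lambda>x. c)"
  by (auto simp: homogeneous_poly_def intro: real_polynomial_function.intros)

lemma homogeneous_poly_linear: "linear p \<Longrightarrow> homogeneous_poly 1 p"
  by (auto simp: homogeneous_poly_def real_polynomial_function_linear linear_scale)

lemma homogeneous_polyD: "homogeneous_poly i p \<Longrightarrow> real_polynomial_function p"
  by (simp add: homogeneous_poly_def)

lemma homogeneous_poly_0: "homogeneous_poly i p \<Longrightarrow> i > 0 \<Longrightarrow> p 0 = 0"
  unfolding homogeneous_poly_def by (metis scaleR_zero_left mult_zero_left zero_power)

lemma homogeneous_poly_const_eq: "homogeneous_poly 0 p \<Longrightarrow> p x = p 0"
  unfolding homogeneous_poly_def by (metis scaleR_zero_left mult_1 power_0)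

lemma conewise_mult:
  assumes "f \<in> conewise P \<Phi>" "g \<in> conewise Q \<Phi>" "\<And>p q. P p \<Longrightarrow> Q q \<Longrightarrow> S (\<lambda>x. p x * q x)"
  shows "(\<lambda>x. f x * g x) \<in> conewise S \<Phi>"
  unfolding conewise_def
proof (intro CollectI conjI ballI)
  fix \<sigma> assume \<sigma>: "\<sigma> \<in> \<Phi>"
  obtain p where "P p" "\<forall>x\<in>\<sigma>. f x = p x" using assms(1) \<sigma> by (auto simp: conewise_def)
  moreover obtain q where "Q q" "\<forall>x\<in>\<sigma>. g x = q x" using assms(2) \<sigma> by (auto simp: conewise_def)
  ultimately show "\<exists>p. S p \<and> (\<forall>x\<in>\<sigma>. f x * g x = p x)"
    using assms(3) by (intro exI[of _ "\<lambda>x. p x * q x"]) simp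
qed (use assms in \<open>auto simp: conewise_def intro: continuous_intros\<close>)

lemma conewise_add:
  assumes "f \<in> conewise P \<Phi>" "g \<in> conewise Q \<Phi>" "\<And>p q. P p \<Longrightarrow> Q q \<Longrightarrow> S (\<lambda>x. p x + q x)"
  shows "(\<lambda>x. f x + g x) \<in> conewise S \<Phi>"
  unfolding conewise_def
proof (intro CollectI conjI ballI)
  fix \<sigma> assume \<sigma>: "\<sigma> \<in> \<Phi>"
  obtain p where "P p" "\<forall>x\<in>\<sigma>. f x = p x" using assms(1) \<sigma> by (auto simp: conewise_def)
  moreover obtain q where "Q q" "\<forall>x\<in>\<sigma>. g x = q x" using assms(2) \<sigma> by (auto simp: conewise_def)
  ultimately show "\<exists>p. S p \<and> (\<forall>x\<in>\<sigma>. f x + g x = p x)"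
    using assms(3) by (intro exI[of _ "\<lambda>x. p x + q x"]) simp
qed (use assms in \<open>auto simp: conewise_def intro: continuous_intros\<close>)

lemma conewise_mono: "f \<in> conewise P \<Phi> \<Longrightarrow> (\<And>p. P p \<Longrightarrow> Q p) \<Longrightarrow> f \<in> conewise Q \<Phi>"
  unfolding conewise_def by blast

lemma conewise_zero: "P (\<lambda>x. 0) \<Longrightarrow> (\<lambda>x. 0) \<in> conewise P \<Phi>"
  unfolding conewise_def by (intro CollectI conjI ballI allI impI exI[of _ "\<lambda>x. 0"]) simp_all

lemma conewise_restrict_fan:
  fixes p :: "'a::euclidean_space \<Rightarrow> real"
  assumes "P p" "real_polynomial_function p"
  shows "restrict_fan \<Phi> p \<in> conewise P \<Phi>"
  unfolding conewise_def
proof (intro CollectI conjI ballI allI impI exI[of _ p])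
  show "continuous_on (\<Union>\<Phi>) (restrict_fan \<Phi> p)"
    by (rule continuous_on_eq[OF real_polynomial_function_continuous_on[OF assms(2)]]) (simp add: restrict_fan_def)
qed (use assms in \<open>auto simp: restrict_fan_def\<close>)

lemma conewise_outside: "f \<in> conewise P \<Phi> \<Longrightarrow> x \<notin> \<Union>\<Phi> \<Longrightarrow> f x = 0"
  unfolding conewise_def by blast

lemma conewiseE:
  assumes "f \<in> conewise P \<Phi>" "\<sigma> \<in> \<Phi>"
  obtains p where "P p" "\<forall>x\<in>\<sigma>. f x = p x"
  using assms unfolding conewise_def by blast

abbreviation "conepoly \<equiv> conewise real_polynomial_function"

context unimodular_complete_fan
begin

text \<open>A nonnegative multiple stays in the same cone, where one homogeneous polynomial
  describes the function; for negative factors the cone may change.\<close>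

lemma conewise_homogeneousD:
  assumes "f \<in> conewise (homogeneous_poly i) \<Phi>" "x \<in> V" "t \<ge> 0"
  shows "f (t *\<^sub>R x) = t ^ i * f x"
proof -
  obtain \<sigma> where \<sigma>: "\<sigma> \<in> \<Phi>" "x \<in> \<sigma>" using V_cases[OF assms(2)] .
  have "t *\<^sub>R x \<in> \<sigma>" using polyhedral_coneD(3)[OF fan_cone[OF \<sigma>(1)]] \<sigma>(2) assms(3) unfolding cone_def by simp
  moreover obtain p where "homogeneous_poly i p" "\<forall>x\<in>\<sigma>. f x = p x" using conewiseE[OF assms(1) \<sigma>(1)] .
  ultimately show ?thesis using \<sigma>(2) by (simp add: homogeneous_poly_def)
qed

section \<open>Monomials in the Courant functions\<close>

text \<open>The multiset is the exponent vector. The case distinction matters for the empty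
  multiset, whose monomial has to be the unit of the ring, which is 0 outside
  \<open>V\<close>.\<close>

definition phi_mono :: "'a set multiset \<Rightarrow> 'a \<Rightarrow> real"
  where "phi_mono M x = (if x \<in> V then (\<Prod>\<rho>\<in>#M. phi \<rho> x) else 0)"

lemma mono_empty: "phi_mono {#} = restrict_fan \<Phi> (\<lambda>x. 1)"
  by (simp add: phi_mono_def restrict_fan_def Union_fan fun_eq_iff)

lemma mono_add_mset: "phi_mono (add_mset \<rho> M) x = phi \<rho> x * phi_mono M x"
  by (simp add: phi_mono_def)

lemma mono_conewise: "phi_mono M \<in> conewise (homogeneous_poly (size M)) \<Phi>"
proof (induction M)
  case empty
  show ?case unfolding mono_empty
    by (rule conewise_restrict_fan) (auto intro: homogeneous_poly_const real_polynomial_function.intros)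
next
  case (add \<rho> M)
  have "(\<lambda>x. phi \<rho> x * phi_mono M x) \<in> conewise (homogeneous_poly (size (add_mset \<rho> M))) \<Phi>"
    by (rule conewise_mult[OF phi_conewise add.IH]) (use homogeneous_poly_mult homogeneous_poly_linear in fastforce)
  then show ?case by (simp add: mono_add_mset[abs_def])
qed

definition monomials :: "('a \<Rightarrow> real) set"
  where "monomials = {phi_mono M | M. set_mset M \<subseteq> R}"

definition monos_deg :: "nat \<Rightarrow> ('a \<Rightarrow> real) set"
  where "monos_deg i = {phi_mono M | M. set_mset M \<subseteq> R \<and> size M = i}"

lemma mono_add: "(\<lambda>x. phi_mono M x * phi_mono N x) = phi_mono (M + N)"
  by (auto simp: phi_mono_def fun_eq_iff)

lemma span_monos_mult:
  assumes "f \<in> span monomials" "g \<in> span monomials"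
  shows "(\<lambda>x. f x * g x) \<in> span monomials"
  using assms(1)
proof (induction rule: span_induct_alt)
  case base
  then show ?case by (auto simp: zero_fun_def[symmetric] span_zero)
next
  case (step c m f)
  then obtain M where M: "m = phi_mono M" "set_mset M \<subseteq> R" by (auto simp: monomials_def)
  have "(\<lambda>x. m x * g x) \<in> span monomials" using assms(2)
  proof (induction rule: span_induct_alt)
    case base
    then show ?case by (auto simp: zero_fun_def[symmetric] span_zero)
  next
    case (step d m' h)
    then obtain N where N: "m' = phi_mono N" "set_mset N \<subseteq> R" by (auto simp: monomials_def)
    have "phi_mono (M + N) \<in> monomials" unfolding monomials_def using M N by (intro CollectI exI[of _ "M + N"]) simp
    then have "d *\<^sub>R phi_mono (M + N) + (\<lambda>x. m x * h x) \<in> span monomials"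
      by (rule span_add[OF span_scale[OF span_base] step.IH])
    also have "d *\<^sub>R phi_mono (M + N) + (\<lambda>x. m x * h x) = (\<lambda>x. m x * (d *\<^sub>R m' + h) x)"
      unfolding mono_add[symmetric] M N by (simp add: fun_eq_iff scaleR_fun_def algebra_simps)
    finally show ?case .
  qed
  then have "c *\<^sub>R (\<lambda>x. m x * g x) + (\<lambda>x. f x * g x) \<in> span monomials" using step by (intro span_add span_scale)
  also have "c *\<^sub>R (\<lambda>x. m x * g x) + (\<lambda>x. f x * g x) = (\<lambda>x. (c *\<^sub>R m + f) x * g x)"
    by (simp add: fun_eq_iff scaleR_fun_def algebra_simps)
  finally show ?case .
qed

lemma phi_in_monos: "\<rho> \<in> R \<Longrightarrow> phi \<rho> \<in> span monomials"
proof -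
  assume "\<rho> \<in> R"
  then have "phi_mono {#\<rho>#} \<in> monomials" unfolding monomials_def by (intro CollectI exI[of _ "{#\<rho>#}"]) simp
  moreover have "phi_mono {#\<rho>#} = phi \<rho>" by (auto simp: phi_mono_def fun_eq_iff phi_outside)
  ultimately show ?thesis by (metis span_base)
qed

lemma span_monos_cmult: "f \<in> span monomials \<Longrightarrow> (\<lambda>x. c * f x) \<in> span monomials"
  using span_scale[of f monomials c] by (simp add: scaleR_fun_def)

lemma sum_fun_apply: "(\<Sum>i\<in>I. f i) = (\<lambda>x. \<Sum>i\<in>I. f i x)" for f :: "'i \<Rightarrow> 'b \<Rightarrow> real"
  by (induction I rule: infinite_finite_induct) (simp_all add: fun_eq_iff)

lemma span_monos_sum: "(\<And>i. i \<in> I \<Longrightarrow> f i \<in> span monomials) \<Longrightarrow> (\<lambda>x. \<Sum>i\<in>I. f i x) \<in> span monomials"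
  using span_sum[of I f monomials] unfolding sum_fun_apply by simp

text \<open>For the rays \<open>I\<close> of a cone, the map sending \<open>x\<close> to the sum of
  the \<open>phi \<rho> x *\<^sub>R v \<rho>\<close> retracts \<open>V\<close> onto that cone.
  Composition with it extends a polynomial on the cone to a polynomial in the Courant
  functions.\<close>

lemma poly_phi_in_monos:
  assumes "real_polynomial_function p" "I \<subseteq> R"
  shows "(\<lambda>x. if x \<in> V then p (\<Sum>\<rho>\<in>I. phi \<rho> x *\<^sub>R v \<rho>) else 0) \<in> span monomials"
  using assms(1)
proof induction
  case (linear p)
  then have lin: "linear p" by (simp add: bounded_linear.linear)
  have "(\<lambda>x. \<Sum>\<rho>\<in>I. p (v \<rho>) * phi \<rho> x) \<in> span monomials"
    using assms(2) by (intro span_monos_sum span_monos_cmult phi_in_monos) blast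
  also have "(\<lambda>x. \<Sum>\<rho>\<in>I. p (v \<rho>) * phi \<rho> x) = (\<lambda>x. if x \<in> V then p (\<Sum>\<rho>\<in>I. phi \<rho> x *\<^sub>R v \<rho>) else 0)"
    by (auto simp: fun_eq_iff linear_sum[OF lin] linear_scale[OF lin] phi_outside mult.commute)
  finally show ?case .
next
  case (const c)
  have "phi_mono {#} \<in> monomials" unfolding monomials_def by (intro CollectI exI[of _ "{#}"]) simp
  then have "(\<lambda>x. c * phi_mono {#} x) \<in> span monomials" by (intro span_monos_cmult span_base)
  also have "(\<lambda>x. c * phi_mono {#} x) = (\<lambda>x. if x \<in> V then c else 0)" by (auto simp: phi_mono_def)
  finally show ?case .
next
  case (add p q)
  from span_add[OF add.IH] show ?case by (rule back_subst[of "\<lambda>f. f \<in> span monomials"]) (auto simp: fun_eq_iff)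
next
  case (mult p q)
  from span_monos_mult[OF mult.IH] show ?case by (rule back_subst[of "\<lambda>f. f \<in> span monomials"]) (auto simp: fun_eq_iff)
qed

lemma span_monos_conepoly: "f \<in> span monomials \<Longrightarrow> f \<in> conepoly \<Phi>"
proof (induction rule: span_induct_alt)
  case base
  then show ?case using conewise_zero[of real_polynomial_function \<Phi>] by (auto simp: zero_fun_def intro: real_polynomial_function.intros)
next
  case (step c m f)
  then obtain M where "m = phi_mono M" by (auto simp: monomials_def)
  then have m: "m \<in> conepoly \<Phi>" using mono_conewise homogeneous_polyD conewise_mono by blast
  have "(\<lambda>x. restrict_fan \<Phi> (\<lambda>_. c) x * m x) \<in> conepoly \<Phi>"
    by (rule conewise_mult[where P = real_polynomial_function and Q = real_polynomial_function, OF conewise_restrict_fan m])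
       (auto intro: real_polynomial_function.intros)
  then have "(\<lambda>x. restrict_fan \<Phi> (\<lambda>_. c) x * m x + f x) \<in> conepoly \<Phi>"
    by (rule conewise_add[OF _ step.IH]) (rule real_polynomial_function.intros(3))
  also have "(\<lambda>x. restrict_fan \<Phi> (\<lambda>_. c) x * m x + f x) = c *\<^sub>R m + f"
    using conewise_outside[OF m] by (auto simp: fun_eq_iff scaleR_fun_def restrict_fan_def)
  finally show ?case .
qed

lemma conepoly_diff:
  assumes "f \<in> conepoly \<Phi>" "g \<in> conepoly \<Phi>" shows "(\<lambda>x. f x - g x) \<in> conepoly \<Phi>"
proof -
  have "(\<lambda>x. restrict_fan \<Phi> (\<lambda>_. -1) x * g x) \<in> conepoly \<Phi>"
    by (rule conewise_mult[where P = real_polynomial_function and Q = real_polynomial_function, OF conewise_restrict_fan assms(2)])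
       (auto intro: real_polynomial_function.intros)
  then have "(\<lambda>x. f x + restrict_fan \<Phi> (\<lambda>_. -1) x * g x) \<in> conepoly \<Phi>"
    by (rule conewise_add[OF assms(1)]) (rule real_polynomial_function.intros(3))
  also have "(\<lambda>x. f x + restrict_fan \<Phi> (\<lambda>_. -1) x * g x) = (\<lambda>x. f x - g x)"
    using conewise_outside[OF assms(2)] by (auto simp: fun_eq_iff restrict_fan_def)
  finally show ?thesis .
qed

lemma phi_sum_mem: "\<sigma> \<in> \<Phi> \<Longrightarrow> (\<Sum>\<rho>\<in>cone_rays \<sigma>. phi \<rho> x *\<^sub>R v \<rho>) \<in> \<sigma>"
  by (rule mem_coneI, assumption, rule conicI[where c = "\<lambda>\<rho>. phi \<rho> x"])
     (use cone_rays_subset phi_nonneg in auto)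

text \<open>Cone-wise polynomials are the polynomials in the Courant functions, as in the
  Stanley-Reisner description. The cones are treated one at a time: the error on a new cone is
  extended by the retraction onto it and added.\<close>

lemma conepoly_eq_span_monos: "conepoly \<Phi> = span monomials"
proof
  show "span monomials \<subseteq> conepoly \<Phi>" using span_monos_conepoly by blast
  show "conepoly \<Phi> \<subseteq> span monomials"
  proof
    fix f assume f: "f \<in> conepoly \<Phi>"
    have "\<exists>g\<in>span monomials. \<forall>\<kappa>\<in>\<Psi>. \<forall>x\<in>\<kappa>. f x = g x" if "\<Psi> \<subseteq> \<Phi>" for \<Psi>
      using finite_subset[OF that finite_fan] that
    proof (induction \<Psi> rule: finite_induct)
      case empty
      then show ?case using span_zero by blast
    next
      case (insert \<sigma> \<Psi>)
      then obtain g where g: "g \<in> span monomials" "\<forall>\<kappa>\<in>\<Psi>. \<forall>x\<in>\<kappa>. f x = g x" by auto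
      have \<sigma>: "\<sigma> \<in> \<Phi>" using insert.prems by simp
      define h where "h x = f x - g x" for x
      have "h \<in> conepoly \<Phi>" unfolding h_def[abs_def] by (rule conepoly_diff[OF f span_monos_conepoly[OF g(1)]])
      then obtain p where p: "real_polynomial_function p" "\<forall>x\<in>\<sigma>. h x = p x" using conewiseE \<sigma> by metis
      define q where "q x = (if x \<in> V then p (\<Sum>\<rho>\<in>cone_rays \<sigma>. phi \<rho> x *\<^sub>R v \<rho>) else 0)" for x
      have q: "q \<in> span monomials" unfolding q_def[abs_def]
        by (rule poly_phi_in_monos[OF p(1) cone_rays_subset[OF \<sigma>]])
      have qh: "q x = h (\<Sum>\<rho>\<in>cone_rays \<sigma>. phi \<rho> x *\<^sub>R v \<rho>)" if "x \<in> V" for x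
        using p(2) phi_sum_mem[OF \<sigma>] that by (simp add: q_def)
      have "f x = (g + q) x" if \<kappa>: "\<kappa> \<in> insert \<sigma> \<Psi>" and x: "x \<in> \<kappa>" for \<kappa> x
      proof (cases "\<kappa> = \<sigma>")
        case True
        then have "x = (\<Sum>\<rho>\<in>cone_rays \<sigma>. phi \<rho> x *\<^sub>R v \<rho>)" using cone_sum_phi \<sigma> x by blast
        then have "q x = h x" using qh[of x] fan_subset[OF \<sigma>] x True by auto
        then show ?thesis by (simp add: h_def)
      next
        case False
        then have \<kappa>: "\<kappa> \<in> \<Psi>" "\<kappa> \<in> \<Phi>" using \<kappa> insert.prems by auto
        \<comment> \<open>The retraction onto \<sigma> maps \<kappa> into itself, because it only
          discards summands of a point of \<kappa>. Hence the correction vanishes on the cones where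
          the error is already 0.\<close>
        let ?y = "\<Sum>\<rho>\<in>cone_rays \<sigma>. phi \<rho> x *\<^sub>R v \<rho>"
        have "?y \<in> conic (cone_rays \<kappa>) v"
        proof (rule conicI)
          show "?y = (\<Sum>\<rho>\<in>cone_rays \<kappa>. (if \<rho> \<in> cone_rays \<sigma> then phi \<rho> x else 0) *\<^sub>R v \<rho>)"
            by (rule sum.mono_neutral_cong[OF finite_rays[OF \<kappa>(2)] finite_rays[OF \<sigma>]])
               (use phi_zero[OF \<kappa>(2) x] in auto)
          show "(if \<rho> \<in> cone_rays \<sigma> then phi \<rho> x else 0) \<ge> 0" if "\<rho> \<in> cone_rays \<kappa>" for \<rho>
            using phi_nonneg cone_rays_subset[OF \<kappa>(2)] that by auto
        qed
        then have "h ?y = 0" using g(2) \<kappa> mem_coneI[OF \<kappa>(2)] by (simp add: h_def)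
        then have "q x = 0" using qh[of x] fan_subset[OF \<kappa>(2)] x by auto
        then show ?thesis using g(2) \<kappa>(1) x by simp
      qed
      then show ?case using span_add[OF g(1) q] by blast
    qed
    from this[OF subset_refl] obtain g where g: "g \<in> span monomials" "\<forall>\<kappa>\<in>\<Phi>. \<forall>x\<in>\<kappa>. f x = g x" by blast
    have "f x = g x" for x
    proof (cases "x \<in> \<Union>\<Phi>")
      case False
      then show ?thesis using conewise_outside[OF f] conewise_outside[OF span_monos_conepoly[OF g(1)]] by simp
    qed (use g(2) in auto)
    then have "f = g" by (simp add: fun_eq_iff)
    then show "f \<in> span monomials" using g(1) by simp
  qed
qed

lemma span_monos_deg_conewise: "f \<in> span (monos_deg i) \<Longrightarrow> f \<in> conewise (homogeneous_poly i) \<Phi>"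
proof (induction rule: span_induct_alt)
  case base
  then show ?case
    using conewise_zero[where P = "homogeneous_poly i", OF homogeneous_poly_zero] by (simp add: zero_fun_def)
next
  case (step c m f)
  then obtain M where "m = phi_mono M" "size M = i" by (auto simp: monos_deg_def)
  then have m: "m \<in> conewise (homogeneous_poly i) \<Phi>" using mono_conewise by blast
  have "(\<lambda>x. restrict_fan \<Phi> (\<lambda>_. c) x * m x) \<in> conewise (homogeneous_poly i) \<Phi>"
    by (rule conewise_mult[where P = "homogeneous_poly 0" and Q = "homogeneous_poly i", OF conewise_restrict_fan m])
       (use homogeneous_poly_mult[of 0 _ i] in \<open>auto intro: homogeneous_poly_const real_polynomial_function.intros\<close>)
  then have "(\<lambda>x. restrict_fan \<Phi> (\<lambda>_. c) x * m x + f x) \<in> conewise (homogeneous_poly i) \<Phi>"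
    by (rule conewise_add[OF _ step.IH]) (rule homogeneous_poly_add)
  also have "(\<lambda>x. restrict_fan \<Phi> (\<lambda>_. c) x * m x + f x) = c *\<^sub>R m + f"
    using conewise_outside[OF m] by (auto simp: fun_eq_iff scaleR_fun_def restrict_fan_def)
  finally show ?case .
qed

lemma conepoly_graded:
  assumes "f \<in> conepoly \<Phi>"
  shows "\<exists>N g. (\<forall>j. g j \<in> span (monos_deg j)) \<and> (\<forall>j>N. g j = (\<lambda>x. 0)) \<and> (\<forall>x. f x = (\<Sum>j\<le>N. g j x))"
proof -
  have "f \<in> span monomials" using assms conepoly_eq_span_monos by simp
  then show ?thesis
  proof (induction rule: span_induct_alt)
    case base
    have z: "(\<lambda>_. 0) \<in> span (monos_deg j)" for j
      using span_zero[of "monos_deg j"] by (simp add: zero_fun_def)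
    show ?case
      by (rule exI[of _ "0::nat"], rule exI[of _ "\<lambda>_ _. 0"]) (simp add: z)
  next
    case (step c m f)
    then obtain M where M: "m = phi_mono M" "set_mset M \<subseteq> R" by (auto simp: monomials_def)
    obtain N g where g: "\<forall>j. g j \<in> span (monos_deg j)" "\<forall>j>N. g j = (\<lambda>x. 0)" "\<forall>x. f x = (\<Sum>j\<le>N. g j x)"
      using step by blast
    define k where "k = size M"
    have m: "m \<in> span (monos_deg k)" unfolding M k_def monos_deg_def using M
      by (intro span_base CollectI exI[of _ M]) simp
    define g' where "g' j = g j + (if j = k then c *\<^sub>R m else 0)" for j
    have "g' j \<in> span (monos_deg j)" for j
      unfolding g'_def using g(1) m by (auto intro!: span_add span_scale span_zero)
    moreover have "g' j = (\<lambda>x. 0)" if "j > max N k" for j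
      using g(2) that by (simp add: g'_def zero_fun_def fun_eq_iff)
    moreover have "(c *\<^sub>R m + f) x = (\<Sum>j\<le>max N k. g' j x)" for x
    proof -
      have "(\<Sum>j\<le>N. g j x) = (\<Sum>j\<le>max N k. g j x)"
        using g(2) by (intro sum.mono_neutral_left) auto
      moreover have "(\<Sum>j\<le>max N k. (if j = k then c *\<^sub>R m else 0) x) = (\<Sum>j\<le>max N k. if j = k then c * m x else 0)"
        by (intro sum.cong) (auto simp: scaleR_fun_def)
      ultimately show ?thesis using g(3) by (simp add: g'_def sum.distrib scaleR_fun_def)
    qed
    ultimately show ?case by blast
  qed
qed

lemma graded_unique:
  fixes c :: "nat \<Rightarrow> real"
  assumes "\<And>t. t \<ge> 0 \<Longrightarrow> (\<Sum>j\<le>N. c j * t ^ j) = 0" "j \<le> N"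
  shows "c j = 0"
proof -
  have "infinite {t::real. (\<Sum>j\<le>N. c j * t ^ j) = 0}"
    using infinite_super[of "{0::real..}" "{t. (\<Sum>j\<le>N. c j * t ^ j) = 0}"] assms(1) infinite_Ici by auto
  then show ?thesis using polyfun_finite_roots[of c N] assms(2) by blast
qed

text \<open>For fixed \<open>x\<close>, compare the coefficients of the powers of
  \<open>t \<ge> 0\<close> in \<open>f (t *\<^sub>R x)\<close> and in the sum of the graded pieces;
  only the piece of degree \<open>i\<close> remains.\<close>

lemma conewise_homogeneous_span:
  assumes f: "f \<in> conewise (homogeneous_poly i) \<Phi>"
  shows "f \<in> span (monos_deg i)"
proof -
  have "f \<in> conepoly \<Phi>" using f homogeneous_polyD conewise_mono by blast
  then obtain N g where g: "\<forall>j. g j \<in> span (monos_deg j)" "\<forall>j>N. g j = (\<lambda>x. 0)" "\<forall>x. f x = (\<Sum>j\<le>N. g j x)"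
    using conepoly_graded by blast
  define M where "M = max N i"
  have "f x = g i x" for x
  proof (cases "x \<in> V")
    case True
    have "(\<Sum>j\<le>M. (g j x - (if j = i then f x else 0)) * t ^ j) = 0" if t: "t \<ge> 0" for t
    proof -
      have tx: "t *\<^sub>R x \<in> V" using True by (rule span_scale)
      have "t ^ i * f x = f (t *\<^sub>R x)" using conewise_homogeneousD[OF f True t] by simp
      also have "\<dots> = (\<Sum>j\<le>N. g j (t *\<^sub>R x))" using g(3) by simp
      also have "\<dots> = (\<Sum>j\<le>N. t ^ j * g j x)"
        using conewise_homogeneousD[OF span_monos_deg_conewise True t] g(1) by (intro sum.cong[OF refl]) simp
      also have "\<dots> = (\<Sum>j\<le>M. t ^ j * g j x)"
        using g(2) by (intro sum.mono_neutral_left) (auto simp: M_def)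
      finally have *: "(\<Sum>j\<le>M. t ^ j * g j x) = t ^ i * f x" by simp
      have "(\<Sum>j\<le>M. (g j x - (if j = i then f x else 0)) * t ^ j) =
        (\<Sum>j\<le>M. t ^ j * g j x - (if j = i then t ^ i * f x else 0))"
        by (intro sum.cong[OF refl]) (simp add: algebra_simps)
      also have "\<dots> = (\<Sum>j\<le>M. t ^ j * g j x) - t ^ i * f x" by (simp add: sum_subtractf M_def)
      finally show ?thesis using * by simp
    qed
    then have "g i x - (if i = i then f x else 0) = 0"
      by (rule graded_unique[where N = M and c = "\<lambda>j. g j x - (if j = i then f x else 0)"]) (simp_all add: M_def)
    then show ?thesis by simp
  next
    case False
    then show ?thesis
      using conewise_outside[OF f] conewise_outside[OF span_monos_deg_conewise[OF g(1)[rule_format, of i]]]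
      by (simp add: Union_fan)
  qed
  then have "f = g i" by (simp add: fun_eq_iff)
  then show ?thesis using g(1) by simp
qed

end

section \<open>Localization of the integral\<close>

context unimodular_complete_fan
begin

definition cone_mono :: "'a set \<Rightarrow> 'a \<Rightarrow> real"
  where "cone_mono \<sigma> x = (\<Prod>\<rho>\<in>cone_rays \<sigma>. phi \<rho> x)"

text \<open>The coefficient has degree \<open>i - k\<close>, and is 0 if this is negative; truncated
  subtraction alone would allow a constant there.\<close>

definition red_deg :: "nat \<Rightarrow> nat \<Rightarrow> ('a \<Rightarrow> real) \<Rightarrow> bool"
  where "red_deg i k p \<longleftrightarrow> (if k \<le> i then homogeneous_poly (i - k) p else p = (\<lambda>x. 0))"

text \<open>A presentation of \<open>f\<close> over the polynomials on the generators
  \<open>cone_mono \<sigma>\<close>. The coefficients at the maximal cones will add up to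
  \<open>brion_zeta\<close>; the degrees are kept to evaluate the integral and to truncate
  series.\<close>

definition reduces :: "nat \<Rightarrow> ('a \<Rightarrow> real) \<Rightarrow> bool"
  where "reduces i f \<longleftrightarrow> (\<exists>a. (\<forall>\<sigma>\<in>\<Phi>. red_deg i (card (cone_rays \<sigma>)) (a \<sigma>)) \<and>
    (\<forall>x\<in>V. f x = (\<Sum>\<sigma>\<in>\<Phi>. a \<sigma> x * cone_mono \<sigma> x)))"

lemma reducesI:
  "(\<And>\<sigma>. \<sigma> \<in> \<Phi> \<Longrightarrow> red_deg i (card (cone_rays \<sigma>)) (a \<sigma>)) \<Longrightarrow>
    (\<And>x. x \<in> V \<Longrightarrow> f x = (\<Sum>\<sigma>\<in>\<Phi>. a \<sigma> x * cone_mono \<sigma> x)) \<Longrightarrow> reduces i f"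
  unfolding reduces_def by (rule exI[of _ a]) simp

lemma reducesE:
  assumes "reduces i f"
  obtains a where "\<forall>\<sigma>\<in>\<Phi>. red_deg i (card (cone_rays \<sigma>)) (a \<sigma>)"
    "\<forall>x\<in>V. f x = (\<Sum>\<sigma>\<in>\<Phi>. a \<sigma> x * cone_mono \<sigma> x)"
  using assms unfolding reduces_def by (elim exE conjE)

lemma red_deg_zero: "red_deg i k (\<lambda>x. 0)"
  by (simp add: red_deg_def homogeneous_poly_zero)

lemma reduces_zero: "(\<And>x. x \<in> V \<Longrightarrow> f x = 0) \<Longrightarrow> reduces i f"
  by (rule reducesI[where a = "\<lambda>_ _. 0"]) (simp_all add: red_deg_zero)

lemma reduces_add:
  assumes "reduces i f" "reduces i g" shows "reduces i (\<lambda>x. f x + g x)"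
proof -
  obtain a where a: "\<forall>\<sigma>\<in>\<Phi>. red_deg i (card (cone_rays \<sigma>)) (a \<sigma>)"
    "\<forall>x\<in>V. f x = (\<Sum>\<sigma>\<in>\<Phi>. a \<sigma> x * cone_mono \<sigma> x)" by (rule reducesE[OF assms(1)])
  obtain b where b: "\<forall>\<sigma>\<in>\<Phi>. red_deg i (card (cone_rays \<sigma>)) (b \<sigma>)"
    "\<forall>x\<in>V. g x = (\<Sum>\<sigma>\<in>\<Phi>. b \<sigma> x * cone_mono \<sigma> x)" by (rule reducesE[OF assms(2)])
  show ?thesis
  proof (rule reducesI[where a = "\<lambda>\<sigma> x. a \<sigma> x + b \<sigma> x"])
    fix \<sigma> assume "\<sigma> \<in> \<Phi>"
    then have "red_deg i (card (cone_rays \<sigma>)) (a \<sigma>)" "red_deg i (card (cone_rays \<sigma>)) (b \<sigma>)" using a b by simp_all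
    then show "red_deg i (card (cone_rays \<sigma>)) (\<lambda>x. a \<sigma> x + b \<sigma> x)"
      by (simp add: red_deg_def homogeneous_poly_add split: if_splits)
  qed (use a b in \<open>simp add: sum.distrib algebra_simps\<close>)
qed

lemma reduces_cmult:
  assumes "reduces i f" shows "reduces i (\<lambda>x. c * f x)"
proof -
  obtain a where a: "\<forall>\<sigma>\<in>\<Phi>. red_deg i (card (cone_rays \<sigma>)) (a \<sigma>)"
    "\<forall>x\<in>V. f x = (\<Sum>\<sigma>\<in>\<Phi>. a \<sigma> x * cone_mono \<sigma> x)" by (rule reducesE[OF assms(1)])
  show ?thesis
  proof (rule reducesI[where a = "\<lambda>\<sigma> x. c * a \<sigma> x"])
    fix \<sigma> assume "\<sigma> \<in> \<Phi>"
    then have "red_deg i (card (cone_rays \<sigma>)) (a \<sigma>)" using a by simp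
    then show "red_deg i (card (cone_rays \<sigma>)) (\<lambda>x. c * a \<sigma> x)"
      by (simp add: red_deg_def homogeneous_poly_cmult split: if_splits)
  qed (use a in \<open>simp add: sum_distrib_left algebra_simps\<close>)
qed

lemma reduces_linear_mult:
  assumes "linear l" "reduces i f" shows "reduces (Suc i) (\<lambda>x. l x * f x)"
proof -
  obtain a where a: "\<forall>\<sigma>\<in>\<Phi>. red_deg i (card (cone_rays \<sigma>)) (a \<sigma>)"
    "\<forall>x\<in>V. f x = (\<Sum>\<sigma>\<in>\<Phi>. a \<sigma> x * cone_mono \<sigma> x)" by (rule reducesE[OF assms(2)])
  show ?thesis
  proof (rule reducesI[where a = "\<lambda>\<sigma> x. l x * a \<sigma> x"])
    fix \<sigma> assume "\<sigma> \<in> \<Phi>"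
    then have "red_deg i (card (cone_rays \<sigma>)) (a \<sigma>)" using a by simp
    then show "red_deg (Suc i) (card (cone_rays \<sigma>)) (\<lambda>x. l x * a \<sigma> x)"
      using homogeneous_poly_mult[OF homogeneous_poly_linear[OF assms(1)], of "i - card (cone_rays \<sigma>)" "a \<sigma>"]
      by (auto simp: red_deg_def Suc_diff_le homogeneous_poly_zero split: if_splits)
  qed (use a in \<open>simp add: sum_distrib_left algebra_simps\<close>)
qed

lemma reduces_sum:
  "finite I \<Longrightarrow> (\<And>j. j \<in> I \<Longrightarrow> reduces i (f j)) \<Longrightarrow> reduces i (\<lambda>x. \<Sum>j\<in>I. f j x)"
  by (induction I rule: finite_induct) (simp_all add: reduces_zero reduces_add)

lemma reduces_cong: "reduces i f \<Longrightarrow> (\<And>x. x \<in> V \<Longrightarrow> f x = g x) \<Longrightarrow> reduces i g"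
  by (simp add: reduces_def)

lemma reduces_squarefree:
  assumes \<sigma>: "\<sigma> \<in> \<Phi>" shows "reduces (card (cone_rays \<sigma>)) (phi_mono (mset_set (cone_rays \<sigma>)))"
proof (rule reducesI[where a = "\<lambda>\<tau> x. if \<tau> = \<sigma> then 1 else 0"])
  fix \<tau> assume "\<tau> \<in> \<Phi>"
  show "red_deg (card (cone_rays \<sigma>)) (card (cone_rays \<tau>)) (\<lambda>x. if \<tau> = \<sigma> then 1 else 0)"
    by (simp add: red_deg_def homogeneous_poly_const homogeneous_poly_zero)
next
  fix x assume "x \<in> V"
  then have "phi_mono (mset_set (cone_rays \<sigma>)) x = cone_mono \<sigma> x"
    by (simp add: phi_mono_def cone_mono_def prod_unfold_prod_mset)
  also have "\<dots> = (\<Sum>\<tau>\<in>\<Phi>. if \<tau> = \<sigma> then cone_mono \<tau> x else 0)" using \<sigma> finite_fan by simp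
  also have "\<dots> = (\<Sum>\<tau>\<in>\<Phi>. (if \<tau> = \<sigma> then 1 else 0) * cone_mono \<tau> x)" by (intro sum.cong) auto
  finally show "phi_mono (mset_set (cone_rays \<sigma>)) x = (\<Sum>\<tau>\<in>\<Phi>. (if \<tau> = \<sigma> then 1 else 0) * cone_mono \<tau> x)" .
qed

text \<open>At a point of a cone \<kappa>, the Courant function of any ray outside \<kappa> is
  0.\<close>

lemma phi_mono_nonface:
  assumes "\<not> (\<exists>\<sigma>\<in>\<Phi>. set_mset M \<subseteq> cone_rays \<sigma>)" "x \<in> V"
  shows "phi_mono M x = 0"
proof -
  obtain \<kappa> where \<kappa>: "\<kappa> \<in> \<Phi>" "x \<in> \<kappa>" using V_cases[OF assms(2)] .
  then obtain \<rho> where \<rho>: "\<rho> \<in># M" "\<rho> \<notin> cone_rays \<kappa>" using assms(1) by (metis subsetI)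
  then have "phi \<rho> x = 0" using phi_zero \<kappa> by simp
  then have "0 \<in># image_mset (\<lambda>\<rho>. phi \<rho> x) M" using \<rho>(1) by (metis image_eqI set_image_mset)
  then show ?thesis by (simp add: phi_mono_def prod_mset_zero_iff)
qed

lemma sum_R_phi:
  assumes "x \<in> V" shows "x = (\<Sum>\<rho>\<in>R. phi \<rho> x *\<^sub>R v \<rho>)"
proof -
  obtain \<kappa> where \<kappa>: "\<kappa> \<in> \<Phi>" "x \<in> \<kappa>" using V_cases[OF assms] .
  have "(\<Sum>\<rho>\<in>R. phi \<rho> x *\<^sub>R v \<rho>) = (\<Sum>\<rho>\<in>cone_rays \<kappa>. phi \<rho> x *\<^sub>R v \<rho>)"
    by (intro sum.mono_neutral_right finite_R cone_rays_subset \<kappa>) (use phi_zero[OF \<kappa>] in simp)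
  then show ?thesis using cone_sum_phi[OF \<kappa>] by simp
qed

lemma linear_V_eq:
  assumes "linear l" "x \<in> V" shows "l x = (\<Sum>\<rho>\<in>R. l (v \<rho>) * (phi \<rho> x :: real))"
proof -
  have "l x = l (\<Sum>\<rho>\<in>R. phi \<rho> x *\<^sub>R v \<rho>)" by (rule arg_cong[OF sum_R_phi[OF assms(2)]])
  then show ?thesis by (simp add: linear_sum[OF assms(1)] linear_scale[OF assms(1)] mult.commute)
qed

lemma squarefree_multiset:
  assumes "\<And>\<rho>. count M \<rho> < 2" shows "M = mset_set (set_mset M)"
proof (rule multiset_eqI)
  fix \<rho>
  have "count M \<rho> < 2" by (rule assms)
  then have "count M \<rho> = 0 \<or> count M \<rho> = 1" by auto
  then show "count M \<rho> = count (mset_set (set_mset M)) \<rho>"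
    by (cases "\<rho> \<in># M") (auto simp: count_eq_zero_iff)
qed

text \<open>A repeated factor \<open>\<phi>\<^sub>\<rho>\<close> is traded, by means of the linear function that is 1 on \<open>v\<^sub>\<rho>\<close> and 0 on the
  other rays of the support, for monomials with larger support.\<close>

lemma reduces_phi_mono:
  "set_mset M \<subseteq> R \<Longrightarrow> size M = i \<Longrightarrow> reduces i (phi_mono M)"
proof (induction i arbitrary: M)
  case 0
  then have M: "M = {#}" by simp
  obtain \<sigma> where \<sigma>: "\<sigma> \<in> \<Phi>" using V_cases[of 0] span_zero by blast
  obtain \<tau> where "\<tau> \<in> \<Phi>" "cone_rays \<tau> = {}" using subset_rays_face[OF \<sigma>, of "{}"] by blast
  then show ?case using reduces_squarefree[of \<tau>] by (simp add: M)
next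
  case (Suc i)
  note IH = Suc.IH
  from Suc.prems show ?case
  \<comment> \<open>The outer induction on the degree handles the multiple of a linear function, the
    inner one on the number of rays missing from the support handles the monomials of the same
    degree.\<close>
  proof (induction "card R - card (set_mset M)" arbitrary: M rule: less_induct)
    case (less M)
    show ?case
    proof (cases "\<exists>\<sigma>\<in>\<Phi>. set_mset M \<subseteq> cone_rays \<sigma>")
      case False
      show ?thesis by (rule reduces_zero) (rule phi_mono_nonface[OF False])
    next
      case True
      then obtain \<sigma> where \<sigma>: "\<sigma> \<in> \<Phi>" "cone_rays \<sigma> = set_mset M" using subset_rays_face by metis
      show ?thesis
      proof (cases "\<forall>\<rho>. count M \<rho> < 2")
        case True
        then have M: "M = mset_set (cone_rays \<sigma>)" unfolding \<sigma>(2) by (intro squarefree_multiset) simp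
        then have "card (cone_rays \<sigma>) = Suc i" using less.prems(2) by (metis size_mset_set)
        then show ?thesis using reduces_squarefree[OF \<sigma>(1)] M by simp
      next
        case False
        then obtain \<rho> where \<rho>: "count M \<rho> \<ge> 2" by (metis linorder_not_less)
        define M' where "M' = M - {#\<rho>#}"
        have "\<rho> \<in># M" using \<rho> by (metis count_inI not_numeral_le_zero)
        then have M: "M = add_mset \<rho> M'" by (simp add: M'_def)
        have "count M' \<rho> > 0" using \<rho> by (simp add: M)
        then have \<rho>M': "\<rho> \<in># M'" by simp
        then have setM': "set_mset M' = set_mset M" by (auto simp: M)
        define l where "l = coord \<sigma> \<rho>"
        have lin: "linear l" unfolding l_def by (rule linear_coord[OF \<sigma>(1)])
        have lv: "l (v \<rho>') = (if \<rho>' = \<rho> then 1 else 0)" if "\<rho>' \<in> cone_rays \<sigma>" for \<rho>'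
          unfolding l_def by (rule coord_v[OF \<sigma>(1) that])
        have \<rho>\<sigma>: "\<rho> \<in> cone_rays \<sigma>" using \<sigma>(2) \<open>\<rho> \<in># M\<close> by simp
        \<comment> \<open>By the choice of \<open>l\<close>, only \<rho> and the rays outside the
          support survive when \<open>l\<close> is expanded in Courant functions.\<close>
        have phi: "phi \<rho> x = l x + (\<Sum>\<rho>'\<in>R - cone_rays \<sigma>. (- l (v \<rho>')) * phi \<rho>' x)" if "x \<in> V" for x
        proof -
          have "l x = (\<Sum>\<rho>'\<in>R. l (v \<rho>') * phi \<rho>' x)" by (rule linear_V_eq[OF lin that])
          also have "\<dots> = (\<Sum>\<rho>'\<in>R - cone_rays \<sigma>. l (v \<rho>') * phi \<rho>' x) + (\<Sum>\<rho>'\<in>cone_rays \<sigma>. l (v \<rho>') * phi \<rho>' x)"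
            by (rule sum.subset_diff[OF cone_rays_subset[OF \<sigma>(1)] finite_R])
          also have "(\<Sum>\<rho>'\<in>cone_rays \<sigma>. l (v \<rho>') * phi \<rho>' x) = (\<Sum>\<rho>'\<in>cone_rays \<sigma>. if \<rho>' = \<rho> then phi \<rho>' x else 0)"
            by (intro sum.cong[OF refl]) (simp add: lv)
          also have "\<dots> = phi \<rho> x" using \<rho>\<sigma> \<sigma>(1) by simp
          finally show ?thesis by (simp add: sum_negf)
        qed
        have "reduces (Suc i) (\<lambda>x. l x * phi_mono M' x + (\<Sum>\<rho>'\<in>R - cone_rays \<sigma>. (- l (v \<rho>')) * phi_mono (add_mset \<rho>' M') x))"
        proof (rule reduces_add[OF reduces_linear_mult[OF lin] reduces_sum[OF _ reduces_cmult]])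
          have M'R: "set_mset M' \<subseteq> R" and size: "size M' = i" using setM' less.prems by (simp, simp add: M)
          show "reduces i (phi_mono M')" by (rule IH[OF M'R size])
          show "finite (R - cone_rays \<sigma>)" using finite_R by simp
          fix \<rho>' assume \<rho>': "\<rho>' \<in> R - cone_rays \<sigma>"
          have set: "set_mset (add_mset \<rho>' M') = insert \<rho>' (set_mset M)" using setM' by simp
          show "reduces (Suc i) (phi_mono (add_mset \<rho>' M'))"
          proof (rule less.hyps)
            have "insert \<rho>' (set_mset M) \<subseteq> R" using \<rho>' less.prems(1) by simp
            then have "card (insert \<rho>' (set_mset M)) \<le> card R" by (rule card_mono[OF finite_R])
            moreover have "card (insert \<rho>' (set_mset M)) = Suc (card (set_mset M))" using \<rho>' \<sigma>(2) by simp
            ultimately have "card R - card (set_mset (add_mset \<rho>' M')) < card R - card (set_mset M)"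
              by (simp only: set)
            then show "card R - card (set_mset (add_mset \<rho>' M')) < card R - card (set_mset M)" .
            show "set_mset (add_mset \<rho>' M') \<subseteq> R" using set \<rho>' less.prems(1) by simp
            show "size (add_mset \<rho>' M') = Suc i" using less.prems(2) by (simp add: M)
          qed
        qed
        then show ?thesis
        proof (rule reduces_cong)
          fix x assume x: "x \<in> V"
          show "l x * phi_mono M' x + (\<Sum>\<rho>'\<in>R - cone_rays \<sigma>. (- l (v \<rho>')) * phi_mono (add_mset \<rho>' M') x) = phi_mono M x"
            unfolding M mono_add_mset phi[OF x] by (simp add: left_diff_distrib sum_distrib_right mult.assoc sum_negf)
        qed
      qed
    qed
  qed
qed

lemma reduces_homogeneous:
  assumes "f \<in> conewise (homogeneous_poly i) \<Phi>" shows "reduces i f"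
  using conewise_homogeneous_span[OF assms]
proof (induction rule: span_induct_alt)
  case base
  show ?case by (rule reduces_zero) simp
next
  case (step c m f)
  then obtain M where "m = phi_mono M" "set_mset M \<subseteq> R" "size M = i" by (auto simp: monos_deg_def)
  then have "reduces i m" using reduces_phi_mono by simp
  then have "reduces i (\<lambda>x. c * m x + f x)" using step by (intro reduces_add reduces_cmult)
  then show ?case by (rule reduces_cong) (simp add: scaleR_fun_def)
qed

text \<open>The form of \<open>reduces\<close> without degrees, available for inhomogeneous
  functions.\<close>

definition represents :: "('a \<Rightarrow> real) \<Rightarrow> ('a set \<Rightarrow> 'a \<Rightarrow> real) \<Rightarrow> bool"
  where "represents f a \<longleftrightarrow> (\<forall>\<sigma>\<in>\<Phi>. real_polynomial_function (a \<sigma>)) \<and>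
    (\<forall>x\<in>V. f x = (\<Sum>\<sigma>\<in>\<Phi>. a \<sigma> x * cone_mono \<sigma> x))"

lemma red_deg_polynomial: "red_deg i k p \<Longrightarrow> real_polynomial_function p"
  by (auto simp: red_deg_def homogeneous_poly_def split: if_splits)

lemma represents_exists:
  assumes "f \<in> conepoly \<Phi>" shows "\<exists>a. represents f a"
proof -
  have "f \<in> span monomials" using assms conepoly_eq_span_monos by simp
  then show ?thesis
  proof (induction rule: span_induct_alt)
    case base
    show ?case by (rule exI[of _ "\<lambda>_ _. 0"]) (auto simp: represents_def)
  next
    case (step c m f)
    then obtain M where "m = phi_mono M" "set_mset M \<subseteq> R" by (auto simp: monomials_def)
    then have "reduces (size M) m" using reduces_phi_mono by simp
    then obtain a where a: "\<forall>\<sigma>\<in>\<Phi>. red_deg (size M) (card (cone_rays \<sigma>)) (a \<sigma>)"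
      "\<forall>x\<in>V. m x = (\<Sum>\<sigma>\<in>\<Phi>. a \<sigma> x * cone_mono \<sigma> x)" by (rule reducesE)
    obtain b where b: "represents f b" using step by blast
    have "represents (c *\<^sub>R m + f) (\<lambda>\<sigma> x. c * a \<sigma> x + b \<sigma> x)"
      unfolding represents_def
    proof (intro conjI ballI)
      fix \<sigma> assume "\<sigma> \<in> \<Phi>"
      then have "real_polynomial_function (a \<sigma>)" "real_polynomial_function (b \<sigma>)"
        using a b red_deg_polynomial by (auto simp: represents_def)
      then show "real_polynomial_function (\<lambda>x. c * a \<sigma> x + b \<sigma> x)"
        by (intro real_polynomial_function.intros(2-4))
    next
      fix x assume "x \<in> V"
      then show "(c *\<^sub>R m + f) x = (\<Sum>\<sigma>\<in>\<Phi>. (c * a \<sigma> x + b \<sigma> x) * cone_mono \<sigma> x)"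
        using a(2) b by (simp add: represents_def scaleR_fun_def sum.distrib sum_distrib_left algebra_simps)
    qed
    then show ?case by blast
  qed
qed

text \<open>Polynomials agreeing on \<kappa> agree on \<open>V\<close>: from any point of
  \<open>V\<close>, the half-line in the direction of the sum of the primitive vectors eventually
  stays in \<kappa>.\<close>

lemma local_poly_eqI:
  assumes \<kappa>: "\<kappa> \<in> Max_cones" and q: "real_polynomial_function q" and fq: "\<And>x. x \<in> \<kappa> \<Longrightarrow> f x = q x"
  shows "local_poly V f \<kappa> = (\<lambda>x. if x \<in> V then q x else 0)"
  unfolding local_poly_def
proof (rule the_equality)
  have \<kappa>\<Phi>: "\<kappa> \<in> \<Phi>" by (rule max_fan[OF \<kappa>])
  show "(\<lambda>x. if x \<in> V then q x else 0) \<in> polys_on V \<and> (\<forall>x\<in>\<kappa>. (if x \<in> V then q x else 0) = f x)"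
    using q fq fan_subset[OF \<kappa>\<Phi>] by (auto simp: polys_on_def)
  fix p assume p: "p \<in> polys_on V \<and> (\<forall>x\<in>\<kappa>. p x = f x)"
  then obtain p' where p': "real_polynomial_function p'" "\<forall>x\<in>V. p x = p' x" "\<forall>x. x \<notin> V \<longrightarrow> p x = 0"
    by (auto simp: polys_on_def)
  have "p' x - q x = 0" if x: "x \<in> V" for x
  proof -
    let ?y = "\<Sum>\<rho>\<in>cone_rays \<kappa>. 1 *\<^sub>R v \<rho>"
    have poly: "real_polynomial_function (\<lambda>x. p' x - q x)" by (rule real_polynomial_function_diff[OF p'(1) q])
    have yV: "?y \<in> V" by (rule sum_v_in_V[OF cone_rays_subset[OF \<kappa>\<Phi>]])
    \<comment> \<open>Each coordinate grows by \<open>t\<close> along the half-line, so the sum of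
      the absolute values of the coordinates of \<open>x\<close> is far enough.\<close>
    let ?T = "\<Sum>\<rho>\<in>cone_rays \<kappa>. \<bar>coord \<kappa> \<rho> x\<bar>"
    have "{?T..} \<subseteq> {t. p' (x + t *\<^sub>R ?y) - q (x + t *\<^sub>R ?y) = 0}"
    proof
      fix t assume t: "t \<in> {?T..}"
      have "x + t *\<^sub>R ?y \<in> \<kappa>"
        unfolding mem_cone_iff[OF \<kappa>\<Phi>] span_max[OF \<kappa>]
      proof (intro conjI ballI)
        show "x + t *\<^sub>R ?y \<in> V" using x yV by (intro span_add span_scale)
        fix \<rho> assume \<rho>: "\<rho> \<in> cone_rays \<kappa>"
        have "\<bar>coord \<kappa> \<rho> x\<bar> \<le> ?T" by (rule member_le_sum) (use \<rho> \<kappa>\<Phi> in simp_all)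
        then have "- coord \<kappa> \<rho> x \<le> t" using t by simp
        moreover have "coord \<kappa> \<rho> (x + t *\<^sub>R ?y) = coord \<kappa> \<rho> x + t * coord \<kappa> \<rho> ?y"
          using linear_coord[OF \<kappa>\<Phi>, of \<rho>] by (simp add: linear_add linear_scale)
        moreover have "coord \<kappa> \<rho> ?y = 1" using coord_sum[OF \<kappa>\<Phi> subset_refl, of \<rho> "\<lambda>_. 1"] \<rho> by simp
        ultimately show "coord \<kappa> \<rho> (x + t *\<^sub>R ?y) \<ge> 0" by simp
      qed
      then show "t \<in> {t. p' (x + t *\<^sub>R ?y) - q (x + t *\<^sub>R ?y) = 0}"
        using p p'(2) fq fan_subset[OF \<kappa>\<Phi>] by fastforce
    qed
    then have "infinite {t. p' (x + t *\<^sub>R ?y) - q (x + t *\<^sub>R ?y) = 0}"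
      by (rule infinite_super) (rule infinite_Ici)
    then show ?thesis by (rule polynomial_function_line_zero[OF poly])
  qed
  then show "p = (\<lambda>x. if x \<in> V then q x else 0)" using p' by (auto simp: fun_eq_iff)
qed

definition loc :: "'a set \<Rightarrow> ('a \<Rightarrow> real) \<Rightarrow> 'a \<Rightarrow> real"
  where "loc \<kappa> f = local_poly V f \<kappa>"

lemma conepoly_loc:
  assumes "f \<in> conepoly \<Phi>" "\<kappa> \<in> Max_cones"
  obtains p where "real_polynomial_function p" "\<forall>x\<in>\<kappa>. f x = p x" "loc \<kappa> f = (\<lambda>x. if x \<in> V then p x else 0)"
proof -
  obtain p where p: "real_polynomial_function p" "\<forall>x\<in>\<kappa>. f x = p x" using conewiseE[OF assms(1) max_fan[OF assms(2)]] .
  then show ?thesis using that local_poly_eqI[OF assms(2)] by (simp add: loc_def)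
qed

lemma loc_add:
  assumes "\<kappa> \<in> Max_cones" "f \<in> conepoly \<Phi>" "g \<in> conepoly \<Phi>"
  shows "loc \<kappa> (\<lambda>x. f x + g x) x = loc \<kappa> f x + loc \<kappa> g x"
proof -
  obtain p where p: "real_polynomial_function p" "\<forall>x\<in>\<kappa>. f x = p x" "loc \<kappa> f = (\<lambda>x. if x \<in> V then p x else 0)"
    using conepoly_loc[OF assms(2,1)] .
  obtain q where q: "real_polynomial_function q" "\<forall>x\<in>\<kappa>. g x = q x" "loc \<kappa> g = (\<lambda>x. if x \<in> V then q x else 0)"
    using conepoly_loc[OF assms(3,1)] .
  have "loc \<kappa> (\<lambda>x. f x + g x) = (\<lambda>x. if x \<in> V then p x + q x else 0)"
    unfolding loc_def by (rule local_poly_eqI[OF assms(1)]) (use p q in \<open>auto intro: real_polynomial_function.intros(3)\<close>)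
  then show ?thesis using p q by simp
qed

lemma loc_mult:
  assumes "\<kappa> \<in> Max_cones" "f \<in> conepoly \<Phi>" "g \<in> conepoly \<Phi>"
  shows "loc \<kappa> (\<lambda>x. f x * g x) x = loc \<kappa> f x * loc \<kappa> g x"
proof -
  obtain p where p: "real_polynomial_function p" "\<forall>x\<in>\<kappa>. f x = p x" "loc \<kappa> f = (\<lambda>x. if x \<in> V then p x else 0)"
    using conepoly_loc[OF assms(2,1)] .
  obtain q where q: "real_polynomial_function q" "\<forall>x\<in>\<kappa>. g x = q x" "loc \<kappa> g = (\<lambda>x. if x \<in> V then q x else 0)"
    using conepoly_loc[OF assms(3,1)] .
  have "loc \<kappa> (\<lambda>x. f x * g x) = (\<lambda>x. if x \<in> V then p x * q x else 0)"
    unfolding loc_def by (rule local_poly_eqI[OF assms(1)]) (use p q in \<open>auto intro: real_polynomial_function.intros(4)\<close>)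
  then show ?thesis using p q by simp
qed

text \<open>On \<kappa> each Courant function is a linear coordinate, which gives the polynomial
  continuation to \<open>V\<close>.\<close>

lemma loc_represents:
  assumes \<kappa>: "\<kappa> \<in> Max_cones" and f: "represents f a" and x: "x \<in> V"
  shows "loc \<kappa> f x = (\<Sum>\<sigma>\<in>\<Phi>. a \<sigma> x * (\<Prod>\<rho>\<in>cone_rays \<sigma>. coord \<kappa> \<rho> x))"
proof -
  have \<kappa>\<Phi>: "\<kappa> \<in> \<Phi>" by (rule max_fan[OF \<kappa>])
  have "loc \<kappa> f = (\<lambda>x. if x \<in> V then \<Sum>\<sigma>\<in>\<Phi>. a \<sigma> x * (\<Prod>\<rho>\<in>cone_rays \<sigma>. coord \<kappa> \<rho> x) else 0)"
    unfolding loc_def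
  proof (rule local_poly_eqI[OF \<kappa>])
    show "real_polynomial_function (\<lambda>x. \<Sum>\<sigma>\<in>\<Phi>. a \<sigma> x * (\<Prod>\<rho>\<in>cone_rays \<sigma>. coord \<kappa> \<rho> x))"
    proof (intro real_polynomial_function_sum finite_fan real_polynomial_function.intros(4))
      fix \<sigma> assume \<sigma>: "\<sigma> \<in> \<Phi>"
      show "real_polynomial_function (a \<sigma>)" using f \<sigma> by (simp add: represents_def)
      show "real_polynomial_function (\<lambda>x. \<Prod>\<rho>\<in>cone_rays \<sigma>. coord \<kappa> \<rho> x)"
        by (intro real_polynomial_function_prod finite_rays \<sigma> real_polynomial_function_linear linear_coord[OF \<kappa>\<Phi>])
    qed
    fix x assume "x \<in> \<kappa>"
    then show "f x = (\<Sum>\<sigma>\<in>\<Phi>. a \<sigma> x * (\<Prod>\<rho>\<in>cone_rays \<sigma>. coord \<kappa> \<rho> x))"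
      using f fan_subset[OF \<kappa>\<Phi>] phi_eq_coord[OF \<kappa>\<Phi>, of x] unfolding represents_def cone_mono_def by auto
  qed
  then show ?thesis using x by simp
qed

lemma infinite_generic_line:
  assumes "x \<in> V" "generic y" shows "infinite {t. generic (x + t *\<^sub>R y)}"
proof -
  have "finite {t. coord \<kappa> \<rho> (x + t *\<^sub>R y) = 0}" if "\<kappa> \<in> Max_cones" "\<rho> \<in> cone_rays \<kappa>" for \<kappa> \<rho>
  proof -
    note lin = linear_coord[OF max_fan[OF that(1)], of \<rho>]
    have "coord \<kappa> \<rho> y \<noteq> 0" using assms(2) that by (simp add: generic_def)
    then have "{t. coord \<kappa> \<rho> (x + t *\<^sub>R y) = 0} \<subseteq> {- coord \<kappa> \<rho> x / coord \<kappa> \<rho> y}"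
      by (auto simp: linear_add[OF lin] linear_scale[OF lin] add_eq_0_iff2 eq_divide_eq)
    then show ?thesis using finite_subset by blast
  qed
  then have "finite (\<Union>\<kappa>\<in>Max_cones. \<Union>\<rho>\<in>cone_rays \<kappa>. {t. coord \<kappa> \<rho> (x + t *\<^sub>R y) = 0})"
    using finite_Max max_fan by (intro finite_UN_I) simp_all
  moreover have "UNIV - {t. generic (x + t *\<^sub>R y)} \<subseteq> (\<Union>\<kappa>\<in>Max_cones. \<Union>\<rho>\<in>cone_rays \<kappa>. {t. coord \<kappa> \<rho> (x + t *\<^sub>R y) = 0})"
  proof
    fix t assume t: "t \<in> UNIV - {t. generic (x + t *\<^sub>R y)}"
    have "x + t *\<^sub>R y \<in> V" using assms by (intro span_add span_scale) (simp_all add: generic_def)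
    then show "t \<in> (\<Union>\<kappa>\<in>Max_cones. \<Union>\<rho>\<in>cone_rays \<kappa>. {t. coord \<kappa> \<rho> (x + t *\<^sub>R y) = 0})"
      using t by (auto simp: generic_def)
  qed
  ultimately have "finite (UNIV - {t. generic (x + t *\<^sub>R y)})" by (rule finite_subset[rotated])
  then show ?thesis using infinite_UNIV_char_0 by (metis Diff_infinite_finite)
qed

text \<open>A line through \<open>x\<close> in a generic direction meets the generic points in an
  infinite set.\<close>

lemma polynomial_eq_on_generic:
  assumes "real_polynomial_function p" "real_polynomial_function q" "\<And>x. generic x \<Longrightarrow> p x = q x" "x \<in> V"
  shows "p x = q x"
proof -
  obtain y where y: "generic y" using generic_exists by blast
  have "p x - q x = 0"
  proof (rule polynomial_function_line_zero[where p = "\<lambda>x. p x - q x"])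
    show "real_polynomial_function (\<lambda>x. p x - q x)" by (rule real_polynomial_function_diff[OF assms(1,2)])
    have "{t. generic (x + t *\<^sub>R y)} \<subseteq> {t. p (x + t *\<^sub>R y) - q (x + t *\<^sub>R y) = 0}" using assms(3) by auto
    then show "infinite {t. p (x + t *\<^sub>R y) - q (x + t *\<^sub>R y) = 0}"
      by (rule infinite_super) (rule infinite_generic_line[OF assms(4) y])
  qed
  then show ?thesis by simp
qed

end

section \<open>Brion's localization formula\<close>

locale normalized_fan = unimodular_complete_fan +
  fixes \<Omega> :: "'a list \<Rightarrow> real"
  assumes normalized: "lattice_normalized \<Lambda> \<Omega>"
begin

text \<open>The primitive vectors of a maximal cone are a lattice basis, whose volume is 1 by the
  normalization of the form.\<close>

lemma cone_volume_max:
  assumes \<kappa>: "\<kappa> \<in> Max_cones" shows "cone_volume \<Lambda> \<Omega> \<kappa> = 1"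
proof -
  have \<kappa>\<Phi>: "\<kappa> \<in> \<Phi>" by (rule max_fan[OF \<kappa>])
  define \<rho>s where "\<rho>s = (SOME \<rho>s. distinct \<rho>s \<and> set \<rho>s = cone_rays \<kappa>)"
  have "\<exists>\<rho>s. distinct \<rho>s \<and> set \<rho>s = cone_rays \<kappa>" using finite_distinct_list[OF finite_rays[OF \<kappa>\<Phi>]] by blast
  from someI_ex[OF this] have \<rho>s: "distinct \<rho>s" "set \<rho>s = cone_rays \<kappa>" by (simp_all add: \<rho>s_def)
  have "distinct (map v \<rho>s)" using \<rho>s inj_v_rays[OF \<kappa>\<Phi>] by (simp add: distinct_map)
  moreover have "lattice_basis \<Lambda> (set (map v \<rho>s))" using lattice_basis_max[OF \<kappa>] \<rho>s by simp
  ultimately have "\<bar>\<Omega> (map v \<rho>s)\<bar> = 1" using normalized unfolding lattice_normalized_def by blast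
  then show ?thesis by (simp add: cone_volume_def \<rho>s_def)
qed

lemma brion_denom_max:
  assumes \<kappa>: "\<kappa> \<in> Max_cones"
  shows "brion_denom \<Lambda> \<Omega> \<Phi> \<kappa> = (\<lambda>x. if x \<in> V then \<Prod>\<rho>\<in>cone_rays \<kappa>. coord \<kappa> \<rho> x else 0)"
  unfolding brion_denom_def
proof (rule local_poly_eqI[OF \<kappa>])
  have \<kappa>\<Phi>: "\<kappa> \<in> \<Phi>" by (rule max_fan[OF \<kappa>])
  show "real_polynomial_function (\<lambda>x. \<Prod>\<rho>\<in>cone_rays \<kappa>. coord \<kappa> \<rho> x)"
    by (intro real_polynomial_function_prod finite_rays \<kappa>\<Phi> real_polynomial_function_linear linear_coord[OF \<kappa>\<Phi>])
  fix x assume "x \<in> \<kappa>"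
  have "(\<Prod>\<rho>\<in>cone_rays \<kappa>. courant \<Lambda> \<Phi> \<rho> x) = (\<Prod>\<rho>\<in>cone_rays \<kappa>. coord \<kappa> \<rho> x)"
    using cone_rays_subset[OF \<kappa>\<Phi>] phi_eq_coord[OF \<kappa>\<Phi> \<open>x \<in> \<kappa>\<close>]
    by (intro prod.cong[OF refl]) (simp add: courant_eq_phi subset_iff)
  then show "inverse (cone_volume \<Lambda> \<Omega> \<kappa>) * (\<Prod>\<rho>\<in>cone_rays \<kappa>. courant \<Lambda> \<Phi> \<rho> x) = (\<Prod>\<rho>\<in>cone_rays \<kappa>. coord \<kappa> \<rho> x)"
    by (simp add: cone_volume_max[OF \<kappa>])
qed

lemma generic_iff_denom:
  "x \<in> V \<Longrightarrow> (\<forall>\<kappa>\<in>Max_cones. brion_denom \<Lambda> \<Omega> \<Phi> \<kappa> x \<noteq> 0) \<longleftrightarrow> generic x"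
  using finite_rays[OF max_fan] by (simp add: generic_def brion_denom_max)

text \<open>After substituting the presentation of \<open>f\<close> and exchanging the sums, the
  factor of \<open>a \<sigma> x\<close> is the sum of \<open>star_sum_inverse\<close>: 1 for maximal
  \<sigma> and 0 otherwise.\<close>

lemma localization_sum:
  assumes f: "represents f a" and x: "generic x"
  shows "(\<Sum>\<kappa>\<in>Max_cones. loc \<kappa> f x / (\<Prod>\<rho>\<in>cone_rays \<kappa>. coord \<kappa> \<rho> x)) = (\<Sum>\<kappa>\<in>Max_cones. a \<kappa> x)"
proof -
  have xV: "x \<in> V" using x by (simp add: generic_def)
  \<comment> \<open>A ray of \<sigma> that is not a ray of \<kappa> has coordinate 0 on
    \<open>V\<close>, so only the cones \<kappa> in the star of \<sigma> contribute.\<close>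
  have quot: "(\<Prod>\<rho>\<in>cone_rays \<sigma>. coord \<kappa> \<rho> x) / (\<Prod>\<rho>\<in>cone_rays \<kappa>. coord \<kappa> \<rho> x) =
      (if \<kappa> \<in> star_max \<sigma> then \<Prod>\<rho>\<in>cone_rays \<kappa> - cone_rays \<sigma>. 1 / coord \<kappa> \<rho> x else 0)"
    if \<kappa>: "\<kappa> \<in> Max_cones" and \<sigma>: "\<sigma> \<in> \<Phi>" for \<kappa> \<sigma>
  proof (cases "cone_rays \<sigma> \<subseteq> cone_rays \<kappa>")
    case True
    have \<kappa>\<Phi>: "\<kappa> \<in> \<Phi>" by (rule max_fan[OF \<kappa>])
    have nz: "(\<Prod>\<rho>\<in>cone_rays \<sigma>. coord \<kappa> \<rho> x) \<noteq> 0"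
      using x \<kappa> True finite_rays[OF \<sigma>] by (auto simp: generic_def)
    have "(\<Prod>\<rho>\<in>cone_rays \<kappa>. coord \<kappa> \<rho> x) = (\<Prod>\<rho>\<in>cone_rays \<kappa> - cone_rays \<sigma>. coord \<kappa> \<rho> x) * (\<Prod>\<rho>\<in>cone_rays \<sigma>. coord \<kappa> \<rho> x)"
      by (rule prod.subset_diff[OF True finite_rays[OF \<kappa>\<Phi>]])
    then show ?thesis using True \<kappa> nz by (simp add: star_max_def prod_dividef)
  next
    case False
    then obtain \<rho> where "\<rho> \<in> cone_rays \<sigma>" "\<rho> \<notin> cone_rays \<kappa>" by blast
    moreover have "x \<in> span \<kappa>" using xV by (simp add: span_max[OF \<kappa>])
    ultimately have "(\<Prod>\<rho>\<in>cone_rays \<sigma>. coord \<kappa> \<rho> x) = 0"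
      using finite_rays[OF \<sigma>] coord_outside[OF max_fan[OF \<kappa>]] by (intro prod_zero) auto
    then show ?thesis using False by (simp add: star_max_def)
  qed
  have "(\<Sum>\<kappa>\<in>Max_cones. loc \<kappa> f x / (\<Prod>\<rho>\<in>cone_rays \<kappa>. coord \<kappa> \<rho> x)) =
    (\<Sum>\<kappa>\<in>Max_cones. \<Sum>\<sigma>\<in>\<Phi>. a \<sigma> x * (if \<kappa> \<in> star_max \<sigma> then \<Prod>\<rho>\<in>cone_rays \<kappa> - cone_rays \<sigma>. 1 / coord \<kappa> \<rho> x else 0))"
  proof (rule sum.cong[OF refl])
    fix \<kappa> assume \<kappa>: "\<kappa> \<in> Max_cones"
    have "loc \<kappa> f x / (\<Prod>\<rho>\<in>cone_rays \<kappa>. coord \<kappa> \<rho> x) =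
      (\<Sum>\<sigma>\<in>\<Phi>. a \<sigma> x * ((\<Prod>\<rho>\<in>cone_rays \<sigma>. coord \<kappa> \<rho> x) / (\<Prod>\<rho>\<in>cone_rays \<kappa>. coord \<kappa> \<rho> x)))"
      unfolding loc_represents[OF \<kappa> f xV] by (simp add: sum_divide_distrib)
    also have "\<dots> = (\<Sum>\<sigma>\<in>\<Phi>. a \<sigma> x * (if \<kappa> \<in> star_max \<sigma> then \<Prod>\<rho>\<in>cone_rays \<kappa> - cone_rays \<sigma>. 1 / coord \<kappa> \<rho> x else 0))"
      by (intro sum.cong[OF refl]) (simp only: quot[OF \<kappa>])
    finally show "loc \<kappa> f x / (\<Prod>\<rho>\<in>cone_rays \<kappa>. coord \<kappa> \<rho> x) = \<dots>" .
  qed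
  also have "\<dots> = (\<Sum>\<sigma>\<in>\<Phi>. a \<sigma> x * (\<Sum>\<kappa>\<in>Max_cones. if \<kappa> \<in> star_max \<sigma> then \<Prod>\<rho>\<in>cone_rays \<kappa> - cone_rays \<sigma>. 1 / coord \<kappa> \<rho> x else 0))"
    unfolding sum_distrib_left by (rule sum.swap)
  also have "\<dots> = (\<Sum>\<sigma>\<in>\<Phi>. a \<sigma> x * of_bool (\<sigma> \<in> Max_cones))"
  proof (rule sum.cong[OF refl])
    fix \<sigma> assume \<sigma>: "\<sigma> \<in> \<Phi>"
    have "(\<Sum>\<kappa>\<in>Max_cones. if \<kappa> \<in> star_max \<sigma> then \<Prod>\<rho>\<in>cone_rays \<kappa> - cone_rays \<sigma>. 1 / coord \<kappa> \<rho> x else 0) =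
      (\<Sum>\<kappa>\<in>star_max \<sigma>. \<Prod>\<rho>\<in>cone_rays \<kappa> - cone_rays \<sigma>. 1 / coord \<kappa> \<rho> x)"
      by (rule sum.mono_neutral_cong_right[OF finite_Max]) (auto simp: star_max_def)
    then show "a \<sigma> x * (\<Sum>\<kappa>\<in>Max_cones. if \<kappa> \<in> star_max \<sigma> then \<Prod>\<rho>\<in>cone_rays \<kappa> - cone_rays \<sigma>. 1 / coord \<kappa> \<rho> x else 0)
      = a \<sigma> x * of_bool (\<sigma> \<in> Max_cones)" by (simp only: star_sum_inverse[OF \<sigma> x])
  qed
  also have "\<dots> = (\<Sum>\<kappa>\<in>Max_cones. a \<kappa> x)"
    by (rule sum.mono_neutral_cong_right[OF finite_fan]) (auto simp: max_fan)
  finally show ?thesis .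
qed

text \<open>The poles cancel: the localization sum is the polynomial formed by the coefficients at
  the maximal cones. It is the only one because generic points determine a polynomial on
  \<open>V\<close>.\<close>

lemma brion_zeta_eq:
  assumes f: "represents f a"
  shows "brion_zeta \<Lambda> \<Omega> \<Phi> f = (\<lambda>x. if x \<in> V then \<Sum>\<kappa>\<in>Max_cones. a \<kappa> x else 0)"
  unfolding brion_zeta_def
proof (rule the_equality)
  let ?q = "\<lambda>x. \<Sum>\<kappa>\<in>Max_cones. a \<kappa> x"
  have q: "real_polynomial_function ?q"
    using f max_fan by (intro real_polynomial_function_sum finite_Max) (simp add: represents_def)
  have sum: "(\<Sum>\<kappa>\<in>Max_cones. local_poly V f \<kappa> x / brion_denom \<Lambda> \<Omega> \<Phi> \<kappa> x) = ?q x" if "generic x" for x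
  proof -
    have "x \<in> V" using that by (simp add: generic_def)
    then show ?thesis unfolding localization_sum[OF f that, symmetric]
      by (intro sum.cong[OF refl]) (simp add: brion_denom_max loc_def)
  qed
  show "(\<lambda>x. if x \<in> V then ?q x else 0) \<in> polys_on V \<and>
    (\<forall>x\<in>V. (\<forall>\<sigma>\<in>Max_cones. brion_denom \<Lambda> \<Omega> \<Phi> \<sigma> x \<noteq> 0) \<longrightarrow>
      (if x \<in> V then ?q x else 0) = (\<Sum>\<sigma>\<in>Max_cones. local_poly V f \<sigma> x / brion_denom \<Lambda> \<Omega> \<Phi> \<sigma> x))"
    using q sum generic_iff_denom by (auto simp: polys_on_def)
  fix p assume p: "p \<in> polys_on V \<and> (\<forall>x\<in>V. (\<forall>\<sigma>\<in>Max_cones. brion_denom \<Lambda> \<Omega> \<Phi> \<sigma> x \<noteq> 0) \<longrightarrow>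
      p x = (\<Sum>\<sigma>\<in>Max_cones. local_poly V f \<sigma> x / brion_denom \<Lambda> \<Omega> \<Phi> \<sigma> x))"
  then obtain p' where p': "real_polynomial_function p'" "\<forall>x\<in>V. p x = p' x" "\<forall>x. x \<notin> V \<longrightarrow> p x = 0"
    by (auto simp: polys_on_def)
  have "p' x = ?q x" if "x \<in> V" for x
  proof (rule polynomial_eq_on_generic[OF p'(1) q _ that])
    fix x assume x: "generic x"
    then have "x \<in> V" by (simp add: generic_def)
    then show "p' x = ?q x" using p p'(2) generic_iff_denom x sum by auto
  qed
  then show "p = (\<lambda>x. if x \<in> V then ?q x else 0)" using p' by (auto simp: fun_eq_iff)
qed

end

section \<open>The Grothendieck group\<close>

lemma linear_betweenD:
  assumes "linear_between S T f"
  shows "x \<in> S \<Longrightarrow> f x \<in> T" "x \<in> S \<Longrightarrow> y \<in> S \<Longrightarrow> f (x + y) = f x + f y" "x \<in> S \<Longrightarrow> f (c *\<^sub>R x) = c *\<^sub>R f x"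
  using assms unfolding linear_between_def by auto

lemma linear_betweenI:
  assumes "\<And>x. x \<in> S \<Longrightarrow> f x \<in> T" "\<And>x y. x \<in> S \<Longrightarrow> y \<in> S \<Longrightarrow> f (x + y) = f x + f y"
    "\<And>c x. x \<in> S \<Longrightarrow> f (c *\<^sub>R x) = c *\<^sub>R f x"
  shows "linear_between S T f"
  using assms unfolding linear_between_def by auto

lemma linear_between_zero: "linear_between S T f \<Longrightarrow> subspace S \<Longrightarrow> f 0 = 0"
  using linear_betweenD(3)[of S T f 0 0] subspace_0 by fastforce

text \<open>Stalk maps are linear only between given subspaces; a total linear map with the same
  values gives access to the theory of spans and images.\<close>

lemma linear_between_extend:
  assumes "linear_between S T f" "subspace S"
  obtains g where "linear g" "\<forall>x\<in>S. g x = f x"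
proof -
  obtain C where C: "C \<subseteq> S" "independent C" "S \<subseteq> span C" by (rule basis_exists)
  obtain g where g: "linear g" "\<forall>x\<in>C. g x = f x" using linear_independent_extend[OF C(2)] by blast
  have "x \<in> S \<and> g x = f x" if "x \<in> span C" for x
    using that
  proof (induction rule: span_induct_alt)
    case base
    then show ?case using linear_between_zero[OF assms] subspace_0[OF assms(2)] linear_0[OF g(1)] by simp
  next
    case (step c x y)
    have x: "x \<in> S" using step C(1) by blast
    have cx: "c *\<^sub>R x \<in> S" by (rule subspace_scale[OF assms(2) x])
    have "g (c *\<^sub>R x + y) = c *\<^sub>R f x + f y"
      using step g by (simp add: linear_add linear_scale)
    also have "\<dots> = f (c *\<^sub>R x + y)"
      using linear_betweenD(2)[OF assms(1) cx] linear_betweenD(3)[OF assms(1) x] step by simp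
    finally show ?case using subspace_add[OF assms(2) cx] step by simp
  qed
  then have "\<forall>x\<in>S. g x = f x" using C(3) by (simp add: subset_iff)
  then show ?thesis by (rule that[OF g(1)])
qed

lemma dim_zero_space: "dim {0::'a::real_vector} = 0"
  using dim_eq_card[of "{}" "{0::'a}", OF _ independent_empty] by simp

lemma dim_singleton_space: "x \<noteq> 0 \<Longrightarrow> dim {x::'a::real_vector} = 1"
  using dim_eq_card_independent[of "{x}"] by simp

text \<open>A basis \<open>A\<close> of the kernel is extended to a basis \<open>C\<close> of
  \<open>S\<close>; the map is injective on the span of the added vectors and sends that span onto
  the image.\<close>

lemma rank_nullity_between:
  assumes f: "linear_between S T f" and S: "subspace S" "S = span B" "finite B"
  shows "dim S = dim {x \<in> S. f x = 0} + dim (f ` S)"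
proof -
  obtain g where g0: "linear g" "\<forall>x\<in>S. g x = f x" by (rule linear_between_extend[OF f S(1)])
  have g: "linear g" "\<And>x. x \<in> S \<Longrightarrow> g x = f x" using g0 by simp_all
  let ?K = "{x \<in> S. f x = 0}"
  obtain A where A: "A \<subseteq> ?K" "independent A" "?K \<subseteq> span A" "card A = dim ?K" by (rule basis_exists)
  have "A \<subseteq> S" using A(1) by blast
  then obtain C where C: "A \<subseteq> C" "C \<subseteq> S" "independent C" "S \<subseteq> span C"
    by (rule maximal_independent_subset_extend[OF _ A(2)])
  have finC: "finite C" using independent_span_bound[OF S(3) C(3)] C(2) S(2) by simp
  have spC: "span C = S" using C(2,4) span_minimal[OF C(2) S(1)] by blast
  have gA: "g a = 0" if "a \<in> A" for a using A(1) g(2) that by auto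
  have inj0: "x = 0" if x: "x \<in> span (C - A)" "g x = 0" for x
  proof -
    have xS: "x \<in> S" using x(1) span_mono[of "C - A" C] spC by auto
    then have "x \<in> span A" using A(3) g(2)[OF xS] x(2) by auto
    then obtain u where u: "x = (\<Sum>a\<in>A. u a *\<^sub>R a)" using span_finite[of A] finC C(1) finite_subset by blast
    obtain w where w: "x = (\<Sum>a\<in>C - A. w a *\<^sub>R a)" using x(1) span_finite[of "C - A"] finC by auto
    \<comment> \<open>Subtracting the two expansions of \<open>x\<close> gives a linear relation on
      the basis \<open>C\<close>.\<close>
    define h where "h a = (if a \<in> A then u a else - w a)" for a
    have "(\<Sum>a\<in>C. h a *\<^sub>R a) = (\<Sum>a\<in>C - A. h a *\<^sub>R a) + (\<Sum>a\<in>A. h a *\<^sub>R a)"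
      by (rule sum.subset_diff[OF C(1) finC])
    also have "(\<Sum>a\<in>C - A. h a *\<^sub>R a) = (\<Sum>a\<in>C - A. - (w a *\<^sub>R a))" by (rule sum.cong) (auto simp: h_def)
    also have "(\<Sum>a\<in>A. h a *\<^sub>R a) = (\<Sum>a\<in>A. u a *\<^sub>R a)" by (rule sum.cong) (auto simp: h_def)
    finally have "(\<Sum>a\<in>C. h a *\<^sub>R a) = 0" using u w by (simp add: sum_negf)
    then have "h a = 0" if "a \<in> C" for a by (rule independentD[OF C(3) finC subset_refl _ that])
    then have "u a = 0" if "a \<in> A" for a using that C(1) by (metis h_def subsetD)
    then show ?thesis unfolding u by (intro sum.neutral) simp
  qed
  have inj: "inj_on g (span (C - A))"
  proof (rule inj_onI)
    fix x y assume "x \<in> span (C - A)" "y \<in> span (C - A)" "g x = g y"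
    then have "x - y = 0" by (intro inj0) (simp_all add: span_diff linear_diff[OF g(1)])
    then show "x = y" by simp
  qed
  have ind: "independent (g ` (C - A))"
    using independent_mono[OF C(3)] by (intro linear_independent_injective_image[OF g(1) _ inj]) blast
  have "f ` S = g ` span C" using g(2) spC by (simp cong: image_cong)
  also have "\<dots> = span (g ` C)" by (rule linear_span_image[OF g(1), symmetric])
  also have "\<dots> = span (g ` (C - A))"
  proof
    have "g ` C \<subseteq> insert 0 (g ` (C - A))" using gA by auto
    then show "span (g ` C) \<subseteq> span (g ` (C - A))" using span_mono[of "g ` C" "insert 0 (g ` (C - A))"] by simp
    show "span (g ` (C - A)) \<subseteq> span (g ` C)" by (intro span_mono) auto
  qed
  finally have "dim (f ` S) = card (g ` (C - A))" using ind by (simp add: dim_eq_card_independent)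
  also have "\<dots> = card (C - A)" using inj span_superset by (intro card_image) (rule inj_on_subset)
  also have "\<dots> = card C - card A" using finC C(1) by (simp add: card_Diff_subset finite_subset)
  finally have "dim (f ` S) = card C - card A" .
  moreover have "dim S = card C" using spC C(3) by (metis dim_span dim_eq_card_independent)
  moreover have "card A \<le> card C" using C(1) finC card_mono by blast
  ultimately show ?thesis using A(4) by simp
qed

lemma dim_bij_between:
  assumes "linear_between S T f" "subspace S" "S = span B" "finite B" "bij_betw f S T"
  shows "dim T = dim S"
proof -
  have "{x \<in> S. f x = 0} = {0}"
  proof (intro equalityI subsetI)
    fix x assume "x \<in> {x \<in> S. f x = 0}"
    then have "f x = f 0" "x \<in> S" using linear_between_zero[OF assms(1,2)] by simp_all
    then have "x = 0" using assms(5) subspace_0[OF assms(2)] unfolding bij_betw_def by (blast dest: inj_onD)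
    then show "x \<in> {0}" by simp
  qed (use subspace_0[OF assms(2)] linear_between_zero[OF assms(1,2)] in auto)
  then have "dim {x \<in> S. f x = 0} = 0" by (simp add: dim_zero_space)
  then show ?thesis using rank_nullity_between[OF assms(1-4)] assms(5) by (simp add: bij_betw_def)
qed

lemma dim_zero_trivial:
  assumes "subspace S" "S = span B" "finite B" "dim S = 0" shows "S = {0}"
proof -
  obtain C where C: "C \<subseteq> S" "independent C" "S \<subseteq> span C" "card C = dim S" by (rule basis_exists)
  have "finite C" using independent_span_bound[OF assms(3) C(2)] C(1) assms(2) by simp
  then have "C = {}" using C(4) assms(4) by simp
  then show ?thesis using C(3) subspace_0[OF assms(1)] by auto
qed

lemma scaleR_fun_app: "(c *\<^sub>R f) x = c *\<^sub>R f x"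
  by (simp add: scaleR_fun_def)

definition e0 :: "nat \<Rightarrow> real"
  where "e0 = (\<lambda>i. if i = 0 then 1 else 0)"

lemma e0_nonzero: "e0 \<noteq> 0" and e0_at_0 [simp]: "e0 0 = 1"
  by (auto simp: e0_def fun_eq_iff)

lemma span_e0_eq: "x \<in> span {e0} \<Longrightarrow> x = x 0 *\<^sub>R e0"
  unfolding span_singleton by (auto simp: scaleR_fun_def)

lemma dim_span_e0: "dim (span {e0}) = 1"
  using dim_singleton_space[OF e0_nonzero] by simp

context unimodular_complete_fan
begin

section \<open>Simple sheaves and additivity of stalk dimensions\<close>

text \<open>The simple sheaf at \<tau>: a line at \<tau>, zero stalks elsewhere.\<close>

definition delta_sheaf :: "'a set \<Rightarrow> 'a ksheaf"
  where "delta_sheaf \<tau> = \<lparr>stalk = (\<lambda>\<sigma>. if \<sigma> = \<tau> then span {e0} else {0}),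
    restr = (\<lambda>\<sigma> \<rho> x. if \<sigma> = \<rho> then x else 0)\<rparr>"

lemma cone_face_antisym: "cone_face \<sigma> \<tau> \<Longrightarrow> cone_face \<tau> \<sigma> \<Longrightarrow> \<sigma> = \<tau>"
  by (rule subset_antisym) (simp_all add: cone_face_def face_of_imp_subset)

lemma delta_sheaf: "is_sheaf \<Phi> (delta_sheaf \<tau>)"
  unfolding is_sheaf_def
proof (intro conjI ballI impI; (elim conjE)?)
  fix \<sigma>
  show "subspace (stalk (delta_sheaf \<tau>) \<sigma>)" by (simp add: delta_sheaf_def subspace_span subspace_single_0)
  show "\<exists>B. finite B \<and> stalk (delta_sheaf \<tau>) \<sigma> = span B"
  proof (cases "\<sigma> = \<tau>")
    case True then show ?thesis by (intro exI[of _ "{e0}"]) (simp add: delta_sheaf_def)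
  next
    case False then show ?thesis by (intro exI[of _ "{}"]) (simp add: delta_sheaf_def)
  qed
  fix \<rho>
  show "linear_between (stalk (delta_sheaf \<tau>) \<sigma>) (stalk (delta_sheaf \<tau>) \<rho>) (restr (delta_sheaf \<tau>) \<sigma> \<rho>)"
    by (rule linear_betweenI) (auto simp: delta_sheaf_def span_0 split: if_splits)
  fix x
  show "restr (delta_sheaf \<tau>) \<sigma> \<sigma> x = x" by (simp add: delta_sheaf_def)
  fix \<mu> \<upsilon> assume "cone_face \<mu> \<sigma>" "cone_face \<upsilon> \<mu>"
  \<comment> \<open>Nothing lies strictly between a cone and itself, so a composite restriction from
    \<tau> to \<tau> never passes through a zero stalk.\<close>
  then have "\<sigma> = \<upsilon> \<Longrightarrow> \<mu> = \<upsilon>" by (simp add: cone_face_antisym)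
  then show "restr (delta_sheaf \<tau>) \<mu> \<upsilon> (restr (delta_sheaf \<tau>) \<sigma> \<mu> x) = restr (delta_sheaf \<tau>) \<sigma> \<upsilon> x"
    by (auto simp: delta_sheaf_def)
qed

lemma cone_face_antisym_rays:
  "\<sigma> \<in> \<Phi> \<Longrightarrow> \<tau> \<in> \<Phi> \<Longrightarrow> cone_face \<tau> \<sigma> \<Longrightarrow> \<tau> \<noteq> \<sigma> \<Longrightarrow> card (cone_rays \<tau>) < card (cone_rays \<sigma>)"
  using cone_face_iff_rays rays_inj finite_rays by (metis psubsetI psubset_card_mono)

lemma is_sheafD:
  assumes "is_sheaf \<Phi> F"
  shows "\<sigma> \<in> \<Phi> \<Longrightarrow> subspace (stalk F \<sigma>)" "\<sigma> \<in> \<Phi> \<Longrightarrow> \<exists>B. finite B \<and> stalk F \<sigma> = span B"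
    "\<sigma> \<in> \<Phi> \<Longrightarrow> \<tau> \<in> \<Phi> \<Longrightarrow> cone_face \<tau> \<sigma> \<Longrightarrow> linear_between (stalk F \<sigma>) (stalk F \<tau>) (restr F \<sigma> \<tau>)"
    "\<sigma> \<in> \<Phi> \<Longrightarrow> x \<in> stalk F \<sigma> \<Longrightarrow> restr F \<sigma> \<sigma> x = x"
    "\<sigma> \<in> \<Phi> \<Longrightarrow> \<tau> \<in> \<Phi> \<Longrightarrow> \<upsilon> \<in> \<Phi> \<Longrightarrow> cone_face \<tau> \<sigma> \<Longrightarrow> cone_face \<upsilon> \<tau> \<Longrightarrow> x \<in> stalk F \<sigma> \<Longrightarrow>
      restr F \<tau> \<upsilon> (restr F \<sigma> \<tau> x) = restr F \<sigma> \<upsilon> x"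
  using assms unfolding is_sheaf_def by simp_all

lemma short_exact_dim:
  assumes "is_sheaf \<Phi> F'" "is_sheaf \<Phi> F" "short_exact \<Phi> F' F F''" "\<sigma> \<in> \<Phi>"
  shows "dim (stalk F \<sigma>) = dim (stalk F' \<sigma>) + dim (stalk F'' \<sigma>)"
proof -
  obtain i p where ip: "sheaf_morphism \<Phi> F' F i" "sheaf_morphism \<Phi> F F'' p"
    "\<forall>\<sigma>\<in>\<Phi>. inj_on (i \<sigma>) (stalk F' \<sigma>) \<and> i \<sigma> ` stalk F' \<sigma> = {x\<in>stalk F \<sigma>. p \<sigma> x = 0} \<and> p \<sigma> ` stalk F \<sigma> = stalk F'' \<sigma>"
    using assms(3) unfolding short_exact_def by (elim exE conjE)
  have lin: "linear_between (stalk F' \<sigma>) (stalk F \<sigma>) (i \<sigma>)" "linear_between (stalk F \<sigma>) (stalk F'' \<sigma>) (p \<sigma>)"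
    using ip assms(4) by (auto simp: sheaf_morphism_def)
  have ex: "inj_on (i \<sigma>) (stalk F' \<sigma>)" "i \<sigma> ` stalk F' \<sigma> = {x\<in>stalk F \<sigma>. p \<sigma> x = 0}" "p \<sigma> ` stalk F \<sigma> = stalk F'' \<sigma>"
    using ip(3) assms(4) by blast+
  obtain B where B: "finite B" "stalk F \<sigma> = span B" using is_sheafD(2)[OF assms(2,4)] by blast
  obtain B' where B': "finite B'" "stalk F' \<sigma> = span B'" using is_sheafD(2)[OF assms(1,4)] by blast
  have "dim (stalk F \<sigma>) = dim {x\<in>stalk F \<sigma>. p \<sigma> x = 0} + dim (p \<sigma> ` stalk F \<sigma>)"
    by (rule rank_nullity_between[OF lin(2) is_sheafD(1)[OF assms(2,4)] B(2,1)])
  moreover have "dim (i \<sigma> ` stalk F' \<sigma>) = dim (stalk F' \<sigma>)"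
  proof (rule dim_bij_between[OF _ is_sheafD(1)[OF assms(1,4)] B'(2,1)])
    show "linear_between (stalk F' \<sigma>) (i \<sigma> ` stalk F' \<sigma>) (i \<sigma>)"
      using lin(1) by (simp add: linear_between_def)
    show "bij_betw (i \<sigma>) (stalk F' \<sigma>) (i \<sigma> ` stalk F' \<sigma>)" using ex(1) by (simp add: bij_betw_def)
  qed
  ultimately show ?thesis using ex by simp
qed

section \<open>Additive functions on the Grothendieck group\<close>

abbreviation "KF \<equiv> K_free \<Phi>"
abbreviation "KR \<equiv> K_relations \<Phi>"
abbreviation "KG \<equiv> K_group \<Phi>"

text \<open>The coset of the generator \<open>F\<close> itself, without the choice of an isomorphic
  copy that \<open>K_class\<close> makes.\<close>

definition K_cls :: "'a ksheaf \<Rightarrow> ('a ksheaf \<Rightarrow>\<^sub>0 int) set"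
  where "K_cls F = KR #>\<^bsub>KF\<^esub> frag_of F"

lemma comm_group_KF: "comm_group KF"
  by (simp add: K_free_def abelian_free_Abelian_group)

lemma group_KF: "group KF"
  by (simp add: K_free_def)

lemma carrier_KF: "x \<in> carrier KF \<longleftrightarrow> Poly_Mapping.keys x \<subseteq> {F. is_sheaf \<Phi> F}"
  by (simp add: K_free_def)

lemma mult_KF: "x \<otimes>\<^bsub>KF\<^esub> y = x + y"
  by (simp add: K_free_def)

lemma frag_of_KF: "is_sheaf \<Phi> (F :: 'a ksheaf) \<Longrightarrow> frag_of F \<in> carrier KF"
  by (simp add: K_free_def)

lemma diff_KF: "x \<in> carrier KF \<Longrightarrow> y \<in> carrier KF \<Longrightarrow> x - y \<in> carrier KF"
  unfolding carrier_KF using keys_diff[of x y] by blast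

lemma K_gens_subset:
  "{frag_of F - frag_of F' - frag_of F'' | F' F F''.
      is_sheaf \<Phi> F' \<and> is_sheaf \<Phi> F \<and> is_sheaf \<Phi> F'' \<and> short_exact \<Phi> F' F F''} \<subseteq> carrier KF"
  by (rule subsetI, elim CollectE exE conjE, hypsubst) (intro diff_KF frag_of_KF)

lemma subgroup_KR: "subgroup KR KF"
  unfolding K_relations_def by (rule group.generate_is_subgroup[OF group_KF K_gens_subset])

lemma normal_KR: "KR \<lhd> KF"
  by (rule comm_group.subgroup_imp_normal[OF comm_group_KF subgroup_KR])

lemma K_mult:
  assumes "x \<in> carrier KF" "y \<in> carrier KF"
  shows "(KR #>\<^bsub>KF\<^esub> x) \<otimes>\<^bsub>KG\<^esub> (KR #>\<^bsub>KF\<^esub> y) = KR #>\<^bsub>KF\<^esub> (x + y)"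
  using normal.rcos_sum[OF normal_KR assms] by (simp add: K_group_def FactGroup_def mult_KF)

lemma K_carrierI: "x \<in> carrier KF \<Longrightarrow> KR #>\<^bsub>KF\<^esub> x \<in> carrier KG"
  by (auto simp: K_group_def FactGroup_def RCOSETS_def)

lemma K_carrierE:
  assumes "\<gamma> \<in> carrier KG" obtains x where "x \<in> carrier KF" "\<gamma> = KR #>\<^bsub>KF\<^esub> x"
  using assms by (auto simp: K_group_def FactGroup_def RCOSETS_def)

lemma K_cls_carrier: "is_sheaf \<Phi> (F :: 'a ksheaf) \<Longrightarrow> K_cls F \<in> carrier KG"
  unfolding K_cls_def by (rule K_carrierI) (rule frag_of_KF)

lemma K_cls_exact:
  fixes F F' F'' :: "'a ksheaf"
  assumes "is_sheaf \<Phi> F'" "is_sheaf \<Phi> F" "is_sheaf \<Phi> F''" "short_exact \<Phi> F' F F''"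
  shows "K_cls F = K_cls F' \<otimes>\<^bsub>KG\<^esub> K_cls F''"
proof -
  let ?y = "frag_of F' + frag_of F''"
  have yc: "?y \<in> carrier KF" unfolding carrier_KF using keys_add[of "frag_of F'" "frag_of F''"] assms by auto
  have "frag_of F - frag_of F' - frag_of F'' \<in> KR" unfolding K_relations_def
    by (rule generate.incl) (use assms in blast)
  then have "(frag_of F - frag_of F' - frag_of F'') \<otimes>\<^bsub>KF\<^esub> ?y \<in> KR #>\<^bsub>KF\<^esub> ?y"
    unfolding r_coset_def by blast
  then have "frag_of F \<in> KR #>\<^bsub>KF\<^esub> ?y" by (simp add: mult_KF)
  then have "KR #>\<^bsub>KF\<^esub> ?y = KR #>\<^bsub>KF\<^esub> frag_of F"
    by (rule group.repr_independence[OF group_KF _ yc subgroup_KR])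
  then show ?thesis using K_mult[OF frag_of_KF[OF assms(1)] frag_of_KF[OF assms(3)]] by (simp add: K_cls_def)
qed

text \<open>Stalk dimension is additive in short exact sequences, so its extension to the free group
  annihilates the relations and descends to the quotient.\<close>

lemma K_delta_exists:
  assumes "\<tau> \<in> \<Phi>"
  shows "\<exists>d. d \<in> hom KG integer_group \<and> (\<forall>F. is_sheaf \<Phi> F \<longrightarrow> d (K_cls F) = int (dim (stalk F \<tau>)))"
proof -
  obtain h where h: "h \<in> hom KF integer_group" "\<And>F. F \<in> {F. is_sheaf \<Phi> F} \<Longrightarrow> h (frag_of F) = int (dim (stalk F \<tau>))"
    unfolding K_free_def
    by (rule comm_group.free_Abelian_group_universal[OF abelian_integer_group, of "\<lambda>F. int (dim (stalk F \<tau>))" "{F. is_sheaf \<Phi> F}"]) auto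
  interpret gh: group_hom KF integer_group h
    by (rule group_hom.intro[OF group_KF group_integer_group]) (simp add: group_hom_axioms_def h(1))
  have hadd: "h (x + y) = h x + h y" if "x \<in> carrier KF" "y \<in> carrier KF" for x y
    using gh.hom_mult[OF that] by (simp add: mult_KF)
  have hdiff: "h (x - y) = h x - h y" if "x \<in> carrier KF" "y \<in> carrier KF" for x y
    using hadd[OF diff_KF[OF that] that(2)] by simp
  have "KR \<subseteq> kernel KF integer_group h" unfolding K_relations_def
  proof (rule group.generate_subgroup_incl[OF group_KF _ gh.subgroup_kernel], rule subsetI)
    fix x :: "'a ksheaf \<Rightarrow>\<^sub>0 int"
    assume "x \<in> {frag_of F - frag_of F' - frag_of F'' | F' F F''.
      is_sheaf \<Phi> F' \<and> is_sheaf \<Phi> F \<and> is_sheaf \<Phi> F'' \<and> short_exact \<Phi> F' F F''}"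
    then obtain F' F F'' where F: "x = frag_of F - frag_of F' - frag_of F''" "is_sheaf \<Phi> F'" "is_sheaf \<Phi> F"
      "is_sheaf \<Phi> F''" "short_exact \<Phi> F' F F''" by blast
    have c: "frag_of F \<in> carrier KF" "frag_of F' \<in> carrier KF" "frag_of F'' \<in> carrier KF" using F frag_of_KF by simp_all
    have "h x = h (frag_of F) - h (frag_of F') - h (frag_of F'')"
      unfolding F(1) by (simp only: hdiff[OF diff_KF[OF c(1,2)] c(3)] hdiff[OF c(1,2)])
    also have "\<dots> = 0" using short_exact_dim[OF F(2,3,5) assms] F by (simp add: h(2))
    finally show "x \<in> kernel KF integer_group h"
      unfolding kernel_def F(1) using diff_KF[OF diff_KF[OF c(1,2)] c(3)] by simp
  qed
  then obtain d where d: "d \<in> hom (KF Mod KR) integer_group" "\<And>x. x \<in> carrier KF \<Longrightarrow> d (KR #>\<^bsub>KF\<^esub> x) = h x"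
    using gh.FactGroup_universal_kernel[OF normal_KR] by metis
  have "d (K_cls F) = int (dim (stalk F \<tau>))" if "is_sheaf \<Phi> F" for F
    using d(2)[OF frag_of_KF[OF that]] h(2) that by (simp add: K_cls_def)
  then show ?thesis using d(1) by (auto simp: K_group_def)
qed

definition K_delta :: "'a set \<Rightarrow> ('a ksheaf \<Rightarrow>\<^sub>0 int) set \<Rightarrow> int"
  where "K_delta \<tau> = (SOME d. d \<in> hom KG integer_group \<and> (\<forall>F. is_sheaf \<Phi> F \<longrightarrow> d (K_cls F) = int (dim (stalk F \<tau>))))"

lemma K_delta:
  assumes "\<tau> \<in> \<Phi>"
  shows "K_delta \<tau> \<in> hom KG integer_group" "is_sheaf \<Phi> F \<Longrightarrow> K_delta \<tau> (K_cls F) = int (dim (stalk F \<tau>))"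
  using someI_ex[OF K_delta_exists[OF assms]] unfolding K_delta_def by blast+

lemma K_delta_add:
  "\<tau> \<in> \<Phi> \<Longrightarrow> x \<in> carrier KG \<Longrightarrow> y \<in> carrier KG \<Longrightarrow> K_delta \<tau> (x \<otimes>\<^bsub>KG\<^esub> y) = K_delta \<tau> x + K_delta \<tau> y"
  using hom_mult[OF K_delta(1)] by simp

text \<open>Values in a real vector space cover both the Euler characteristic, read in the reals,
  and the Chern character, whose values are sequences of functions.\<close>

definition K_additive :: "(('a ksheaf \<Rightarrow>\<^sub>0 int) set \<Rightarrow> 'b::real_vector) \<Rightarrow> bool"
  where "K_additive h \<longleftrightarrow> (\<forall>x\<in>carrier KG. \<forall>y\<in>carrier KG. h (x \<otimes>\<^bsub>KG\<^esub> y) = h x + h y)"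

text \<open>If \<tau> is minimal in the support, all restrictions from \<tau> to proper faces are 0,
  so any line in the stalk at \<tau> is a subsheaf. The quotient is realised inside the same space
  of sequences, on a complement of that line.\<close>

lemma sheaf_split:
  assumes F: "is_sheaf \<Phi> F" and pos: "(\<Sum>\<sigma>\<in>\<Phi>. dim (stalk F \<sigma>)) > 0"
  shows "\<exists>\<tau>\<in>\<Phi>. \<exists>F''. is_sheaf \<Phi> F'' \<and> short_exact \<Phi> (delta_sheaf \<tau>) F F''"
proof -
  let ?N = "{\<sigma>\<in>\<Phi>. dim (stalk F \<sigma>) > 0}"
  have "?N \<noteq> {}" using pos by (metis (mono_tags, lifting) empty_Collect_eq gr0I sum.neutral less_irrefl)
  \<comment> \<open>Least number of rays implies minimality for the face order.\<close>
  then obtain \<tau> where \<tau>N: "\<tau> \<in> ?N" and min: "\<And>\<sigma>. \<sigma> \<in> ?N \<Longrightarrow> card (cone_rays \<tau>) \<le> card (cone_rays \<sigma>)"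
    using ex_has_least_nat[of "\<lambda>\<sigma>. \<sigma> \<in> ?N" _ "\<lambda>\<sigma>. card (cone_rays \<sigma>)"] by blast
  have \<tau>: "\<tau> \<in> \<Phi>" "dim (stalk F \<tau>) > 0" using \<tau>N by auto
  have low: "stalk F \<upsilon> = {0}" if "\<upsilon> \<in> \<Phi>" "cone_face \<upsilon> \<tau>" "\<upsilon> \<noteq> \<tau>" for \<upsilon>
  proof -
    have "card (cone_rays \<upsilon>) < card (cone_rays \<tau>)" using cone_face_antisym_rays[OF \<tau>(1) that] .
    then have "\<upsilon> \<notin> ?N" using min by (metis linorder_not_less)
    then have "dim (stalk F \<upsilon>) = 0" using that(1) by simp
    then show ?thesis using dim_zero_trivial is_sheafD(1,2)[OF F that(1)] by metis
  qed
  obtain C where C: "C \<subseteq> stalk F \<tau>" "independent C" "stalk F \<tau> \<subseteq> span C" "card C = dim (stalk F \<tau>)" by (rule basis_exists)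
  obtain B where B: "finite B" "stalk F \<tau> = span B" using is_sheafD(2)[OF F \<tau>(1)] by blast
  have finC: "finite C" using independent_span_bound[OF B(1) C(2)] C(1) B(2) by simp
  have spC: "stalk F \<tau> = span C" using C(3) span_minimal[OF C(1) is_sheafD(1)[OF F \<tau>(1)]] by blast
  have "C \<noteq> {}" using C(4) \<tau>(2) by auto
  then obtain b where b: "b \<in> C" by blast
  have b0: "b \<noteq> 0" using C(2) b dependent_zero by blast
  \<comment> \<open>The projection of the stalk at \<tau> that annihilates \<open>b\<close> and
    fixes the other basis vectors; it plays the role of the quotient map.\<close>
  obtain P :: "(nat \<Rightarrow> real) \<Rightarrow> (nat \<Rightarrow> real)" where P: "linear P" "\<forall>x\<in>C. P x = (if x = b then 0 else x)"
    using linear_independent_extend[OF C(2), of "\<lambda>x. if x = b then 0 else x"] by blast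
  have Pb: "P b = 0" using P(2) b by simp
  have Pin: "P x \<in> span (C - {b})" if "x \<in> span C" for x
  proof -
    have "P x \<in> span (P ` C)" using linear_span_image[OF P(1), of C] that by blast
    moreover have "P ` C \<subseteq> insert 0 (C - {b})" using P(2) by auto
    ultimately show ?thesis using span_mono[of "P ` C" "insert 0 (C - {b})"] by auto
  qed
  have Pid: "P x = x" if "x \<in> span (C - {b})" for x
    by (rule linear_eq_on[OF P(1) linear_id that, simplified]) (use P(2) in auto)
  have Pker: "x - P x \<in> span {b}" if "x \<in> span C" for x
    using that
  proof (induction rule: span_induct_alt)
    case base
    show ?case by (simp only: linear_0[OF P(1)] diff_0_right span_0)
  next
    case (step c x y)
    have "x - P x \<in> span {b}" using step P(2) by (auto simp: span_0 span_base)
    then have "c *\<^sub>R (x - P x) + (y - P y) \<in> span {b}" using step by (intro span_add span_scale)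
    also have "c *\<^sub>R (x - P x) + (y - P y) = (c *\<^sub>R x + y) - P (c *\<^sub>R x + y)"
      by (simp add: linear_add[OF P(1)] linear_scale[OF P(1)] algebra_simps)
    finally show ?case .
  qed
  have sub: "span (C - {b}) \<subseteq> span C" by (intro span_mono) auto
  \<comment> \<open>Restrictions arriving at \<tau> are followed by the projection; the others are
    those of \<open>F\<close>.\<close>
  define rr where "rr \<sigma> \<rho> x = (if \<sigma> = \<rho> then x else if \<rho> = \<tau> then P (restr F \<sigma> \<tau> x) else restr F \<sigma> \<rho> x)" for \<sigma> \<rho> x
  define F'' :: "'a ksheaf" where "F'' = \<lparr>stalk = (\<lambda>\<sigma>. if \<sigma> = \<tau> then span (C - {b}) else stalk F \<sigma>), restr = rr\<rparr>"
  have st: "stalk F'' \<tau> = span (C - {b})" "\<And>\<sigma>. \<sigma> \<noteq> \<tau> \<Longrightarrow> stalk F'' \<sigma> = stalk F \<sigma>" "restr F'' = rr"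
    by (simp_all add: F''_def)
  have stsub: "x \<in> stalk F \<sigma>" if "x \<in> stalk F'' \<sigma>" for x \<sigma>
    using that sub spC st by (cases "\<sigma> = \<tau>") auto
  have lb: "linear_between (stalk F'' \<sigma>) (stalk F'' \<rho>) (rr \<sigma> \<rho>)" if "\<sigma> \<in> \<Phi>" "\<rho> \<in> \<Phi>" "cone_face \<rho> \<sigma>" for \<sigma> \<rho>
  proof -
    note L = is_sheafD(3)[OF F that]
    note LD = linear_betweenD[OF L]
    consider "\<sigma> = \<rho>" | "\<sigma> \<noteq> \<rho>" "\<rho> = \<tau>" | "\<sigma> \<noteq> \<rho>" "\<rho> \<noteq> \<tau>" by blast
    then show ?thesis
    proof cases
      case 1
      then show ?thesis by (intro linear_betweenI) (simp_all add: rr_def)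
    next
      case 2
      show ?thesis
      proof (rule linear_betweenI)
        fix x y c assume x: "x \<in> stalk F'' \<sigma>"
        show "rr \<sigma> \<rho> x \<in> stalk F'' \<rho>" using 2 LD(1)[OF stsub[OF x]] Pin spC by (simp add: rr_def st)
        show "rr \<sigma> \<rho> (c *\<^sub>R x) = c *\<^sub>R rr \<sigma> \<rho> x"
          using 2 LD(3)[OF stsub[OF x]] by (simp add: rr_def linear_scale[OF P(1)])
        assume y: "y \<in> stalk F'' \<sigma>"
        show "rr \<sigma> \<rho> (x + y) = rr \<sigma> \<rho> x + rr \<sigma> \<rho> y"
          using 2 LD(2)[OF stsub[OF x] stsub[OF y]] by (simp add: rr_def linear_add[OF P(1)])
      qed
    next
      case 3
      show ?thesis
      proof (rule linear_betweenI)
        fix x y c assume x: "x \<in> stalk F'' \<sigma>"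
        show "rr \<sigma> \<rho> x \<in> stalk F'' \<rho>" using 3 LD(1)[OF stsub[OF x]] by (simp add: rr_def st)
        show "rr \<sigma> \<rho> (c *\<^sub>R x) = c *\<^sub>R rr \<sigma> \<rho> x"
          using 3 LD(3)[OF stsub[OF x]] by (simp add: rr_def)
        assume y: "y \<in> stalk F'' \<sigma>"
        show "rr \<sigma> \<rho> (x + y) = rr \<sigma> \<rho> x + rr \<sigma> \<rho> y"
          using 3 LD(2)[OF stsub[OF x] stsub[OF y]] by (simp add: rr_def)
      qed
    qed
  qed
  have ftrans: "cone_face \<upsilon> \<sigma>" if "cone_face \<upsilon> \<mu>" "cone_face \<mu> \<sigma>" for \<sigma> \<mu> \<upsilon> :: "'a set"
    using that face_of_trans by (auto simp: cone_face_def)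
  have rzero: "restr F \<sigma> \<upsilon> x = 0" if "\<sigma> \<in> \<Phi>" "\<upsilon> \<in> \<Phi>" "cone_face \<upsilon> \<sigma>" "stalk F \<upsilon> = {0}" "x \<in> stalk F \<sigma>" for \<sigma> \<upsilon> x
    using linear_betweenD(1)[OF is_sheafD(3)[OF F that(1-3)] that(5)] that(4) by simp
  have comp: "rr \<mu> \<upsilon> (rr \<sigma> \<mu> x) = rr \<sigma> \<upsilon> x"
    if \<Phi>: "\<sigma> \<in> \<Phi>" "\<mu> \<in> \<Phi>" "\<upsilon> \<in> \<Phi>" and fc: "cone_face \<mu> \<sigma>" "cone_face \<upsilon> \<mu>" and x: "x \<in> stalk F'' \<sigma>" for \<sigma> \<mu> \<upsilon> x
  proof -
    note xF = stsub[OF x]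
    note cF = is_sheafD(5)[OF F \<Phi> fc xF]
    consider "\<sigma> = \<mu> \<or> \<mu> = \<upsilon>" | "\<sigma> \<noteq> \<mu>" "\<mu> \<noteq> \<upsilon>" by blast
    then show ?thesis
    proof cases
      case 1
      then show ?thesis by (auto simp: rr_def)
    next
      case 2
      have ne: "\<sigma> \<noteq> \<upsilon>"
        using cone_face_antisym_rays[OF \<Phi>(1,2) fc(1)] cone_face_antisym_rays[OF \<Phi>(2,3) fc(2)] 2 by auto
      consider "\<upsilon> = \<tau>" | "\<upsilon> \<noteq> \<tau>" "\<mu> = \<tau>" | "\<upsilon> \<noteq> \<tau>" "\<mu> \<noteq> \<tau>" by blast
      then show ?thesis
      proof cases
        case 1
        then show ?thesis using 2 ne cF by (simp add: rr_def)
      next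
        case c2: 2
        \<comment> \<open>Minimality of \<tau> enters here: the projection applied at \<tau> has no
          further effect, since every restriction from \<tau> to a proper face is 0.\<close>
        have z: "stalk F \<upsilon> = {0}" using low[OF \<Phi>(3)] fc(2) c2 by simp
        have "P (restr F \<sigma> \<tau> x) \<in> stalk F \<tau>"
          using Pin sub spC linear_betweenD(1)[OF is_sheafD(3)[OF F \<Phi>(1,2) fc(1)] xF] c2 by blast
        then have "restr F \<tau> \<upsilon> (P (restr F \<sigma> \<tau> x)) = 0" using rzero[OF \<tau>(1) \<Phi>(3) _ z] fc(2) c2 by simp
        moreover have "restr F \<sigma> \<upsilon> x = 0" by (rule rzero[OF \<Phi>(1,3) ftrans[OF fc(2,1)] z xF])
        ultimately show ?thesis using 2 c2 ne by (simp add: rr_def)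
      next
        case 3
        then show ?thesis using 2 ne cF by (simp add: rr_def)
      qed
    qed
  qed
  have F''sheaf: "is_sheaf \<Phi> F''"
    unfolding is_sheaf_def
  proof (intro conjI ballI impI; (elim conjE)?)
    fix \<sigma> assume \<sigma>: "\<sigma> \<in> \<Phi>"
    show "subspace (stalk F'' \<sigma>)" using is_sheafD(1)[OF F \<sigma>] st by (cases "\<sigma> = \<tau>") (auto simp: subspace_span)
    show "\<exists>B. finite B \<and> stalk F'' \<sigma> = span B"
    proof (cases "\<sigma> = \<tau>")
      case True
      then show ?thesis using finC st(1) by (intro exI[of _ "C - {b}"]) simp
    next
      case False
      then show ?thesis using is_sheafD(2)[OF F \<sigma>] st(2) by simp
    qed
    show "restr F'' \<sigma> \<sigma> x = x" if "x \<in> stalk F'' \<sigma>" for x by (simp add: st rr_def)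
  next
    fix \<sigma> \<rho> assume "\<sigma> \<in> \<Phi>" "\<rho> \<in> \<Phi>" "cone_face \<rho> \<sigma>"
    then show "linear_between (stalk F'' \<sigma>) (stalk F'' \<rho>) (restr F'' \<sigma> \<rho>)" unfolding st(3) by (rule lb)
  next
    fix \<sigma> \<mu> \<upsilon> x assume "\<sigma> \<in> \<Phi>" "\<mu> \<in> \<Phi>" "\<upsilon> \<in> \<Phi>" "cone_face \<mu> \<sigma>" "cone_face \<upsilon> \<mu>" "x \<in> stalk F'' \<sigma>"
    then show "restr F'' \<mu> \<upsilon> (restr F'' \<sigma> \<mu> x) = restr F'' \<sigma> \<upsilon> x" unfolding st(3) by (rule comp)
  qed
  \<comment> \<open>An element of \<open>span {e0}\<close> has its coordinate at index 0.\<close>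
  define ii where "ii \<sigma> x = (if \<sigma> = \<tau> then x 0 *\<^sub>R b else 0)" for \<sigma> :: "'a set" and x :: "nat \<Rightarrow> real"
  define pp where "pp \<sigma> x = (if \<sigma> = \<tau> then P x else x)" for \<sigma> :: "'a set" and x
  have dst: "stalk (delta_sheaf \<tau>) \<sigma> = (if \<sigma> = \<tau> then span {e0} else {0})"
    "restr (delta_sheaf \<tau>) \<sigma> \<rho> x = (if \<sigma> = \<rho> then x else 0)" for \<sigma> \<rho> x
    by (simp_all add: delta_sheaf_def)
  have bspan: "c *\<^sub>R b \<in> stalk F \<tau>" for c unfolding spC using b by (intro span_scale span_base)
  have mi: "sheaf_morphism \<Phi> (delta_sheaf \<tau>) F ii"
    unfolding sheaf_morphism_def
  proof (intro conjI ballI impI)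
    fix \<sigma> assume \<sigma>: "\<sigma> \<in> \<Phi>"
    show "linear_between (stalk (delta_sheaf \<tau>) \<sigma>) (stalk F \<sigma>) (ii \<sigma>)"
      using bspan subspace_0[OF is_sheafD(1)[OF F \<sigma>]]
      by (intro linear_betweenI) (auto simp: ii_def scaleR_fun_app scaleR_left_distrib)
  next
    fix \<sigma> \<rho> x assume \<sigma>\<rho>: "\<sigma> \<in> \<Phi>" "\<rho> \<in> \<Phi>" "cone_face \<rho> \<sigma>" and x: "x \<in> stalk (delta_sheaf \<tau>) \<sigma>"
    have z: "restr F \<sigma> \<rho> 0 = 0" by (rule linear_between_zero[OF is_sheafD(3)[OF F \<sigma>\<rho>] is_sheafD(1)[OF F \<sigma>\<rho>(1)]])
    consider "\<sigma> = \<rho>" | "\<sigma> \<noteq> \<rho>" "\<sigma> = \<tau>" | "\<sigma> \<noteq> \<rho>" "\<sigma> \<noteq> \<tau>" by blast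
    then show "ii \<rho> (restr (delta_sheaf \<tau>) \<sigma> \<rho> x) = restr F \<sigma> \<rho> (ii \<sigma> x)"
    proof cases
      case 1
      have "ii \<sigma> x \<in> stalk F \<sigma>" using bspan subspace_0[OF is_sheafD(1)[OF F \<sigma>\<rho>(1)]] by (auto simp: ii_def)
      then show ?thesis using 1 is_sheafD(4)[OF F \<sigma>\<rho>(1)] by (simp add: dst)
    next
      case 2
      have "restr F \<tau> \<rho> (x 0 *\<^sub>R b) = 0" using rzero[OF _ _ _ low bspan] \<sigma>\<rho> 2 by simp
      then show ?thesis using 2 by (simp add: dst ii_def)
    next
      case 3
      then show ?thesis using z by (simp add: dst ii_def)
    qed
  qed
  have mp: "sheaf_morphism \<Phi> F F'' pp"
    unfolding sheaf_morphism_def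
  proof (intro conjI ballI impI)
    fix \<sigma> assume \<sigma>: "\<sigma> \<in> \<Phi>"
    show "linear_between (stalk F \<sigma>) (stalk F'' \<sigma>) (pp \<sigma>)"
      using Pin spC st by (intro linear_betweenI) (auto simp: pp_def linear_add[OF P(1)] linear_scale[OF P(1)])
  next
    fix \<sigma> \<rho> x assume \<sigma>\<rho>: "\<sigma> \<in> \<Phi>" "\<rho> \<in> \<Phi>" "cone_face \<rho> \<sigma>" and x: "x \<in> stalk F \<sigma>"
    consider "\<sigma> = \<rho>" | "\<sigma> \<noteq> \<rho>" "\<rho> = \<tau>" | "\<sigma> \<noteq> \<rho>" "\<sigma> = \<tau>" | "\<sigma> \<noteq> \<rho>" "\<rho> \<noteq> \<tau>" "\<sigma> \<noteq> \<tau>" by blast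
    then show "pp \<rho> (restr F \<sigma> \<rho> x) = restr F'' \<sigma> \<rho> (pp \<sigma> x)"
    proof cases
      case 1
      then show ?thesis using is_sheafD(4)[OF F \<sigma>\<rho>(1) x] by (simp add: st rr_def)
    next
      case 3
      have xC: "x \<in> span C" using x 3 spC by simp
      have "P x \<in> stalk F \<tau>" using Pin[OF xC] sub spC by blast
      then have "restr F \<tau> \<rho> (P x) = 0" "restr F \<tau> \<rho> x = 0" using rzero[OF _ _ _ low] \<sigma>\<rho> 3 x by simp_all
      then show ?thesis using 3 by (simp add: st rr_def pp_def)
    qed (simp_all add: st rr_def pp_def)
  qed
  have "short_exact \<Phi> (delta_sheaf \<tau>) F F''"
    unfolding short_exact_def
  proof (rule exI[of _ ii], rule exI[of _ pp], intro conjI ballI mi mp)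
    fix \<sigma> assume \<sigma>: "\<sigma> \<in> \<Phi>"
    show "inj_on (ii \<sigma>) (stalk (delta_sheaf \<tau>) \<sigma>)"
    proof (rule inj_onI)
      fix x y assume xy: "x \<in> stalk (delta_sheaf \<tau>) \<sigma>" "y \<in> stalk (delta_sheaf \<tau>) \<sigma>" "ii \<sigma> x = ii \<sigma> y"
      show "x = y"
      proof (cases "\<sigma> = \<tau>")
        case True
        then have "x 0 = y 0" using xy(3) b0 by (simp add: ii_def)
        moreover have "x = x 0 *\<^sub>R e0" "y = y 0 *\<^sub>R e0" using xy True by (auto simp: dst intro: span_e0_eq)
        ultimately show ?thesis by metis
      qed (use xy in \<open>simp add: dst\<close>)
    qed
    show "ii \<sigma> ` stalk (delta_sheaf \<tau>) \<sigma> = {x\<in>stalk F \<sigma>. pp \<sigma> x = 0}"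
    proof (cases "\<sigma> = \<tau>")
      case True
      have "ii \<tau> ` span {e0} = {x\<in>stalk F \<tau>. P x = 0}"
      proof (intro equalityI subsetI)
        fix y assume "y \<in> ii \<tau> ` span {e0}"
        then show "y \<in> {x\<in>stalk F \<tau>. P x = 0}"
          using bspan Pb by (auto simp: ii_def linear_scale[OF P(1)])
      next
        fix y assume y: "y \<in> {x\<in>stalk F \<tau>. P x = 0}"
        then have "y \<in> span {b}" using Pker[of y] spC by simp
        then obtain c where "y = c *\<^sub>R b" unfolding span_singleton by blast
        then have "y = ii \<tau> (c *\<^sub>R e0)" by (simp add: ii_def scaleR_fun_app)
        moreover have "c *\<^sub>R e0 \<in> span {e0}" by (intro span_scale span_base) simp
        ultimately show "y \<in> ii \<tau> ` span {e0}" by (rule image_eqI)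
      qed
      then show ?thesis using True by (simp add: dst pp_def)
    next
      case False
      then show ?thesis using subspace_0[OF is_sheafD(1)[OF F \<sigma>]] by (auto simp: dst ii_def pp_def)
    qed
    show "pp \<sigma> ` stalk F \<sigma> = stalk F'' \<sigma>"
    proof (cases "\<sigma> = \<tau>")
      case True
      have "P ` span C = span (C - {b})"
      proof (intro equalityI subsetI)
        fix y assume y: "y \<in> span (C - {b})"
        have "y = P y" using Pid[OF y] by simp
        moreover have "y \<in> span C" using y sub by blast
        ultimately show "y \<in> P ` span C" by (rule image_eqI)
      qed (use Pin in blast)
      then show ?thesis using True spC by (simp add: pp_def[abs_def] st)
    next
      case False
      then show ?thesis by (simp add: pp_def[abs_def] st)
    qed
  qed
  then show ?thesis using \<tau>(1) F''sheaf by blast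
qed

text \<open>Yields the relation \<open>[F] = [F] + [F]\<close>, by which additive functions vanish
  on zero sheaves.\<close>

lemma zero_sheaf_exact:
  assumes F: "is_sheaf \<Phi> F" and z: "\<And>\<sigma>. \<sigma> \<in> \<Phi> \<Longrightarrow> stalk F \<sigma> = {0}"
  shows "short_exact \<Phi> F F F"
proof -
  have rz: "restr F \<sigma> \<rho> x = 0" if "\<sigma> \<in> \<Phi>" "\<rho> \<in> \<Phi>" "cone_face \<rho> \<sigma>" "x \<in> stalk F \<sigma>" for \<sigma> \<rho> x
    using linear_betweenD(1)[OF is_sheafD(3)[OF F that(1-3)] that(4)] z that(2) by simp
  have "sheaf_morphism \<Phi> F F (\<lambda>_ x. 0)"
    unfolding sheaf_morphism_def linear_between_def using rz z by auto
  then show ?thesis unfolding short_exact_def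
    by (intro exI[of _ "\<lambda>_ x. 0"] conjI) (auto simp: z)
qed

text \<open>Induction on the total dimension of the stalks, splitting off one simple sheaf at a
  time.\<close>

lemma K_additive_sheaf:
  fixes h :: "('a ksheaf \<Rightarrow>\<^sub>0 int) set \<Rightarrow> 'b::real_vector"
  assumes h: "K_additive h" and F: "is_sheaf \<Phi> F"
  shows "h (K_cls F) = (\<Sum>\<tau>\<in>\<Phi>. of_nat (dim (stalk F \<tau>)) *\<^sub>R h (K_cls (delta_sheaf \<tau>)))"
  using F
proof (induction "\<Sum>\<sigma>\<in>\<Phi>. dim (stalk F \<sigma>)" arbitrary: F rule: less_induct)
  case (less F)
  have hadd: "h (K_cls G) = h (K_cls G') + h (K_cls G'')"
    if "is_sheaf \<Phi> G'" "is_sheaf \<Phi> G" "is_sheaf \<Phi> G''" "short_exact \<Phi> G' G G''" for G' G G''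
    using K_cls_exact[OF that] h K_cls_carrier that unfolding K_additive_def by metis
  show ?case
  proof (cases "(\<Sum>\<sigma>\<in>\<Phi>. dim (stalk F \<sigma>)) > 0")
    case False
    then have d0: "dim (stalk F \<sigma>) = 0" if "\<sigma> \<in> \<Phi>" for \<sigma> using that finite_fan by simp
    have "stalk F \<sigma> = {0}" if "\<sigma> \<in> \<Phi>" for \<sigma>
      using dim_zero_trivial d0[OF that] is_sheafD(1,2)[OF less.prems that] by metis
    then have "h (K_cls F) = h (K_cls F) + h (K_cls F)"
      by (intro hadd less.prems zero_sheaf_exact)
    then have "h (K_cls F) = 0" by simp
    then show ?thesis using d0 by (simp add: sum.neutral)
  next
    case True
    then obtain \<tau> F'' where \<tau>: "\<tau> \<in> \<Phi>" and F'': "is_sheaf \<Phi> F''" and ex: "short_exact \<Phi> (delta_sheaf \<tau>) F F''"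
      using sheaf_split[OF less.prems] by blast
    have dims: "dim (stalk F \<sigma>) = (if \<sigma> = \<tau> then 1 else 0) + dim (stalk F'' \<sigma>)" if "\<sigma> \<in> \<Phi>" for \<sigma>
      using short_exact_dim[OF delta_sheaf less.prems ex that] by (simp add: delta_sheaf_def dim_span_e0[simplified] dim_zero_space)
    have "(\<Sum>\<sigma>\<in>\<Phi>. dim (stalk F \<sigma>)) = (\<Sum>\<sigma>\<in>\<Phi>. (if \<sigma> = \<tau> then 1 else 0) + dim (stalk F'' \<sigma>))"
      by (rule sum.cong[OF refl dims])
    also have "\<dots> = 1 + (\<Sum>\<sigma>\<in>\<Phi>. dim (stalk F'' \<sigma>))" using finite_fan \<tau> by (simp add: sum.distrib)
    finally have IH: "h (K_cls F'') = (\<Sum>\<tau>\<in>\<Phi>. of_nat (dim (stalk F'' \<tau>)) *\<^sub>R h (K_cls (delta_sheaf \<tau>)))"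
      by (intro less.hyps F'') simp
    have "h (K_cls F) = h (K_cls (delta_sheaf \<tau>)) + h (K_cls F'')"
      by (rule hadd[OF delta_sheaf less.prems F'' ex])
    also have "\<dots> = (\<Sum>\<sigma>\<in>\<Phi>. (if \<sigma> = \<tau> then h (K_cls (delta_sheaf \<sigma>)) else 0) + of_nat (dim (stalk F'' \<sigma>)) *\<^sub>R h (K_cls (delta_sheaf \<sigma>)))"
      using finite_fan \<tau> by (simp add: IH sum.distrib)
    also have "\<dots> = (\<Sum>\<sigma>\<in>\<Phi>. of_nat (dim (stalk F \<sigma>)) *\<^sub>R h (K_cls (delta_sheaf \<sigma>)))"
      by (intro sum.cong[OF refl]) (simp add: dims scaleR_left_distrib)
    finally show ?thesis .
  qed
qed

text \<open>The difference of the two sides is additive and vanishes on the classes of sheaves,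
  which generate the group.\<close>

lemma K_additive_expand:
  fixes h :: "('a ksheaf \<Rightarrow>\<^sub>0 int) set \<Rightarrow> 'b::real_vector"
  assumes h: "K_additive h" and \<gamma>: "\<gamma> \<in> carrier KG"
  shows "h \<gamma> = (\<Sum>\<tau>\<in>\<Phi>. of_int (K_delta \<tau> \<gamma>) *\<^sub>R h (K_cls (delta_sheaf \<tau>)))"
proof -
  define g where "g x = h x - (\<Sum>\<tau>\<in>\<Phi>. of_int (K_delta \<tau> x) *\<^sub>R h (K_cls (delta_sheaf \<tau>)))" for x
  have gadd: "g (x \<otimes>\<^bsub>KG\<^esub> y) = g x + g y" if "x \<in> carrier KG" "y \<in> carrier KG" for x y
  proof -
    have "(\<Sum>\<tau>\<in>\<Phi>. of_int (K_delta \<tau> (x \<otimes>\<^bsub>KG\<^esub> y)) *\<^sub>R h (K_cls (delta_sheaf \<tau>))) =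
      (\<Sum>\<tau>\<in>\<Phi>. of_int (K_delta \<tau> x) *\<^sub>R h (K_cls (delta_sheaf \<tau>)) + of_int (K_delta \<tau> y) *\<^sub>R h (K_cls (delta_sheaf \<tau>)))"
      by (intro sum.cong[OF refl]) (simp add: K_delta_add[OF _ that] scaleR_left_distrib)
    then show ?thesis using h that by (simp add: g_def K_additive_def sum.distrib)
  qed
  have gdiff: "g (KR #>\<^bsub>KF\<^esub> (x - y)) = g (KR #>\<^bsub>KF\<^esub> x) - g (KR #>\<^bsub>KF\<^esub> y)" if "x \<in> carrier KF" "y \<in> carrier KF" for x y
  proof -
    have "g (KR #>\<^bsub>KF\<^esub> x) = g ((KR #>\<^bsub>KF\<^esub> (x - y)) \<otimes>\<^bsub>KG\<^esub> (KR #>\<^bsub>KF\<^esub> y))"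
      by (simp add: K_mult[OF diff_KF[OF that] that(2)])
    also have "\<dots> = g (KR #>\<^bsub>KF\<^esub> (x - y)) + g (KR #>\<^bsub>KF\<^esub> y)"
      by (intro gadd K_carrierI diff_KF that)
    finally show ?thesis by simp
  qed
  obtain x where x: "x \<in> carrier KF" "\<gamma> = KR #>\<^bsub>KF\<^esub> x" using K_carrierE[OF \<gamma>] .
  have "Poly_Mapping.keys x \<subseteq> {F. is_sheaf \<Phi> F}" using x(1) carrier_KF by simp
  then have "g (KR #>\<^bsub>KF\<^esub> x) = 0"
  proof (rule free_Abelian_group_induct[where P = "\<lambda>x. g (KR #>\<^bsub>KF\<^esub> x) = 0"])
    have "0 \<in> carrier KF" by (simp add: carrier_KF)
    from gdiff[OF this this] show "g (KR #>\<^bsub>KF\<^esub> 0) = 0" by simp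
  next
    fix x y :: "'a ksheaf \<Rightarrow>\<^sub>0 int"
    assume "Poly_Mapping.keys x \<subseteq> {F. is_sheaf \<Phi> F}" "Poly_Mapping.keys y \<subseteq> {F. is_sheaf \<Phi> F}"
      "g (KR #>\<^bsub>KF\<^esub> x) = 0" "g (KR #>\<^bsub>KF\<^esub> y) = 0"
    then show "g (KR #>\<^bsub>KF\<^esub> (x - y)) = 0" using gdiff[of x y] by (simp add: carrier_KF)
  next
    fix F :: "'a ksheaf" assume "F \<in> {F. is_sheaf \<Phi> F}"
    then have F: "is_sheaf \<Phi> F" by simp
    have "(\<Sum>\<tau>\<in>\<Phi>. of_int (K_delta \<tau> (K_cls F)) *\<^sub>R h (K_cls (delta_sheaf \<tau>))) =
      (\<Sum>\<tau>\<in>\<Phi>. of_nat (dim (stalk F \<tau>)) *\<^sub>R h (K_cls (delta_sheaf \<tau>)))"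
      by (intro sum.cong[OF refl]) (simp add: K_delta(2)[OF _ F])
    then have "g (K_cls F) = 0" using K_additive_sheaf[OF h F] by (simp add: g_def)
    then show "g (KR #>\<^bsub>KF\<^esub> frag_of F) = 0" by (simp add: K_cls_def)
  qed
  then show ?thesis by (simp add: g_def x(2))
qed

text \<open>The chosen copy of \<open>F\<close> is known only up to isomorphism; it has the stalk
  dimensions of \<open>F\<close>, and these determine the value of every additive function.\<close>

lemma K_class_eq:
  fixes F :: "('a, 'u::real_vector) fan_sheaf"
  assumes ex: "\<exists>G :: 'a ksheaf. is_sheaf \<Phi> G \<and> sheaf_isomorphic \<Phi> F G"
    and fin: "\<And>\<sigma>. \<sigma> \<in> \<Phi> \<Longrightarrow> subspace (stalk F \<sigma>) \<and> (\<exists>B. finite B \<and> stalk F \<sigma> = span B)"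
  obtains G where "is_sheaf \<Phi> G" "K_class \<Phi> F = K_cls G" "\<forall>\<sigma>\<in>\<Phi>. dim (stalk G \<sigma>) = dim (stalk F \<sigma>)"
proof -
  define G :: "'a ksheaf" where "G = (SOME G. is_sheaf \<Phi> G \<and> sheaf_isomorphic \<Phi> F G)"
  have G: "is_sheaf \<Phi> G" "sheaf_isomorphic \<Phi> F G" using someI_ex[OF ex] by (simp_all add: G_def)
  obtain m where m: "sheaf_morphism \<Phi> F G m" "\<forall>\<sigma>\<in>\<Phi>. bij_betw (m \<sigma>) (stalk F \<sigma>) (stalk G \<sigma>)"
    using G(2) unfolding sheaf_isomorphic_def by blast
  have "dim (stalk G \<sigma>) = dim (stalk F \<sigma>)" if \<sigma>: "\<sigma> \<in> \<Phi>" for \<sigma>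
  proof -
    obtain B where B: "finite B" "stalk F \<sigma> = span B" using fin[OF \<sigma>] by blast
    have "linear_between (stalk F \<sigma>) (stalk G \<sigma>) (m \<sigma>)" using m(1) \<sigma> by (simp add: sheaf_morphism_def)
    then show ?thesis by (rule dim_bij_between) (use B fin[OF \<sigma>] m(2) \<sigma> in auto)
  qed
  moreover have "K_class \<Phi> F = K_cls G" by (simp add: K_class_def K_cls_def G_def)
  ultimately show ?thesis by (intro that[OF G(1)]) simp_all
qed

lemma K_class_additive:
  fixes F :: "('a, 'u::real_vector) fan_sheaf" and h :: "('a ksheaf \<Rightarrow>\<^sub>0 int) set \<Rightarrow> 'b::real_vector"
  assumes "\<exists>G :: 'a ksheaf. is_sheaf \<Phi> G \<and> sheaf_isomorphic \<Phi> F G"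
    "\<And>\<sigma>. \<sigma> \<in> \<Phi> \<Longrightarrow> subspace (stalk F \<sigma>) \<and> (\<exists>B. finite B \<and> stalk F \<sigma> = span B)"
    and h: "K_additive h"
  shows "h (K_class \<Phi> F) = (\<Sum>\<tau>\<in>\<Phi>. of_nat (dim (stalk F \<tau>)) *\<^sub>R h (K_cls (delta_sheaf \<tau>)))"
proof -
  obtain G where G: "is_sheaf \<Phi> G" "K_class \<Phi> F = K_cls G" "\<forall>\<sigma>\<in>\<Phi>. dim (stalk G \<sigma>) = dim (stalk F \<sigma>)"
    by (rule K_class_eq[OF assms(1,2)])
  show ?thesis unfolding G(2) K_additive_sheaf[OF h G(1)] by (intro sum.cong[OF refl]) (simp add: G(3))
qed

lemma sheaf_isomorphic_refl: "is_sheaf \<Phi> F \<Longrightarrow> sheaf_isomorphic \<Phi> F F"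
  unfolding sheaf_isomorphic_def sheaf_morphism_def
  by (rule exI[of _ "\<lambda>_ x. x"]) (auto simp: linear_between_def bij_betw_def)

end

section \<open>Euler characteristic and the sheaves \<open>\<O>(\<sigma>)\<close>\<close>

context unimodular_complete_fan
begin

text \<open>The index \<open>i\<close> is the codimension of the cone; \<open>card_rays_le\<close>
  guarantees that it can be recovered from the truncated difference.\<close>

lemma sheaf_euler_eq:
  "sheaf_euler n \<Phi> F = (\<Sum>\<tau>\<in>\<Phi>. (-1) ^ (n - card (cone_rays \<tau>)) * int (dim (stalk F \<tau>)))"
proof -
  have "sheaf_euler n \<Phi> F = (\<Sum>i\<le>n. \<Sum>\<sigma>\<in>\<Phi>. if dim \<sigma> = n - i then (-1) ^ i * int (dim (stalk F \<sigma>)) else 0)"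
    unfolding sheaf_euler_def sum_distrib_left
    by (intro sum.cong[OF refl] sum.mono_neutral_cong_left finite_fan) (auto simp: cones_of_dim_def)
  also have "\<dots> = (\<Sum>\<sigma>\<in>\<Phi>. \<Sum>i\<le>n. if dim \<sigma> = n - i then (-1) ^ i * int (dim (stalk F \<sigma>)) else 0)"
    by (rule sum.swap)
  also have "\<dots> = (\<Sum>\<tau>\<in>\<Phi>. (-1) ^ (n - card (cone_rays \<tau>)) * int (dim (stalk F \<tau>)))"
  proof (rule sum.cong[OF refl])
    fix \<sigma> assume \<sigma>: "\<sigma> \<in> \<Phi>"
    have "(\<Sum>i\<le>n. if dim \<sigma> = n - i then (-1) ^ i * int (dim (stalk F \<sigma>)) else 0) =
      (\<Sum>i\<le>n. if i = n - card (cone_rays \<sigma>) then (-1) ^ i * int (dim (stalk F \<sigma>)) else 0)"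
      using card_rays_le[OF \<sigma>] dim_eq_card_rays[OF \<sigma>] by (intro sum.cong[OF refl]) auto
    then show "(\<Sum>i\<le>n. if dim \<sigma> = n - i then (-1) ^ i * int (dim (stalk F \<sigma>)) else 0) =
      (-1) ^ (n - card (cone_rays \<sigma>)) * int (dim (stalk F \<sigma>))" by simp
  qed
  finally show ?thesis .
qed

lemma sum_delta_sheaf:
  fixes f :: "'a set \<Rightarrow> 'b::real_vector"
  assumes "\<tau> \<in> \<Phi>"
  shows "(\<Sum>\<sigma>\<in>\<Phi>. of_nat (dim (stalk (delta_sheaf \<tau>) \<sigma>)) *\<^sub>R f \<sigma>) = f \<tau>"
proof -
  have "(\<Sum>\<sigma>\<in>\<Phi>. of_nat (dim (stalk (delta_sheaf \<tau>) \<sigma>)) *\<^sub>R f \<sigma>) = (\<Sum>\<sigma>\<in>\<Phi>. if \<sigma> = \<tau> then f \<sigma> else 0)"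
    by (intro sum.cong[OF refl]) (simp add: delta_sheaf_def dim_span_e0[simplified] dim_zero_space)
  then show ?thesis using assms finite_fan by simp
qed

lemma K_class_sheaf_ex: "is_sheaf \<Phi> (F :: 'a ksheaf) \<Longrightarrow> \<exists>G :: 'a ksheaf. is_sheaf \<Phi> G \<and> sheaf_isomorphic \<Phi> F G"
  using sheaf_isomorphic_refl by blast

lemma K_class_delta:
  fixes h :: "('a ksheaf \<Rightarrow>\<^sub>0 int) set \<Rightarrow> 'b::real_vector"
  assumes "K_additive h" "\<tau> \<in> \<Phi>"
  shows "h (K_class \<Phi> (delta_sheaf \<tau>)) = h (K_cls (delta_sheaf \<tau>))"
  using K_class_additive[OF K_class_sheaf_ex[OF delta_sheaf] _ assms(1), of \<tau>] is_sheafD(1,2)[OF delta_sheaf]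
    sum_delta_sheaf[OF assms(2)] by simp

text \<open>The combination \<open>h0\<close> of the multiplicities shows that a function as
  required exists. The chosen one is additive with known values on the simple sheaves, hence given
  by the same combination.\<close>

lemma K_euler_eq:
  assumes \<gamma>: "\<gamma> \<in> carrier KG"
  shows "real_of_int (K_euler \<Lambda> \<Phi> \<gamma>) = (\<Sum>\<tau>\<in>\<Phi>. of_int (K_delta \<tau> \<gamma>) * (-1) ^ (n - card (cone_rays \<tau>)))"
proof -
  let ?P = "\<lambda>h. h \<in> hom KG integer_group \<and> (\<forall>F :: 'a ksheaf. is_sheaf \<Phi> F \<longrightarrow> h (K_class \<Phi> F) = sheaf_euler n \<Phi> F)"
  define h0 where "h0 x = (\<Sum>\<tau>\<in>\<Phi>. (-1) ^ (n - card (cone_rays \<tau>)) * K_delta \<tau> x)" for x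
  have "h0 \<in> hom KG integer_group"
  proof (rule homI)
    fix x y assume "x \<in> carrier KG" "y \<in> carrier KG"
    then show "h0 (x \<otimes>\<^bsub>KG\<^esub> y) = h0 x \<otimes>\<^bsub>integer_group\<^esub> h0 y"
      by (simp add: h0_def K_delta_add distrib_left sum.distrib)
  qed simp
  moreover have "h0 (K_class \<Phi> F) = sheaf_euler n \<Phi> F" if F: "is_sheaf \<Phi> F" for F :: "'a ksheaf"
  proof -
    obtain G where G: "is_sheaf \<Phi> G" "K_class \<Phi> F = K_cls G" "\<forall>\<sigma>\<in>\<Phi>. dim (stalk G \<sigma>) = dim (stalk F \<sigma>)"
      by (rule K_class_eq[OF K_class_sheaf_ex[OF F]]) (use is_sheafD(1,2)[OF F] in auto)
    show ?thesis unfolding h0_def G(2) sheaf_euler_eq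
      by (intro sum.cong[OF refl]) (simp add: K_delta(2)[OF _ G(1)] G(3))
  qed
  ultimately have "?P h0" by blast
  then have E: "?P (K_euler \<Lambda> \<Phi>)" unfolding K_euler_def by (rule someI[of ?P])
  have add: "K_additive (\<lambda>x. real_of_int (K_euler \<Lambda> \<Phi> x))"
    unfolding K_additive_def using hom_mult[OF conjunct1[OF E]] by simp
  have "real_of_int (K_euler \<Lambda> \<Phi> (K_cls (delta_sheaf \<tau>))) = (-1) ^ (n - card (cone_rays \<tau>))" if \<tau>: "\<tau> \<in> \<Phi>" for \<tau>
  proof -
    have "sheaf_euler n \<Phi> (delta_sheaf \<tau>) = (\<Sum>\<sigma>\<in>\<Phi>. if \<sigma> = \<tau> then (-1) ^ (n - card (cone_rays \<sigma>)) else 0)"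
      unfolding sheaf_euler_eq
      by (intro sum.cong[OF refl]) (simp add: delta_sheaf_def dim_span_e0[simplified] dim_zero_space)
    then have "sheaf_euler n \<Phi> (delta_sheaf \<tau>) = (-1) ^ (n - card (cone_rays \<tau>))" using \<tau> finite_fan by simp
    then have "K_euler \<Lambda> \<Phi> (K_class \<Phi> (delta_sheaf \<tau>)) = (-1) ^ (n - card (cone_rays \<tau>))"
      using E delta_sheaf by simp
    then show ?thesis using K_class_delta[OF add \<tau>] by simp
  qed
  then show ?thesis using K_additive_expand[OF add \<gamma>] by simp
qed

section \<open>The stalks of the sheaves \<O>(\<sigma>)\<close>

text \<open>The functional on \<open>span \<rho>\<close> with value 1 at \<open>v \<rho>\<close>,
  extended by zero as \<open>dual_space\<close> requires. The inner product merely gives a formula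
  for it.\<close>

definition theta :: "'a set \<Rightarrow> 'a \<Rightarrow> real"
  where "theta \<rho> x = (if x \<in> span \<rho> then (x \<bullet> v \<rho>) / (v \<rho> \<bullet> v \<rho>) else 0)"

lemma span_ray: "\<rho> \<in> R \<Longrightarrow> span \<rho> = span {v \<rho>}"
proof
  assume \<rho>: "\<rho> \<in> R"
  have "\<rho> \<subseteq> span {v \<rho>}"
  proof
    fix x assume "x \<in> \<rho>"
    then have "x \<in> {c *\<^sub>R v \<rho> | c. c \<ge> 0}" by (rule subsetD[OF equalityD1[OF primitive_vector_ray(4)[OF \<rho>]]])
    then show "x \<in> span {v \<rho>}" by (elim CollectE exE conjE) (simp add: span_scale span_base)
  qed
  then show "span \<rho> \<subseteq> span {v \<rho>}" by (rule span_minimal[OF _ subspace_span])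
  show "span {v \<rho>} \<subseteq> span \<rho>" using primitive_vector_ray(1)[OF \<rho>] by (intro span_mono) simp
qed

lemma theta_v: "\<rho> \<in> R \<Longrightarrow> theta \<rho> (v \<rho>) = 1"
  using primitive_vector_ray(1,3) by (simp add: theta_def span_base)

lemma dual_space_ray: "\<rho> \<in> R \<Longrightarrow> f \<in> dual_space (span \<rho>) \<longleftrightarrow> (\<exists>c. f = c *\<^sub>R theta \<rho>)"
proof
  assume \<rho>: "\<rho> \<in> R" and f: "f \<in> dual_space (span \<rho>)"
  have "f = f (v \<rho>) *\<^sub>R theta \<rho>"
  proof
    fix x
    show "f x = (f (v \<rho>) *\<^sub>R theta \<rho>) x"
    proof (cases "x \<in> span \<rho>")
      case True
      then obtain c where c: "x = c *\<^sub>R v \<rho>" using span_ray[OF \<rho>] unfolding span_singleton by auto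
      have "f (c *\<^sub>R v \<rho>) = c *\<^sub>R f (v \<rho>)"
        using f span_base[OF primitive_vector_ray(1)[OF \<rho>]] by (simp add: dual_space_def linear_between_def)
      moreover have "theta \<rho> x = c" using True primitive_vector_ray(3)[OF \<rho>] by (simp add: theta_def c)
      ultimately show ?thesis by (simp add: c scaleR_fun_app)
    next
      case False
      then show ?thesis using f by (simp add: dual_space_def theta_def scaleR_fun_app)
    qed
  qed
  then show "\<exists>c. f = c *\<^sub>R theta \<rho>" by blast
next
  assume "\<exists>c. f = c *\<^sub>R theta \<rho>"
  then obtain c where "f = c *\<^sub>R theta \<rho>" ..
  then show "f \<in> dual_space (span \<rho>)"
    by (auto simp: dual_space_def linear_between_def theta_def scaleR_fun_app span_add span_scale inner_left_distrib
      add_divide_distrib algebra_simps)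
qed

lemma ray_mem_star:
  assumes "\<rho> \<in> R" "\<tau> \<in> \<Phi>" shows "\<tau> \<in> star \<Phi> \<rho> \<longleftrightarrow> \<rho> \<in> cone_rays \<tau>"
  using assms by (simp add: star_def cone_rays_def cones_of_dim_def)

text \<open>On the star the projection is the identity and its kernel is 0; off the star it is 0 and
  its kernel is the whole dual line.\<close>

lemma stalk_ray_sheaf:
  assumes "\<rho> \<in> R" "\<tau> \<in> \<Phi>"
  shows "f \<in> stalk (ray_sheaf \<Phi> \<rho>) \<tau> \<longleftrightarrow> (if \<rho> \<in> cone_rays \<tau> then f = 0 else (\<exists>c. f = c *\<^sub>R theta \<rho>))"
proof -
  have "\<exists>c. 0 = c *\<^sub>R theta \<rho>" by (rule exI[of _ 0]) simp
  then show ?thesis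
    unfolding ray_sheaf_def kernel_sheaf_def const_sheaf_def const_sheaf_proj_def
    by (auto simp: ray_mem_star[OF assms] dual_space_ray[OF assms(1)] zero_fun_def)
qed

lemma restr_ray_sheaf: "restr (ray_sheaf \<Phi> \<rho>) \<sigma> \<tau> x = x"
  by (simp add: ray_sheaf_def kernel_sheaf_def const_sheaf_def)

definition tens :: "'a set \<Rightarrow> ('a set \<Rightarrow> 'a) \<Rightarrow> real"
  where "tens \<sigma> = pure_tensor (cone_rays \<sigma>) theta"

text \<open>Tensors are functions of families of vectors indexed by rays. Evaluation at the family
  of primitive vectors shows that \<open>tens \<sigma>\<close> is nonzero and serves as a coordinate
  on its line.\<close>

lemma tens_v: "\<sigma> \<in> \<Phi> \<Longrightarrow> tens \<sigma> v = 1"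
  using cone_rays_subset by (simp add: tens_def pure_tensor_def theta_v subset_iff)

text \<open>If \<sigma> and \<tau> have no common ray, every factor is a line and pure tensors are
  multiples of \<open>tens \<sigma>\<close>; a common ray makes one factor, and so every pure
  tensor, zero.\<close>

lemma stalk_cone_sheaf:
  assumes \<sigma>: "\<sigma> \<in> \<Phi>" and \<tau>: "\<tau> \<in> \<Phi>"
  shows "stalk (cone_sheaf \<Phi> \<sigma>) \<tau> = (if cone_rays \<sigma> \<inter> cone_rays \<tau> = {} then span {tens \<sigma>} else {0})"
proof -
  let ?G = "{pure_tensor (cone_rays \<sigma>) e | e. \<forall>i\<in>cone_rays \<sigma>. e i \<in> stalk (ray_sheaf \<Phi> i) \<tau>}"
  have st: "stalk (cone_sheaf \<Phi> \<sigma>) \<tau> = span ?G" by (simp add: cone_sheaf_def tensor_sheaf_def)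
  have mem: "f \<in> stalk (ray_sheaf \<Phi> i) \<tau> \<longleftrightarrow> (if i \<in> cone_rays \<tau> then f = 0 else (\<exists>c. f = c *\<^sub>R theta i))"
    if "i \<in> cone_rays \<sigma>" for f i
    using that cone_rays_subset[OF \<sigma>] by (intro stalk_ray_sheaf \<tau>) blast
  show ?thesis
  proof (cases "cone_rays \<sigma> \<inter> cone_rays \<tau> = {}")
    case True
    have "tens \<sigma> \<in> ?G"
    proof -
      have "\<forall>i\<in>cone_rays \<sigma>. theta i \<in> stalk (ray_sheaf \<Phi> i) \<tau>"
      proof
        fix i assume i: "i \<in> cone_rays \<sigma>"
        have "\<exists>c. theta i = c *\<^sub>R theta i" by (rule exI[of _ 1]) simp
        moreover have "i \<notin> cone_rays \<tau>" using True i by blast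
        ultimately show "theta i \<in> stalk (ray_sheaf \<Phi> i) \<tau>" using mem[OF i, of "theta i"] by simp
      qed
      then show ?thesis unfolding tens_def by blast
    qed
    moreover have "?G \<subseteq> span {tens \<sigma>}"
    proof
      fix g assume "g \<in> ?G"
      then obtain e where e: "g = pure_tensor (cone_rays \<sigma>) e" "\<forall>i\<in>cone_rays \<sigma>. e i \<in> stalk (ray_sheaf \<Phi> i) \<tau>" by blast
      have "\<forall>i\<in>cone_rays \<sigma>. \<exists>c. e i = c *\<^sub>R theta i"
      proof
        fix i assume i: "i \<in> cone_rays \<sigma>"
        then have "i \<notin> cone_rays \<tau>" using True by blast
        then show "\<exists>c. e i = c *\<^sub>R theta i" using bspec[OF e(2) i] mem[OF i, of "e i"] by simp
      qed
      then obtain c where c: "\<forall>i\<in>cone_rays \<sigma>. e i = c i *\<^sub>R theta i" by metis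
      have "g = (\<Prod>i\<in>cone_rays \<sigma>. c i) *\<^sub>R tens \<sigma>"
        unfolding e(1) tens_def pure_tensor_def using c
        by (auto simp: fun_eq_iff scaleR_fun_app prod.distrib[symmetric] intro: prod.cong)
      then show "g \<in> span {tens \<sigma>}" by (simp add: span_scale span_base)
    qed
    ultimately have "span ?G = span {tens \<sigma>}"
      by (intro equalityI span_minimal[OF _ subspace_span] span_mono) (auto intro: span_base)
    then show ?thesis using True st by simp
  next
    case False
    then obtain j where j: "j \<in> cone_rays \<sigma>" "j \<in> cone_rays \<tau>" by blast
    have "g = 0" if g: "g \<in> ?G" for g
    proof -
      from g obtain e where e: "g = pure_tensor (cone_rays \<sigma>) e" "\<forall>i\<in>cone_rays \<sigma>. e i \<in> stalk (ray_sheaf \<Phi> i) \<tau>" by blast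
      have "e j = 0" using bspec[OF e(2) j(1)] mem[OF j(1), of "e j"] j(2) by simp
      then have "(\<Prod>i\<in>cone_rays \<sigma>. e i (x i)) = 0" for x
        using \<sigma> by (intro prod_zero bexI[of _ j] j(1)) simp_all
      then show ?thesis by (simp add: e(1) pure_tensor_def fun_eq_iff)
    qed
    then have "?G \<subseteq> {0}" by blast
    then have "span ?G \<subseteq> {0}" using span_minimal[of ?G "{0}"] subspace_single_0 by blast
    then show ?thesis using False st span_0[of ?G] by auto
  qed
qed

text \<open>The identity meets the requirements on the chosen restriction map, and these fix its
  values on the generators of the stalk.\<close>

lemma restr_cone_sheaf:
  assumes \<sigma>: "\<sigma> \<in> \<Phi>" and x: "x \<in> stalk (cone_sheaf \<Phi> \<sigma>) \<mu>"
  shows "restr (cone_sheaf \<Phi> \<sigma>) \<mu> \<tau> x = x"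
proof -
  let ?G = "{pure_tensor (cone_rays \<sigma>) e | e. \<forall>i\<in>cone_rays \<sigma>. e i \<in> stalk (ray_sheaf \<Phi> i) \<mu>}"
  let ?P = "\<lambda>h :: (('a set \<Rightarrow> 'a) \<Rightarrow> real) \<Rightarrow> (('a set \<Rightarrow> 'a) \<Rightarrow> real). linear h \<and>
    (\<forall>e. (\<forall>i\<in>cone_rays \<sigma>. e i \<in> stalk (ray_sheaf \<Phi> i) \<mu>) \<longrightarrow>
         h (pure_tensor (cone_rays \<sigma>) e) = pure_tensor (cone_rays \<sigma>) (\<lambda>i. restr (ray_sheaf \<Phi> i) \<mu> \<tau> (e i)))"
  define h where "h = restr (cone_sheaf \<Phi> \<sigma>) \<mu> \<tau>"
  have "?P (\<lambda>x. x)" using linear_id by (simp add: restr_ray_sheaf id_def)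
  then have "?P h" unfolding h_def cone_sheaf_def tensor_sheaf_def fan_sheaf.simps by (rule someI[of ?P])
  then have lin: "linear h" and gen: "\<And>g. g \<in> ?G \<Longrightarrow> h g = g" by (auto simp: restr_ray_sheaf)
  have "x \<in> span ?G" using x by (simp add: cone_sheaf_def tensor_sheaf_def)
  then have "h x = x" using linear_eq_on[OF lin linear_id _ , of x ?G] gen by simp
  then show ?thesis by (simp add: h_def)
qed

text \<open>Evaluation at the family \<open>v\<close> carries each nonzero stalk to the line of
  \<open>e0\<close>. It commutes with restriction because all restriction maps are identities;
  passing to a face preserves the absence of common rays.\<close>

lemma cone_sheaf_iso_exists:
  assumes \<sigma>: "\<sigma> \<in> \<Phi>"
  shows "\<exists>G :: 'a ksheaf. is_sheaf \<Phi> G \<and> sheaf_isomorphic \<Phi> (cone_sheaf \<Phi> \<sigma>) G"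
proof -
  define D where "D \<tau> \<longleftrightarrow> cone_rays \<sigma> \<inter> cone_rays \<tau> = {}" for \<tau> :: "'a set"
  have Dface: "D \<tau>" if "\<mu> \<in> \<Phi>" "cone_face \<tau> \<mu>" "D \<mu>" for \<mu> \<tau>
    using face_rays_subset[OF that(1,2)] that(3) by (auto simp: D_def)
  define G :: "'a ksheaf" where "G = \<lparr>stalk = (\<lambda>\<tau>. if D \<tau> then span {e0} else {0}), restr = (\<lambda>_ _ x. x)\<rparr>"
  have Gst: "stalk G \<tau> = (if D \<tau> then span {e0} else {0})" "restr G \<mu> \<tau> = (\<lambda>x. x)" for \<tau> \<mu> by (simp_all add: G_def)
  have sheaf: "is_sheaf \<Phi> G"
    unfolding is_sheaf_def
  proof (intro conjI ballI impI; (elim conjE)?)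
    fix \<tau>
    show "subspace (stalk G \<tau>)" by (simp add: Gst subspace_span subspace_single_0)
    show "\<exists>B. finite B \<and> stalk G \<tau> = span B"
    proof (cases "D \<tau>")
      case True then show ?thesis by (intro exI[of _ "{e0}"]) (simp add: Gst)
    next
      case False then show ?thesis by (intro exI[of _ "{}"]) (simp add: Gst)
    qed
  next
    fix \<mu> \<tau> assume "\<mu> \<in> \<Phi>" "\<tau> \<in> \<Phi>" "cone_face \<tau> \<mu>"
    then have "D \<mu> \<Longrightarrow> D \<tau>" using Dface by blast
    then show "linear_between (stalk G \<mu>) (stalk G \<tau>) (restr G \<mu> \<tau>)"
      by (intro linear_betweenI) (auto simp: Gst span_0 split: if_splits)
  qed (simp_all add: Gst)
  define m where "m = (\<lambda>(\<tau> :: 'a set) (f :: ('a set \<Rightarrow> 'a) \<Rightarrow> real). f v *\<^sub>R e0)"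
  have stc: "stalk (cone_sheaf \<Phi> \<sigma>) \<tau> = (if D \<tau> then span {tens \<sigma>} else {0})" if "\<tau> \<in> \<Phi>" for \<tau>
    using stalk_cone_sheaf[OF \<sigma> that] by (simp add: D_def)
  have "sheaf_morphism \<Phi> (cone_sheaf \<Phi> \<sigma>) G m"
    unfolding sheaf_morphism_def
  proof (intro conjI ballI impI)
    fix \<tau> assume \<tau>: "\<tau> \<in> \<Phi>"
    show "linear_between (stalk (cone_sheaf \<Phi> \<sigma>) \<tau>) (stalk G \<tau>) (m \<tau>)"
      by (rule linear_betweenI)
         (auto simp: stc[OF \<tau>] Gst m_def scaleR_fun_app scaleR_left_distrib span_scale span_base split: if_splits)
  next
    fix \<mu> \<tau> x assume "x \<in> stalk (cone_sheaf \<Phi> \<sigma>) \<mu>"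
    then show "m \<tau> (restr (cone_sheaf \<Phi> \<sigma>) \<mu> \<tau> x) = restr G \<mu> \<tau> (m \<mu> x)"
      by (simp add: restr_cone_sheaf[OF \<sigma>] Gst m_def)
  qed
  moreover have "bij_betw (m \<tau>) (stalk (cone_sheaf \<Phi> \<sigma>) \<tau>) (stalk G \<tau>)" if \<tau>: "\<tau> \<in> \<Phi>" for \<tau>
  proof (cases "D \<tau>")
    case True
    have mt: "m \<tau> (c *\<^sub>R tens \<sigma>) = c *\<^sub>R e0" for c by (simp add: m_def scaleR_fun_app tens_v[OF \<sigma>])
    have inj: "inj_on (m \<tau>) (span {tens \<sigma>})"
    proof (rule inj_onI)
      fix x y assume "x \<in> span {tens \<sigma>}" "y \<in> span {tens \<sigma>}" "m \<tau> x = m \<tau> y"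
      then have xy: "x \<in> range (\<lambda>c. c *\<^sub>R tens \<sigma>)" "y \<in> range (\<lambda>c. c *\<^sub>R tens \<sigma>)" "m \<tau> x = m \<tau> y"
        unfolding span_singleton by simp_all
      obtain c where c: "x = c *\<^sub>R tens \<sigma>" using xy(1) by (rule rangeE)
      obtain d where d: "y = d *\<^sub>R tens \<sigma>" using xy(2) by (rule rangeE)
      note cd = c d
      have "c *\<^sub>R e0 = d *\<^sub>R e0" using xy(3) unfolding cd mt .
      then have "c = d" using e0_nonzero by simp
      then show "x = y" using cd by simp
    qed
    have "m \<tau> ` span {tens \<sigma>} = span {e0}"
      unfolding span_singleton image_image mt ..
    then show ?thesis using inj True by (simp add: bij_betw_def stc[OF \<tau>] Gst)
  next
    case False
    then show ?thesis by (simp add: bij_betw_def stc[OF \<tau>] Gst m_def)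
  qed
  ultimately show ?thesis using sheaf unfolding sheaf_isomorphic_def by blast
qed

lemma tens_nonzero: "\<sigma> \<in> \<Phi> \<Longrightarrow> tens \<sigma> \<noteq> 0"
  using tens_v by force

lemma K_class_cone_sheaf_delta:
  fixes h :: "('a ksheaf \<Rightarrow>\<^sub>0 int) set \<Rightarrow> 'b::real_vector"
  assumes \<sigma>: "\<sigma> \<in> \<Phi>" and h: "K_additive h"
  shows "h (K_class \<Phi> (cone_sheaf \<Phi> \<sigma>)) =
    (\<Sum>\<tau>\<in>\<Phi>. if cone_rays \<sigma> \<inter> cone_rays \<tau> = {} then h (K_cls (delta_sheaf \<tau>)) else 0)"
proof -
  have fin: "subspace (stalk (cone_sheaf \<Phi> \<sigma>) \<tau>) \<and> (\<exists>B. finite B \<and> stalk (cone_sheaf \<Phi> \<sigma>) \<tau> = span B)"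
    if \<tau>: "\<tau> \<in> \<Phi>" for \<tau>
  proof (cases "cone_rays \<sigma> \<inter> cone_rays \<tau> = {}")
    case True
    then show ?thesis by (intro conjI exI[of _ "{tens \<sigma>}"]) (simp_all add: stalk_cone_sheaf[OF \<sigma> \<tau>] subspace_span)
  next
    case False
    then show ?thesis by (intro conjI exI[of _ "{}"]) (simp_all add: stalk_cone_sheaf[OF \<sigma> \<tau>] subspace_single_0)
  qed
  have "h (K_class \<Phi> (cone_sheaf \<Phi> \<sigma>)) =
    (\<Sum>\<tau>\<in>\<Phi>. of_nat (dim (stalk (cone_sheaf \<Phi> \<sigma>) \<tau>)) *\<^sub>R h (K_cls (delta_sheaf \<tau>)))"
    by (rule K_class_additive[OF cone_sheaf_iso_exists[OF \<sigma>] _ h]) (rule fin)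
  also have "\<dots> = (\<Sum>\<tau>\<in>\<Phi>. if cone_rays \<sigma> \<inter> cone_rays \<tau> = {} then h (K_cls (delta_sheaf \<tau>)) else 0)"
    by (intro sum.cong[OF refl])
       (simp add: stalk_cone_sheaf[OF \<sigma>] dim_singleton_space[OF tens_nonzero[OF \<sigma>]] dim_zero_space)
  finally show ?thesis .
qed

text \<open>The matrix of the relation ``no common ray'' on \<open>\<Phi>\<close> is nonsingular: adjoining a ray to \<open>A\<close> in
  the sums over \<open>{\<tau>. A \<subseteq> [\<tau>](1), B \<inter> [\<tau>](1) = {}}\<close> is a difference of two such sums.\<close>

lemma disjointness_injective:
  fixes y :: "'a set \<Rightarrow> 'b::real_vector"
  assumes zero: "\<And>\<sigma>. \<sigma> \<in> \<Phi> \<Longrightarrow> (\<Sum>\<tau>\<in>\<Phi>. if cone_rays \<sigma> \<inter> cone_rays \<tau> = {} then y \<tau> else 0) = 0"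
    and \<tau>: "\<tau> \<in> \<Phi>"
  shows "y \<tau> = 0"
proof -
  define Y where "Y A B = (\<Sum>\<tau>\<in>\<Phi>. if A \<subseteq> cone_rays \<tau> \<and> B \<inter> cone_rays \<tau> = {} then y \<tau> else 0)" for A B
  have Y0: "Y A B = 0" if "finite A" "A \<inter> B = {}" "\<exists>\<sigma>\<in>\<Phi>. A \<union> B = cone_rays \<sigma>" for A B
    using that
  proof (induction A arbitrary: B rule: finite_induct)
    case empty
    then obtain \<sigma> where "\<sigma> \<in> \<Phi>" "B = cone_rays \<sigma>" by auto
    then show ?case using zero[of \<sigma>] by (simp add: Y_def)
  next
    case (insert \<rho> A)
    obtain \<sigma> where \<sigma>: "\<sigma> \<in> \<Phi>" "insert \<rho> A \<union> B = cone_rays \<sigma>" using insert.prems by blast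
    obtain \<sigma>' where \<sigma>': "\<sigma>' \<in> \<Phi>" "cone_rays \<sigma>' = A \<union> B"
      using subset_rays_face[OF \<sigma>(1), of "A \<union> B"] \<sigma>(2) by blast
    have "Y A B = 0" by (rule insert.IH) (use insert.prems \<sigma>' in auto)
    moreover have "Y A (insert \<rho> B) = 0" by (rule insert.IH) (use insert.hyps insert.prems \<sigma> in auto)
    moreover have "Y A B = Y (insert \<rho> A) B + Y A (insert \<rho> B)"
      unfolding Y_def sum.distrib[symmetric] by (intro sum.cong[OF refl]) auto
    ultimately show ?case by simp
  qed
  have up: "(\<Sum>\<tau>\<in>\<Phi>. if cone_rays \<sigma> \<subseteq> cone_rays \<tau> then y \<tau> else 0) = 0" if "\<sigma> \<in> \<Phi>" for \<sigma>
    using Y0[of "cone_rays \<sigma>" "{}"] that by (auto simp: Y_def)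
  show ?thesis using \<tau>
  \<comment> \<open>The sums over the cones containing \<tau> form a triangular system, solved from
    the maximal cones downwards.\<close>
  proof (induction "n - card (cone_rays \<tau>)" arbitrary: \<tau> rule: less_induct)
    case (less \<tau>)
    have "(if cone_rays \<tau> \<subseteq> cone_rays \<sigma> then y \<sigma> else 0) = (if \<sigma> = \<tau> then y \<sigma> else 0)" if \<sigma>: "\<sigma> \<in> \<Phi>" for \<sigma>
    proof (cases "cone_rays \<tau> \<subset> cone_rays \<sigma>")
      case True
      then have "card (cone_rays \<tau>) < card (cone_rays \<sigma>)" using \<sigma> by (simp add: psubset_card_mono)
      then have "y \<sigma> = 0" using card_rays_le[OF \<sigma>] by (intro less.hyps \<sigma>) simp
      then show ?thesis by simp
    next
      case False
      then have "cone_rays \<tau> \<subseteq> cone_rays \<sigma> \<longleftrightarrow> \<sigma> = \<tau>" using rays_inj[OF \<sigma> less.prems] by blast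
      then show ?thesis by simp
    qed
    then have "(\<Sum>\<sigma>\<in>\<Phi>. if cone_rays \<tau> \<subseteq> cone_rays \<sigma> then y \<sigma> else 0) = (\<Sum>\<sigma>\<in>\<Phi>. if \<sigma> = \<tau> then y \<sigma> else 0)"
      by (intro sum.cong[OF refl])
    then show ?case using up[OF less.prems] less.prems finite_fan by simp
  qed
qed

text \<open>Values prescribed on the classes of the \<O>(\<sigma>) determine the function, by
  injectivity of the disjointness matrix. This is what makes \<open>ch_tilde\<close> computable,
  since it is specified on those classes.\<close>

lemma K_additive_unique:
  fixes h :: "('a ksheaf \<Rightarrow>\<^sub>0 int) set \<Rightarrow> 'b::real_vector"
  assumes h: "K_additive h" and \<gamma>: "\<gamma> \<in> carrier KG"
    and s: "\<And>\<sigma>. \<sigma> \<in> \<Phi> \<Longrightarrow> h (K_class \<Phi> (cone_sheaf \<Phi> \<sigma>)) =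
      (\<Sum>\<tau>\<in>\<Phi>. if cone_rays \<sigma> \<inter> cone_rays \<tau> = {} then s \<tau> else 0)"
  shows "h \<gamma> = (\<Sum>\<tau>\<in>\<Phi>. of_int (K_delta \<tau> \<gamma>) *\<^sub>R s \<tau>)"
proof -
  have "h (K_cls (delta_sheaf \<tau>)) - s \<tau> = 0" if "\<tau> \<in> \<Phi>" for \<tau>
  proof (rule disjointness_injective[OF _ that, of "\<lambda>\<tau>. h (K_cls (delta_sheaf \<tau>)) - s \<tau>"])
    fix \<sigma> assume \<sigma>: "\<sigma> \<in> \<Phi>"
    have "(\<Sum>\<tau>\<in>\<Phi>. if cone_rays \<sigma> \<inter> cone_rays \<tau> = {} then h (K_cls (delta_sheaf \<tau>)) - s \<tau> else 0) =
      (\<Sum>\<tau>\<in>\<Phi>. (if cone_rays \<sigma> \<inter> cone_rays \<tau> = {} then h (K_cls (delta_sheaf \<tau>)) else 0) -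
        (if cone_rays \<sigma> \<inter> cone_rays \<tau> = {} then s \<tau> else 0))"
      by (intro sum.cong[OF refl]) simp
    also have "\<dots> = 0"
      unfolding sum_subtractf K_class_cone_sheaf_delta[OF \<sigma> h, symmetric] s[OF \<sigma>] by simp
    finally show "(\<Sum>\<tau>\<in>\<Phi>. if cone_rays \<sigma> \<inter> cone_rays \<tau> = {} then h (K_cls (delta_sheaf \<tau>)) - s \<tau> else 0) = 0" .
  qed
  then show ?thesis using K_additive_expand[OF h \<gamma>] by simp
qed

end

section \<open>Cohomology and the completed ring\<close>

context unimodular_complete_fan
begin

abbreviation "CR \<equiv> cpoly_ring \<Phi>"
abbreviation "HR \<equiv> hat_ring \<Phi>"

lemma carrier_CR: "carrier CR = conepoly \<Phi>"
  and mult_CR: "f \<otimes>\<^bsub>CR\<^esub> g = (\<lambda>x. f x * g x)"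
  and add_CR: "f \<oplus>\<^bsub>CR\<^esub> g = f + g"
  and zero_CR: "\<zero>\<^bsub>CR\<^esub> = 0"
  and one_CR: "\<one>\<^bsub>CR\<^esub> = restrict_fan \<Phi> (\<lambda>_. 1)"
  by (auto simp: cpoly_ring_def plus_fun_def zero_fun_def restrict_fan_def indicator_def fun_eq_iff)

lemma conepoly_add: "f \<in> conepoly \<Phi> \<Longrightarrow> g \<in> conepoly \<Phi> \<Longrightarrow> f + g \<in> conepoly \<Phi>"
  unfolding plus_fun_def
  by (rule conewise_add[where P = real_polynomial_function and Q = real_polynomial_function])
     (auto intro: real_polynomial_function.intros(3))

lemma conepoly_mult: "f \<in> conepoly \<Phi> \<Longrightarrow> g \<in> conepoly \<Phi> \<Longrightarrow> (\<lambda>x. f x * g x) \<in> conepoly \<Phi>"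
  by (rule conewise_mult[where P = real_polynomial_function and Q = real_polynomial_function])
     (auto intro: real_polynomial_function.intros(4))

lemma conepoly_zero: "0 \<in> conepoly \<Phi>"
  unfolding zero_fun_def by (rule conewise_zero) (rule real_polynomial_function.intros(2))

lemma conepoly_restrict: "real_polynomial_function p \<Longrightarrow> restrict_fan \<Phi> p \<in> conepoly \<Phi>"
  by (rule conewise_restrict_fan)

lemma conepoly_uminus: "f \<in> conepoly \<Phi> \<Longrightarrow> - f \<in> conepoly \<Phi>"
  using conepoly_diff[OF conepoly_zero, of f] by (simp add: fun_Compl_def)

lemma restrict_mult: "f \<in> conewise P \<Phi> \<Longrightarrow> (\<lambda>x. restrict_fan \<Phi> p x * f x) = (\<lambda>x. p x * f x)"
  using conewise_outside by (fastforce simp: restrict_fan_def fun_eq_iff)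

lemma cring_CR: "cring CR"
proof (rule cringI)
  show "abelian_group CR"
  proof (rule abelian_groupI)
    fix f assume "f \<in> carrier CR"
    then show "\<exists>g\<in>carrier CR. g \<oplus>\<^bsub>CR\<^esub> f = \<zero>\<^bsub>CR\<^esub>"
      by (intro bexI[of _ "- f"]) (simp_all add: carrier_CR add_CR zero_CR conepoly_uminus)
  qed (simp_all add: carrier_CR add_CR zero_CR conepoly_add conepoly_zero add_ac)
  show "comm_monoid CR"
  proof (rule comm_monoidI)
    show "\<one>\<^bsub>CR\<^esub> \<in> carrier CR" unfolding carrier_CR one_CR
      by (rule conepoly_restrict) (rule real_polynomial_function.intros(2))
    fix f assume "f \<in> carrier CR"
    then show "\<one>\<^bsub>CR\<^esub> \<otimes>\<^bsub>CR\<^esub> f = f" unfolding carrier_CR one_CR mult_CR by (simp add: restrict_mult)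
  qed (simp_all add: carrier_CR mult_CR conepoly_mult mult_ac)
qed (simp add: add_CR mult_CR plus_fun_def algebra_simps)

section \<open>The completed ring and homogeneous components\<close>

text \<open>The components of \<open>s\<close> at a point form a formal power series. The product of
  \<open>hat_ring\<close> becomes that of series, so ring identities are checked one point at a
  time.\<close>

definition ser :: "'a \<Rightarrow> (nat \<Rightarrow> 'a \<Rightarrow> real) \<Rightarrow> real fps"
  where "ser x s = Abs_fps (\<lambda>i. s i x)"

lemma ser_ext: "(\<And>x. ser x s = ser x t) \<Longrightarrow> s = t"
  by (auto simp: ser_def fun_eq_iff fps_eq_iff)

lemma carrier_HR: "s \<in> carrier HR \<longleftrightarrow> (\<forall>i. s i \<in> conewise (homogeneous_poly i) \<Phi>)"
  and mult_HR: "s \<otimes>\<^bsub>HR\<^esub> t = (\<lambda>i x. \<Sum>j\<le>i. s j x * t (i - j) x)"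
  and add_HR: "s \<oplus>\<^bsub>HR\<^esub> t = s + t"
  and zero_HR: "\<zero>\<^bsub>HR\<^esub> = 0"
  and one_HR: "\<one>\<^bsub>HR\<^esub> = (\<lambda>i. if i = 0 then restrict_fan \<Phi> (\<lambda>_. 1) else 0)"
  by (auto simp: hat_ring_def plus_fun_def zero_fun_def restrict_fan_def indicator_def fun_eq_iff)

lemma ser_mult: "ser x (s \<otimes>\<^bsub>HR\<^esub> t) = ser x s * ser x t"
  by (simp add: ser_def mult_HR fps_eq_iff fps_mult_nth atLeast0AtMost)

lemma ser_add: "ser x (s + t) = ser x s + ser x t"
  by (simp add: ser_def fps_eq_iff)

lemma ser_one: "ser x \<one>\<^bsub>HR\<^esub> = (if x \<in> V then 1 else 0)"
  by (simp add: ser_def one_HR fps_eq_iff restrict_fan_def Union_fan)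

lemma ser_outside: "s \<in> carrier HR \<Longrightarrow> x \<notin> V \<Longrightarrow> ser x s = 0"
proof -
  assume s: "s \<in> carrier HR" and x: "x \<notin> V"
  have "s i x = 0" for i
  proof -
    have "s i \<in> conewise (homogeneous_poly i) \<Phi>" using s by (simp add: carrier_HR)
    from conewise_outside[OF this] show "s i x = 0" using x by (simp add: Union_fan)
  qed
  then show ?thesis by (simp add: ser_def fps_eq_iff)
qed

lemma conewise_homogeneous_sum:
  "(\<And>j. j \<in> I \<Longrightarrow> f j \<in> conewise (homogeneous_poly i) \<Phi>) \<Longrightarrow> (\<lambda>x. \<Sum>j\<in>I. f j x) \<in> conewise (homogeneous_poly i) \<Phi>"
proof (induction I rule: infinite_finite_induct)
  case (insert j I)
  then have "(\<lambda>x. f j x + (\<Sum>j\<in>I. f j x)) \<in> conewise (homogeneous_poly i) \<Phi>"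
    by (intro conewise_add[where P = "homogeneous_poly i" and Q = "homogeneous_poly i"] homogeneous_poly_add) auto
  then show ?case using insert by simp
qed (simp_all add: conewise_zero homogeneous_poly_zero)

lemma conewise_homogeneous_mult:
  "f \<in> conewise (homogeneous_poly i) \<Phi> \<Longrightarrow> g \<in> conewise (homogeneous_poly j) \<Phi> \<Longrightarrow>
    (\<lambda>x. f x * g x) \<in> conewise (homogeneous_poly (i + j)) \<Phi>"
  by (rule conewise_mult[where P = "homogeneous_poly i" and Q = "homogeneous_poly j"]) (auto intro: homogeneous_poly_mult)

lemma conewise_homogeneous_conepoly: "f \<in> conewise (homogeneous_poly i) \<Phi> \<Longrightarrow> f \<in> conepoly \<Phi>"
  by (erule conewise_mono) (rule homogeneous_polyD)

lemma HR_mult_closed: "s \<in> carrier HR \<Longrightarrow> t \<in> carrier HR \<Longrightarrow> s \<otimes>\<^bsub>HR\<^esub> t \<in> carrier HR"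
  unfolding carrier_HR mult_HR
proof (intro allI conewise_homogeneous_sum)
  fix i j :: nat
  assume "\<forall>i. s i \<in> conewise (homogeneous_poly i) \<Phi>" "\<forall>i. t i \<in> conewise (homogeneous_poly i) \<Phi>" "j \<in> {..i}"
  then show "(\<lambda>x. s j x * t (i - j) x) \<in> conewise (homogeneous_poly i) \<Phi>"
    using conewise_homogeneous_mult[of "s j" j "t (i - j)" "i - j"] by simp
qed

lemma HR_add_closed: "s \<in> carrier HR \<Longrightarrow> t \<in> carrier HR \<Longrightarrow> s + t \<in> carrier HR"
  unfolding carrier_HR plus_fun_def
  by (intro allI conewise_add[where P = "homogeneous_poly _" and Q = "homogeneous_poly _"] homogeneous_poly_add) auto

lemma HR_scale_closed: "s \<in> carrier HR \<Longrightarrow> c *\<^sub>R s \<in> carrier HR"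
  unfolding carrier_HR
proof
  fix i assume "\<forall>i. s i \<in> conewise (homogeneous_poly i) \<Phi>"
  then have s: "s i \<in> conewise (homogeneous_poly i) \<Phi>" by simp
  have "restrict_fan \<Phi> (\<lambda>_. c) \<in> conewise (homogeneous_poly 0) \<Phi>"
    by (rule conewise_restrict_fan[where P = "homogeneous_poly 0", OF homogeneous_poly_const])
       (rule real_polynomial_function.intros(2))
  from conewise_homogeneous_mult[OF this s] show "(c *\<^sub>R s) i \<in> conewise (homogeneous_poly i) \<Phi>"
    unfolding restrict_mult[OF s] by (simp add: scaleR_fun_def)
qed

lemma HR_zero_closed: "0 \<in> carrier HR"
  unfolding carrier_HR zero_fun_def by (intro allI conewise_zero homogeneous_poly_zero)

lemma HR_uminus_closed: "s \<in> carrier HR \<Longrightarrow> - s \<in> carrier HR"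
  using HR_scale_closed[of s "-1"] by simp

lemma HR_diff_closed: "s \<in> carrier HR \<Longrightarrow> t \<in> carrier HR \<Longrightarrow> s - t \<in> carrier HR"
  using HR_add_closed[of s "- t"] HR_uminus_closed[of t] by simp

lemma HR_one_closed: "\<one>\<^bsub>HR\<^esub> \<in> carrier HR"
  unfolding carrier_HR one_HR
proof
  fix i
  have "restrict_fan \<Phi> (\<lambda>_. 1) \<in> conewise (homogeneous_poly 0) \<Phi>"
    by (rule conewise_restrict_fan[where P = "homogeneous_poly 0", OF homogeneous_poly_const])
       (rule real_polynomial_function.intros(2))
  moreover have "0 \<in> conewise (homogeneous_poly i) \<Phi>"
    unfolding zero_fun_def by (rule conewise_zero[where P = "homogeneous_poly i"]) (rule homogeneous_poly_zero)
  ultimately show "(if i = 0 then restrict_fan \<Phi> (\<lambda>_. 1) else 0) \<in> conewise (homogeneous_poly i) \<Phi>"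
    by simp
qed

lemma cring_HR: "cring HR"
proof (rule cringI)
  show "abelian_group HR"
  proof (rule abelian_groupI)
    fix f assume "f \<in> carrier HR"
    then show "\<exists>g\<in>carrier HR. g \<oplus>\<^bsub>HR\<^esub> f = \<zero>\<^bsub>HR\<^esub>"
      by (intro bexI[of _ "- f"]) (simp_all add: add_HR zero_HR HR_uminus_closed)
  qed (simp_all add: add_HR zero_HR HR_add_closed HR_zero_closed add_ac)
  show "comm_monoid HR"
  proof (rule comm_monoidI)
    fix s t u assume "s \<in> carrier HR" "t \<in> carrier HR"
    show "s \<otimes>\<^bsub>HR\<^esub> t \<otimes>\<^bsub>HR\<^esub> u = s \<otimes>\<^bsub>HR\<^esub> (t \<otimes>\<^bsub>HR\<^esub> u)" by (rule ser_ext) (simp add: ser_mult mult_ac)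
    show "s \<otimes>\<^bsub>HR\<^esub> t = t \<otimes>\<^bsub>HR\<^esub> s" by (rule ser_ext) (simp add: ser_mult mult_ac)
    show "\<one>\<^bsub>HR\<^esub> \<otimes>\<^bsub>HR\<^esub> s = s"
      by (rule ser_ext) (use ser_outside[OF \<open>s \<in> carrier HR\<close>] in \<open>simp add: ser_mult ser_one\<close>)
  qed (simp_all add: HR_mult_closed HR_one_closed)
  fix s t u
  show "(s \<oplus>\<^bsub>HR\<^esub> t) \<otimes>\<^bsub>HR\<^esub> u = s \<otimes>\<^bsub>HR\<^esub> u \<oplus>\<^bsub>HR\<^esub> t \<otimes>\<^bsub>HR\<^esub> u"
    by (rule ser_ext) (simp add: ser_mult ser_add add_HR algebra_simps)
qed

text \<open>\<open>s\<close> is the sequence of homogeneous components of \<open>f\<close>. An upper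
  bound on the degrees replaces the finite support in \<open>hat_incl\<close>, so that sums can be
  extended to a common range.\<close>

definition grades :: "('a \<Rightarrow> real) \<Rightarrow> (nat \<Rightarrow> 'a \<Rightarrow> real) \<Rightarrow> bool"
  where "grades f s \<longleftrightarrow> s \<in> carrier HR \<and> (\<exists>N. (\<forall>i>N. s i = (\<lambda>x. 0)) \<and> (\<forall>x. f x = (\<Sum>i\<le>N. s i x)))"

lemma gradesE:
  assumes "grades f s"
  obtains N where "s \<in> carrier HR" "\<forall>i>N. s i = (\<lambda>x. 0)" "\<forall>M\<ge>N. \<forall>x. f x = (\<Sum>i\<le>M. s i x)"
proof -
  obtain N where N: "s \<in> carrier HR" "\<forall>i>N. s i = (\<lambda>x. 0)" "\<forall>x. f x = (\<Sum>i\<le>N. s i x)"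
    using assms unfolding grades_def by (elim conjE exE)
  have "f x = (\<Sum>i\<le>M. s i x)" if "M \<ge> N" for M x
  proof -
    have "(\<Sum>i\<le>N. s i x) = (\<Sum>i\<le>M. s i x)" using that N(2) by (intro sum.mono_neutral_left) auto
    then show ?thesis using N(3) by simp
  qed
  then show ?thesis by (intro that[OF N(1,2)] allI impI)
qed

text \<open>On a half-line through \<open>x\<close> both sums of components are polynomials in the
  factor \<open>r\<close>; agreeing for all \<open>r \<ge> 0\<close>, they have the same
  coefficients.\<close>

lemma grades_unique:
  assumes "grades f s" "grades f t" shows "s = t"
proof -
  obtain N where s: "s \<in> carrier HR" "\<forall>i>N. s i = (\<lambda>x. 0)" "\<forall>M\<ge>N. \<forall>x. f x = (\<Sum>i\<le>M. s i x)"
    by (rule gradesE[OF assms(1)])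
  obtain N' where t: "t \<in> carrier HR" "\<forall>i>N'. t i = (\<lambda>x. 0)" "\<forall>M\<ge>N'. \<forall>x. f x = (\<Sum>i\<le>M. t i x)"
    by (rule gradesE[OF assms(2)])
  define M where "M = max N N'"
  have "s i x = t i x" for i x
  proof (cases "i \<le> M \<and> x \<in> V")
    case True
    have "(\<Sum>j\<le>M. (s j x - t j x) * r ^ j) = 0" if r: "r \<ge> 0" for r
    proof -
      have scal: "w j (r *\<^sub>R x) = w j x * r ^ j" if "w \<in> carrier HR" for w j
      proof -
        have "w j \<in> conewise (homogeneous_poly j) \<Phi>" using that by (simp add: carrier_HR)
        from conewise_homogeneousD[OF this _ r] show ?thesis using True by (simp add: mult.commute)
      qed
      have "(\<Sum>j\<le>M. s j (r *\<^sub>R x)) = (\<Sum>j\<le>M. t j (r *\<^sub>R x))"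
        using s(3)[rule_format, of M "r *\<^sub>R x"] t(3)[rule_format, of M "r *\<^sub>R x"] by (simp add: M_def)
      moreover have "(\<Sum>j\<le>M. s j (r *\<^sub>R x)) = (\<Sum>j\<le>M. s j x * r ^ j)"
        by (intro sum.cong[OF refl]) (simp add: scal[OF s(1)])
      moreover have "(\<Sum>j\<le>M. t j (r *\<^sub>R x)) = (\<Sum>j\<le>M. t j x * r ^ j)"
        by (intro sum.cong[OF refl]) (simp add: scal[OF t(1)])
      ultimately show ?thesis by (simp add: left_diff_distrib sum_subtractf)
    qed
    then have "s i x - t i x = 0"
      by (rule graded_unique[where N = M and c = "\<lambda>j. s j x - t j x"]) (use True in auto)
    then show ?thesis by simp
  next
    case False
    then consider "i > N" "i > N'" | "x \<notin> \<Union>\<Phi>" by (auto simp: M_def Union_fan)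
    then show ?thesis
    proof cases
      case 1 then show ?thesis using s(2) t(2) by simp
    next
      case 2
      have "s i \<in> conewise (homogeneous_poly i) \<Phi>" "t i \<in> conewise (homogeneous_poly i) \<Phi>" using s(1) t(1) by (simp_all add: carrier_HR)
      then show ?thesis using conewise_outside 2 by metis
    qed
  qed
  then show ?thesis by (simp add: fun_eq_iff)
qed

lemma grades_iff_finite:
  "grades f s \<longleftrightarrow> s \<in> carrier HR \<and> finite {i. s i \<noteq> (\<lambda>x. 0)} \<and> (\<forall>x. f x = (\<Sum>i | s i \<noteq> (\<lambda>x. 0). s i x))"
proof
  assume "grades f s"
  then obtain N where N: "s \<in> carrier HR" "\<forall>i>N. s i = (\<lambda>x. 0)" "\<forall>x. f x = (\<Sum>i\<le>N. s i x)"
    unfolding grades_def by (elim conjE exE)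
  have sub: "{i. s i \<noteq> (\<lambda>x. 0)} \<subseteq> {..N}" using N(2) by (auto simp: not_le[symmetric])
  have "(\<Sum>i\<le>N. s i x) = (\<Sum>i | s i \<noteq> (\<lambda>x. 0). s i x)" for x
    using sub by (intro sum.mono_neutral_right) (auto simp: fun_eq_iff)
  then show "s \<in> carrier HR \<and> finite {i. s i \<noteq> (\<lambda>x. 0)} \<and> (\<forall>x. f x = (\<Sum>i | s i \<noteq> (\<lambda>x. 0). s i x))"
    using N finite_subset[OF sub finite_atMost] by simp
next
  assume *: "s \<in> carrier HR \<and> finite {i. s i \<noteq> (\<lambda>x. 0)} \<and> (\<forall>x. f x = (\<Sum>i | s i \<noteq> (\<lambda>x. 0). s i x))"
  then obtain N where N: "{i. s i \<noteq> (\<lambda>x. 0)} \<subseteq> {..N}" using finite_nat_iff_bounded_le by blast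
  have "(\<Sum>i\<le>N. s i x) = (\<Sum>i | s i \<noteq> (\<lambda>x. 0). s i x)" for x
    using N by (intro sum.mono_neutral_right) (auto simp: fun_eq_iff)
  moreover have "s i = (\<lambda>x. 0)" if "i > N" for i
    using N that by (metis (mono_tags, lifting) atMost_iff linorder_not_less mem_Collect_eq subsetD)
  ultimately show "grades f s" unfolding grades_def using * by (intro conjI exI[of _ N]) auto
qed

lemma hat_incl_eq: "grades f s \<Longrightarrow> hat_incl \<Phi> f = s"
  unfolding hat_incl_def grades_iff_finite[symmetric] by (rule the_equality) (auto dest: grades_unique)

lemma grades_exists:
  assumes "f \<in> conepoly \<Phi>" shows "grades f (hat_incl \<Phi> f)"
proof -
  obtain N g where g: "\<forall>j. g j \<in> span (monos_deg j)" "\<forall>j>N. g j = (\<lambda>x. 0)" "\<forall>x. f x = (\<Sum>j\<le>N. g j x)"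
    using conepoly_graded[OF assms] by blast
  then have "grades f g" unfolding grades_def carrier_HR using span_monos_deg_conewise by blast
  then show ?thesis using hat_incl_eq by simp
qed

lemma grades_add:
  assumes "grades f s" "grades g t" shows "grades (f + g) (s + t)"
proof -
  obtain N where s: "s \<in> carrier HR" "\<forall>i>N. s i = (\<lambda>x. 0)" "\<forall>M\<ge>N. \<forall>x. f x = (\<Sum>i\<le>M. s i x)"
    by (rule gradesE[OF assms(1)])
  obtain N' where t: "t \<in> carrier HR" "\<forall>i>N'. t i = (\<lambda>x. 0)" "\<forall>M\<ge>N'. \<forall>x. g x = (\<Sum>i\<le>M. t i x)"
    by (rule gradesE[OF assms(2)])
  show ?thesis unfolding grades_def
  proof (intro conjI exI[of _ "max N N'"] allI impI)
    show "s + t \<in> carrier HR" by (rule HR_add_closed[OF s(1) t(1)])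
    show "(s + t) i = (\<lambda>x. 0)" if "i > max N N'" for i using s(2) t(2) that by (simp add: plus_fun_def)
    show "(f + g) x = (\<Sum>i\<le>max N N'. (s + t) i x)" for x
      using s(3)[rule_format, of "max N N'" x] t(3)[rule_format, of "max N N'" x] by (simp add: sum.distrib)
  qed
qed

lemma grades_mult:
  assumes "grades f s" "grades g t" shows "grades (\<lambda>x. f x * g x) (s \<otimes>\<^bsub>HR\<^esub> t)"
proof -
  obtain N where s: "s \<in> carrier HR" "\<forall>i>N. s i = (\<lambda>x. 0)" "\<forall>M\<ge>N. \<forall>x. f x = (\<Sum>i\<le>M. s i x)"
    by (rule gradesE[OF assms(1)])
  obtain N' where t: "t \<in> carrier HR" "\<forall>i>N'. t i = (\<lambda>x. 0)" "\<forall>M\<ge>N'. \<forall>x. g x = (\<Sum>i\<le>M. t i x)"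
    by (rule gradesE[OF assms(2)])
  show ?thesis unfolding grades_def
  proof (intro conjI exI[of _ "N + N'"] allI impI)
    show "s \<otimes>\<^bsub>HR\<^esub> t \<in> carrier HR" by (rule HR_mult_closed[OF s(1) t(1)])
    fix i assume i: "i > N + N'"
    have "(\<Sum>j\<le>i. s j x * t (i - j) x) = 0" for x
    proof (rule sum.neutral, rule ballI)
      fix j assume "j \<in> {..i}"
      then have "j > N \<or> i - j > N'" using i by auto
      then show "s j x * t (i - j) x = 0" using s(2) t(2) by auto
    qed
    then show "(s \<otimes>\<^bsub>HR\<^esub> t) i = (\<lambda>x. 0)" by (simp add: mult_HR)
  next
    fix x
    \<comment> \<open>The components are taken as coefficients of polynomials in one variable,
      multiplied, and evaluated at 1.\<close>
    have "(\<Sum>i\<le>N. s i x * 1 ^ i) * (\<Sum>j\<le>N'. t j x * 1 ^ j) =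
      (\<Sum>r\<le>N + N'. (\<Sum>k\<le>r. s k x * t (r - k) x) * 1 ^ r)"
      by (rule polynomial_product) (simp_all add: s(2) t(2))
    then show "f x * g x = (\<Sum>i\<le>N + N'. (s \<otimes>\<^bsub>HR\<^esub> t) i x)"
      using s(3)[rule_format, of N x] t(3)[rule_format, of N' x] by (simp add: mult_HR)
  qed
qed

section \<open>Comparison of the cohomology ring with its completed form\<close>

abbreviation "CI \<equiv> cpoly_ideal \<Phi>"
abbreviation "HI \<equiv> hat_ideal \<Phi>"

lemma ideal_CI: "ideal CI CR"
  unfolding cpoly_ideal_def using cring_CR
  by (intro ring.genideal_ideal cring.axioms(1)) (auto simp: carrier_CR conepoly_restrict)

lemma HI_gen_carrier:
  "(\<forall>i. homogeneous_poly i (p i)) \<Longrightarrow> (\<lambda>i. restrict_fan \<Phi> (p i)) \<in> carrier HR"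
  unfolding carrier_HR by (auto intro: conewise_restrict_fan homogeneous_polyD)

lemma ideal_HI: "ideal HI HR"
  unfolding hat_ideal_def using cring_HR
  by (intro ring.genideal_ideal cring.axioms(1)) (auto simp: HI_gen_carrier)

lemma HI_gen:
  "(\<forall>i. homogeneous_poly i (p i)) \<Longrightarrow> p 0 = (\<lambda>x. 0) \<Longrightarrow> (\<lambda>i. restrict_fan \<Phi> (p i)) \<in> HI"
  unfolding hat_ideal_def
  by (rule subsetD[OF ring.genideal_self[OF cring.axioms(1)[OF cring_HR]]]) (auto simp: HI_gen_carrier)

text \<open>Commutativity leaves one side to check, and closure under negatives comes from
  multiplication by minus one.\<close>

lemma ring_idealI:
  assumes "cring S" "I \<subseteq> carrier S" "\<zero>\<^bsub>S\<^esub> \<in> I" "\<And>x y. x \<in> I \<Longrightarrow> y \<in> I \<Longrightarrow> x \<oplus>\<^bsub>S\<^esub> y \<in> I"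
    "\<And>x r. x \<in> I \<Longrightarrow> r \<in> carrier S \<Longrightarrow> r \<otimes>\<^bsub>S\<^esub> x \<in> I"
  shows "ideal I S"
proof -
  interpret cring S by fact
  show ?thesis
  proof (rule idealI[OF ring_axioms])
    show "subgroup I (add_monoid S)"
    proof (rule group.subgroupI)
      show "group (add_monoid S)" by (rule a_group)
      show "I \<noteq> {}" using assms(3) by blast
      fix a assume a: "a \<in> I"
      have "(\<ominus>\<^bsub>S\<^esub> \<one>\<^bsub>S\<^esub>) \<otimes>\<^bsub>S\<^esub> a \<in> I" by (rule assms(5)[OF a]) simp
      moreover have "(\<ominus>\<^bsub>S\<^esub> \<one>\<^bsub>S\<^esub>) \<otimes>\<^bsub>S\<^esub> a = \<ominus>\<^bsub>S\<^esub> a" using a assms(2) by (simp add: l_minus subset_iff)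
      ultimately show "inv\<^bsub>add_monoid S\<^esub> a \<in> I" by (simp add: a_inv_def)
    qed (use assms in auto)
    fix a x assume "a \<in> I" "x \<in> carrier S"
    then show "x \<otimes>\<^bsub>S\<^esub> a \<in> I" "a \<otimes>\<^bsub>S\<^esub> x \<in> I"
      using assms(2,5) m_comm[of a x] by (auto simp: subset_iff)
  qed
qed

lemma HI_carrier: "s \<in> HI \<Longrightarrow> s \<in> carrier HR"
  by (rule ideal.Icarr[OF ideal_HI])

lemma HI_add: "s \<in> HI \<Longrightarrow> t \<in> HI \<Longrightarrow> s + t \<in> HI"
  using additive_subgroup.a_closed[OF ideal.axioms(1)[OF ideal_HI]] by (simp add: add_HR)

lemma HI_zero: "0 \<in> HI"
  using additive_subgroup.zero_closed[OF ideal.axioms(1)[OF ideal_HI]] by (simp add: zero_HR)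

lemma HI_mult_left: "r \<in> carrier HR \<Longrightarrow> s \<in> HI \<Longrightarrow> r \<otimes>\<^bsub>HR\<^esub> s \<in> HI"
  using ideal.I_l_closed[OF ideal_HI] by blast

lemma HI_mult_right: "r \<in> carrier HR \<Longrightarrow> s \<in> HI \<Longrightarrow> s \<otimes>\<^bsub>HR\<^esub> r \<in> HI"
  using ideal.I_r_closed[OF ideal_HI] by blast

lemma HI_uminus:
  assumes "s \<in> HI" shows "- s \<in> HI"
proof -
  have "(- \<one>\<^bsub>HR\<^esub>) \<otimes>\<^bsub>HR\<^esub> s \<in> HI" by (intro HI_mult_left assms HR_uminus_closed HR_one_closed)
  moreover have "(- \<one>\<^bsub>HR\<^esub>) \<otimes>\<^bsub>HR\<^esub> s = - s"
  proof (rule ser_ext)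
    fix x
    have neg: "ser x (- u) = - ser x u" for u by (simp add: ser_def fps_eq_iff)
    show "ser x ((- \<one>\<^bsub>HR\<^esub>) \<otimes>\<^bsub>HR\<^esub> s) = ser x (- s)"
      using ser_outside[OF HI_carrier[OF assms], of x] by (simp add: ser_mult neg ser_one)
  qed
  ultimately show ?thesis by simp
qed

lemma HI_sum: "(\<And>i. i \<in> I \<Longrightarrow> f i \<in> HI) \<Longrightarrow> sum f I \<in> HI"
  by (induction I rule: infinite_finite_induct) (simp_all add: HI_zero HI_add)

lemma HI_coset: "HI +>\<^bsub>HR\<^esub> s = {i + s | i. i \<in> HI}"
  by (auto simp: a_r_coset_def' add_HR)

lemma HI_coset_eq_iff: "HI +>\<^bsub>HR\<^esub> s = HI +>\<^bsub>HR\<^esub> t \<longleftrightarrow> s - t \<in> HI"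
proof
  assume eq: "HI +>\<^bsub>HR\<^esub> s = HI +>\<^bsub>HR\<^esub> t"
  have "0 + s \<in> HI +>\<^bsub>HR\<^esub> s" unfolding HI_coset by (rule CollectI, rule exI[of _ 0]) (simp add: HI_zero)
  then have "0 + s \<in> HI +>\<^bsub>HR\<^esub> t" unfolding eq .
  then have "0 + s \<in> {i + t | i. i \<in> HI}" unfolding HI_coset .
  then obtain i where "0 + s = i + t" "i \<in> HI" by (elim CollectE exE conjE)
  then show "s - t \<in> HI" by (simp add: eq_diff_eq[symmetric])
next
  assume st: "s - t \<in> HI"
  show "HI +>\<^bsub>HR\<^esub> s = HI +>\<^bsub>HR\<^esub> t" unfolding HI_coset
  proof (intro equalityI subsetI)
    fix y assume "y \<in> {i + s | i. i \<in> HI}"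
    then obtain i where i: "i \<in> HI" "y = i + s" by (elim CollectE exE conjE)
    show "y \<in> {i + t | i. i \<in> HI}"
      by (rule CollectI, rule exI[of _ "i + (s - t)"], intro conjI HI_add i(1) st) (simp add: i(2))
  next
    fix y assume "y \<in> {i + t | i. i \<in> HI}"
    then obtain i where i: "i \<in> HI" "y = i + t" by (elim CollectE exE conjE)
    show "y \<in> {i + s | i. i \<in> HI}"
      by (rule CollectI, rule exI[of _ "i + - (s - t)"], intro conjI HI_add HI_uminus i(1) st) (simp add: i(2))
  qed
qed

lemma hat_incl_add: "f \<in> conepoly \<Phi> \<Longrightarrow> g \<in> conepoly \<Phi> \<Longrightarrow> hat_incl \<Phi> (f + g) = hat_incl \<Phi> f + hat_incl \<Phi> g"
  by (intro hat_incl_eq grades_add grades_exists)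

lemma hat_incl_mult: "f \<in> conepoly \<Phi> \<Longrightarrow> g \<in> conepoly \<Phi> \<Longrightarrow>
    hat_incl \<Phi> (\<lambda>x. f x * g x) = hat_incl \<Phi> f \<otimes>\<^bsub>HR\<^esub> hat_incl \<Phi> g"
  by (intro hat_incl_eq grades_mult grades_exists)

lemma hat_incl_carrier: "f \<in> conepoly \<Phi> \<Longrightarrow> hat_incl \<Phi> f \<in> carrier HR"
  using grades_exists by (simp add: grades_def)

lemma polynomial_homogeneous_parts:
  fixes p :: "'a \<Rightarrow> real"
  assumes "real_polynomial_function p"
  shows "\<exists>q N. (\<forall>i. homogeneous_poly i (q i)) \<and> (\<forall>i>N. q i = (\<lambda>x. 0)) \<and> (\<forall>x. p x = (\<Sum>i\<le>N. q i x))"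
  using assms
proof induction
  case (linear p)
  then have "linear p" by (simp add: bounded_linear.linear)
  then show ?case
    by (intro exI[of _ "\<lambda>i. if i = 1 then p else (\<lambda>x. 0)"] exI[of _ 1])
       (auto simp: homogeneous_poly_linear[simplified] homogeneous_poly_zero)
next
  case (const c)
  show ?case
    by (intro exI[of _ "\<lambda>i. if i = 0 then (\<lambda>x. c) else (\<lambda>x. 0)"] exI[of _ 0])
       (auto simp: homogeneous_poly_const homogeneous_poly_zero)
next
  case (add p1 p2)
  obtain q1 N1 where 1: "\<forall>i. homogeneous_poly i (q1 i)" "\<forall>i>N1. q1 i = (\<lambda>x. 0)" "\<forall>x. p1 x = (\<Sum>i\<le>N1. q1 i x)" using add.IH by blast
  obtain q2 N2 where 2: "\<forall>i. homogeneous_poly i (q2 i)" "\<forall>i>N2. q2 i = (\<lambda>x. 0)" "\<forall>x. p2 x = (\<Sum>i\<le>N2. q2 i x)" using add.IH by blast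
  have "(\<Sum>i\<le>N1. q1 i x) = (\<Sum>i\<le>max N1 N2. q1 i x)" for x
    using 1(2) by (intro sum.mono_neutral_left) auto
  moreover have "(\<Sum>i\<le>N2. q2 i x) = (\<Sum>i\<le>max N1 N2. q2 i x)" for x
    using 2(2) by (intro sum.mono_neutral_left) auto
  ultimately have "p1 x + p2 x = (\<Sum>i\<le>max N1 N2. q1 i x + q2 i x)" for x
    using 1(3) 2(3) by (simp add: sum.distrib)
  then show ?case using 1(1,2) 2(1,2)
    by (intro exI[of _ "\<lambda>i x. q1 i x + q2 i x"] exI[of _ "max N1 N2"]) (simp add: homogeneous_poly_add)
next
  case (mult p1 p2)
  obtain q1 N1 where 1: "\<forall>i. homogeneous_poly i (q1 i)" "\<forall>i>N1. q1 i = (\<lambda>x. 0)" "\<forall>x. p1 x = (\<Sum>i\<le>N1. q1 i x)" using mult.IH by blast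
  obtain q2 N2 where 2: "\<forall>i. homogeneous_poly i (q2 i)" "\<forall>i>N2. q2 i = (\<lambda>x. 0)" "\<forall>x. p2 x = (\<Sum>i\<le>N2. q2 i x)" using mult.IH by blast
  have hsum: "homogeneous_poly i (\<lambda>x. \<Sum>j\<in>J. f j x)" if "finite J" "\<And>j. j \<in> J \<Longrightarrow> homogeneous_poly i (f j)"
    for i and J :: "nat set" and f :: "nat \<Rightarrow> 'a \<Rightarrow> real"
    using that by (induction J rule: finite_induct) (simp_all add: homogeneous_poly_zero homogeneous_poly_add)
  show ?case
  proof (intro exI[of _ "\<lambda>i x. \<Sum>j\<le>i. q1 j x * q2 (i - j) x"] exI[of _ "N1 + N2"] conjI allI impI)
    fix i
    show "homogeneous_poly i (\<lambda>x. \<Sum>j\<le>i. q1 j x * q2 (i - j) x)"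
    proof (rule hsum)
      fix j assume "j \<in> {..i}"
      then show "homogeneous_poly i (\<lambda>x. q1 j x * q2 (i - j) x)"
        using homogeneous_poly_mult[of j "q1 j" "i - j" "q2 (i - j)"] 1(1) 2(1) by simp
    qed simp
    assume i: "i > N1 + N2"
    show "(\<lambda>x. \<Sum>j\<le>i. q1 j x * q2 (i - j) x) = (\<lambda>x. 0)"
    proof (intro ext sum.neutral ballI)
      fix x j assume "j \<in> {..i}"
      then have "j > N1 \<or> i - j > N2" using i by auto
      then show "q1 j x * q2 (i - j) x = 0" using 1(2) 2(2) by auto
    qed
  next
    fix x
    have "(\<Sum>i\<le>N1. q1 i x * 1 ^ i) * (\<Sum>j\<le>N2. q2 j x * 1 ^ j) = (\<Sum>r\<le>N1 + N2. (\<Sum>k\<le>r. q1 k x * q2 (r - k) x) * 1 ^ r)"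
      by (rule polynomial_product) (use 1(2) 2(2) in simp_all)
    then show "p1 x * p2 x = (\<Sum>i\<le>N1 + N2. \<Sum>j\<le>i. q1 j x * q2 (i - j) x)" using 1(3) 2(3) by simp
  qed
qed

text \<open>The component of degree 0 is constant with value \<open>p 0 = 0\<close>, so the sequence
  of homogeneous parts is itself a generator of the ideal.\<close>

lemma hat_incl_restrict_in_HI:
  assumes p: "real_polynomial_function p" "p 0 = 0"
  shows "hat_incl \<Phi> (restrict_fan \<Phi> p) \<in> HI"
proof -
  obtain q N where q: "\<forall>i. homogeneous_poly i (q i)" "\<forall>i>N. q i = (\<lambda>x. 0)" "\<forall>x. p x = (\<Sum>i\<le>N. q i x)"
    using polynomial_homogeneous_parts[OF p(1)] by blast
  have q0: "q i 0 = 0" if "i > 0" for i using homogeneous_poly_0 q(1) that by blast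
  have "p 0 = q 0 0 + (\<Sum>i\<in>{..N} - {0}. q i 0)" using q(3) by (subst sum.remove[of _ 0, symmetric]) auto
  then have "q 0 0 = 0" using p(2) q0 by simp
  then have "q 0 = (\<lambda>x. 0)" using homogeneous_poly_const_eq[of "q 0"] q(1) by (metis ext)
  then have "(\<lambda>i. restrict_fan \<Phi> (q i)) \<in> HI" using q(1) by (intro HI_gen) auto
  moreover have "grades (restrict_fan \<Phi> p) (\<lambda>i. restrict_fan \<Phi> (q i))"
    unfolding grades_def
    by (intro conjI exI[of _ N] HI_gen_carrier q(1)) (use q(2,3) in \<open>auto simp: restrict_fan_def fun_eq_iff\<close>)
  ultimately show ?thesis using hat_incl_eq by simp
qed

text \<open>The way the ideal is used: a property that defines an ideal is tested on the
  generators.\<close>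

lemma CI_subset_ideal:
  assumes "ideal I CR" "\<And>p. real_polynomial_function p \<Longrightarrow> p 0 = 0 \<Longrightarrow> restrict_fan \<Phi> p \<in> I"
  shows "CI \<subseteq> I"
  unfolding cpoly_ideal_def
  by (rule ring.genideal_minimal[OF cring.axioms(1)[OF cring_CR] assms(1)]) (use assms(2) in auto)

lemma HI_subset_ideal:
  assumes "ideal I HR"
    "\<And>p. (\<forall>i. homogeneous_poly i (p i)) \<Longrightarrow> p 0 = (\<lambda>x. 0) \<Longrightarrow> (\<lambda>i. restrict_fan \<Phi> (p i)) \<in> I"
  shows "HI \<subseteq> I"
  unfolding hat_ideal_def
  by (rule ring.genideal_minimal[OF cring.axioms(1)[OF cring_HR] assms(1)]) (use assms(2) in auto)

text \<open>The inclusion is multiplicative, so the functions it sends into \<open>hat_ideal\<close>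
  form an ideal, and the generators are among them.\<close>

lemma hat_incl_CI:
  assumes "f \<in> CI" shows "hat_incl \<Phi> f \<in> HI"
proof -
  let ?I = "{f \<in> conepoly \<Phi>. hat_incl \<Phi> f \<in> HI}"
  have "grades 0 0" unfolding grades_def
    by (intro conjI HR_zero_closed exI[of _ 0]) (simp_all add: zero_fun_def)
  then have z: "hat_incl \<Phi> 0 \<in> HI" using hat_incl_eq HI_zero by simp
  have "CI \<subseteq> ?I"
  proof (rule CI_subset_ideal)
    show "ideal ?I CR"
    proof (rule ring_idealI[OF cring_CR])
      fix f r assume f: "f \<in> ?I" and r: "r \<in> carrier CR"
      then show "r \<otimes>\<^bsub>CR\<^esub> f \<in> ?I"
        by (simp add: mult_CR carrier_CR conepoly_mult hat_incl_mult HI_mult_left hat_incl_carrier)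
    qed (auto simp: carrier_CR zero_CR add_CR conepoly_zero conepoly_add z hat_incl_add HI_add)
  qed (simp add: conepoly_restrict hat_incl_restrict_in_HI)
  then show ?thesis using assms by blast
qed

lemma CI_carrier: "f \<in> CI \<Longrightarrow> f \<in> conepoly \<Phi>"
  using ideal.Icarr[OF ideal_CI] by (simp add: carrier_CR)

lemma CI_coset: "CI +>\<^bsub>CR\<^esub> f = {i + f | i. i \<in> CI}"
  by (auto simp: a_r_coset_def' add_CR)

lemma CI_zero: "0 \<in> CI"
  using additive_subgroup.zero_closed[OF ideal.axioms(1)[OF ideal_CI]] by (simp add: zero_CR)

lemma the_elem_constant: "A \<noteq> {} \<Longrightarrow> (\<And>x. x \<in> A \<Longrightarrow> g x = c) \<Longrightarrow> the_elem (g ` A) = c"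
  by (metis (no_types, lifting) image_constant_conv image_cong the_elem_eq)

text \<open>Representatives of one class have congruent images, so the set from which
  \<open>the_elem\<close> takes its value is a singleton.\<close>

lemma H_to_hat_coset:
  assumes f: "f \<in> conepoly \<Phi>"
  shows "H_to_hat \<Phi> (CI +>\<^bsub>CR\<^esub> f) = HI +>\<^bsub>HR\<^esub> hat_incl \<Phi> f"
  unfolding H_to_hat_def
proof (rule the_elem_constant)
  show "CI +>\<^bsub>CR\<^esub> f \<noteq> {}" unfolding CI_coset using CI_zero by blast
  fix g assume "g \<in> CI +>\<^bsub>CR\<^esub> f"
  then have "g \<in> {i + f | i. i \<in> CI}" unfolding CI_coset .
  then obtain i where i: "i \<in> CI" "g = i + f" by (elim CollectE exE conjE)
  then have "hat_incl \<Phi> g - hat_incl \<Phi> f = hat_incl \<Phi> i" using hat_incl_add[OF CI_carrier f] by simp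
  then show "HI +>\<^bsub>HR\<^esub> hat_incl \<Phi> g = HI +>\<^bsub>HR\<^esub> hat_incl \<Phi> f"
    unfolding HI_coset_eq_iff using hat_incl_CI[OF i(1)] by simp
qed

lemma carrier_H_ring: "h \<in> carrier (H_ring \<Phi>) \<longleftrightarrow> (\<exists>f\<in>conepoly \<Phi>. h = CI +>\<^bsub>CR\<^esub> f)"
  by (auto simp: H_ring_def FactRing_def A_RCOSETS_def' carrier_CR)

lemma cone_mono_conewise:
  assumes "\<sigma> \<in> \<Phi>" shows "restrict_fan \<Phi> (cone_mono \<sigma>) \<in> conewise (homogeneous_poly (card (cone_rays \<sigma>))) \<Phi>"
proof -
  have "restrict_fan \<Phi> (cone_mono \<sigma>) = phi_mono (mset_set (cone_rays \<sigma>))"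
    by (auto simp: fun_eq_iff restrict_fan_def Union_fan phi_mono_def cone_mono_def prod_unfold_prod_mset)
  then show ?thesis using mono_conewise[of "mset_set (cone_rays \<sigma>)"] by simp
qed

lemma sum_nat_fun_apply: "(\<Sum>i\<in>I. f i) k = (\<Sum>i\<in>I. f i k)"
  by (induction I rule: infinite_finite_induct) simp_all

text \<open>Finite generation of the cone-wise polynomials over the polynomials makes every element of the
  completed ring congruent to its truncation at degree \<open>n\<close>, up to finitely many products.\<close>

lemma hat_truncation:
  assumes s: "s \<in> carrier HR"
  shows "\<exists>f\<in>conepoly \<Phi>. hat_incl \<Phi> f - s \<in> HI"
proof -
  have "\<forall>i. \<exists>a. (\<forall>\<sigma>\<in>\<Phi>. red_deg i (card (cone_rays \<sigma>)) (a \<sigma>)) \<and> (\<forall>x\<in>V. s i x = (\<Sum>\<sigma>\<in>\<Phi>. a \<sigma> x * cone_mono \<sigma> x))"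
    using s reduces_homogeneous unfolding carrier_HR reduces_def by blast
  then have "\<exists>a. \<forall>i. (\<forall>\<sigma>\<in>\<Phi>. red_deg i (card (cone_rays \<sigma>)) (a i \<sigma>)) \<and>
      (\<forall>x\<in>V. s i x = (\<Sum>\<sigma>\<in>\<Phi>. a i \<sigma> x * cone_mono \<sigma> x))" by (rule choice)
  then obtain a where a0: "\<forall>i. (\<forall>\<sigma>\<in>\<Phi>. red_deg i (card (cone_rays \<sigma>)) (a i \<sigma>)) \<and>
      (\<forall>x\<in>V. s i x = (\<Sum>\<sigma>\<in>\<Phi>. a i \<sigma> x * cone_mono \<sigma> x))" ..
  have a: "\<And>i \<sigma>. \<sigma> \<in> \<Phi> \<Longrightarrow> red_deg i (card (cone_rays \<sigma>)) (a i \<sigma>)"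
    "\<And>i x. x \<in> V \<Longrightarrow> s i x = (\<Sum>\<sigma>\<in>\<Phi>. a i \<sigma> x * cone_mono \<sigma> x)" using a0 by simp_all
  \<comment> \<open>\<open>A \<sigma> i\<close> is the coefficient of
    \<open>cone_mono \<sigma>\<close> in the component of degree
    \<open>i + card (cone_rays \<sigma>)\<close>. Discarding \<open>i = 0\<close> puts the series
    \<open>p \<sigma>\<close> into the ideal.\<close>
  define A where "A \<sigma> i = (if i = 0 then (\<lambda>x. 0) else a (i + card (cone_rays \<sigma>)) \<sigma>)" for \<sigma> i
  define p where "p \<sigma> = (\<lambda>i. restrict_fan \<Phi> (A \<sigma> i))" for \<sigma>
  define m where "m \<sigma> = (\<lambda>i. if i = card (cone_rays \<sigma>) then restrict_fan \<Phi> (cone_mono \<sigma>) else (\<lambda>x. 0))" for \<sigma>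
  have pHI: "p \<sigma> \<in> HI" if \<sigma>: "\<sigma> \<in> \<Phi>" for \<sigma>
    unfolding p_def
  proof (rule HI_gen)
    show "\<forall>i. homogeneous_poly i (A \<sigma> i)"
    proof
      fix i show "homogeneous_poly i (A \<sigma> i)"
        using a(1)[OF \<sigma>, of "i + card (cone_rays \<sigma>)"] by (simp add: A_def red_deg_def homogeneous_poly_zero)
    qed
  qed (simp add: A_def)
  have mHR: "m \<sigma> \<in> carrier HR" if "\<sigma> \<in> \<Phi>" for \<sigma>
    unfolding carrier_HR m_def using cone_mono_conewise[OF that]
    by (auto intro!: conewise_zero homogeneous_poly_zero)
  define u where "u = (\<Sum>\<sigma>\<in>\<Phi>. p \<sigma> \<otimes>\<^bsub>HR\<^esub> m \<sigma>)"
  have u: "u \<in> HI" unfolding u_def by (intro HI_sum HI_mult_right mHR pHI)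
  \<comment> \<open>Above degree \<open>n\<close> nothing has been discarded:
    \<open>k - card (cone_rays \<sigma>)\<close> is positive there.\<close>
  have pm: "(p \<sigma> \<otimes>\<^bsub>HR\<^esub> m \<sigma>) k x = a k \<sigma> x * cone_mono \<sigma> x" if \<sigma>: "\<sigma> \<in> \<Phi>" and k: "k > n" and x: "x \<in> V" for \<sigma> k x
  proof -
    let ?c = "card (cone_rays \<sigma>)"
    have c: "?c < k" using card_rays_le[OF \<sigma>] k by simp
    have "(p \<sigma> \<otimes>\<^bsub>HR\<^esub> m \<sigma>) k x = (\<Sum>j\<le>k. if j = k - ?c then A \<sigma> j x * cone_mono \<sigma> x else 0)"
      unfolding mult_HR p_def m_def using x c
      by (intro sum.cong[OF refl]) (auto simp: restrict_fan_def Union_fan)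
    also have "\<dots> = a k \<sigma> x * cone_mono \<sigma> x" using c by (simp add: A_def)
    finally show ?thesis .
  qed
  define r where "r = s - u"
  have r: "r \<in> carrier HR" unfolding r_def by (rule HR_diff_closed[OF s HI_carrier[OF u]])
  have r0: "r k = (\<lambda>x. 0)" if k: "k > n" for k
  proof
    fix x
    show "r k x = 0"
    proof (cases "x \<in> V")
      case True
      have "u k x = (\<Sum>\<sigma>\<in>\<Phi>. (p \<sigma> \<otimes>\<^bsub>HR\<^esub> m \<sigma>) k x)"
        unfolding u_def
        by (simp only: sum_nat_fun_apply sum_fun_apply)
      also have "\<dots> = (\<Sum>\<sigma>\<in>\<Phi>. a k \<sigma> x * cone_mono \<sigma> x)" by (intro sum.cong[OF refl] pm k True)
      finally show ?thesis using a(2)[OF True, of k] by (simp add: r_def)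
    next
      case False
      then show ?thesis using r conewise_outside by (metis Union_fan carrier_HR)
    qed
  qed
  define f where "f x = (\<Sum>k\<le>n. r k x)" for x
  have "grades f r" unfolding grades_def using r r0 f_def by blast
  then have fr: "hat_incl \<Phi> f = r" by (rule hat_incl_eq)
  have "f \<in> conepoly \<Phi>"
  proof -
    have "(\<lambda>x. \<Sum>k\<in>K. r k x) \<in> conepoly \<Phi>" if "finite K" for K
      using that
    proof (induction K rule: finite_induct)
      case empty then show ?case using conepoly_zero by (simp add: zero_fun_def)
    next
      case (insert k K)
      have "r k \<in> conepoly \<Phi>" using r conewise_homogeneous_conepoly[where i = k and f = "r k"] by (simp add: carrier_HR)
      from conepoly_add[OF this insert.IH] show ?case using insert by (simp add: plus_fun_def)
    qed
    then show ?thesis unfolding f_def[abs_def] by blast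
  qed
  moreover have "hat_incl \<Phi> f - s \<in> HI" using HI_uminus[OF u] by (simp add: fr r_def)
  ultimately show ?thesis by blast
qed

text \<open>Truncation puts the coset of \<open>s\<close> into the image of \<open>H_to_hat\<close>,
  so \<open>inv_into\<close> returns a genuine preimage, and any function representing it is
  congruent to \<open>s\<close>.\<close>

lemma H_proj_representative:
  assumes s: "s \<in> carrier HR"
  shows "\<exists>f\<in>conepoly \<Phi>. H_proj \<Phi> s = CI +>\<^bsub>CR\<^esub> f \<and> hat_incl \<Phi> f - s \<in> HI"
proof -
  obtain g where g: "g \<in> conepoly \<Phi>" "hat_incl \<Phi> g - s \<in> HI" using hat_truncation[OF s] by blast
  have "H_to_hat \<Phi> (CI +>\<^bsub>CR\<^esub> g) = HI +>\<^bsub>HR\<^esub> s" using H_to_hat_coset[OF g(1)] g(2) HI_coset_eq_iff by simp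
  moreover have "CI +>\<^bsub>CR\<^esub> g \<in> carrier (H_ring \<Phi>)" using g(1) carrier_H_ring by blast
  ultimately have im: "HI +>\<^bsub>HR\<^esub> s \<in> H_to_hat \<Phi> ` carrier (H_ring \<Phi>)" by (metis imageI)
  have "H_proj \<Phi> s \<in> carrier (H_ring \<Phi>)" unfolding H_proj_def by (rule inv_into_into[OF im])
  then obtain f where f: "f \<in> conepoly \<Phi>" "H_proj \<Phi> s = CI +>\<^bsub>CR\<^esub> f" using carrier_H_ring by blast
  have "H_to_hat \<Phi> (H_proj \<Phi> s) = HI +>\<^bsub>HR\<^esub> s" unfolding H_proj_def by (rule f_inv_into_f[OF im])
  then have "hat_incl \<Phi> f - s \<in> HI" unfolding f(2) H_to_hat_coset[OF f(1)] HI_coset_eq_iff .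
  then show ?thesis using f by blast
qed

lemma H_ring_mult:
  assumes "f \<in> conepoly \<Phi>" "g \<in> conepoly \<Phi>"
  shows "(CI +>\<^bsub>CR\<^esub> f) \<otimes>\<^bsub>H_ring \<Phi>\<^esub> (CI +>\<^bsub>CR\<^esub> g) = CI +>\<^bsub>CR\<^esub> (\<lambda>x. f x * g x)"
  using ideal.rcoset_mult_add[OF ideal_CI, of f g] assms by (simp add: H_ring_def FactRing_def carrier_CR mult_CR)

end

section \<open>The integral on classes\<close>

context normalized_fan
begin

definition intg :: "('a \<Rightarrow> real) \<Rightarrow> real"
  where "intg f = brion_zeta \<Lambda> \<Omega> \<Phi> f 0"

lemma intg_eq: "represents f a \<Longrightarrow> intg f = (\<Sum>\<kappa>\<in>Max_cones. a \<kappa> 0)"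
  by (simp add: intg_def brion_zeta_eq span_zero)

lemma intg_add:
  assumes "f \<in> conepoly \<Phi>" "g \<in> conepoly \<Phi>" shows "intg (f + g) = intg f + intg g"
proof -
  obtain a where a: "represents f a" using represents_exists[OF assms(1)] by blast
  obtain b where b: "represents g b" using represents_exists[OF assms(2)] by blast
  have "represents (f + g) (\<lambda>\<sigma> x. a \<sigma> x + b \<sigma> x)"
    using a b by (auto simp: represents_def sum.distrib algebra_simps intro: real_polynomial_function.intros(3))
  then show ?thesis using intg_eq a b by (simp add: sum.distrib)
qed

text \<open>Multiplying all coefficients of a presentation by \<open>p\<close> presents the
  product.\<close>

lemma intg_poly_mult:
  assumes "f \<in> conepoly \<Phi>" "real_polynomial_function p"
  shows "intg (\<lambda>x. f x * restrict_fan \<Phi> p x) = p 0 * intg f"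
proof -
  obtain a where a: "represents f a" using represents_exists[OF assms(1)] by blast
  have "represents (\<lambda>x. f x * restrict_fan \<Phi> p x) (\<lambda>\<sigma> x. p x * a \<sigma> x)"
    unfolding represents_def
  proof (intro conjI ballI)
    fix \<sigma> assume "\<sigma> \<in> \<Phi>"
    then show "real_polynomial_function (\<lambda>x. p x * a \<sigma> x)"
      using a assms(2) by (intro real_polynomial_function.intros(4)) (simp_all add: represents_def)
  next
    fix x assume "x \<in> V"
    then show "f x * restrict_fan \<Phi> p x = (\<Sum>\<sigma>\<in>\<Phi>. p x * a \<sigma> x * cone_mono \<sigma> x)"
      using a by (simp add: represents_def restrict_fan_def Union_fan sum_distrib_left mult_ac)
  qed
  then show ?thesis using intg_eq a by (simp add: sum_distrib_left)
qed

lemma intg_zero: "intg 0 = 0"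
  using intg_add[OF conepoly_zero conepoly_zero] by simp

lemma intg_sum:
  assumes "finite I" "\<And>i. i \<in> I \<Longrightarrow> f i \<in> conepoly \<Phi>"
  shows "(\<Sum>i\<in>I. f i) \<in> conepoly \<Phi> \<and> intg (\<Sum>i\<in>I. f i) = (\<Sum>i\<in>I. intg (f i))"
  using assms by (induction I rule: finite_induct) (simp_all add: conepoly_zero conepoly_add intg_zero intg_add)

text \<open>The kernel of the integral need not be an ideal. The functions all of whose multiples
  have integral 0 do form one, and it contains the generators by
  \<open>intg_poly_mult\<close>.\<close>

lemma intg_CI:
  assumes "f \<in> CI" shows "intg f = 0"
proof -
  let ?I = "{f \<in> conepoly \<Phi>. \<forall>r\<in>conepoly \<Phi>. intg (\<lambda>x. r x * f x) = 0}"
  have "CI \<subseteq> ?I"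
  proof (rule CI_subset_ideal)
    show "ideal ?I CR"
    proof (rule ring_idealI[OF cring_CR])
      show "\<zero>\<^bsub>CR\<^esub> \<in> ?I" using intg_zero conepoly_zero by (simp add: zero_CR zero_fun_def)
      fix f assume f: "f \<in> ?I"
      show "f \<oplus>\<^bsub>CR\<^esub> g \<in> ?I" if g: "g \<in> ?I" for g
      proof -
        have "intg (\<lambda>x. r x * (f + g) x) = 0" if r: "r \<in> conepoly \<Phi>" for r
          using intg_add[OF conepoly_mult[OF r] conepoly_mult[OF r], of f g] f g r
          by (simp add: plus_fun_def distrib_left)
        then show ?thesis using f g conepoly_add by (simp add: add_CR)
      qed
      show "s \<otimes>\<^bsub>CR\<^esub> f \<in> ?I" if s: "s \<in> carrier CR" for s
      proof -
        have "intg (\<lambda>x. r x * (s x * f x)) = 0" if r: "r \<in> conepoly \<Phi>" for r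
          using f conepoly_mult[OF r, of s] s by (simp add: carrier_CR mult.assoc[symmetric])
        then show ?thesis using f s conepoly_mult by (simp add: mult_CR carrier_CR)
      qed
    qed (auto simp: carrier_CR)
    fix p :: "'a \<Rightarrow> real" assume p: "real_polynomial_function p" "p 0 = 0"
    show "restrict_fan \<Phi> p \<in> ?I" using conepoly_restrict[OF p(1)] intg_poly_mult[OF _ p(1)] p(2) by simp
  qed
  then have f: "f \<in> ?I" using assms by blast
  have "restrict_fan \<Phi> (\<lambda>_. 1) \<in> conepoly \<Phi>"
    by (rule conepoly_restrict) (rule real_polynomial_function.intros(2))
  then have "intg (\<lambda>x. restrict_fan \<Phi> (\<lambda>_. 1) x * f x) = 0" using f by blast
  then show ?thesis using f by (simp add: restrict_mult[where P = real_polynomial_function])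
qed

lemma fan_integral_coset:
  assumes f: "f \<in> conepoly \<Phi>" shows "fan_integral \<Lambda> \<Omega> \<Phi> (CI +>\<^bsub>CR\<^esub> f) = intg f"
  unfolding fan_integral_def
proof (rule the_elem_constant)
  show "CI +>\<^bsub>CR\<^esub> f \<noteq> {}" unfolding CI_coset using CI_zero by blast
  fix g assume "g \<in> CI +>\<^bsub>CR\<^esub> f"
  then have "g \<in> {i + f | i. i \<in> CI}" unfolding CI_coset .
  then obtain i where i: "i \<in> CI" "g = i + f" by (elim CollectE exE conjE)
  then show "brion_zeta \<Lambda> \<Omega> \<Phi> g 0 = intg f"
    using intg_add[OF CI_carrier f] intg_CI by (simp add: intg_def)
qed

lemma homogeneous_represents:
  assumes "f \<in> conewise (homogeneous_poly i) \<Phi>"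
  obtains a where "represents f a" "\<forall>\<sigma>\<in>\<Phi>. red_deg i (card (cone_rays \<sigma>)) (a \<sigma>)"
proof -
  obtain a where a: "\<forall>\<sigma>\<in>\<Phi>. red_deg i (card (cone_rays \<sigma>)) (a \<sigma>)" "\<forall>x\<in>V. f x = (\<Sum>\<sigma>\<in>\<Phi>. a \<sigma> x * cone_mono \<sigma> x)"
    using reduces_homogeneous[OF assms] by (rule reducesE)
  show ?thesis
  proof (rule that[OF _ a(1)])
    show "represents f a" unfolding represents_def
      by (intro conjI a(2) ballI) (rule red_deg_polynomial[OF bspec[OF a(1)]])
  qed
qed

text \<open>The coefficient at a maximal cone has degree \<open>i - n\<close>: if this is positive
  it vanishes at 0, and if negative it is 0 by \<open>red_deg\<close>.\<close>

lemma intg_homogeneous_other: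
  assumes "f \<in> conewise (homogeneous_poly i) \<Phi>" "i \<noteq> n" shows "intg f = 0"
proof -
  obtain a where a: "represents f a" "\<forall>\<sigma>\<in>\<Phi>. red_deg i (card (cone_rays \<sigma>)) (a \<sigma>)"
    using homogeneous_represents[OF assms(1)] .
  have "a \<kappa> 0 = 0" if "\<kappa> \<in> Max_cones" for \<kappa>
  proof -
    have "\<kappa> \<in> \<Phi>" "card (cone_rays \<kappa>) = n" using that by (simp_all add: Max_cones_iff)
    then have "red_deg i n (a \<kappa>)" using bspec[OF a(2), of \<kappa>] by simp
    then show ?thesis using homogeneous_poly_0[of "i - n" "a \<kappa>"] assms(2) by (simp add: red_deg_def split: if_splits)
  qed
  then show ?thesis using intg_eq[OF a(1)] by simp
qed

text \<open>In degree \<open>n\<close> the coefficients at the maximal cones are constants, so the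
  value at the origin, where all denominators of positive degree vanish, can be computed at any
  generic point.\<close>

lemma intg_homogeneous_top:
  assumes "f \<in> conewise (homogeneous_poly n) \<Phi>" "generic x"
  shows "intg f = (\<Sum>\<kappa>\<in>Max_cones. loc \<kappa> f x / (\<Prod>\<rho>\<in>cone_rays \<kappa>. coord \<kappa> \<rho> x))"
proof -
  obtain a where a: "represents f a" "\<forall>\<sigma>\<in>\<Phi>. red_deg n (card (cone_rays \<sigma>)) (a \<sigma>)"
    using homogeneous_represents[OF assms(1)] .
  have "a \<kappa> x = a \<kappa> 0" if "\<kappa> \<in> Max_cones" for \<kappa>
  proof -
    have "\<kappa> \<in> \<Phi>" "card (cone_rays \<kappa>) = n" using that by (simp_all add: Max_cones_iff)
    then have "red_deg n n (a \<kappa>)" using bspec[OF a(2), of \<kappa>] by simp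
    then show ?thesis using homogeneous_poly_const_eq by (simp add: red_deg_def)
  qed
  then show ?thesis using intg_eq[OF a(1)] localization_sum[OF a(1) assms(2)] by simp
qed

lemma intg_hat_incl:
  assumes "f \<in> conepoly \<Phi>" shows "intg f = intg (hat_incl \<Phi> f n)"
proof -
  let ?s = "hat_incl \<Phi> f"
  obtain N where s: "?s \<in> carrier HR" "\<forall>i>N. ?s i = (\<lambda>x. 0)" "\<forall>M\<ge>N. \<forall>x. f x = (\<Sum>i\<le>M. ?s i x)"
    by (rule gradesE[OF grades_exists[OF assms]])
  have con: "?s i \<in> conepoly \<Phi>" for i
    using s(1) conewise_homogeneous_conepoly[where i = i and f = "?s i"] by (simp add: carrier_HR)
  have "f = (\<Sum>i\<le>max N n. ?s i)" using s(3)[rule_format, of "max N n"] by (simp add: fun_eq_iff sum_fun_apply)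
  then have "intg f = (\<Sum>i\<le>max N n. intg (?s i))" using intg_sum[of "{..max N n}" ?s] con by simp
  also have "\<dots> = (\<Sum>i\<le>max N n. if i = n then intg (?s i) else 0)"
  proof (rule sum.cong[OF refl])
    fix i
    have "?s i \<in> conewise (homogeneous_poly i) \<Phi>" using s(1) by (simp add: carrier_HR)
    then show "intg (?s i) = (if i = n then intg (?s i) else 0)" using intg_homogeneous_other[where i = i and f = "?s i"] by simp
  qed
  finally show ?thesis by simp
qed

lemma HR_nth_conepoly: "s \<in> carrier HR \<Longrightarrow> s i \<in> conepoly \<Phi>"
  unfolding carrier_HR by (rule conewise_homogeneous_conepoly[where i = i]) (rule spec)

text \<open>As for \<open>cpoly_ideal\<close>, now with the component of degree \<open>n\<close>:
  sequences all of whose multiples have integral 0 there form an ideal, and it contains the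
  generators because each component of a generator is a polynomial vanishing at 0.\<close>

lemma intg_HI:
  assumes "s \<in> HI" shows "intg (s n) = 0"
proof -
  let ?I = "{s \<in> carrier HR. \<forall>r\<in>carrier HR. intg ((r \<otimes>\<^bsub>HR\<^esub> s) n) = 0}"
  have dist: "r \<otimes>\<^bsub>HR\<^esub> (s + t) = r \<otimes>\<^bsub>HR\<^esub> s + r \<otimes>\<^bsub>HR\<^esub> t" for r s t
    by (rule ser_ext) (simp add: ser_mult ser_add algebra_simps)
  have assoc: "r \<otimes>\<^bsub>HR\<^esub> (s \<otimes>\<^bsub>HR\<^esub> t) = (r \<otimes>\<^bsub>HR\<^esub> s) \<otimes>\<^bsub>HR\<^esub> t" for r s t
    by (rule ser_ext) (simp add: ser_mult algebra_simps)
  have "HI \<subseteq> ?I"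
  proof (rule HI_subset_ideal)
    show "ideal ?I HR"
    proof (rule ring_idealI[OF cring_HR])
      have "r \<otimes>\<^bsub>HR\<^esub> 0 = 0" for r by (simp add: mult_HR fun_eq_iff)
      then show "\<zero>\<^bsub>HR\<^esub> \<in> ?I" using intg_zero HR_zero_closed by (simp add: zero_HR)
      fix s assume s: "s \<in> ?I"
      show "s \<oplus>\<^bsub>HR\<^esub> t \<in> ?I" if t: "t \<in> ?I" for t
      proof -
        have "intg ((r \<otimes>\<^bsub>HR\<^esub> (s + t)) n) = 0" if r: "r \<in> carrier HR" for r
          using intg_add[OF HR_nth_conepoly[OF HR_mult_closed[OF r, of s]] HR_nth_conepoly[OF HR_mult_closed[OF r, of t]]] s t r
          by (simp add: dist)
        then show ?thesis using s t HR_add_closed by (simp add: add_HR)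
      qed
      show "t \<otimes>\<^bsub>HR\<^esub> s \<in> ?I" if t: "t \<in> carrier HR" for t
        using s t HR_mult_closed by (simp add: assoc)
    qed auto
    fix p :: "nat \<Rightarrow> 'a \<Rightarrow> real" assume p: "\<forall>i. homogeneous_poly i (p i)" "p 0 = (\<lambda>x. 0)"
    have p0: "p i 0 = 0" for i using homogeneous_poly_0[of i "p i"] p by (cases "i = 0") auto
    have "intg ((r \<otimes>\<^bsub>HR\<^esub> (\<lambda>i. restrict_fan \<Phi> (p i))) n) = 0" if r: "r \<in> carrier HR" for r
    proof -
      have "(r \<otimes>\<^bsub>HR\<^esub> (\<lambda>i. restrict_fan \<Phi> (p i))) n = (\<Sum>j\<le>n. (\<lambda>x. r j x * restrict_fan \<Phi> (p (n - j)) x))"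
        by (simp add: mult_HR sum_fun_apply)
      moreover have "(\<lambda>x. r j x * restrict_fan \<Phi> (p (n - j)) x) \<in> conepoly \<Phi>" for j
        by (rule conepoly_mult[OF HR_nth_conepoly[OF r] conepoly_restrict[OF homogeneous_polyD[OF p(1)[rule_format]]]])
      moreover have "intg (\<lambda>x. r j x * restrict_fan \<Phi> (p (n - j)) x) = 0" for j
        using intg_poly_mult[OF HR_nth_conepoly[OF r] homogeneous_polyD[OF p(1)[rule_format, of "n - j"]]] p0 by simp
      ultimately show ?thesis using intg_sum[of "{..n}" "\<lambda>j x. r j x * restrict_fan \<Phi> (p (n - j)) x"] by simp
    qed

    then show "(\<lambda>i. restrict_fan \<Phi> (p i)) \<in> ?I"
      by (intro CollectI conjI ballI HI_gen_carrier p(1))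
  qed
  then have s: "s \<in> ?I" using assms by blast
  have "\<one>\<^bsub>HR\<^esub> \<otimes>\<^bsub>HR\<^esub> s = s" using cring_HR s by (simp add: monoid.l_one[OF ring.is_monoid[OF cring.axioms(1)]])
  then show ?thesis using s HR_one_closed by (metis (mono_tags, lifting) mem_Collect_eq)
qed

text \<open>The two classes have function representatives congruent to \<open>c\<close> and
  \<open>t\<close>, and the integral of a function is that of its component of degree
  \<open>n\<close>. Thus the product may be formed in the completed ring.\<close>

theorem fan_integral_product:
  assumes c: "c \<in> carrier HR" and t: "t \<in> carrier HR"
  shows "fan_integral \<Lambda> \<Omega> \<Phi> (H_proj \<Phi> c \<otimes>\<^bsub>H_ring \<Phi>\<^esub> H_proj \<Phi> t) = intg ((c \<otimes>\<^bsub>HR\<^esub> t) n)"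
proof -
  obtain f where f: "f \<in> conepoly \<Phi>" "H_proj \<Phi> c = CI +>\<^bsub>CR\<^esub> f" "hat_incl \<Phi> f - c \<in> HI"
    using H_proj_representative[OF c] by blast
  obtain g where g: "g \<in> conepoly \<Phi>" "H_proj \<Phi> t = CI +>\<^bsub>CR\<^esub> g" "hat_incl \<Phi> g - t \<in> HI"
    using H_proj_representative[OF t] by blast
  note hf = hat_incl_carrier[OF f(1)] and hg = hat_incl_carrier[OF g(1)]
  \<comment> \<open>The usual error term of a product,
    \<open>f g - c t = (f - c) g + c (g - t)\<close>.\<close>
  define d where "d = (hat_incl \<Phi> f - c) \<otimes>\<^bsub>HR\<^esub> hat_incl \<Phi> g + c \<otimes>\<^bsub>HR\<^esub> (hat_incl \<Phi> g - t)"
  have d: "d \<in> HI" unfolding d_def by (intro HI_add HI_mult_left HI_mult_right f g c hg)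
  have "hat_incl \<Phi> f \<otimes>\<^bsub>HR\<^esub> hat_incl \<Phi> g = c \<otimes>\<^bsub>HR\<^esub> t + d"
  proof (rule ser_ext)
    fix x
    have diff: "ser x (u - w) = ser x u - ser x w" for u w by (simp add: ser_def fps_eq_iff)
    show "ser x (hat_incl \<Phi> f \<otimes>\<^bsub>HR\<^esub> hat_incl \<Phi> g) = ser x (c \<otimes>\<^bsub>HR\<^esub> t + d)"
      by (simp add: d_def ser_mult ser_add diff algebra_simps)
  qed
  then have "intg (\<lambda>x. f x * g x) = intg ((c \<otimes>\<^bsub>HR\<^esub> t) n + d n)"
    using intg_hat_incl[OF conepoly_mult[OF f(1) g(1)]] by (simp add: hat_incl_mult[OF f(1) g(1)])
  also have "\<dots> = intg ((c \<otimes>\<^bsub>HR\<^esub> t) n)"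
    using intg_add[OF HR_nth_conepoly[OF HR_mult_closed[OF c t]] HR_nth_conepoly[OF HI_carrier[OF d]]] intg_HI[OF d] by simp
  finally show ?thesis
    unfolding f(2) g(2) H_ring_mult[OF f(1) g(1)] by (simp add: fan_integral_coset[OF conepoly_mult[OF f(1) g(1)]])
qed

end

section \<open>Chern character and Todd class\<close>

text \<open>The substitution of \<open>c t\<close> for the variable, which turns a series into its
  value at a Courant function equal to \<open>c\<close>, graded by degree.\<close>

definition fps_scale :: "real fps \<Rightarrow> real \<Rightarrow> real fps"
  where "fps_scale G c = Abs_fps (\<lambda>i. fps_nth G i * c ^ i)"

lemma fps_scale_mult: "fps_scale (G * H) c = fps_scale G c * fps_scale H c"
proof (rule fps_ext)
  fix i
  have "fps_nth G j * fps_nth H (i - j) * c ^ i = (fps_nth G j * c ^ j) * (fps_nth H (i - j) * c ^ (i - j))"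
    if "j \<le> i" for j
    using that power_add[of c j "i - j"] by (simp add: mult_ac)
  then show "fps_nth (fps_scale (G * H) c) i = fps_nth (fps_scale G c * fps_scale H c) i"
    unfolding fps_scale_def fps_mult_nth fps_nth_Abs_fps sum_distrib_right by (intro sum.cong[OF refl]) simp
qed

lemma fps_scale_diff: "fps_scale (G - H) c = fps_scale G c - fps_scale H c"
  and fps_scale_one: "fps_scale 1 c = 1"
  and fps_scale_exp: "fps_scale (fps_exp (-1)) c = fps_exp (- c)"
  by (auto simp: fps_scale_def fps_eq_iff algebra_simps power_minus[of c])

lemma fps_scale_X: "fps_scale fps_X c = fps_const c * fps_X"
  by (rule fps_ext) (simp add: fps_scale_def fps_X_def)

lemma fps_scale_0: "fps_scale G 0 = fps_const (fps_nth G 0)"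
  by (rule fps_ext) (simp add: fps_scale_def)

abbreviation todd :: "real fps"
  where "todd \<equiv> fps_X / (1 - fps_exp (-1))"

text \<open>The division in \<open>todd\<close> is exact: the divisor divides \<open>fps_X\<close>,
  with quotient \<open>- bern (-1)\<close>.\<close>

lemma todd_mult: "todd * (1 - fps_exp (-1)) = fps_X"
proof -
  have "fps_X = (1 - fps_exp (-1)) * (- bern (-1))" using bern_mult[of "-1"] by (simp add: algebra_simps)
  then have "1 - fps_exp (-1) dvd (fps_X :: real fps)" by (rule dvdI)
  then show ?thesis by (rule dvd_div_mult_self)
qed

text \<open>This normalization makes rays with coordinate 0 drop out of the localized Todd
  class.\<close>

lemma todd_nth_0: "fps_nth todd 0 = 1"
proof -
  have "fps_nth (todd * (1 - fps_exp (-1))) 1 = 1" unfolding todd_mult by simp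
  then show ?thesis by (simp add: fps_mult_nth)
qed

lemma fps_scale_todd: "fps_scale todd c * (1 - fps_exp (- c)) = fps_const c * fps_X"
  using fps_scale_mult[of todd "1 - fps_exp (-1)" c]
  unfolding todd_mult fps_scale_diff fps_scale_one fps_scale_exp fps_scale_X by simp

text \<open>In closed form, \<open>exp (- c t)\<close> times \<open>c t / (1 - exp (- c t))\<close>
  is \<open>c t / (exp (c t) - 1)\<close>; the common factor \<open>exp (c t) - 1\<close> is nonzero
  and cancels.\<close>

lemma fps_scale_todd_bern:
  assumes "c \<noteq> 0" shows "fps_exp (- c) * fps_scale todd c = fps_const c * bern c"
proof -
  have e: "fps_exp (- c) * fps_exp c = 1" using fps_exp_add_mult[of "- c" c] by simp
  have "fps_exp (- c) * fps_scale todd c * (fps_exp c - 1) = fps_scale todd c * (fps_exp (- c) * fps_exp c - fps_exp (- c))"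
    by (simp add: algebra_simps)
  also have "\<dots> = fps_const c * fps_X" unfolding e by (rule fps_scale_todd)
  also have "\<dots> = fps_const c * bern c * (fps_exp c - 1)" by (simp add: bern_mult[OF assms] mult.assoc)
  finally show ?thesis using exp_minus_1_nonzero[OF assms] by simp
qed

lemma sum_Pow_prod:
  fixes a b :: "'i \<Rightarrow> 'b::comm_ring_1"
  assumes "finite A"
  shows "(\<Sum>S\<in>Pow A. \<Prod>i\<in>A. if i \<in> S then a i else b i) = (\<Prod>i\<in>A. a i + b i)"
  unfolding prod_add[OF assms]
proof (rule sum.cong[OF refl])
  fix S assume "S \<in> Pow A"
  then have "A \<inter> S = S" "A \<inter> - S = A - S" by auto
  then show "(\<Prod>i\<in>A. if i \<in> S then a i else b i) = prod a S * prod b (A - S)"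
    using prod.If_cases[OF assms, of "\<lambda>i. i \<in> S" a b] by simp
qed

lemma fps_const_prod: "(\<Prod>i\<in>A. fps_const (f i)) = fps_const (\<Prod>i\<in>A. f i :: 'b::comm_ring_1)"
  by (induction A rule: infinite_finite_induct) simp_all

context unimodular_complete_fan
begin

lemma homogeneous_poly_power:
  assumes "linear p" shows "homogeneous_poly i (\<lambda>x. c * p x ^ i)"
proof (induction i)
  case 0
  show ?case using homogeneous_poly_const by simp
next
  case (Suc i)
  from homogeneous_poly_mult[OF homogeneous_poly_linear[OF assms] Suc]
  show ?case by (simp add: mult_ac)
qed

lemma fps_at_phi_closed: "fps_at \<Phi> G (phi \<rho>) \<in> carrier HR"
  unfolding carrier_HR
proof
  fix i
  have cont: "continuous_on (\<Union>\<Phi>) (phi \<rho>)" and lin: "\<forall>\<sigma>\<in>\<Phi>. \<exists>p. linear p \<and> (\<forall>x\<in>\<sigma>. phi \<rho> x = p x)"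
    using phi_conewise[of \<rho>] unfolding conewise_def by simp_all
  show "fps_at \<Phi> G (phi \<rho>) i \<in> conewise (homogeneous_poly i) \<Phi>"
    unfolding conewise_def
  proof (intro CollectI conjI allI impI ballI)
    have "continuous_on (\<Union>\<Phi>) (\<lambda>x. fps_nth G i * phi \<rho> x ^ i)" by (intro continuous_intros cont)
    then show "continuous_on (\<Union>\<Phi>) (fps_at \<Phi> G (phi \<rho>) i)"
      by (rule continuous_on_eq) (simp add: fps_at_def restrict_fan_def)
    show "fps_at \<Phi> G (phi \<rho>) i x = 0" if "x \<notin> \<Union>\<Phi>" for x using that by (simp add: fps_at_def restrict_fan_def)
    fix \<sigma> assume \<sigma>: "\<sigma> \<in> \<Phi>"
    obtain p where p: "linear p" "\<forall>x\<in>\<sigma>. phi \<rho> x = p x" using bspec[OF lin \<sigma>] by (elim exE conjE)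
    show "\<exists>p. homogeneous_poly i p \<and> (\<forall>x\<in>\<sigma>. fps_at \<Phi> G (phi \<rho>) i x = p x)"
    proof (intro exI[of _ "\<lambda>x. fps_nth G i * p x ^ i"] conjI ballI homogeneous_poly_power p(1))
      fix x assume "x \<in> \<sigma>"
      moreover have "x \<in> \<Union>\<Phi>" using \<open>x \<in> \<sigma>\<close> \<sigma> by blast
      ultimately show "fps_at \<Phi> G (phi \<rho>) i x = fps_nth G i * p x ^ i" using p(2) by (simp add: fps_at_def restrict_fan_def)
    qed
  qed
qed

lemma comm_monoid_HR: "comm_monoid HR"
  using cring_HR by (simp add: cring_def)

lemma finprod_HR_closed: "(\<And>a. a \<in> A \<Longrightarrow> f a \<in> carrier HR) \<Longrightarrow> finprod HR f A \<in> carrier HR"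
  by (rule comm_monoid.finprod_closed[OF comm_monoid_HR]) blast

text \<open>Stated for an abstract multiplicative \<open>F\<close>, since both the values
  \<open>ser x\<close> at points of \<open>V\<close> and the localizations
  \<open>locser \<kappa> x\<close> are instances.\<close>

lemma finprod_HR_hom:
  fixes F :: "(nat \<Rightarrow> 'a \<Rightarrow> real) \<Rightarrow> real fps"
  assumes A: "finite A" and f: "\<And>a. a \<in> A \<Longrightarrow> f a \<in> carrier HR" and one: "F \<one>\<^bsub>HR\<^esub> = 1"
    and mult: "\<And>s t. s \<in> carrier HR \<Longrightarrow> t \<in> carrier HR \<Longrightarrow> F (s \<otimes>\<^bsub>HR\<^esub> t) = F s * F t"
  shows "F (finprod HR f A) = (\<Prod>a\<in>A. F (f a))"
  using A f
proof (induction A rule: finite_induct)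
  case empty
  show ?case using one by (simp add: comm_monoid.finprod_empty[OF comm_monoid_HR])
next
  case (insert a A)
  have "finprod HR f (insert a A) = f a \<otimes>\<^bsub>HR\<^esub> finprod HR f A"
    by (rule comm_monoid.finprod_insert[OF comm_monoid_HR insert.hyps]) (use insert.prems in auto)
  then show ?case using insert by (simp add: mult finprod_HR_closed)
qed

lemma ser_fps_at: "x \<in> V \<Longrightarrow> ser x (fps_at \<Phi> G \<phi>) = fps_scale G (\<phi> x)"
  by (simp add: ser_def fps_at_def restrict_fan_def Union_fan fps_scale_def)

lemma ser_diff: "ser x (s - t) = ser x s - ser x t"
  by (simp add: ser_def fps_eq_iff)

abbreviation ray_exp :: "'a set \<Rightarrow> nat \<Rightarrow> 'a \<Rightarrow> real"
  where "ray_exp \<rho> \<equiv> fps_at \<Phi> (fps_exp (-1)) (phi \<rho>)"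

text \<open>The Chern character of a one-dimensional sheaf supported at \<open>\<tau>\<close>.\<close>

definition delta_ch :: "'a set \<Rightarrow> nat \<Rightarrow> 'a \<Rightarrow> real"
  where "delta_ch \<tau> = finprod HR (\<lambda>\<rho>. if \<rho> \<in> cone_rays \<tau> then \<one>\<^bsub>HR\<^esub> - ray_exp \<rho> else ray_exp \<rho>) R"

lemma delta_factor_closed: "(if P then \<one>\<^bsub>HR\<^esub> - ray_exp \<rho> else ray_exp \<rho>) \<in> carrier HR"
  by (simp add: HR_diff_closed HR_one_closed fps_at_phi_closed)

lemma delta_ch_closed: "delta_ch \<tau> \<in> carrier HR"
  unfolding delta_ch_def by (rule finprod_HR_closed) (rule delta_factor_closed)

lemma HR_sum_closed: "(\<And>i. i \<in> I \<Longrightarrow> f i \<in> carrier HR) \<Longrightarrow> sum f I \<in> carrier HR"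
  by (induction I rule: infinite_finite_induct) (simp_all add: HR_zero_closed HR_add_closed)

lemma ser_zero: "ser x 0 = 0"
  by (simp add: ser_def fps_eq_iff)

lemma ser_sum: "ser x (sum f I) = (\<Sum>i\<in>I. ser x (f i))"
  by (induction I rule: infinite_finite_induct) (simp_all only: sum.infinite sum.empty sum.insert ser_zero ser_add not_False_eq_True)

text \<open>At a fixed point, the sum over cones without common ray with \<sigma> can be enlarged to
  all sets of rays outside \<sigma>, because the new terms vanish. It then factorizes, each ray
  outside \<sigma> contributing \<open>(1 - a \<rho>) + a \<rho> = 1\<close>.\<close>

lemma delta_ch_sum:
  assumes \<sigma>: "\<sigma> \<in> \<Phi>"
  shows "(\<Sum>\<tau>\<in>\<Phi>. if cone_rays \<sigma> \<inter> cone_rays \<tau> = {} then delta_ch \<tau> else 0) = finprod HR ray_exp (cone_rays \<sigma>)"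
    (is "?L = ?P")
proof (rule ser_ext)
  fix x
  have P: "?P \<in> carrier HR" by (intro finprod_HR_closed fps_at_phi_closed)
  have L: "?L \<in> carrier HR" by (intro HR_sum_closed) (simp add: delta_ch_closed HR_zero_closed)
  show "ser x ?L = ser x ?P"
  proof (cases "x \<in> V")
    case x: True
    then obtain \<kappa> where \<kappa>: "\<kappa> \<in> \<Phi>" "x \<in> \<kappa>" by (rule V_cases)
    define a where "a \<rho> = fps_exp (- phi \<rho> x)" for \<rho>
    have sa: "ser x (ray_exp \<rho>) = a \<rho>" for \<rho> unfolding ser_fps_at[OF x] fps_scale_exp a_def ..
    define T where "T S = (\<Prod>\<rho>\<in>R. if \<rho> \<in> S then 1 - a \<rho> else a \<rho>)" for S
    have sd: "ser x (delta_ch \<tau>) = T (cone_rays \<tau>)" for \<tau>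
    proof -
      have "ser x (delta_ch \<tau>) = (\<Prod>\<rho>\<in>R. ser x (if \<rho> \<in> cone_rays \<tau> then \<one>\<^bsub>HR\<^esub> - ray_exp \<rho> else ray_exp \<rho>))"
        unfolding delta_ch_def
        by (rule finprod_HR_hom[OF finite_R delta_factor_closed]) (simp_all add: ser_one x ser_mult)
      also have "\<dots> = T (cone_rays \<tau>)" unfolding T_def
        by (intro prod.cong[OF refl]) (simp add: ser_diff ser_one x sa)
      finally show ?thesis .
    qed
    \<comment> \<open>A set that is not the set of rays of a cone contains a ray outside \<kappa>;
      its Courant function is 0 at \<open>x\<close>, and its factor is \<open>1 - 1\<close>.\<close>
    have T0: "T S = 0" if S: "S \<subseteq> R" "S \<notin> cone_rays ` \<Phi>" for S
    proof -
      have "\<not> S \<subseteq> cone_rays \<kappa>"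
      proof
        assume "S \<subseteq> cone_rays \<kappa>"
        then obtain \<tau> where "\<tau> \<in> \<Phi>" "cone_rays \<tau> = S" by (rule subset_rays_face[OF \<kappa>(1)])
        then show False using S(2) by blast
      qed
      then obtain \<rho> where \<rho>: "\<rho> \<in> S" "\<rho> \<notin> cone_rays \<kappa>" by blast
      have "a \<rho> = 1" using phi_zero[OF \<kappa> \<rho>(2)] by (simp add: a_def)
      then show ?thesis unfolding T_def using \<rho>(1) S(1)
        by (intro prod_zero bexI[of _ \<rho>] finite_R) auto
    qed
    let ?D = "{\<tau> \<in> \<Phi>. cone_rays \<sigma> \<inter> cone_rays \<tau> = {}}"
    have inj: "inj_on cone_rays ?D" by (rule inj_onI) (use rays_inj in blast)
    have sub: "cone_rays ` ?D \<subseteq> Pow (R - cone_rays \<sigma>)" using cone_rays_subset by blast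
    have "ser x ?L = (\<Sum>\<tau>\<in>?D. T (cone_rays \<tau>))"
      unfolding ser_sum sum.inter_filter[OF finite_fan] by (intro sum.cong[OF refl]) (simp add: sd ser_zero)
    also have "\<dots> = (\<Sum>S\<in>cone_rays ` ?D. T S)" by (simp add: sum.reindex[OF inj])
    also have "\<dots> = (\<Sum>S\<in>Pow (R - cone_rays \<sigma>). T S)"
    proof (rule sum.mono_neutral_left[OF _ sub])
      show "\<forall>S\<in>Pow (R - cone_rays \<sigma>) - cone_rays ` ?D. T S = 0"
      proof
        fix S assume S: "S \<in> Pow (R - cone_rays \<sigma>) - cone_rays ` ?D"
        then have "S \<notin> cone_rays ` \<Phi>" by blast
        then show "T S = 0" using S by (intro T0) auto
      qed
    qed (simp add: finite_R[simplified])
    also have "\<dots> = (\<Sum>S\<in>Pow (R - cone_rays \<sigma>). (\<Prod>\<rho>\<in>R - cone_rays \<sigma>. if \<rho> \<in> S then 1 - a \<rho> else a \<rho>) * (\<Prod>\<rho>\<in>cone_rays \<sigma>. a \<rho>))"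
    proof (rule sum.cong[OF refl])
      fix S assume "S \<in> Pow (R - cone_rays \<sigma>)"
      then have "(\<Prod>\<rho>\<in>cone_rays \<sigma>. if \<rho> \<in> S then 1 - a \<rho> else a \<rho>) = (\<Prod>\<rho>\<in>cone_rays \<sigma>. a \<rho>)"
        by (intro prod.cong[OF refl]) auto
      then show "T S = (\<Prod>\<rho>\<in>R - cone_rays \<sigma>. if \<rho> \<in> S then 1 - a \<rho> else a \<rho>) * (\<Prod>\<rho>\<in>cone_rays \<sigma>. a \<rho>)"
        unfolding T_def prod.subset_diff[OF cone_rays_subset[OF \<sigma>] finite_R] by simp
    qed
    also have "\<dots> = (\<Prod>\<rho>\<in>cone_rays \<sigma>. a \<rho>)"
      unfolding sum_distrib_right[symmetric] sum_Pow_prod[OF finite_Diff[OF finite_R]] by simp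
    also have "\<dots> = ser x ?P"
      by (subst finprod_HR_hom[OF finite_rays[OF \<sigma>] fps_at_phi_closed]) (simp_all add: ser_one x ser_mult sa)
    finally show ?thesis .
  next
    case False
    show ?thesis unfolding ser_outside[OF L False] ser_outside[OF P False] ..
  qed
qed

text \<open>The right side is a homomorphism with the prescribed values on the \<O>(\<sigma>), so
  the choice is not void; \<open>K_additive_unique\<close> then evaluates the chosen
  homomorphism.\<close>

lemma ch_tilde_eq:
  assumes \<gamma>: "\<gamma> \<in> carrier KG"
  shows "ch_tilde \<Lambda> \<Phi> \<gamma> = (\<Sum>\<tau>\<in>\<Phi>. of_int (K_delta \<tau> \<gamma>) *\<^sub>R delta_ch \<tau>)"
proof -
  let ?P = "\<lambda>h. h \<in> hom KG (add_monoid HR) \<and>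
    (\<forall>\<sigma>\<in>\<Phi>. h (K_class \<Phi> (cone_sheaf \<Phi> \<sigma>)) =
      finprod HR (\<lambda>\<rho>. fps_at \<Phi> (fps_exp (-1)) (courant \<Lambda> \<Phi> \<rho>)) (cone_rays \<sigma>))"
  have fp: "finprod HR (\<lambda>\<rho>. fps_at \<Phi> (fps_exp (-1)) (courant \<Lambda> \<Phi> \<rho>)) (cone_rays \<sigma>) =
      (\<Sum>\<tau>\<in>\<Phi>. if cone_rays \<sigma> \<inter> cone_rays \<tau> = {} then delta_ch \<tau> else 0)" if \<sigma>: "\<sigma> \<in> \<Phi>" for \<sigma>
    unfolding delta_ch_sum[OF \<sigma>]
  proof (rule comm_monoid.finprod_cong'[OF comm_monoid_HR refl])
    show "ray_exp \<in> cone_rays \<sigma> \<rightarrow> carrier HR" by (intro funcsetI fps_at_phi_closed)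
    fix \<rho> assume "\<rho> \<in> cone_rays \<sigma>"
    then have "\<rho> \<in> R" using cone_rays_subset[OF \<sigma>] by blast
    then show "fps_at \<Phi> (fps_exp (-1)) (courant \<Lambda> \<Phi> \<rho>) = ray_exp \<rho>" by (simp add: courant_eq_phi)
  qed
  define h where "h x = (\<Sum>\<tau>\<in>\<Phi>. of_int (K_delta \<tau> x) *\<^sub>R delta_ch \<tau>)" for x
  have hadd: "h (x \<otimes>\<^bsub>KG\<^esub> y) = h x + h y" if "x \<in> carrier KG" "y \<in> carrier KG" for x y
    unfolding h_def sum.distrib[symmetric]
    by (intro sum.cong[OF refl]) (simp add: K_delta_add that scaleR_left_distrib)
  have hK: "K_additive h" unfolding K_additive_def by (intro ballI hadd)
  have "h \<in> hom KG (add_monoid HR)"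
  proof (rule homI)
    fix x assume "x \<in> carrier KG"
    show "h x \<in> carrier (add_monoid HR)" unfolding h_def
      by (simp add: HR_sum_closed HR_scale_closed delta_ch_closed)
  qed (simp add: hadd add_HR)
  moreover have "h (K_cls (delta_sheaf \<tau>)) = delta_ch \<tau>" if \<tau>: "\<tau> \<in> \<Phi>" for \<tau>
  proof -
    have "h (K_cls (delta_sheaf \<tau>)) = (\<Sum>\<sigma>\<in>\<Phi>. of_nat (dim (stalk (delta_sheaf \<tau>) \<sigma>)) *\<^sub>R delta_ch \<sigma>)"
      unfolding h_def by (intro sum.cong[OF refl]) (simp add: K_delta(2)[OF _ delta_sheaf])
    then show ?thesis unfolding sum_delta_sheaf[OF \<tau>] .
  qed
  then have "h (K_class \<Phi> (cone_sheaf \<Phi> \<sigma>)) = (\<Sum>\<tau>\<in>\<Phi>. if cone_rays \<sigma> \<inter> cone_rays \<tau> = {} then delta_ch \<tau> else 0)"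
    if \<sigma>: "\<sigma> \<in> \<Phi>" for \<sigma>
    unfolding K_class_cone_sheaf_delta[OF \<sigma> hK] by (intro sum.cong[OF refl]) simp
  ultimately have "?P h" using fp by simp
  then have E: "?P (ch_tilde \<Lambda> \<Phi>)" unfolding ch_tilde_def by (rule someI[of ?P])
  have "K_additive (ch_tilde \<Lambda> \<Phi>)"
    unfolding K_additive_def using hom_mult[OF conjunct1[OF E]] by (simp add: add_HR)
  then show ?thesis
    by (rule K_additive_unique[OF _ \<gamma>]) (use E fp in simp)
qed

end

context normalized_fan
begin

text \<open>Localization at \<kappa> followed by evaluation at \<open>x\<close>, the exponent of the
  variable recording the degree. For \<open>x\<close> in \<open>V\<close> it is a ring homomorphism
  on \<open>hat_ring\<close> with values in power series.\<close>

definition locser :: "'a set \<Rightarrow> 'a \<Rightarrow> (nat \<Rightarrow> 'a \<Rightarrow> real) \<Rightarrow> real fps"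
  where "locser \<kappa> x s = Abs_fps (\<lambda>i. loc \<kappa> (s i) x)"

lemma loc_restrict:
  "\<kappa> \<in> Max_cones \<Longrightarrow> real_polynomial_function p \<Longrightarrow> x \<in> V \<Longrightarrow> loc \<kappa> (restrict_fan \<Phi> p) x = p x"
  unfolding loc_def using max_fan[of \<kappa>]
  by (subst local_poly_eqI[where q = p]) (auto simp: restrict_fan_def)

lemma loc_zero: "\<kappa> \<in> Max_cones \<Longrightarrow> loc \<kappa> 0 x = 0"
  unfolding loc_def
  by (subst local_poly_eqI[where q = "\<lambda>_. 0"]) (auto intro: real_polynomial_function.intros(2))

lemma loc_scale:
  assumes \<kappa>: "\<kappa> \<in> Max_cones" and f: "f \<in> conepoly \<Phi>" and x: "x \<in> V"
  shows "loc \<kappa> (c *\<^sub>R f) x = c * loc \<kappa> f x"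
proof -
  have p: "real_polynomial_function (\<lambda>_::'a. c)" by (rule real_polynomial_function.intros(2))
  have "c *\<^sub>R f = (\<lambda>x. restrict_fan \<Phi> (\<lambda>_. c) x * f x)"
    unfolding restrict_mult[OF f] by (simp add: scaleR_fun_def)
  then show ?thesis using loc_mult[OF \<kappa> conepoly_restrict[OF p] f] loc_restrict[OF \<kappa> p x] by simp
qed

lemma loc_sum:
  assumes "\<kappa> \<in> Max_cones" "finite I" "\<And>i. i \<in> I \<Longrightarrow> f i \<in> conepoly \<Phi>"
  shows "loc \<kappa> (\<lambda>x. \<Sum>i\<in>I. f i x) x = (\<Sum>i\<in>I. loc \<kappa> (f i) x)"
  using assms(2,3)
proof (induction I rule: finite_induct)
  case empty
  show ?case using loc_zero[OF assms(1)] by (simp add: zero_fun_def)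
next
  case (insert i I)
  have "(\<Sum>i\<in>I. f i) \<in> conepoly \<Phi>" using intg_sum[OF insert.hyps(1), of f] insert.prems by simp
  then have "(\<lambda>x. \<Sum>i\<in>I. f i x) \<in> conepoly \<Phi>" unfolding sum_fun_apply .
  from loc_add[OF assms(1) _ this, of "f i" x] show ?case using insert by simp
qed

lemma locser_mult:
  assumes "\<kappa> \<in> Max_cones" "s \<in> carrier HR" "t \<in> carrier HR"
  shows "locser \<kappa> x (s \<otimes>\<^bsub>HR\<^esub> t) = locser \<kappa> x s * locser \<kappa> x t"
proof (rule fps_ext)
  fix i
  have st: "s j \<in> conepoly \<Phi>" "t j \<in> conepoly \<Phi>" for j using HR_nth_conepoly assms(2,3) by blast+
  have "loc \<kappa> ((s \<otimes>\<^bsub>HR\<^esub> t) i) x = (\<Sum>j\<le>i. loc \<kappa> (\<lambda>x. s j x * t (i - j) x) x)"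
    unfolding mult_HR by (rule loc_sum[OF assms(1)]) (simp_all add: conepoly_mult st)
  also have "\<dots> = (\<Sum>j\<le>i. loc \<kappa> (s j) x * loc \<kappa> (t (i - j)) x)"
    by (intro sum.cong[OF refl] loc_mult assms(1) st)
  finally show "fps_nth (locser \<kappa> x (s \<otimes>\<^bsub>HR\<^esub> t)) i = fps_nth (locser \<kappa> x s * locser \<kappa> x t) i"
    by (simp add: locser_def fps_mult_nth atLeast0AtMost)
qed

lemma locser_add:
  "\<kappa> \<in> Max_cones \<Longrightarrow> s \<in> carrier HR \<Longrightarrow> t \<in> carrier HR \<Longrightarrow> locser \<kappa> x (s + t) = locser \<kappa> x s + locser \<kappa> x t"
  using loc_add[OF _ HR_nth_conepoly HR_nth_conepoly] by (intro fps_ext) (simp add: locser_def plus_fun_def)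

lemma locser_scale:
  "\<kappa> \<in> Max_cones \<Longrightarrow> s \<in> carrier HR \<Longrightarrow> x \<in> V \<Longrightarrow> locser \<kappa> x (c *\<^sub>R s) = fps_const c * locser \<kappa> x s"
  using loc_scale[OF _ HR_nth_conepoly] by (intro fps_ext) (simp add: locser_def scaleR_fun_app)

lemma locser_zero: "\<kappa> \<in> Max_cones \<Longrightarrow> locser \<kappa> x 0 = 0"
  by (intro fps_ext) (simp add: locser_def loc_zero)

lemma locser_one: "\<kappa> \<in> Max_cones \<Longrightarrow> x \<in> V \<Longrightarrow> locser \<kappa> x \<one>\<^bsub>HR\<^esub> = 1"
  by (intro fps_ext)
     (simp add: locser_def one_HR loc_zero loc_restrict real_polynomial_function.intros(2))

lemma locser_sum:
  assumes "\<kappa> \<in> Max_cones" "\<And>i. i \<in> I \<Longrightarrow> f i \<in> carrier HR"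
  shows "locser \<kappa> x (sum f I) = (\<Sum>i\<in>I. locser \<kappa> x (f i))"
  using assms(2)
  by (induction I rule: infinite_finite_induct)
     (simp_all add: locser_zero[OF assms(1)] locser_add[OF assms(1)] HR_sum_closed)

lemma locser_diff:
  assumes "\<kappa> \<in> Max_cones" "s \<in> carrier HR" "t \<in> carrier HR"
  shows "locser \<kappa> x (s - t) = locser \<kappa> x s - locser \<kappa> x t"
  using locser_add[OF assms(1) HR_diff_closed[OF assms(2,3)] assms(3), of x] by simp

lemma locser_fps_at:
  assumes \<kappa>: "\<kappa> \<in> Max_cones" and x: "x \<in> V"
  shows "locser \<kappa> x (fps_at \<Phi> G (phi \<rho>)) = fps_scale G (coord \<kappa> \<rho> x)"
proof (rule fps_ext)
  fix i
  have \<kappa>\<Phi>: "\<kappa> \<in> \<Phi>" by (rule max_fan[OF \<kappa>])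
  have "local_poly V (fps_at \<Phi> G (phi \<rho>) i) \<kappa> = (\<lambda>x. if x \<in> V then fps_nth G i * coord \<kappa> \<rho> x ^ i else 0)"
  proof (rule local_poly_eqI[OF \<kappa>])
    show "real_polynomial_function (\<lambda>x. fps_nth G i * coord \<kappa> \<rho> x ^ i)"
      by (rule homogeneous_polyD[OF homogeneous_poly_power[OF linear_coord[OF \<kappa>\<Phi>]]])
    fix y assume y: "y \<in> \<kappa>"
    then have "y \<in> \<Union>\<Phi>" using \<kappa>\<Phi> by blast
    then show "fps_at \<Phi> G (phi \<rho>) i y = fps_nth G i * coord \<kappa> \<rho> y ^ i"
      by (simp add: fps_at_def restrict_fan_def phi_eq_coord[OF \<kappa>\<Phi> y])
  qed
  then show "fps_nth (locser \<kappa> x (fps_at \<Phi> G (phi \<rho>))) i = fps_nth (fps_scale G (coord \<kappa> \<rho> x)) i"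
    using x by (simp add: locser_def loc_def fps_scale_def)
qed

definition todd_hat :: "nat \<Rightarrow> 'a \<Rightarrow> real"
  where "todd_hat = finprod HR (\<lambda>\<rho>. fps_at \<Phi> todd (phi \<rho>)) R"

lemma todd_hat_closed: "todd_hat \<in> carrier HR"
  unfolding todd_hat_def by (intro finprod_HR_closed fps_at_phi_closed)

lemma Td_eq: "Td \<Lambda> \<Phi> = H_proj \<Phi> todd_hat"
proof -
  have "finprod HR (\<lambda>\<rho>. fps_at \<Phi> todd (courant \<Lambda> \<Phi> \<rho>)) R = todd_hat"
    unfolding todd_hat_def
    by (rule comm_monoid.finprod_cong'[OF comm_monoid_HR refl]) (simp_all add: fps_at_phi_closed courant_eq_phi)
  then show ?thesis by (simp add: Td_def)
qed

text \<open>Writing \<open>c\<close> for the coordinate at \<rho>, the factor is \<open>c X\<close>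
  for a ray of \<tau> and \<open>c\<close> times the Bernoulli series for another ray of
  \<kappa>.\<close>

lemma locser_delta_todd:
  assumes \<kappa>: "\<kappa> \<in> Max_cones" and \<tau>: "\<tau> \<in> \<Phi>" and x: "generic x"
  shows "locser \<kappa> x (delta_ch \<tau>) * locser \<kappa> x todd_hat =
    (if \<kappa> \<in> star_max \<tau> then fps_const (\<Prod>\<rho>\<in>cone_rays \<kappa>. coord \<kappa> \<rho> x) * fps_X ^ card (cone_rays \<tau>) *
       (\<Prod>\<rho>\<in>cone_rays \<kappa> - cone_rays \<tau>. bern (coord \<kappa> \<rho> x)) else 0)"
proof -
  have xV: "x \<in> V" using x by (simp add: generic_def)
  have \<kappa>\<Phi>: "\<kappa> \<in> \<Phi>" by (rule max_fan[OF \<kappa>])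
  let ?c = "\<lambda>\<rho>. coord \<kappa> \<rho> x"
  define g where "g \<rho> = (if \<rho> \<in> cone_rays \<tau> then 1 - fps_exp (- ?c \<rho>) else fps_exp (- ?c \<rho>)) * fps_scale todd (?c \<rho>)" for \<rho>
  have "locser \<kappa> x (delta_ch \<tau>) = (\<Prod>\<rho>\<in>R. locser \<kappa> x (if \<rho> \<in> cone_rays \<tau> then \<one>\<^bsub>HR\<^esub> - ray_exp \<rho> else ray_exp \<rho>))"
    unfolding delta_ch_def
    by (rule finprod_HR_hom[OF finite_R delta_factor_closed locser_one[OF \<kappa> xV] locser_mult[OF \<kappa>]])
  also have "\<dots> = (\<Prod>\<rho>\<in>R. if \<rho> \<in> cone_rays \<tau> then 1 - fps_exp (- ?c \<rho>) else fps_exp (- ?c \<rho>))"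
    by (intro prod.cong[OF refl])
       (simp add: locser_diff[OF \<kappa> HR_one_closed fps_at_phi_closed] locser_one[OF \<kappa> xV] locser_fps_at[OF \<kappa> xV] fps_scale_exp)
  finally have 1: "locser \<kappa> x (delta_ch \<tau>) = \<dots>" .
  have "locser \<kappa> x todd_hat = (\<Prod>\<rho>\<in>R. locser \<kappa> x (fps_at \<Phi> todd (phi \<rho>)))"
    unfolding todd_hat_def
    by (rule finprod_HR_hom[OF finite_R fps_at_phi_closed locser_one[OF \<kappa> xV] locser_mult[OF \<kappa>]])
  then have 2: "locser \<kappa> x todd_hat = (\<Prod>\<rho>\<in>R. fps_scale todd (?c \<rho>))" unfolding locser_fps_at[OF \<kappa> xV] .
  have prod: "locser \<kappa> x (delta_ch \<tau>) * locser \<kappa> x todd_hat = prod g R"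
    unfolding 1 2 g_def prod.distrib[symmetric] ..
  have out: "?c \<rho> = 0" if "\<rho> \<notin> cone_rays \<kappa>" for \<rho>
    using coord_outside[OF \<kappa>\<Phi> _ that] xV by (simp add: span_max[OF \<kappa>])
  show ?thesis
  proof (cases "\<kappa> \<in> star_max \<tau>")
    case True
    then have sub: "cone_rays \<tau> \<subseteq> cone_rays \<kappa>" by (simp add: star_max_def)
    \<comment> \<open>Away from \<kappa> the coordinate is 0, so the exponential and the Todd factor
      are both 1.\<close>
    have "g \<rho> = 1" if "\<rho> \<in> R - cone_rays \<kappa>" for \<rho>
      using that sub out by (auto simp: g_def fps_scale_0 todd_nth_0)
    then have "prod g R = prod g (cone_rays \<kappa>)"
      using cone_rays_subset[OF \<kappa>\<Phi>] finite_R by (intro prod.mono_neutral_right) auto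
    also have "\<dots> = (\<Prod>\<rho>\<in>cone_rays \<kappa>. fps_const (?c \<rho>) * (if \<rho> \<in> cone_rays \<tau> then fps_X else bern (?c \<rho>)))"
    proof (rule prod.cong[OF refl])
      fix \<rho> assume "\<rho> \<in> cone_rays \<kappa>"
      then have "?c \<rho> \<noteq> 0" using x \<kappa> by (simp add: generic_def)
      then show "g \<rho> = fps_const (?c \<rho>) * (if \<rho> \<in> cone_rays \<tau> then fps_X else bern (?c \<rho>))"
        using fps_scale_todd[of "?c \<rho>"] fps_scale_todd_bern[of "?c \<rho>"] by (simp add: g_def mult.commute)
    qed
    also have "\<dots> = fps_const (\<Prod>\<rho>\<in>cone_rays \<kappa>. ?c \<rho>) *
        (\<Prod>\<rho>\<in>cone_rays \<kappa>. if \<rho> \<in> cone_rays \<tau> then fps_X else bern (?c \<rho>))"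
      unfolding prod.distrib fps_const_prod ..
    also have "(\<Prod>\<rho>\<in>cone_rays \<kappa>. if \<rho> \<in> cone_rays \<tau> then fps_X else bern (?c \<rho>)) =
        (\<Prod>\<rho>\<in>cone_rays \<kappa> - cone_rays \<tau>. if \<rho> \<in> cone_rays \<tau> then fps_X else bern (?c \<rho>)) *
        (\<Prod>\<rho>\<in>cone_rays \<tau>. if \<rho> \<in> cone_rays \<tau> then fps_X else bern (?c \<rho>))"
      by (rule prod.subset_diff[OF sub finite_rays[OF \<kappa>\<Phi>]])
    also have "\<dots> = (\<Prod>\<rho>\<in>cone_rays \<kappa> - cone_rays \<tau>. bern (?c \<rho>)) * fps_X ^ card (cone_rays \<tau>)"
      by simp
    finally show ?thesis using True prod by (simp add: mult_ac)
  next
    case False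
    then obtain \<rho> where \<rho>: "\<rho> \<in> cone_rays \<tau>" "\<rho> \<notin> cone_rays \<kappa>" using \<kappa> by (auto simp: star_max_def)
    \<comment> \<open>A ray of \<tau> missing from \<kappa> has coordinate 0, and its Chern factor
      is \<open>1 - exp 0\<close>.\<close>
    have "g \<rho> = 0" using \<rho> out by (simp add: g_def)
    then have "prod g R = 0" using \<rho>(1) cone_rays_subset[OF \<tau>] by (intro prod_zero bexI[of _ \<rho>] finite_R) auto
    then show ?thesis using False prod by simp
  qed
qed

text \<open>The product of the coordinates cancels the denominator, and the power of
  \<open>fps_X\<close> shifts degree \<open>n\<close> to \<open>n - card (cone_rays \<tau>)\<close>,
  exactly the degree in which the Bernoulli sum over the star has its single term.\<close>

lemma delta_todd_sum:
  assumes \<tau>: "\<tau> \<in> \<Phi>" and x: "generic x"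
  shows "(\<Sum>\<kappa>\<in>Max_cones. fps_nth (locser \<kappa> x (delta_ch \<tau>) * locser \<kappa> x todd_hat) n / (\<Prod>\<rho>\<in>cone_rays \<kappa>. coord \<kappa> \<rho> x)) =
    (-1) ^ (n - card (cone_rays \<tau>))"
proof -
  let ?k = "card (cone_rays \<tau>)"
  let ?B = "\<lambda>\<kappa>. \<Prod>\<rho>\<in>cone_rays \<kappa> - cone_rays \<tau>. bern (coord \<kappa> \<rho> x)"
  have k: "?k \<le> n" by (rule card_rays_le[OF \<tau>])
  have "fps_nth (locser \<kappa> x (delta_ch \<tau>) * locser \<kappa> x todd_hat) n / (\<Prod>\<rho>\<in>cone_rays \<kappa>. coord \<kappa> \<rho> x) =
      (if \<kappa> \<in> star_max \<tau> then fps_nth (?B \<kappa>) (n - ?k) else 0)" if \<kappa>: "\<kappa> \<in> Max_cones" for \<kappa>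
  proof -
    have "(\<Prod>\<rho>\<in>cone_rays \<kappa>. coord \<kappa> \<rho> x) \<noteq> 0"
      using x \<kappa> finite_rays[OF max_fan[OF \<kappa>]] by (simp add: generic_def)
    moreover have "fps_nth (fps_X ^ ?k * ?B \<kappa>) n = fps_nth (?B \<kappa>) (n - ?k)"
      using k by (simp add: fps_X_power_mult_nth)
    ultimately show ?thesis unfolding locser_delta_todd[OF \<kappa> \<tau> x] by (simp add: mult.assoc)
  qed
  then have "(\<Sum>\<kappa>\<in>Max_cones. fps_nth (locser \<kappa> x (delta_ch \<tau>) * locser \<kappa> x todd_hat) n / (\<Prod>\<rho>\<in>cone_rays \<kappa>. coord \<kappa> \<rho> x)) =
      (\<Sum>\<kappa>\<in>Max_cones. if \<kappa> \<in> star_max \<tau> then fps_nth (?B \<kappa>) (n - ?k) else 0)"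
    by (intro sum.cong[OF refl])
  also have "\<dots> = (\<Sum>\<kappa>\<in>star_max \<tau>. fps_nth (?B \<kappa>) (n - ?k))"
    using finite_Max by (intro sum.mono_neutral_cong_right) (auto simp: star_max_def)
  also have "\<dots> = fps_nth (\<Sum>\<kappa>\<in>star_max \<tau>. ?B \<kappa>) (n - ?k)" by (simp add: fps_sum_nth)
  also have "\<dots> = (-1) ^ (n - ?k)" unfolding star_sum_bern[OF \<tau> x] by (simp add: fps_X_power_nth)
  finally show ?thesis .
qed

text \<open>Both sides are linear in the multiplicities \<open>K_delta \<tau> \<gamma>\<close>,
  which reduces the claim to the simple classes.\<close>

theorem riemann_roch:
  assumes \<gamma>: "\<gamma> \<in> carrier KG"
  shows "real_of_int (K_euler \<Lambda> \<Phi> \<gamma>) = fan_integral \<Lambda> \<Omega> \<Phi> (ch \<Lambda> \<Phi> \<gamma> \<otimes>\<^bsub>H_ring \<Phi>\<^esub> Td \<Lambda> \<Phi>)"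
proof -
  obtain x where x: "generic x" using generic_exists by blast
  then have xV: "x \<in> V" by (simp add: generic_def)
  let ?d = "\<lambda>\<tau>. real_of_int (K_delta \<tau> \<gamma>)"
  let ?c = "ch_tilde \<Lambda> \<Phi> \<gamma>"
  let ?p = "\<lambda>\<kappa>. \<Prod>\<rho>\<in>cone_rays \<kappa>. coord \<kappa> \<rho> x"
  let ?f = "\<lambda>\<kappa> \<tau>. fps_nth (locser \<kappa> x (delta_ch \<tau>) * locser \<kappa> x todd_hat) n"
  have c: "?c \<in> carrier HR"
    unfolding ch_tilde_eq[OF \<gamma>] by (intro HR_sum_closed HR_scale_closed delta_ch_closed)
  have "loc \<kappa> ((?c \<otimes>\<^bsub>HR\<^esub> todd_hat) n) x = (\<Sum>\<tau>\<in>\<Phi>. ?d \<tau> * ?f \<kappa> \<tau>)" if \<kappa>: "\<kappa> \<in> Max_cones" for \<kappa>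
  proof -
    have "locser \<kappa> x ?c = (\<Sum>\<tau>\<in>\<Phi>. fps_const (?d \<tau>) * locser \<kappa> x (delta_ch \<tau>))"
      unfolding ch_tilde_eq[OF \<gamma>]
      by (subst locser_sum[OF \<kappa>]) (simp_all add: HR_scale_closed delta_ch_closed locser_scale[OF \<kappa> _ xV])
    then have "locser \<kappa> x (?c \<otimes>\<^bsub>HR\<^esub> todd_hat) =
        (\<Sum>\<tau>\<in>\<Phi>. fps_const (?d \<tau>) * (locser \<kappa> x (delta_ch \<tau>) * locser \<kappa> x todd_hat))"
      unfolding locser_mult[OF \<kappa> c todd_hat_closed] by (simp add: sum_distrib_right mult.assoc)
    then have "fps_nth (locser \<kappa> x (?c \<otimes>\<^bsub>HR\<^esub> todd_hat)) n = (\<Sum>\<tau>\<in>\<Phi>. ?d \<tau> * ?f \<kappa> \<tau>)"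
      by (simp only: fps_sum_nth fps_mult_left_const_nth)
    then show ?thesis by (simp add: locser_def)
  qed
  moreover have "(?c \<otimes>\<^bsub>HR\<^esub> todd_hat) n \<in> conewise (homogeneous_poly n) \<Phi>"
    using HR_mult_closed[OF c todd_hat_closed] by (simp add: carrier_HR)
  \<comment> \<open>The summands depend on the generic point, though their total does not; hence one
    point \<open>x\<close> is fixed throughout before the sums over \<kappa> and \<tau> are
    exchanged.\<close>
  ultimately have "intg ((?c \<otimes>\<^bsub>HR\<^esub> todd_hat) n) = (\<Sum>\<kappa>\<in>Max_cones. (\<Sum>\<tau>\<in>\<Phi>. ?d \<tau> * ?f \<kappa> \<tau>) / ?p \<kappa>)"
    by (subst intg_homogeneous_top[OF _ x]) (auto intro: sum.cong)
  also have "\<dots> = (\<Sum>\<kappa>\<in>Max_cones. \<Sum>\<tau>\<in>\<Phi>. ?d \<tau> * (?f \<kappa> \<tau> / ?p \<kappa>))"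
    by (simp add: sum_divide_distrib)
  also have "\<dots> = (\<Sum>\<tau>\<in>\<Phi>. \<Sum>\<kappa>\<in>Max_cones. ?d \<tau> * (?f \<kappa> \<tau> / ?p \<kappa>))" by (rule sum.swap)
  also have "\<dots> = (\<Sum>\<tau>\<in>\<Phi>. ?d \<tau> * (-1) ^ (n - card (cone_rays \<tau>)))"
    unfolding sum_distrib_left[symmetric] using delta_todd_sum[OF _ x] by (intro sum.cong[OF refl]) simp
  finally show ?thesis
    unfolding K_euler_eq[OF \<gamma>] ch_def Td_eq fan_integral_product[OF c todd_hat_closed] by simp
qed

end

theorem theorem7p5:
  fixes \<Lambda> :: "'a::euclidean_space set"
    and \<Omega> :: "'a list \<Rightarrow> real"
    and \<Phi> :: "'a set set"
    and \<gamma> :: "('a ksheaf \<Rightarrow>\<^sub>0 int) set"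
  assumes "is_lattice \<Lambda>"
    and "volume_form (span \<Lambda>) \<Omega>"
    and "lattice_normalized \<Lambda> \<Omega>"
    and "is_fan (span \<Lambda>) \<Phi>"
    and "complete_fan (span \<Lambda>) \<Phi>"
    and "simplicial_fan \<Phi>"
    and "unimodular_fan \<Lambda> \<Phi>"
    and "\<gamma> \<in> carrier (K_group \<Phi>)"
  shows "real_of_int (K_euler \<Lambda> \<Phi> \<gamma>) =
    fan_integral \<Lambda> \<Omega> \<Phi> (ch \<Lambda> \<Phi> \<gamma> \<otimes>\<^bsub>H_ring \<Phi>\<^esub> Td \<Lambda> \<Phi>)"
proof -
  interpret normalized_fan \<Lambda> \<Phi> \<Omega>
    using assms by unfold_locales
  show ?thesis by (rule riemann_roch) (rule assms)
qed

end
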